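(* Let $k$ be a field of characteristic $0$ and let $M=\mathcal T_r$. Then $\Lambda_0=\Lambda$ for both cell algebras $S_L(\mathcal T_r,k)$ and $S_R(\mathcal T_r,k)$. Both $S_L(\mathcal T_r,k)$ and $S_R(\mathcal T_r,k)$ are quasi-hereditary algebras.
   Context: **Monoids.** $r\ge1$ and $n\ge r$ are integers; $\bar m=\{1,\dots,m\}$. $\bar\tau_r$ is the monoid (under composition) of all maps $\alpha:\bar r\cup\{0\}\to\bar r\cup\{0\}$ with $\alpha(0)=0$. Permutations of $\bar i$ are extended by $0\mapsto0$, so $\mathfrak S_r\subseteq\bar\tau_r$. $M$ denotes a monoid with $\mathfrak S_r\subseteq M\subseteq\bar\tau_r$. The full transformation semigroup $\mathcal T_r$ (all maps $\bar r\to\bar r$) is identified with the submonoid of $\alpha\in\bar\tau_r$ with $\alpha^{-1}(0)=\{0\}$. The index of $\alpha$ is $|\mathrm{image}(\alpha)\setminus\{0\}|$, and $I(M)$ is the set of indices of elements of $M$ (so $I(\mathcal T_r)=\bar r$). $\Lambda(r,n)$ is the set of compositions of $r$ with $n$ (nonnegative) parts; for $\mu\in\Lambda(r,n)$, $b^\mu_1,b^\mu_2,\dots$ are the consecutive blocks of $\bar r$ with $|b^\mu_j|=\mu_j$, and $\mathfrak S_\mu$ is the Young subgroup preserving each block (similarly for compositions of $i$). **The algebras.** For $\mu,\nu\in\Lambda(r,n)$, ${}^\mu A^\nu$ is the $\mathbb Z$-submodule of $\mathbb Z[M]$ of elements invariant under left multiplication by $\mathfrak S_\mu$ and right multiplication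 by $\mathfrak S_\nu$. ${}_\mu M_\nu$ is the set of double cosets $\mathbf D=\mathfrak S_\mu m\mathfrak S_\nu$, $m\in M$; the sums $X(\mathbf D)=\sum_{m\in\mathbf D}m$ form a $\mathbb Z$-basis of ${}^\mu A^\nu$. $\bar A=\bigoplus_{\mu,\nu\in\Lambda(r,n)}{}^\mu A^\nu$ (external direct sum) has $\mathbb Z$-basis the elements $b_{\mathbf D}=X(\mathbf D)$. For $\mathbf D_1\in{}_\mu M_\nu$, $\mathbf D_2\in{}_\nu M_\pi$ write, in $\mathbb Z[M]$, $X(\mathbf D_1)X(\mathbf D_2)=\sum_{\mathbf D\in{}_\mu M_\pi}a(\mathbf D_1,\mathbf D_2,\mathbf D)X(\mathbf D)$. For $\mathbf D\in{}_\mu M_\nu$ let $n_L(\mathbf D)=|\mathfrak S_\mu m|$ and $n_R(\mathbf D)=|m\mathfrak S_\nu|$ for any $m\in\mathbf D$. For $*\in\{L,R\}$ define bilinear products on $\bar A$ by $b_{\mathbf D_1}*_{*}b_{\mathbf D_2}=\sum_{\mathbf D}\frac{n_*(\mathbf D)}{n_*(\mathbf D_1)n_*(\mathbf D_2)}a(\mathbf D_1,\mathbf D_2,\mathbf D)b_{\mathbf D}$ for $\mathbf D_1\in{}_\mu M_\nu,\mathbf D_2\in{}_\nu M_\pi$, and $0$ for $\mathbf D_1\in{}_\mu M_\nu,\mathbf D_2\in{}_\rho M_\pi$ with $\nu\ne\rho$. It is known that the structure constants are integers and the products are associative with identity. $A_L^{\mathbb Z}$, $A_R^{\mathbb Z}$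 denote $\bar A$ with product $*_L$, $*_R$; for a field $k$, $S_L(M,k)=k\otimes_{\mathbb Z}A_L^{\mathbb Z}$ and $S_R(M,k)=k\otimes_{\mathbb Z}A_R^{\mathbb Z}$. **Combinatorial data.** $C(i,r)$ is the set of $i$-element subsets of $\bar r$; for $C=\{c_1<\dots<c_i\}$, $\phi_C:\bar i\cup\{0\}\to\bar r\cup\{0\}$ is $\phi_C(j)=c_j$, $\phi_C(0)=0$. $P_r$ is the set of all subsets of $\bar r$; $\mathfrak S_\nu$ acts on the right by $S\pi=\pi^{-1}(S)$. For $\nu\in\Lambda(r,n)$ order $P_r$ as follows: $s(d)$ is the increasing string of elements of $d$; $\bar s(\nu,d)$ is the string of length $r$ obtained from $s(d)$ by replacing each $x$ by the number of the $\nu$-block containing it and appending $r-|d|$ zeros (it determines the $\mathfrak S_\nu$-orbit of $d$); $d<d'$ iff $\bar s(\nu,d)<\bar s(\nu,d')$ lexicographically, or these are equal and $s(d)<s(d')$ lexicographically. The orbits are ordered $O_1<\dots<O_{N_\nu}$ by $\bar s$. $D(i,r)$ is the collection of sets $D$ of $i$ nonempty pairwise disjoint subsets of $\bar r$; writing $D=\{S_{a_1}<\dots<S_{a_i}\}$ in the order for $\nu$, $\psi_D:\bar r\cup\{0\}\to\bar i\cup\{0\}$ sends $x\in S_{a_j}$ to $j$ and all other $x$ to $0$. Each $\alpha\in\bar\tau_r$ of index $i$ is uniquely $\alpha=\phi_{C_\alpha}\circ\sigma_\alpha\circ\psi_{D_\alpha}$ with $C_\alpha\in C(i,r)$, $\sigma_\alpha\in\mathfrak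 S_i$, $D_\alpha\in D(i,r)$; $D(M,i,r)=\{D_\alpha:\alpha\in M\text{ of index }i\}$. $\mathfrak S_\mu$ acts on the left on $C(i,r)$ by $\rho C=\rho(C)$; $\mathfrak S_\nu$ acts on the right on $D(M,i,r)$ by $D\pi=\{\pi^{-1}(d):d\in D\}$. For $C\in C(i,r)$, $\mu(C)$ is the composition of $i$ with $\mu(C)_j=|b^\mu_j\cap C|$; for $D\in D(M,i,r)$, $\nu(D)$ is the composition of $i$ with $N_\nu$ parts $\nu(D)_j=|D\cap O_j|$. These depend only on the orbits $O_\mu\ni C$, $O_\nu\ni D$; write $\mu(O_\mu)$, $\nu(O_\nu)$. **The cell basis.** $\Lambda(i)$ is the set of partitions of $i$ ($\Lambda(0)=\{\lambda_0\}$, the empty partition), $\Lambda=\bigcup_{i\in I(M)}\Lambda(i)$, ordered by $\lambda\ge\mu$ iff $\mathrm{index}(\lambda)<\mathrm{index}(\mu)$, or the indices agree and $\lambda$ dominates $\mu$ (index of $\lambda\in\Lambda(i)$ is $i$). For $\lambda\in\Lambda(i)$, $L(\lambda)$ is the set of pairs $(O_\mu,S)$ with $\mu\in\Lambda(r,n)$ (part of the data), $O_\mu$ an $\mathfrak S_\mu$-orbit in $C(i,r)$, $S$ a semistandard $\lambda$-tableau of type $\mu(O_\mu)$; $R(\lambda)$ is the set of pairs $(O_\nu,T)$ with $\nu\in\Lambda(r,n)$ (part of the data), $O_\nu$ an $\mathfrak S_\nu$-orbit in $D(M,i,r)$, $T$ a semistandard $\lambda$-tableau of type $\nu(O_\nu)$.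 The Murphy basis of $\mathbb Z[\mathfrak S_i]$: for a standard $\lambda$-tableau $s$ let $d(s)\in\mathfrak S_i$ be the permutation taking the entries of the row-reading tableau $t^\lambda$ to those of $s$, $r_\lambda=\sum_{\sigma\in\mathfrak S_\lambda}\sigma$, and ${}_sC_t^\lambda=d(s)\,r_\lambda\,d(t)^{-1}$. A standard tableau has type $S$ with respect to a composition if replacing each entry by the number of the block containing it gives $S$. Set ${}_SC_T^\lambda=\sum_{s,t}{}_sC_t^\lambda$, over standard $s$ of type $S$ (w.r.t. $\mu(O_\mu)$) and standard $t$ of type $T$ (w.r.t. $\nu(O_\nu)$), and ${}_{(O_\mu,S)}C^\lambda_{(O_\nu,T)}=\sum_{C\in O_\mu}\sum_{D\in O_\nu}\phi_C\circ{}_SC_T^\lambda\circ\psi_D\in{}^\mu A^\nu\subseteq\bar A$. These elements form a cell basis of $S_L(M,k)$ and of $S_R(M,k)$. **$\Lambda_0$.** In a cell algebra with cell basis ${}_sC_t^\lambda$ ($\lambda\in\Lambda$, $s\in L(\lambda)$, $t\in R(\lambda)$), let $\hat A^\lambda$ be the span of the ${}_sC_t^\mu$ with $\mu>\lambda$. For $s\in L(\lambda)$, $t\in R(\lambda)$ there is a scalar $r_{st}$ with ${}_{s'}C_t^\lambda\cdot{}_sC_{t'}^\lambda\equiv r_{st}\,{}_{s'}C_{t'}^\lambda\bmod\hat A^\lambda$ for all $s'\in L(\lambda),t'\in R(\lambda)$; the bracket is the bilinear pairing with $\langle C_t^\lambda,{}_sC^\lambda\rangle=r_{st}$. $\Lambda_0$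 is the set of $\lambda\in\Lambda$ for which the bracket is not identically zero, i.e. $r_{st}\neq0$ for some $s,t$. "Quasi-hereditary" is in the usual sense of Cline–Parshall–Scott. *)

theory Defs
  imports
    "HOL-Combinatorics.Permutations"
    "HOL-Algebra.Module"
    "HOL-Algebra.QuotRing"
    "HOL-Algebra.Ideal_Product"
begin

section \<open>Transformation monoids and double cosets\<close>

text \<open>
  A map \<open>{0..r} \<rightarrow> {0..r}\<close>, and likewise a map \<open>{0..i} \<rightarrow> {0..r}\<close> or \<open>{0..r} \<rightarrow> {0..i}\<close> with
  \<open>i \<le> r\<close>, is extended to a function on all natural numbers that fixes every number beyond its
  domain.  Composition of maps is then composition of functions, and the permutations of
  \<open>{1..i}\<close> are the functions that permute \<open>{1..i}\<close> in the sense of the library.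
\<close>

type_synonym transf = "nat \<Rightarrow> nat"

definition tau :: "nat \<Rightarrow> transf set" where
  "tau r = {\<alpha>. \<alpha> 0 = 0 \<and> (\<forall>x\<in>{1..r}. \<alpha> x \<le> r) \<and> (\<forall>x>r. \<alpha> x = x)}"

definition full_transf :: "nat \<Rightarrow> transf set" where
  "full_transf r = {\<alpha> \<in> tau r. \<alpha> -` {0} = {0}}"

definition transf_index :: "nat \<Rightarrow> transf \<Rightarrow> nat" where
  "transf_index r \<alpha> = card (\<alpha> ` {0..r} - {0})"

definition index_set :: "nat \<Rightarrow> transf set \<Rightarrow> nat set" where
  "index_set r M = transf_index r ` M"

definition compositions :: "nat \<Rightarrow> nat \<Rightarrow> nat list set" where
  "compositions r n = {\<mu>. length \<mu> = n \<and> sum_list \<mu> = r}"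

text \<open>Blocks are numbered from 1.\<close>

definition block :: "nat list \<Rightarrow> nat \<Rightarrow> nat set" where
  "block \<mu> j = {sum_list (take (j - 1) \<mu>)<..sum_list (take j \<mu>)}"

definition block_no :: "nat list \<Rightarrow> nat \<Rightarrow> nat" where
  "block_no \<mu> x = (THE j. j \<in> {1..length \<mu>} \<and> x \<in> block \<mu> j)"

definition young :: "nat list \<Rightarrow> transf set" where
  "young \<mu> = {\<sigma>. \<sigma> permutes {1..sum_list \<mu>} \<and> (\<forall>j\<in>{1..length \<mu>}. \<sigma> ` block \<mu> j = block \<mu> j)}"

definition double_coset :: "nat list \<Rightarrow> transf \<Rightarrow> nat list \<Rightarrow> transf set" where
  "double_coset \<mu> m \<nu> = {\<sigma> \<circ> m \<circ> \<pi> | \<sigma> \<pi>. \<sigma> \<in> young \<mu> \<and> \<pi> \<in> young \<nu>}"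

definition double_cosets :: "transf set \<Rightarrow> nat list \<Rightarrow> nat list \<Rightarrow> transf set set" where
  "double_cosets M \<mu> \<nu> = (\<lambda>m. double_coset \<mu> m \<nu>) ` M"


section \<open>The algebras \<open>S\<^sub>L\<close> and \<open>S\<^sub>R\<close>\<close>

text \<open>Elements of the integral monoid ring are given by their coefficient functions.\<close>

definition mring_mult :: "transf set \<Rightarrow> (transf \<Rightarrow> int) \<Rightarrow> (transf \<Rightarrow> int) \<Rightarrow> (transf \<Rightarrow> int)" where
  "mring_mult M f g = (\<lambda>m. \<Sum>(a, b) \<in> {(a, b) \<in> M \<times> M. a \<circ> b = m}. f a * g b)"

definition coset_sum :: "transf set \<Rightarrow> (transf \<Rightarrow> int)" where
  "coset_sum D = (\<lambda>m. if m \<in> D then 1 else 0)"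

text \<open>
  The functions \<open>X(D)\<close> are the indicator functions of the double cosets, so the coefficient of
  \<open>X(D)\<close> in an element of the bi-invariant submodule is the value of that element at any member
  of \<open>D\<close>.
\<close>

definition coset_coeff :: "(transf \<Rightarrow> int) \<Rightarrow> transf set \<Rightarrow> int" where
  "coset_coeff f D = f (SOME m. m \<in> D)"

definition a_coeff :: "transf set \<Rightarrow> transf set \<Rightarrow> transf set \<Rightarrow> transf set \<Rightarrow> int" where
  "a_coeff M D1 D2 D = coset_coeff (mring_mult M (coset_sum D1) (coset_sum D2)) D"

text \<open>
  A basis index \<open>(\<mu>, \<nu>, D)\<close> stands for \<open>b\<^sub>D\<close> with \<open>D\<close> regarded as an element of
  \<open>double_cosets M \<mu> \<nu>\<close>; the same set \<open>D\<close> may occur for several pairs \<open>(\<mu>, \<nu>)\<close>.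
\<close>

type_synonym bidx = "nat list \<times> nat list \<times> transf set"

definition basis_set :: "nat \<Rightarrow> nat \<Rightarrow> transf set \<Rightarrow> bidx set" where
  "basis_set r n M =
     {(\<mu>, \<nu>, D). \<mu> \<in> compositions r n \<and> \<nu> \<in> compositions r n \<and> D \<in> double_cosets M \<mu> \<nu>}"

fun n_L :: "bidx \<Rightarrow> nat" where
  "n_L (\<mu>, \<nu>, D) = card ((\<lambda>\<sigma>. \<sigma> \<circ> (SOME m. m \<in> D)) ` young \<mu>)"

fun n_R :: "bidx \<Rightarrow> nat" where
  "n_R (\<mu>, \<nu>, D) = card ((\<lambda>\<pi>. (SOME m. m \<in> D) \<circ> \<pi>) ` young \<nu>)"

text \<open>The integer division below is exact.\<close>

fun struct_const :: "(bidx \<Rightarrow> nat) \<Rightarrow> transf set \<Rightarrow> bidx \<Rightarrow> bidx \<Rightarrow> bidx \<Rightarrow> int" where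
  "struct_const nf M (\<mu>1, \<nu>1, D1) (\<mu>2, \<nu>2, D2) (\<mu>, \<nu>, D) =
     (if \<nu>1 = \<mu>2 \<and> \<mu> = \<mu>1 \<and> \<nu> = \<nu>2
      then (int (nf (\<mu>, \<nu>, D)) * a_coeff M D1 D2 D)
             div (int (nf (\<mu>1, \<nu>1, D1)) * int (nf (\<mu>2, \<nu>2, D2)))
      else 0)"

text \<open>
  The base change to \<open>k\<close> of the integral algebra with these structure constants: elements are the
  coordinate functions with respect to the basis \<open>b\<^sub>D\<close>.  The identity is the sum of the basis
  elements belonging to the double cosets \<open>\<SS>\<^sub>\<mu> 1 \<SS>\<^sub>\<mu> = \<SS>\<^sub>\<mu>\<close>.
\<close>

definition twisted_algebra ::
  "(bidx \<Rightarrow> nat) \<Rightarrow> nat \<Rightarrow> nat \<Rightarrow> transf set \<Rightarrow> ('k::field, bidx \<Rightarrow> 'k) module" where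
  "twisted_algebra nf r n M =
     \<lparr> carrier = {f. \<forall>b. b \<notin> basis_set r n M \<longrightarrow> f b = 0},
       mult = (\<lambda>f g b. if b \<in> basis_set r n M
          then \<Sum>b1\<in>basis_set r n M. \<Sum>b2\<in>basis_set r n M.
                 f b1 * g b2 * of_int (struct_const nf M b1 b2 b)
          else 0),
       one = (\<lambda>b. if b \<in> {(\<mu>, \<mu>, young \<mu>) | \<mu>. \<mu> \<in> compositions r n} then 1 else 0),
       zero = (\<lambda>b. 0),
       add = (\<lambda>f g b. f b + g b),
       smult = (\<lambda>c f b. c * f b) \<rparr>"

definition S_L :: "nat \<Rightarrow> nat \<Rightarrow> transf set \<Rightarrow> ('k::field, bidx \<Rightarrow> 'k) module" where
  "S_L = twisted_algebra n_L"

definition S_R :: "nat \<Rightarrow> nat \<Rightarrow> transf set \<Rightarrow> ('k::field, bidx \<Rightarrow> 'k) module" where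
  "S_R = twisted_algebra n_R"


section \<open>The sets \<open>C(i,r)\<close> and \<open>D(M,i,r)\<close>\<close>

definition C_sets :: "nat \<Rightarrow> nat \<Rightarrow> nat set set" where
  "C_sets i r = {C. C \<subseteq> {1..r} \<and> card C = i}"

definition phi :: "nat set \<Rightarrow> transf" where
  "phi C = (\<lambda>j. if j \<in> {1..card C} then sorted_list_of_set C ! (j - 1) else j)"

definition sbar :: "nat list \<Rightarrow> nat set \<Rightarrow> nat list" where
  "sbar \<nu> d = map (block_no \<nu>) (sorted_list_of_set d) @ replicate (sum_list \<nu> - card d) 0"

definition subset_less :: "nat list \<Rightarrow> nat set \<Rightarrow> nat set \<Rightarrow> bool" where
  "subset_less \<nu> d d' \<longleftrightarrow>
     (sbar \<nu> d, sbar \<nu> d') \<in> lexord less_than \<or>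
     (sbar \<nu> d = sbar \<nu> d' \<and>
      (sorted_list_of_set d, sorted_list_of_set d') \<in> lexord less_than)"

definition subset_orbits :: "nat list \<Rightarrow> nat set set set" where
  "subset_orbits \<nu> = (\<lambda>d. (\<lambda>\<pi>. \<pi> -` d) ` young \<nu>) ` Pow {1..sum_list \<nu>}"

text \<open>The list \<open>O\<^sub>1 < \<dots> < O\<^sub>N\<close>; the string \<open>sbar \<nu> d\<close> is constant on orbits.\<close>

definition orbit_list :: "nat list \<Rightarrow> nat set set list" where
  "orbit_list \<nu> = (THE Os. set Os = subset_orbits \<nu> \<and>
     sorted_wrt (\<lambda>P Q. \<forall>d\<in>P. \<forall>d'\<in>Q. (sbar \<nu> d, sbar \<nu> d') \<in> lexord less_than) Os)"

definition D_sets :: "nat \<Rightarrow> nat \<Rightarrow> nat set set set" where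
  "D_sets i r = {D. D \<subseteq> Pow {1..r} - {{}} \<and> disjoint D \<and> card D = i}"

definition D_list :: "nat list \<Rightarrow> nat set set \<Rightarrow> nat set list" where
  "D_list \<nu> D = (THE l. set l = D \<and> sorted_wrt (subset_less \<nu>) l)"

definition psi :: "nat list \<Rightarrow> nat set set \<Rightarrow> transf" where
  "psi \<nu> D = (\<lambda>x. if x \<in> \<Union>D then (THE j. j \<in> {1..card D} \<and> x \<in> D_list \<nu> D ! (j - 1))
                   else if x \<in> {1..sum_list \<nu>} then 0 else x)"

text \<open>
  The set of all \<open>D\<^sub>\<alpha>\<close> with \<open>\<alpha> \<in> M\<close> of index \<open>i\<close>.  The map \<open>psi \<nu> D\<close> depends on \<open>\<nu>\<close> only up to a
  permutation of \<open>{1..i}\<close>, so the set is independent of \<open>\<nu>\<close>.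
\<close>

definition DM_sets :: "transf set \<Rightarrow> nat list \<Rightarrow> nat \<Rightarrow> nat \<Rightarrow> nat set set set" where
  "DM_sets M \<nu> i r = {D \<in> D_sets i r. \<exists>\<alpha>\<in>M. transf_index r \<alpha> = i \<and>
     (\<exists>C\<in>C_sets i r. \<exists>\<sigma>. \<sigma> permutes {1..i} \<and> \<alpha> = phi C \<circ> \<sigma> \<circ> psi \<nu> D)}"

definition C_orbits :: "nat list \<Rightarrow> nat \<Rightarrow> nat \<Rightarrow> nat set set set" where
  "C_orbits \<mu> i r = (\<lambda>C. (\<lambda>\<rho>. \<rho> ` C) ` young \<mu>) ` C_sets i r"

definition D_orbits :: "transf set \<Rightarrow> nat list \<Rightarrow> nat \<Rightarrow> nat \<Rightarrow> nat set set set set" where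
  "D_orbits M \<nu> i r = (\<lambda>D. (\<lambda>\<pi>. (\<lambda>d. \<pi> -` d) ` D) ` young \<nu>) ` DM_sets M \<nu> i r"

definition comp_C :: "nat list \<Rightarrow> nat set \<Rightarrow> nat list" where
  "comp_C \<mu> C = map (\<lambda>j. card (block \<mu> j \<inter> C)) [1..<Suc (length \<mu>)]"

definition comp_D :: "nat list \<Rightarrow> nat set set \<Rightarrow> nat list" where
  "comp_D \<nu> D = map (\<lambda>P. card (D \<inter> P)) (orbit_list \<nu>)"

definition comp_C_orbit :: "nat list \<Rightarrow> nat set set \<Rightarrow> nat list" where
  "comp_C_orbit \<mu> P = comp_C \<mu> (SOME C. C \<in> P)"

definition comp_D_orbit :: "nat list \<Rightarrow> nat set set set \<Rightarrow> nat list" where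
  "comp_D_orbit \<nu> P = comp_D \<nu> (SOME D. D \<in> P)"


section \<open>Partitions and tableaux\<close>

definition partitions :: "nat \<Rightarrow> nat list set" where
  "partitions i = {l. sorted_wrt (\<ge>) l \<and> 0 \<notin> set l \<and> sum_list l = i}"

definition dominates :: "nat list \<Rightarrow> nat list \<Rightarrow> bool" where
  "dominates l m \<longleftrightarrow> (\<forall>j. sum_list (take j m) \<le> sum_list (take j l))"

definition part_ge :: "nat list \<Rightarrow> nat list \<Rightarrow> bool" where
  "part_ge l m \<longleftrightarrow>
     sum_list l < sum_list m \<or> (sum_list l = sum_list m \<and> dominates l m)"

definition Lam :: "nat \<Rightarrow> transf set \<Rightarrow> nat list set" where
  "Lam r M = (\<Union>i\<in>index_set r M. partitions i)"

text \<open>A tableau is the list of its rows.\<close>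

type_synonym tableau = "nat list list"

definition column_strict :: "tableau \<Rightarrow> bool" where
  "column_strict t \<longleftrightarrow>
     (\<forall>a b. Suc a < length t \<and> b < length (t ! Suc a) \<longrightarrow> t ! a ! b < t ! Suc a ! b)"

definition standard_tableaux :: "nat list \<Rightarrow> tableau set" where
  "standard_tableaux l = {t. map length t = l \<and>
     distinct (concat t) \<and> set (concat t) = {1..sum_list l} \<and>
     (\<forall>w\<in>set t. sorted_wrt (<) w) \<and> column_strict t}"

definition semistandard_tableaux :: "nat list \<Rightarrow> nat list \<Rightarrow> tableau set" where
  "semistandard_tableaux l \<rho> = {t. map length t = l \<and>
     set (concat t) \<subseteq> {1..length \<rho>} \<and>
     (\<forall>j\<in>{1..length \<rho>}. count_list (concat t) j = \<rho> ! (j - 1)) \<and>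
     (\<forall>w\<in>set t. sorted_wrt (\<le>) w) \<and> column_strict t}"

definition tableau_type :: "nat list \<Rightarrow> tableau \<Rightarrow> tableau" where
  "tableau_type \<rho> t = map (map (block_no \<rho>)) t"

text \<open>
  The row-reading tableau has the entry \<open>j\<close> in the \<open>j\<close>-th position of the row reading order, which
  is the order of \<open>concat\<close>.
\<close>

definition d_perm :: "tableau \<Rightarrow> transf" where
  "d_perm t = (\<lambda>j. if j \<in> {1..length (concat t)} then concat t ! (j - 1) else j)"


section \<open>The cell basis\<close>

text \<open>Again, group and monoid ring elements are given by their coefficient functions.\<close>

definition murphy :: "nat list \<Rightarrow> tableau \<Rightarrow> tableau \<Rightarrow> (transf \<Rightarrow> int)" where
  "murphy l s t =
     (\<lambda>x. \<Sum>\<sigma>\<in>young l. if x = d_perm s \<circ> \<sigma> \<circ> inv_into UNIV (d_perm t) then 1 else 0)"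

definition murphy_type ::
  "nat list \<Rightarrow> nat list \<Rightarrow> tableau \<Rightarrow> nat list \<Rightarrow> tableau \<Rightarrow> (transf \<Rightarrow> int)" where
  "murphy_type l \<rho> S \<rho>' T = (\<lambda>x.
     \<Sum>s\<in>{s \<in> standard_tableaux l. tableau_type \<rho> s = S}.
     \<Sum>t\<in>{t \<in> standard_tableaux l. tableau_type \<rho>' t = T}. murphy l s t x)"

type_synonym lidx = "nat list \<times> nat set set \<times> tableau"
type_synonym ridx = "nat list \<times> nat set set set \<times> tableau"

definition L_set :: "nat \<Rightarrow> nat \<Rightarrow> nat list \<Rightarrow> lidx set" where
  "L_set r n l = {(\<mu>, P, S). \<mu> \<in> compositions r n \<and> P \<in> C_orbits \<mu> (sum_list l) r \<and>
     S \<in> semistandard_tableaux l (comp_C_orbit \<mu> P)}"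

definition R_set :: "nat \<Rightarrow> nat \<Rightarrow> transf set \<Rightarrow> nat list \<Rightarrow> ridx set" where
  "R_set r n M l = {(\<nu>, Q, T). \<nu> \<in> compositions r n \<and> Q \<in> D_orbits M \<nu> (sum_list l) r \<and>
     T \<in> semistandard_tableaux l (comp_D_orbit \<nu> Q)}"

fun cell_mring :: "nat list \<Rightarrow> lidx \<Rightarrow> ridx \<Rightarrow> (transf \<Rightarrow> int)" where
  "cell_mring l (\<mu>, P, S) (\<nu>, Q, T) = (\<lambda>x. \<Sum>C\<in>P. \<Sum>D\<in>Q.
     \<Sum>\<sigma> | \<sigma> permutes {1..sum_list l}.
       murphy_type l (comp_C_orbit \<mu> P) S (comp_D_orbit \<nu> Q) T \<sigma>
         * (if x = phi C \<circ> \<sigma> \<circ> psi \<nu> D then 1 else 0))"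

definition cell_elem ::
  "nat \<Rightarrow> nat \<Rightarrow> transf set \<Rightarrow> nat list \<Rightarrow> lidx \<Rightarrow> ridx \<Rightarrow> (bidx \<Rightarrow> 'k::field)" where
  "cell_elem r n M l u v = (\<lambda>(\<mu>, \<nu>, D).
     if (\<mu>, \<nu>, D) \<in> basis_set r n M \<and> \<mu> = fst u \<and> \<nu> = fst v
     then of_int (coset_coeff (cell_mring l u v) D) else 0)"


section \<open>The bracket of a cell algebra\<close>

definition k_span :: "('k::field, 'a, 'm) module_scheme \<Rightarrow> 'a set \<Rightarrow> 'a set" where
  "k_span A G = {\<Oplus>\<^bsub>A\<^esub>b\<in>F. c b \<odot>\<^bsub>A\<^esub> b | F c. finite F \<and> F \<subseteq> G}"

text \<open>
  Parameters: the algebra, the index set \<open>\<Lambda>\<close> with its order (as \<open>ge \<lambda> \<mu>\<close>), the families \<open>L\<close> and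
  \<open>R\<close>, and the cell basis.
\<close>

definition cell_hat ::
  "('k::field, 'a, 'm) module_scheme \<Rightarrow> 'l set \<Rightarrow> ('l \<Rightarrow> 'l \<Rightarrow> bool) \<Rightarrow>
   ('l \<Rightarrow> 's set) \<Rightarrow> ('l \<Rightarrow> 't set) \<Rightarrow> ('l \<Rightarrow> 's \<Rightarrow> 't \<Rightarrow> 'a) \<Rightarrow> 'l \<Rightarrow> 'a set" where
  "cell_hat A \<Lambda> ge L R C l =
     k_span A {C m s t | m s t. m \<in> \<Lambda> \<and> ge m l \<and> m \<noteq> l \<and> s \<in> L m \<and> t \<in> R m}"

definition cell_bracket ::
  "('k::field, 'a, 'm) module_scheme \<Rightarrow> 'l set \<Rightarrow> ('l \<Rightarrow> 'l \<Rightarrow> bool) \<Rightarrow>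
   ('l \<Rightarrow> 's set) \<Rightarrow> ('l \<Rightarrow> 't set) \<Rightarrow> ('l \<Rightarrow> 's \<Rightarrow> 't \<Rightarrow> 'a) \<Rightarrow> 'l \<Rightarrow> 's \<Rightarrow> 't \<Rightarrow> 'k" where
  "cell_bracket A \<Lambda> ge L R C l s t = (THE c. \<forall>s'\<in>L l. \<forall>t'\<in>R l.
     (C l s' t \<otimes>\<^bsub>A\<^esub> C l s t') \<ominus>\<^bsub>A\<^esub> (c \<odot>\<^bsub>A\<^esub> C l s' t') \<in> cell_hat A \<Lambda> ge L R C l)"

definition cell_Lam0 ::
  "('k::field, 'a, 'm) module_scheme \<Rightarrow> 'l set \<Rightarrow> ('l \<Rightarrow> 'l \<Rightarrow> bool) \<Rightarrow>
   ('l \<Rightarrow> 's set) \<Rightarrow> ('l \<Rightarrow> 't set) \<Rightarrow> ('l \<Rightarrow> 's \<Rightarrow> 't \<Rightarrow> 'a) \<Rightarrow> 'l set" where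
  "cell_Lam0 A \<Lambda> ge L R C =
     {l \<in> \<Lambda>. \<exists>s\<in>L l. \<exists>t\<in>R l. cell_bracket A \<Lambda> ge L R C l s t \<noteq> 0}"

text \<open>\<open>\<Lambda>\<^sub>0\<close> for \<open>A = S_L r n M\<close> or \<open>A = S_R r n M\<close>, which have the same cell basis.\<close>

definition Lam0 ::
  "nat \<Rightarrow> nat \<Rightarrow> transf set \<Rightarrow> ('k::field, bidx \<Rightarrow> 'k) module \<Rightarrow> nat list set" where
  "Lam0 r n M A = cell_Lam0 A (Lam r M) part_ge (L_set r n) (R_set r n M) (cell_elem r n M)"


section \<open>Quasi-hereditary algebras\<close>

locale fd_algebra = ring A for A :: "('k::field, 'a, 'm) module_scheme" (structure) +
  assumes smult_closed: "x \<in> carrier A \<Longrightarrow> c \<odot> x \<in> carrier A"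
    and smult_add_left: "x \<in> carrier A \<Longrightarrow> (c + d) \<odot> x = c \<odot> x \<oplus> d \<odot> x"
    and smult_add_right: "\<lbrakk>x \<in> carrier A; y \<in> carrier A\<rbrakk> \<Longrightarrow> c \<odot> (x \<oplus> y) = c \<odot> x \<oplus> c \<odot> y"
    and smult_smult: "x \<in> carrier A \<Longrightarrow> (c * d) \<odot> x = c \<odot> (d \<odot> x)"
    and smult_one: "x \<in> carrier A \<Longrightarrow> 1 \<odot> x = x"
    and smult_mult_left: "\<lbrakk>x \<in> carrier A; y \<in> carrier A\<rbrakk> \<Longrightarrow> (c \<odot> x) \<otimes> y = c \<odot> (x \<otimes> y)"
    and smult_mult_right: "\<lbrakk>x \<in> carrier A; y \<in> carrier A\<rbrakk> \<Longrightarrow> x \<otimes> (c \<odot> y) = c \<odot> (x \<otimes> y)"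
    and finite_dim: "\<exists>B. finite B \<and> B \<subseteq> carrier A \<and> k_span A B = carrier A"

definition left_ideal :: "('a, 'm) ring_scheme \<Rightarrow> 'a set \<Rightarrow> bool" where
  "left_ideal R I \<longleftrightarrow>
     additive_subgroup I R \<and> (\<forall>a\<in>carrier R. \<forall>x\<in>I. a \<otimes>\<^bsub>R\<^esub> x \<in> I)"

definition maximal_left_ideal :: "('a, 'm) ring_scheme \<Rightarrow> 'a set \<Rightarrow> bool" where
  "maximal_left_ideal R I \<longleftrightarrow> left_ideal R I \<and> I \<noteq> carrier R \<and>
     (\<forall>K. left_ideal R K \<and> I \<subseteq> K \<longrightarrow> K = I \<or> K = carrier R)"

definition jacobson_radical :: "('a, 'm) ring_scheme \<Rightarrow> 'a set" where
  "jacobson_radical R = carrier R \<inter> \<Inter>{I. maximal_left_ideal R I}"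

definition free_right :: "('a, 'm) ring_scheme \<Rightarrow> 'x set \<Rightarrow> ('x \<Rightarrow> 'a) set" where
  "free_right R X = {f. (\<forall>i. f i \<in> carrier R) \<and> (\<forall>i. i \<notin> X \<longrightarrow> f i = \<zero>\<^bsub>R\<^esub>) \<and>
     finite {i. f i \<noteq> \<zero>\<^bsub>R\<^esub>}}"

text \<open>
  A right ideal \<open>P\<close> is projective as a right module if it is isomorphic to a direct summand of a
  free module, that is, if there are module maps \<open>s : P \<rightarrow> F\<close> and \<open>p : F \<rightarrow> P\<close> with \<open>F\<close> free and
  \<open>p \<circ> s\<close> the identity.  Since \<open>P\<close> is a quotient of the free module on the set \<open>P\<close>, basis sets
  of the element type suffice.
\<close>

definition projective_right :: "('a, 'm) ring_scheme \<Rightarrow> 'a set \<Rightarrow> bool" where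
  "projective_right R P \<longleftrightarrow> (\<exists>(X :: 'a set) s p.
     s \<in> P \<rightarrow> free_right R X \<and> p \<in> free_right R X \<rightarrow> P \<and>
     (\<forall>x\<in>P. \<forall>y\<in>P. s (x \<oplus>\<^bsub>R\<^esub> y) = (\<lambda>i. s x i \<oplus>\<^bsub>R\<^esub> s y i)) \<and>
     (\<forall>x\<in>P. \<forall>a\<in>carrier R. s (x \<otimes>\<^bsub>R\<^esub> a) = (\<lambda>i. s x i \<otimes>\<^bsub>R\<^esub> a)) \<and>
     (\<forall>f\<in>free_right R X. \<forall>g\<in>free_right R X. p (\<lambda>i. f i \<oplus>\<^bsub>R\<^esub> g i) = p f \<oplus>\<^bsub>R\<^esub> p g) \<and>
     (\<forall>f\<in>free_right R X. \<forall>a\<in>carrier R. p (\<lambda>i. f i \<otimes>\<^bsub>R\<^esub> a) = p f \<otimes>\<^bsub>R\<^esub> a) \<and>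
     (\<forall>x\<in>P. p (s x) = x))"

text \<open>
  Heredity ideals and quasi-hereditary algebras after Cline, Parshall and Scott.  For a
  finite-dimensional algebra, asking for projectivity on the left instead of on the right in the
  definition of a heredity ideal gives the same notion.  Two-sided ideals of a unital algebra are
  subspaces, so the definition of a heredity ideal needs only the ring structure.
\<close>

definition heredity_ideal :: "('a, 'm) ring_scheme \<Rightarrow> 'a set \<Rightarrow> bool" where
  "heredity_ideal R J \<longleftrightarrow> ideal J R \<and>
     J \<cdot>\<^bsub>R\<^esub> J = J \<and>
     (J \<cdot>\<^bsub>R\<^esub> jacobson_radical R) \<cdot>\<^bsub>R\<^esub> J = {\<zero>\<^bsub>R\<^esub>} \<and>
     projective_right R J"

definition quasi_hereditary :: "('k::field, 'a, 'm) module_scheme \<Rightarrow> bool" where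
  "quasi_hereditary A \<longleftrightarrow> fd_algebra A \<and>
     (\<exists>m (J :: nat \<Rightarrow> 'a set).
        J 0 = {\<zero>\<^bsub>A\<^esub>} \<and> J m = carrier A \<and>
        (\<forall>t\<le>m. ideal (J t) A) \<and>
        (\<forall>t<m. J t \<subseteq> J (Suc t) \<and>
          heredity_ideal (A Quot J t) ((\<lambda>x. J t +>\<^bsub>A\<^esub> x) ` J (Suc t))))"

end

theory Submission
  imports Defs "HOL.Vector_Spaces" "HOL-Library.Function_Algebras"
begin

text \<open>
  Replacing \<open>b\<^sub>D\<close> by \<open>X(D) / n(D)\<close> turns the twisted product into the product of the monoid algebra.
  In characteristic 0 both algebras therefore become the algebra of families of functions
  \<open>F \<mu> \<nu>\<close> on the monoid that are invariant under \<open>\<SS>\<^sub>\<mu>\<close> on the left and \<open>\<SS>\<^sub>\<nu>\<close> on the right, with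
  matrix convolution as product (\<open>mult_formula\<close>) and the averages over the Young subgroups as unit.
  The two normalizations enter only through a few arithmetic properties, so that one argument serves
  both (locales \<open>twisted\<close>, \<open>full_twisted\<close>, \<open>cell_twisted\<close>).

  Quasi-heredity comes from the filtration by rank: \<open>J\<^sub>i\<close> consists of the functions supported on maps of
  rank at most \<open>i\<close>.  The full transformation monoid contains an idempotent map of every rank \<open>i\<close>, here
  \<open>x \<mapsto> min x i\<close>.  Regarded as an element \<open>e\<close> of the block of the composition \<open>(1,\<dots>,1,0,\<dots>,0)\<close>,
  whose Young subgroup is trivial, it has two properties modulo \<open>J\<^sub>i\<^sub>-\<^sub>1\<close>.  First, \<open>e A e\<close> is the group
  algebra of the symmetric group on \<open>i\<close> letters, which is von Neumann regular by Maschke's theorem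
  (\<open>corner_regular\<close>).  Second, a map of rank \<open>i\<close> with image \<open>C\<close> factors through the increasing
  bijection from \<open>{1..i}\<close> to \<open>C\<close>, and this yields a finite dual basis of the right module \<open>J\<^sub>i\<close> with
  generators in \<open>A e\<close> and coordinates in \<open>e A\<close> (\<open>gen_coord_sum\<close>, \<open>coord_fun_mult\<close>).  These
  properties make \<open>J\<^sub>i / J\<^sub>i\<^sub>-\<^sub>1\<close> a heredity ideal (\<open>heredity_ideal_criterion\<close>): the dual basis gives
  projectivity and idempotence, and the regularity of \<open>e A e\<close> kills \<open>J rad J\<close>.

  For the bracket of a partition \<open>\<lambda>\<close> of \<open>i\<close>, take the indices \<open>u\<close>, \<open>v\<close> that belong to the same
  composition \<open>(1,\<dots>,1,0,\<dots>,0)\<close>, the subset \<open>{1..i}\<close>, the set system of \<open>x \<mapsto> min x i\<close> and the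
  row-reading tableau.  Since \<open>r\<^sub>\<lambda> r\<^sub>\<lambda> = |\<SS>\<^sub>\<lambda>| r\<^sub>\<lambda>\<close>, the product of the cell basis elements with indices
  \<open>(s', v)\<close> and \<open>(u, t')\<close> is exactly \<open>|\<SS>\<^sub>\<lambda>|\<close> times the one with indices \<open>(s', t')\<close> (\<open>cell_mult\<close>).  It remains
  to see that the bracket, which is the unique scalar with this property modulo the larger cells,
  really equals \<open>|\<SS>\<^sub>\<lambda>|\<close>, that is, that some cell basis element of \<open>\<lambda>\<close> lies outside the span of the
  larger cells.  The alternating sum over the column stabilizer of \<open>\<lambda>\<close> defines a linear functional
  with value 1 on the element with indices \<open>(u, v)\<close> (\<open>col_sum_std\<close>).  It vanishes on the larger cells
  (\<open>col_sum_cell\<close>): a cell of smaller index has smaller rank, and if \<open>m\<close> strictly dominates \<open>\<lambda>\<close>, some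
  row of \<open>m\<close> contains two entries of a column of \<open>\<lambda>\<close>, whose transposition makes the terms cancel
  in pairs.
\<close>

section \<open>Heredity ideals\<close>

lemma left_ideal_carrier: "left_ideal R I \<Longrightarrow> I \<subseteq> carrier R"
  unfolding left_ideal_def using additive_subgroup.a_subset by blast

context ring
begin

lemma left_idealI:
  assumes "I \<subseteq> carrier R" "\<zero> \<in> I" "\<And>x y. x \<in> I \<Longrightarrow> y \<in> I \<Longrightarrow> x \<oplus> y \<in> I"
    "\<And>a x. a \<in> carrier R \<Longrightarrow> x \<in> I \<Longrightarrow> a \<otimes> x \<in> I"
  shows "left_ideal R I"
proof -
  have "\<ominus> x \<in> I" if "x \<in> I" for x
    using assms(4)[of "\<ominus> \<one>" x] that assms(1) by (auto simp: l_minus)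
  then have "subgroup I (add_monoid R)"
    by (intro add.subgroupI) (use assms in \<open>auto simp: a_inv_def[symmetric]\<close>)
  then show ?thesis
    unfolding left_ideal_def using assms(4) by (auto intro: additive_subgroupI)
qed

lemma left_ideal_closed:
  assumes "left_ideal R I"
  shows "I \<subseteq> carrier R" "\<zero> \<in> I" "\<And>x y. x \<in> I \<Longrightarrow> y \<in> I \<Longrightarrow> x \<oplus> y \<in> I"
    "\<And>a x. a \<in> carrier R \<Longrightarrow> x \<in> I \<Longrightarrow> a \<otimes> x \<in> I"
proof -
  interpret I: additive_subgroup I R using assms by (simp add: left_ideal_def)
  show "I \<subseteq> carrier R" "\<zero> \<in> I" "\<And>x y. x \<in> I \<Longrightarrow> y \<in> I \<Longrightarrow> x \<oplus> y \<in> I"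
    using I.a_subset I.zero_closed I.a_closed by blast+
  show "\<And>a x. a \<in> carrier R \<Longrightarrow> x \<in> I \<Longrightarrow> a \<otimes> x \<in> I" using assms by (simp add: left_ideal_def)
qed

text \<open>If \<open>R(1 - z)\<close> were proper, Zorn's lemma would put it into a maximal left ideal, which would
  contain both \<open>1 - z\<close> and \<open>z\<close>.\<close>

lemma radical_left_quasi_inverse:
  assumes z: "z \<in> jacobson_radical R"
  shows "\<exists>c\<in>carrier R. c \<otimes> (\<one> \<ominus> z) = \<one>"
proof (rule ccontr)
  assume no: "\<not> ?thesis"
  have zc: "z \<in> carrier R" using z by (auto simp: jacobson_radical_def)
  define L where "L = (\<lambda>c. c \<otimes> (\<one> \<ominus> z)) ` carrier R"
  have L: "left_ideal R L"
  proof (rule left_idealI)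
    show "L \<subseteq> carrier R" using zc by (auto simp: L_def)
    have "\<zero> = \<zero> \<otimes> (\<one> \<ominus> z)" using zc by simp
    then show "\<zero> \<in> L" unfolding L_def by blast
    show "x \<oplus> y \<in> L" if "x \<in> L" "y \<in> L" for x y
    proof -
      from that obtain c d where cd: "c \<in> carrier R" "d \<in> carrier R"
        and xy: "x = c \<otimes> (\<one> \<ominus> z)" "y = d \<otimes> (\<one> \<ominus> z)"
        unfolding L_def by auto
      then have "x \<oplus> y = (c \<oplus> d) \<otimes> (\<one> \<ominus> z)" using zc by (simp add: l_distr)
      then show ?thesis unfolding L_def using cd by blast
    qed
    show "a \<otimes> x \<in> L" if "a \<in> carrier R" "x \<in> L" for a x
    proof -
      from that obtain c where c: "c \<in> carrier R" and x: "x = c \<otimes> (\<one> \<ominus> z)"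
        unfolding L_def by auto
      then have "a \<otimes> x = (a \<otimes> c) \<otimes> (\<one> \<ominus> z)" using zc that by (simp add: m_assoc)
      then show ?thesis unfolding L_def using c that by blast
    qed
  qed
  have one_L: "\<one> \<notin> L" using no by (auto simp: L_def)
  define \<S> where "\<S> = {I. left_ideal R I \<and> L \<subseteq> I \<and> \<one> \<notin> I}"
  have "\<exists>U\<in>\<S>. \<forall>X\<in>\<S>. U \<subseteq> X \<longrightarrow> X = U"
  proof (rule subset_Zorn_nonempty)
    show "\<S> \<noteq> {}" using L one_L by (auto simp: \<S>_def)
    fix \<C> assume ne: "\<C> \<noteq> {}" and ch: "subset.chain \<S> \<C>"
    then have sub: "\<C> \<subseteq> \<S>" by (auto simp: subset.chain_def)
    have "left_ideal R (\<Union>\<C>)"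
    proof (rule left_idealI)
      show "\<Union>\<C> \<subseteq> carrier R" using sub left_ideal_carrier by (auto simp: \<S>_def)
      obtain I where "I \<in> \<C>" using ne by blast
      then show "\<zero> \<in> \<Union>\<C>" using sub left_ideal_closed(2)[of I] by (auto simp: \<S>_def)
      show "x \<oplus> y \<in> \<Union>\<C>" if "x \<in> \<Union>\<C>" "y \<in> \<Union>\<C>" for x y
      proof -
        from that obtain I K where IK: "x \<in> I" "I \<in> \<C>" "y \<in> K" "K \<in> \<C>" by blast
        then have "I \<subseteq> K \<or> K \<subseteq> I" using ch by (auto simp: subset.chain_def)
        then show ?thesis
          using IK sub left_ideal_closed(3)[of I x y] left_ideal_closed(3)[of K x y]
          unfolding \<S>_def by blast
      qed
      show "a \<otimes> x \<in> \<Union>\<C>" if "a \<in> carrier R" "x \<in> \<Union>\<C>" for a x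
      proof -
        from that obtain I where I: "x \<in> I" "I \<in> \<C>" by blast
        then have "left_ideal R I" using sub by (auto simp: \<S>_def)
        then have "a \<otimes> x \<in> I" using left_ideal_closed(4) that(1) I(1) by blast
        then show ?thesis using I by blast
      qed
    qed
    then show "\<Union>\<C> \<in> \<S>" using ne sub by (auto simp: \<S>_def)
  qed
  then obtain U where U: "U \<in> \<S>" "\<And>X. X \<in> \<S> \<Longrightarrow> U \<subseteq> X \<Longrightarrow> X = U" by blast
  have lU: "left_ideal R U" and LU: "L \<subseteq> U" and oneU: "\<one> \<notin> U" using U(1) by (auto simp: \<S>_def)
  have full: "K = carrier R" if "left_ideal R K" "\<one> \<in> K" for K
  proof
    show "K \<subseteq> carrier R" using that left_ideal_carrier by blast
    show "carrier R \<subseteq> K"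
    proof
      fix a assume "a \<in> carrier R"
      then show "a \<in> K" using left_ideal_closed(4)[OF that(1), of a \<one>] that(2) by simp
    qed
  qed
  have "maximal_left_ideal R U"
    unfolding maximal_left_ideal_def
    using lU oneU U(2) full LU by (auto simp: \<S>_def)
  then have "z \<in> U" using z by (auto simp: jacobson_radical_def)
  moreover have "\<one> \<ominus> z \<in> U"
  proof -
    have "\<one> \<ominus> z = \<one> \<otimes> (\<one> \<ominus> z)" using zc by simp
    then show ?thesis using LU unfolding L_def by blast
  qed
  ultimately have "(\<one> \<ominus> z) \<oplus> z \<in> U" using left_ideal_closed(3)[OF lU] by blast
  moreover have "(\<one> \<ominus> z) \<oplus> z = \<one>" using zc by (simp add: minus_eq a_assoc l_neg)
  ultimately show False using oneU by simp
qed

lemma jacobson_radical_mult_left: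
  assumes "z \<in> jacobson_radical R" "a \<in> carrier R"
  shows "a \<otimes> z \<in> jacobson_radical R"
proof -
  have "a \<otimes> z \<in> I" if "maximal_left_ideal R I" for I
  proof -
    have "left_ideal R I" "z \<in> I"
      using that assms by (auto simp: maximal_left_ideal_def jacobson_radical_def)
    then show ?thesis using left_ideal_closed(4) assms(2) by blast
  qed
  then show ?thesis using assms by (auto simp: jacobson_radical_def)
qed

lemma zero_in_jacobson_radical: "\<zero> \<in> jacobson_radical R"
proof -
  have "\<zero> \<in> I" if "maximal_left_ideal R I" for I
    using left_ideal_closed(2) that by (simp add: maximal_left_ideal_def)
  then show ?thesis by (auto simp: jacobson_radical_def)
qed

text \<open>With \<open>w = a z b\<close>, the element \<open>b h a z\<close> lies in the radical and \<open>(1 - b h a z) b h w = 0\<close>, where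
  the first factor can be cancelled.  So \<open>w = w h w = a z (b h w) = 0\<close>.\<close>

lemma regular_radical_element_zero:
  assumes z: "z \<in> jacobson_radical R" and c: "a \<in> carrier R" "b \<in> carrier R" "h \<in> carrier R"
    and reg: "(a \<otimes> z \<otimes> b) \<otimes> h \<otimes> (a \<otimes> z \<otimes> b) = a \<otimes> z \<otimes> b"
  shows "a \<otimes> z \<otimes> b = \<zero>"
proof -
  have zc: "z \<in> carrier R" using z by (auto simp: jacobson_radical_def)
  define w where "w = a \<otimes> z \<otimes> b"
  have wc: "w \<in> carrier R" using c zc by (simp add: w_def)
  have "(b \<otimes> h \<otimes> a) \<otimes> z \<in> jacobson_radical R"
    using jacobson_radical_mult_left[OF z] c by simp
  then obtain d where d: "d \<in> carrier R" "d \<otimes> (\<one> \<ominus> (b \<otimes> h \<otimes> a) \<otimes> z) = \<one>"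
    using radical_left_quasi_inverse by blast
  have "(b \<otimes> h \<otimes> a) \<otimes> z \<otimes> (b \<otimes> h \<otimes> w) = b \<otimes> h \<otimes> (w \<otimes> h \<otimes> w)"
    using c zc wc by (simp add: w_def m_assoc)
  also have "\<dots> = b \<otimes> h \<otimes> w" using reg by (simp add: w_def)
  finally have eq: "(b \<otimes> h \<otimes> a) \<otimes> z \<otimes> (b \<otimes> h \<otimes> w) = b \<otimes> h \<otimes> w" .
  have "b \<otimes> h \<otimes> w = (d \<otimes> (\<one> \<ominus> (b \<otimes> h \<otimes> a) \<otimes> z)) \<otimes> (b \<otimes> h \<otimes> w)"
    using d c wc by simp
  also have "\<dots> = d \<otimes> ((\<one> \<ominus> (b \<otimes> h \<otimes> a) \<otimes> z) \<otimes> (b \<otimes> h \<otimes> w))"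
    using d c zc wc by (intro m_assoc) auto
  also have "(\<one> \<ominus> (b \<otimes> h \<otimes> a) \<otimes> z) \<otimes> (b \<otimes> h \<otimes> w) = (b \<otimes> h \<otimes> w) \<ominus> ((b \<otimes> h \<otimes> a) \<otimes> z \<otimes> (b \<otimes> h \<otimes> w))"
    using c zc wc by (simp add: minus_eq l_distr l_minus)
  also have "\<dots> = \<zero>" using eq c wc by (simp add: minus_eq r_neg)
  finally have z0: "b \<otimes> h \<otimes> w = \<zero>" using d by simp
  have "w = w \<otimes> h \<otimes> w" using reg by (simp add: w_def)
  also have "\<dots> = (a \<otimes> z) \<otimes> (b \<otimes> h \<otimes> w)" using c zc wc by (simp add: w_def m_assoc)
  also have "\<dots> = \<zero>" using z0 c zc by simp
  finally show ?thesis by (simp add: w_def)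
qed

lemma finsum_fibres:
  assumes "finite K" "\<And>k. k \<in> K \<Longrightarrow> g k \<in> carrier R"
  shows "(\<Oplus>a\<in>x ` K. \<Oplus>k\<in>{k \<in> K. x k = a}. g k) = (\<Oplus>k\<in>K. g k)"
  using assms
proof (induction "x ` K" arbitrary: K rule: infinite_finite_induct)
  case infinite
  then show ?case by simp
next
  case empty
  then show ?case by simp
next
  case (insert a F)
  let ?K1 = "{k \<in> K. x k = a}" and ?K2 = "{k \<in> K. x k \<noteq> a}"
  have im: "x ` ?K2 = F" using insert(2,4) by auto
  have K: "K = ?K1 \<union> ?K2" by auto
  have "(\<Oplus>a\<in>x ` K. \<Oplus>k\<in>{k \<in> K. x k = a}. g k)
      = (\<Oplus>k\<in>?K1. g k) \<oplus> (\<Oplus>b\<in>F. \<Oplus>k\<in>{k \<in> K. x k = b}. g k)"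
    unfolding insert(4)[symmetric] using insert
    by (subst finsum_insert) (auto intro!: finsum_closed)
  also have "(\<Oplus>b\<in>F. \<Oplus>k\<in>{k \<in> K. x k = b}. g k) = (\<Oplus>b\<in>F. \<Oplus>k\<in>{k \<in> ?K2. x k = b}. g k)"
  proof (rule finsum_cong')
    show "(\<lambda>b. \<Oplus>k\<in>{k \<in> ?K2. x k = b}. g k) \<in> F \<rightarrow> carrier R"
      using insert by (auto intro!: finsum_closed)
    fix b assume "b \<in> F"
    then have "{k \<in> K. x k = b} = {k \<in> ?K2. x k = b}" using insert(2) by auto
    then show "(\<Oplus>k\<in>{k \<in> K. x k = b}. g k) = (\<Oplus>k\<in>{k \<in> ?K2. x k = b}. g k)" by simp
  qed simp
  also have "\<dots> = (\<Oplus>k\<in>?K2. g k)"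
    using insert(3)[of ?K2] im insert(5,6) by auto
  also have "(\<Oplus>k\<in>?K1. g k) \<oplus> (\<Oplus>k\<in>?K2. g k) = (\<Oplus>k\<in>?K1 \<union> ?K2. g k)"
    using insert by (intro finsum_Un_disjoint[symmetric]) auto
  finally show ?case using K by simp
qed

text \<open>This is the dual basis lemma.  The free module is indexed by the elements \<open>x k\<close> themselves, so the
  functionals that belong to equal elements are added up.\<close>

lemma projective_right_dual_basis:
  fixes x :: "'i \<Rightarrow> 'a"
  assumes K: "finite K" and J: "J \<subseteq> carrier R"
    and J_add: "\<And>y y'. y \<in> J \<Longrightarrow> y' \<in> J \<Longrightarrow> y \<oplus> y' \<in> J"
    and J_zero: "\<zero> \<in> J"
    and J_mult: "\<And>y a. y \<in> J \<Longrightarrow> a \<in> carrier R \<Longrightarrow> y \<otimes> a \<in> J"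
    and x: "\<And>k. k \<in> K \<Longrightarrow> x k \<in> J"
    and f: "\<And>k y. k \<in> K \<Longrightarrow> y \<in> J \<Longrightarrow> f k y \<in> carrier R"
    and f_add: "\<And>k y y'. k \<in> K \<Longrightarrow> y \<in> J \<Longrightarrow> y' \<in> J \<Longrightarrow> f k (y \<oplus> y') = f k y \<oplus> f k y'"
    and f_mult: "\<And>k y a. k \<in> K \<Longrightarrow> y \<in> J \<Longrightarrow> a \<in> carrier R \<Longrightarrow> f k (y \<otimes> a) = f k y \<otimes> a"
    and dual: "\<And>y. y \<in> J \<Longrightarrow> (\<Oplus>k\<in>K. x k \<otimes> f k y) = y"
  shows "projective_right R J"
proof -
  define X where "X = x ` K"
  have X: "finite X" "X \<subseteq> J" using K x by (auto simp: X_def)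
  define s where "s y = (\<lambda>a. if a \<in> X then (\<Oplus>k\<in>{k \<in> K. x k = a}. f k y) else \<zero>)" for y
  define p where "p g = (\<Oplus>a\<in>X. a \<otimes> g a)" for g
  have fin: "finite {k \<in> K. x k = a}" for a using K by simp
  have xc: "x k \<in> carrier R" if "k \<in> K" for k using x J that by blast
  have Xc: "a \<in> carrier R" if "a \<in> X" for a using X J that by blast
  have p_J: "(\<Oplus>a\<in>Y. a \<otimes> g a) \<in> J" if "finite Y" "Y \<subseteq> X" "g \<in> free_right R X" for Y g
    using that
  proof (induction Y rule: finite_induct)
    case empty then show ?case using J_zero by simp
  next
    case (insert a Y)
    have g: "g b \<in> carrier R" for b using insert(5) by (auto simp: free_right_def)
    have "(\<Oplus>a\<in>insert a Y. a \<otimes> g a) = a \<otimes> g a \<oplus> (\<Oplus>a\<in>Y. a \<otimes> g a)"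
      using insert Xc g by (subst finsum_insert) auto
    then show ?case using insert X J_add J_mult g by auto
  qed
  show ?thesis
    unfolding projective_right_def
  proof (intro exI[of _ X] exI[of _ s] exI[of _ p] conjI ballI)
    show "s \<in> J \<rightarrow> free_right R X"
      using f X by (auto simp: free_right_def s_def intro!: finsum_closed)
    show "p \<in> free_right R X \<rightarrow> J" using p_J[OF X(1)] by (auto simp: p_def)
    show "s (y \<oplus> y') = (\<lambda>i. s y i \<oplus> s y' i)" if "y \<in> J" "y' \<in> J" for y y'
    proof
      fix a
      have "(\<Oplus>k\<in>{k \<in> K. x k = a}. f k (y \<oplus> y')) = (\<Oplus>k\<in>{k \<in> K. x k = a}. f k y \<oplus> f k y')"
        using that f f_add by (intro finsum_cong') auto
      also have "\<dots> = (\<Oplus>k\<in>{k \<in> K. x k = a}. f k y) \<oplus> (\<Oplus>k\<in>{k \<in> K. x k = a}. f k y')"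
        using that f by (intro finsum_addf) auto
      finally show "s (y \<oplus> y') a = s y a \<oplus> s y' a" by (simp add: s_def)
    qed
    show "s (y \<otimes> b) = (\<lambda>i. s y i \<otimes> b)" if "y \<in> J" "b \<in> carrier R" for y b
    proof
      fix a
      have "(\<Oplus>k\<in>{k \<in> K. x k = a}. f k (y \<otimes> b)) = (\<Oplus>k\<in>{k \<in> K. x k = a}. f k y \<otimes> b)"
        using that f f_mult by (intro finsum_cong') auto
      also have "\<dots> = (\<Oplus>k\<in>{k \<in> K. x k = a}. f k y) \<otimes> b"
        using that f fin by (intro finsum_ldistr[symmetric]) auto
      finally show "s (y \<otimes> b) a = s y a \<otimes> b" using that by (simp add: s_def)
    qed
    show "p (\<lambda>i. g i \<oplus> g' i) = p g \<oplus> p g'" if "g \<in> free_right R X" "g' \<in> free_right R X" for g g'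
    proof -
      have c: "g b \<in> carrier R" "g' b \<in> carrier R" for b using that by (auto simp: free_right_def)
      have "p (\<lambda>i. g i \<oplus> g' i) = (\<Oplus>a\<in>X. a \<otimes> g a \<oplus> a \<otimes> g' a)"
        unfolding p_def using c X J by (intro finsum_cong') (auto simp: r_distr subset_iff)
      also have "\<dots> = p g \<oplus> p g'"
        unfolding p_def using c X J by (intro finsum_addf) auto
      finally show ?thesis .
    qed
    show "p (\<lambda>i. g i \<otimes> b) = p g \<otimes> b" if "g \<in> free_right R X" "b \<in> carrier R" for g b
    proof -
      have c: "g b \<in> carrier R" for b using that by (auto simp: free_right_def)
      have "p (\<lambda>i. g i \<otimes> b) = (\<Oplus>a\<in>X. (a \<otimes> g a) \<otimes> b)"
        unfolding p_def using c X J that by (intro finsum_cong') (auto simp: m_assoc subset_iff)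
      also have "\<dots> = p g \<otimes> b"
        unfolding p_def using c X J that by (intro finsum_ldistr[symmetric]) auto
      finally show ?thesis .
    qed
    show "p (s y) = y" if y: "y \<in> J" for y
    proof -
      have "p (s y) = (\<Oplus>a\<in>X. \<Oplus>k\<in>{k \<in> K. x k = a}. x k \<otimes> f k y)"
        unfolding p_def
      proof (rule finsum_cong')
        show "(\<lambda>a. \<Oplus>k\<in>{k \<in> K. x k = a}. x k \<otimes> f k y) \<in> X \<rightarrow> carrier R"
          using f xc y by (auto intro!: finsum_closed)
        fix a assume a: "a \<in> X"
        then have ac: "a \<in> carrier R" using X J by auto
        have "a \<otimes> s y a = (\<Oplus>k\<in>{k \<in> K. x k = a}. a \<otimes> f k y)"
          using a ac f y fin by (auto simp: s_def intro!: finsum_rdistr)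
        also have "\<dots> = (\<Oplus>k\<in>{k \<in> K. x k = a}. x k \<otimes> f k y)"
          using ac f xc y by (intro finsum_cong') auto
        finally show "a \<otimes> s y a = (\<Oplus>k\<in>{k \<in> K. x k = a}. x k \<otimes> f k y)" .
      qed simp
      also have "\<dots> = (\<Oplus>k\<in>K. x k \<otimes> f k y)"
        unfolding X_def using K f xc y by (intro finsum_fibres) auto
      finally show ?thesis using dual[OF y] by simp
    qed
  qed
qed

text \<open>If \<open>z\<close> is in the radical, the dual basis writes \<open>y z y'\<close> as a sum of terms \<open>x\<^sub>k w f\<^sub>l(y')\<close> in which
  \<open>w = f\<^sub>k(y) z x\<^sub>l\<close> lies in \<open>e R e\<close>; such a \<open>w\<close> vanishes, because it is regular and a multiple of \<open>z\<close>.
  Idempotence and projectivity are immediate from the dual basis.\<close>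

lemma heredity_ideal_criterion:
  fixes x :: "'i \<Rightarrow> 'a"
  assumes J: "ideal J R" and K: "finite K"
    and x: "\<And>k. k \<in> K \<Longrightarrow> x k \<in> J"
    and f: "\<And>k y. k \<in> K \<Longrightarrow> y \<in> J \<Longrightarrow> f k y \<in> J"
    and f_add: "\<And>k y y'. k \<in> K \<Longrightarrow> y \<in> J \<Longrightarrow> y' \<in> J \<Longrightarrow> f k (y \<oplus> y') = f k y \<oplus> f k y'"
    and f_mult: "\<And>k y a. k \<in> K \<Longrightarrow> y \<in> J \<Longrightarrow> a \<in> carrier R \<Longrightarrow> f k (y \<otimes> a) = f k y \<otimes> a"
    and dual: "\<And>y. y \<in> J \<Longrightarrow> (\<Oplus>k\<in>K. x k \<otimes> f k y) = y"
    and e: "e \<in> carrier R" "\<And>k. k \<in> K \<Longrightarrow> x k \<otimes> e = x k"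
      "\<And>k y. k \<in> K \<Longrightarrow> y \<in> J \<Longrightarrow> e \<otimes> f k y = f k y"
    and reg: "\<And>z. z \<in> carrier R \<Longrightarrow>
      \<exists>h\<in>carrier R. (e \<otimes> z \<otimes> e) \<otimes> h \<otimes> (e \<otimes> z \<otimes> e) = e \<otimes> z \<otimes> e"
  shows "heredity_ideal R J"
proof -
  interpret J: ideal J R by fact
  note Jc = J.a_Hcarr
  have sum_in: "(\<Oplus>k\<in>F. g k) \<in> S" if "finite F" "\<And>k. k \<in> F \<Longrightarrow> g k \<in> S" "S \<subseteq> carrier R" "\<zero> \<in> S"
      "\<And>a b. a \<in> S \<Longrightarrow> b \<in> S \<Longrightarrow> a \<oplus> b \<in> S" for F S and g :: "'i \<Rightarrow> 'a"
    using that(1,2)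
  proof (induction F rule: finite_induct)
    case empty then show ?case using that by simp
  next
    case (insert a F)
    have "(\<Oplus>k\<in>insert a F. g k) = g a \<oplus> (\<Oplus>k\<in>F. g k)"
      using insert that(3) by (subst finsum_insert) auto
    then show ?case using insert that by auto
  qed
  have JJ: "J \<cdot> J = J"
  proof
    show "J \<cdot> J \<subseteq> J" using ideal_prod_inter[OF J J] by blast
    have z: "\<zero> \<in> J \<cdot> J"
      using ideal_prod.prod[of \<zero> J \<zero> J R] J.zero_closed by simp
    show "J \<subseteq> J \<cdot> J"
    proof
      fix y assume y: "y \<in> J"
      have "(\<Oplus>k\<in>K. x k \<otimes> f k y) \<in> J \<cdot> J"
        using sum_in[of K "\<lambda>k. x k \<otimes> f k y" "J \<cdot> J"] K z x f y
        by (auto intro: ideal_prod.intros ideal_prod_in_carrier[OF J J, THEN subsetD])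
      then show "y \<in> J \<cdot> J" using dual[OF y] by simp
    qed
  qed
  have vanish: "y \<otimes> z \<otimes> y' = \<zero>" if y: "y \<in> J" "y' \<in> J" and z: "z \<in> jacobson_radical R" for y z y'
  proof -
    have zc: "z \<in> carrier R" using z by (auto simp: jacobson_radical_def)
    have mid: "f k y \<otimes> z \<otimes> x l = \<zero>" if k: "k \<in> K" "l \<in> K" for k l
    proof -
      have c: "f k y \<in> carrier R" "x l \<in> carrier R" using f x k y Jc by auto
      have "f k y \<otimes> z \<otimes> x l = (e \<otimes> f k y) \<otimes> z \<otimes> (x l \<otimes> e)" using e k y by simp
      also have "\<dots> = e \<otimes> (f k y \<otimes> z \<otimes> x l) \<otimes> e" using c zc e(1) by (simp add: m_assoc)
      finally have eq: "f k y \<otimes> z \<otimes> x l = e \<otimes> (f k y \<otimes> z \<otimes> x l) \<otimes> e" .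
      obtain h where "h \<in> carrier R" "(f k y \<otimes> z \<otimes> x l) \<otimes> h \<otimes> (f k y \<otimes> z \<otimes> x l) = f k y \<otimes> z \<otimes> x l"
        using reg[of "f k y \<otimes> z \<otimes> x l"] c zc eq by auto
      then show ?thesis using regular_radical_element_zero[OF z] c by blast
    qed
    have c: "f k y \<in> carrier R" "f k y' \<in> carrier R" "x k \<in> carrier R" if "k \<in> K" for k
      using f x that y Jc by auto
    have yz: "f k y \<otimes> z \<otimes> y' = \<zero>" if k: "k \<in> K" for k
    proof -
      have "f k y \<otimes> z \<otimes> y' = f k y \<otimes> z \<otimes> (\<Oplus>l\<in>K. x l \<otimes> f l y')" using dual y by simp
      also have "\<dots> = (\<Oplus>l\<in>K. (f k y \<otimes> z) \<otimes> (x l \<otimes> f l y'))"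
        using K c k zc by (intro finsum_rdistr) auto
      also have "\<dots> = (\<Oplus>l\<in>K. (f k y \<otimes> z \<otimes> x l) \<otimes> f l y')"
        using c k zc by (intro finsum_cong') (auto simp: m_assoc)
      also have "\<dots> = (\<Oplus>l\<in>K. \<zero>)"
        using c k zc by (intro finsum_cong') (auto simp: mid)
      finally show ?thesis by simp
    qed
    have "y \<otimes> z \<otimes> y' = (\<Oplus>k\<in>K. x k \<otimes> f k y) \<otimes> (z \<otimes> y')"
      using dual y zc Jc by (simp add: m_assoc)
    also have "\<dots> = (\<Oplus>k\<in>K. x k \<otimes> f k y \<otimes> (z \<otimes> y'))"
      using K c zc y Jc by (intro finsum_ldistr) auto
    also have "\<dots> = (\<Oplus>k\<in>K. x k \<otimes> (f k y \<otimes> z \<otimes> y'))"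
      using c zc y Jc by (intro finsum_cong') (auto simp: m_assoc)
    also have "\<dots> = (\<Oplus>k\<in>K. \<zero>)"
      using c by (intro finsum_cong') (auto simp: yz)
    finally show ?thesis by simp
  qed
  have rad: "(J \<cdot> jacobson_radical R) \<cdot> J = {\<zero>}"
  proof
    have rc: "jacobson_radical R \<subseteq> carrier R" by (auto simp: jacobson_radical_def)
    have 1: "s \<in> carrier R \<and> (\<forall>y\<in>J. s \<otimes> y = \<zero>)" if "s \<in> J \<cdot> jacobson_radical R" for s
      using that
    proof (induction s rule: ideal_prod.induct)
      case (prod i j)
      then show ?case using vanish rc Jc by auto
    next
      case (sum s1 s2)
      then show ?case using Jc by (auto simp: l_distr)
    qed
    have "s = \<zero>" if "s \<in> (J \<cdot> jacobson_radical R) \<cdot> J" for s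
      using that by (induction s rule: ideal_prod.induct) (use 1 in auto)
    then show "(J \<cdot> jacobson_radical R) \<cdot> J \<subseteq> {\<zero>}" by blast
    have "\<zero> \<otimes> \<zero> \<otimes> \<zero> \<in> (J \<cdot> jacobson_radical R) \<cdot> J"
      by (intro ideal_prod.intros J.zero_closed zero_in_jacobson_radical)
    then show "{\<zero>} \<subseteq> (J \<cdot> jacobson_radical R) \<cdot> J" by simp
  qed
  have "projective_right R J"
    using J.a_subset J.zero_closed J.a_closed J.I_r_closed Jc
    by (intro projective_right_dual_basis[OF K, of J x f]) (auto simp: x f f_add f_mult dual)
  then show ?thesis unfolding heredity_ideal_def using J JJ rad by blast
qed

end

text \<open>Passing to \<open>J/I\<close>: the functionals \<open>f\<^sub>k\<close> descend to the quotient because they are additive and map \<open>I\<close>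
  into itself, so linearity and duality have to hold only modulo \<open>I\<close>.\<close>

lemma (in ring) heredity_ideal_quotient:
  fixes x :: "'i \<Rightarrow> 'a"
  assumes I: "ideal I R" and J: "ideal J R" and IJ: "I \<subseteq> J" and K: "finite K"
    and x: "\<And>k. k \<in> K \<Longrightarrow> x k \<in> J"
    and f: "\<And>k y. k \<in> K \<Longrightarrow> y \<in> J \<Longrightarrow> f k y \<in> J"
    and f_I: "\<And>k y. k \<in> K \<Longrightarrow> y \<in> I \<Longrightarrow> f k y \<in> I"
    and f_add: "\<And>k y y'. k \<in> K \<Longrightarrow> y \<in> J \<Longrightarrow> y' \<in> J \<Longrightarrow> f k (y \<oplus> y') = f k y \<oplus> f k y'"
    and f_mult: "\<And>k y a. k \<in> K \<Longrightarrow> y \<in> J \<Longrightarrow> a \<in> carrier R \<Longrightarrow> f k (y \<otimes> a) \<ominus> f k y \<otimes> a \<in> I"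
    and dual: "\<And>y. y \<in> J \<Longrightarrow> (\<Oplus>k\<in>K. x k \<otimes> f k y) \<ominus> y \<in> I"
    and e: "e \<in> carrier R" "\<And>k. k \<in> K \<Longrightarrow> x k \<otimes> e = x k"
      "\<And>k y. k \<in> K \<Longrightarrow> y \<in> J \<Longrightarrow> e \<otimes> f k y = f k y"
    and reg: "\<And>z. z \<in> carrier R \<Longrightarrow>
      \<exists>h\<in>carrier R. (e \<otimes> z \<otimes> e) \<otimes> h \<otimes> (e \<otimes> z \<otimes> e) \<ominus> e \<otimes> z \<otimes> e \<in> I"
  shows "heredity_ideal (R Quot I) ((+>) I ` J)"
proof -
  interpret I: ideal I R by fact
  interpret J: ideal J R by fact
  interpret Q: ring "R Quot I" by (rule I.quotient_is_ring)
  interpret h: ring_hom_ring R "R Quot I" "(+>) I" by (rule I.rcos_ring_hom_ring)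
  note Ic = I.a_Hcarr and Jc = J.a_Hcarr
  have Qc: "\<exists>c\<in>carrier R. b = I +> c" if "b \<in> carrier (R Quot I)" for b
    using that by (auto simp: FactRing_def A_RCOSETS_def RCOSETS_def a_r_coset_def)
  have hsum: "I +> (\<Oplus>k\<in>F. u k) = (\<Oplus>\<^bsub>R Quot I\<^esub>k\<in>F. I +> u k)"
    if "finite F" "\<And>k. k \<in> F \<Longrightarrow> u k \<in> carrier R" for F and u :: "'i \<Rightarrow> 'a"
    using that
  proof (induction F rule: finite_induct)
    case empty
    show ?case using h.hom_zero by simp
  next
    case (insert a F)
    then have "(\<Oplus>k\<in>insert a F. u k) = u a \<oplus> (\<Oplus>k\<in>F. u k)"
      by (subst finsum_insert) auto
    moreover have "(\<Oplus>\<^bsub>R Quot I\<^esub>k\<in>insert a F. I +> u k)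
        = (I +> u a) \<oplus>\<^bsub>R Quot I\<^esub> (\<Oplus>\<^bsub>R Quot I\<^esub>k\<in>F. I +> u k)"
      using insert by (subst Q.finsum_insert) auto
    moreover have "(\<Oplus>k\<in>F. u k) \<in> carrier R" using insert by (intro finsum_closed) auto
    ultimately show ?case using insert by simp
  qed
  have eqI: "I +> a = I +> b" if "a \<ominus> b \<in> I" "a \<in> carrier R" "b \<in> carrier R" for a b
    using that quotient_eq_iff_same_a_r_cos[OF I] by simp
  have eqD: "a \<ominus> b \<in> I" if "I +> a = I +> b" "a \<in> carrier R" "b \<in> carrier R" for a b
    using that quotient_eq_iff_same_a_r_cos[OF I] by simp
  define g where "g k Y = I +> f k (SOME y. y \<in> J \<and> Y = I +> y)" for k Y
  \<comment> \<open>Two representatives differ by an element of \<open>I\<close>, on which \<open>f k\<close> takes values in \<open>I\<close>.\<close>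
  have g: "g k (I +> y) = I +> f k y" if k: "k \<in> K" and y: "y \<in> J" for k y
  proof -
    define y' where "y' = (SOME y'. y' \<in> J \<and> I +> y = I +> y')"
    have y': "y' \<in> J \<and> I +> y = I +> y'"
      unfolding y'_def by (rule someI[where x = y]) (use y in auto)
    have d: "y \<ominus> y' \<in> I" using y' y Jc by (intro eqD) auto
    have "y = (y \<ominus> y') \<oplus> y'" using y y' Jc by (simp add: minus_eq a_assoc l_neg)
    then have "f k y = f k (y \<ominus> y') \<oplus> f k y'" using f_add[OF k, of "y \<ominus> y'" y'] d IJ y' by auto
    moreover have "f k (y \<ominus> y') \<in> I" using f_I k d by blast
    moreover have "f k y' \<in> carrier R" using f k y' Jc by blast
    ultimately have "f k y \<ominus> f k y' \<in> I"
      using Ic by (simp add: minus_eq a_assoc r_neg)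
    then have "I +> f k y = I +> f k y'" using f k y y' Jc by (intro eqI) auto
    then show ?thesis by (simp add: g_def y'_def)
  qed
  have fc: "f k y \<in> carrier R" if "k \<in> K" "y \<in> J" for k y using f that Jc by blast
  have xc: "x k \<in> carrier R" if "k \<in> K" for k using x that Jc by blast
  have idl: "ideal ((+>) I ` J) (R Quot I)"
  proof (rule idealI)
    show "subgroup ((+>) I ` J) (add_monoid (R Quot I))"
    proof (rule Q.add.subgroupI)
      show "(+>) I ` J \<subseteq> carrier (R Quot I)" using h.hom_closed Jc by blast
      show "(+>) I ` J \<noteq> {}" using J.zero_closed by blast
      fix a assume "a \<in> (+>) I ` J"
      then obtain y where y: "y \<in> J" "a = I +> y" by blast
      have "\<ominus>\<^bsub>R Quot I\<^esub> a = I +> (\<ominus> y)" using y Jc by simp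
      moreover have "\<ominus> y \<in> J" using y by simp
      ultimately show "\<ominus>\<^bsub>R Quot I\<^esub> a \<in> (+>) I ` J" by blast
    next
      fix a b assume "a \<in> (+>) I ` J" "b \<in> (+>) I ` J"
      then obtain y y' where "y \<in> J" "a = I +> y" "y' \<in> J" "b = I +> y'" by blast
      then have "a \<oplus>\<^bsub>R Quot I\<^esub> b = I +> (y \<oplus> y')" "y \<oplus> y' \<in> J" using Jc by auto
      then show "a \<oplus>\<^bsub>R Quot I\<^esub> b \<in> (+>) I ` J" by blast
    qed
  next
    fix a b assume a: "a \<in> (+>) I ` J" and b: "b \<in> carrier (R Quot I)"
    from a obtain y where y: "y \<in> J" "a = I +> y" by blast
    from Qc[OF b] obtain c where c: "c \<in> carrier R" "b = I +> c" by blast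
    have "b \<otimes>\<^bsub>R Quot I\<^esub> a = I +> (c \<otimes> y)" "a \<otimes>\<^bsub>R Quot I\<^esub> b = I +> (y \<otimes> c)"
      using y c Jc by auto
    then show "b \<otimes>\<^bsub>R Quot I\<^esub> a \<in> (+>) I ` J" "a \<otimes>\<^bsub>R Quot I\<^esub> b \<in> (+>) I ` J"
      using y c J.I_l_closed J.I_r_closed by blast+
  qed (rule Q.ring_axioms)
  show ?thesis
  proof (rule Q.heredity_ideal_criterion[OF idl K, where x = "\<lambda>k. I +> x k" and f = g and e = "I +> e"])
    show "I +> x k \<in> (+>) I ` J" if "k \<in> K" for k using x that by blast
    show "g k y \<in> (+>) I ` J" if "k \<in> K" "y \<in> (+>) I ` J" for k y using g f that by auto
    show "g k (y \<oplus>\<^bsub>R Quot I\<^esub> y') = g k y \<oplus>\<^bsub>R Quot I\<^esub> g k y'"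
      if k: "k \<in> K" and Y: "y \<in> (+>) I ` J" "y' \<in> (+>) I ` J" for k y y'
    proof -
      from Y obtain z z' where z: "z \<in> J" "y = I +> z" "z' \<in> J" "y' = I +> z'" by blast
      have "g k (y \<oplus>\<^bsub>R Quot I\<^esub> y') = g k (I +> (z \<oplus> z'))" using z Jc by simp
      also have "\<dots> = I +> (f k z \<oplus> f k z')" using z k g f_add J.a_closed by (simp del: h.hom_add)
      also have "\<dots> = g k y \<oplus>\<^bsub>R Quot I\<^esub> g k y'" using z k g fc by simp
      finally show ?thesis .
    qed
    show "g k (y \<otimes>\<^bsub>R Quot I\<^esub> a) = g k y \<otimes>\<^bsub>R Quot I\<^esub> a"
      if k: "k \<in> K" and Y: "y \<in> (+>) I ` J" and A: "a \<in> carrier (R Quot I)" for k y a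
    proof -
      from Y obtain z where z: "z \<in> J" "y = I +> z" by blast
      from Qc[OF A] obtain c where c: "c \<in> carrier R" "a = I +> c" by blast
      have zc: "z \<otimes> c \<in> J" using z c J.I_r_closed by blast
      have "g k (y \<otimes>\<^bsub>R Quot I\<^esub> a) = g k (I +> (z \<otimes> c))" using z c Jc by simp
      also have "\<dots> = I +> f k (z \<otimes> c)" using g k zc by blast
      also have "\<dots> = I +> (f k z \<otimes> c)" using f_mult k z c fc zc by (intro eqI) auto
      also have "\<dots> = g k y \<otimes>\<^bsub>R Quot I\<^esub> a" using z c k g fc by simp
      finally show ?thesis .
    qed
    show "(\<Oplus>\<^bsub>R Quot I\<^esub>k\<in>K. (I +> x k) \<otimes>\<^bsub>R Quot I\<^esub> g k y) = y" if Y: "y \<in> (+>) I ` J" for y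
    proof -
      from Y obtain z where z: "z \<in> J" "y = I +> z" by blast
      have "(\<Oplus>\<^bsub>R Quot I\<^esub>k\<in>K. (I +> x k) \<otimes>\<^bsub>R Quot I\<^esub> g k y)
          = (\<Oplus>\<^bsub>R Quot I\<^esub>k\<in>K. I +> (x k \<otimes> f k z))"
        using z g fc xc by (intro Q.finsum_cong') auto
      also have "\<dots> = I +> (\<Oplus>k\<in>K. x k \<otimes> f k z)"
        using fc xc z hsum[OF K, of "\<lambda>k. x k \<otimes> f k z"] by simp
      also have "\<dots> = I +> z" using dual z fc xc Jc by (intro eqI) (auto intro!: finsum_closed)
      finally show ?thesis using z by simp
    qed
    show "I +> e \<in> carrier (R Quot I)" using e(1) by simp
    show "(I +> x k) \<otimes>\<^bsub>R Quot I\<^esub> (I +> e) = I +> x k" if "k \<in> K" for k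
      using e that xc by (simp flip: h.hom_mult)
    show "(I +> e) \<otimes>\<^bsub>R Quot I\<^esub> g k y = g k y" if "k \<in> K" "y \<in> (+>) I ` J" for k y
      using that e g fc by (auto simp flip: h.hom_mult)
    show "\<exists>h\<in>carrier (R Quot I).
        (I +> e) \<otimes>\<^bsub>R Quot I\<^esub> z \<otimes>\<^bsub>R Quot I\<^esub> (I +> e) \<otimes>\<^bsub>R Quot I\<^esub> h \<otimes>\<^bsub>R Quot I\<^esub>
          ((I +> e) \<otimes>\<^bsub>R Quot I\<^esub> z \<otimes>\<^bsub>R Quot I\<^esub> (I +> e)) =
        (I +> e) \<otimes>\<^bsub>R Quot I\<^esub> z \<otimes>\<^bsub>R Quot I\<^esub> (I +> e)"
      if Z: "z \<in> carrier (R Quot I)" for z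
    proof -
      from Qc[OF Z] obtain c where c: "c \<in> carrier R" "z = I +> c" by blast
      from reg[OF c(1)] obtain h where h: "h \<in> carrier R"
        "(e \<otimes> c \<otimes> e) \<otimes> h \<otimes> (e \<otimes> c \<otimes> e) \<ominus> e \<otimes> c \<otimes> e \<in> I" by blast
      have "I +> ((e \<otimes> c \<otimes> e) \<otimes> h \<otimes> (e \<otimes> c \<otimes> e)) = I +> (e \<otimes> c \<otimes> e)"
        using h c e(1) by (intro eqI) auto
      then show ?thesis using h c e(1) by (intro bexI[of _ "I +> h"]) auto
    qed
  qed
qed

section \<open>Von Neumann regularity of group algebras\<close>

abbreviation pinv :: "('a \<Rightarrow> 'a) \<Rightarrow> 'a \<Rightarrow> 'a" where
  "pinv \<equiv> inv_into UNIV"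

text \<open>The product of the group algebra, where a function \<open>w\<close> stands for \<open>\<Sum> w(g) g\<close>.\<close>

definition grp_conv :: "('a \<Rightarrow> 'a) set \<Rightarrow> (('a \<Rightarrow> 'a) \<Rightarrow> 'k::field) \<Rightarrow> (('a \<Rightarrow> 'a) \<Rightarrow> 'k) \<Rightarrow> ('a \<Rightarrow> 'a) \<Rightarrow> 'k" where
  "grp_conv G w h x = (\<Sum>g\<in>G. w g * h (pinv g \<circ> x))"

lemma sum_fun_apply: "(\<Sum>a\<in>A. F a) x = (\<Sum>a\<in>A. (F a x :: 'b::comm_monoid_add))"
  by (induction A rule: infinite_finite_induct) auto

lemma sum_permutes_translate:
  assumes g: "g permutes X"
  shows "(\<Sum>\<sigma> | \<sigma> permutes X. f (g \<circ> \<sigma>)) = (\<Sum>\<sigma> | \<sigma> permutes X. f \<sigma>)"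
  by (rule sum.reindex_bij_witness[where i = "\<lambda>\<sigma>. pinv g \<circ> \<sigma>" and j = "\<lambda>\<sigma>. g \<circ> \<sigma>"])
    (use g permutes_inv_o[OF g] in \<open>auto simp: o_assoc intro: permutes_compose permutes_inv\<close>)

lemma sum_permutes_translate_right:
  assumes g: "g permutes X"
  shows "(\<Sum>\<sigma> | \<sigma> permutes X. f (\<sigma> \<circ> g)) = (\<Sum>\<sigma> | \<sigma> permutes X. f \<sigma>)"
  by (rule sum.reindex_bij_witness[where i = "\<lambda>\<sigma>. \<sigma> \<circ> pinv g" and j = "\<lambda>\<sigma>. \<sigma> \<circ> g"])
    (use g permutes_inv_o[OF g] in \<open>auto simp: comp_assoc intro: permutes_compose permutes_inv\<close>)

text \<open>This is Maschke's theorem: a linear section of right multiplication by \<open>w\<close> becomes linear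
  over the group algebra by averaging, and the section is then right multiplication by some \<open>h\<close>.\<close>

lemma group_algebra_regular_supported:
  fixes w :: "('a \<Rightarrow> 'a) \<Rightarrow> 'k::field_char_0" and X :: "'a set"
  assumes X: "finite X" and w: "\<And>x. \<not> x permutes X \<Longrightarrow> w x = 0"
  defines "G \<equiv> {\<sigma>. \<sigma> permutes X}"
  shows "\<exists>h. grp_conv G (grp_conv G w h) w = w"
proof -
  have G: "finite G" using X by (simp add: G_def finite_permutations)
  have id_G: "id \<in> G" by (simp add: G_def permutes_id)
  define N where "N = (of_nat (card G) :: 'k)"
  have N: "N \<noteq> 0" using G id_G by (auto simp: N_def)
  have inv_G: "pinv g \<in> G" if "g \<in> G" for g using that by (simp add: G_def permutes_inv)
  have comp_G: "g \<circ> h \<in> G" if "g \<in> G" "h \<in> G" for g h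
    using that by (auto simp: G_def permutes_compose)
  have inv_cancel: "pinv g \<circ> g = id" "g \<circ> pinv g = id" "pinv (pinv g) = g"
      "pinv g \<circ> (g \<circ> x) = x" "g \<circ> (pinv g \<circ> x) = x" if "g \<in> G" for g and x :: "'a \<Rightarrow> 'a"
    using that permutes_inv_o[of g X] by (auto simp: G_def o_assoc permutes_inv_inv)
  have inv_comp: "pinv (g \<circ> h) = pinv h \<circ> pinv g" if "g \<in> G" "h \<in> G" for g h
    using that by (auto simp: G_def o_inv_distrib permutes_bij)
  have tr: "(\<Sum>\<sigma>\<in>G. f (g \<circ> \<sigma>)) = (\<Sum>\<sigma>\<in>G. f \<sigma>)" if "g \<in> G" for g and f :: "('a \<Rightarrow> 'a) \<Rightarrow> 'k"
    using sum_permutes_translate[of g X f] that by (simp add: G_def)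
  let ?scale = "(\<lambda>c f x. c * f x) :: 'k \<Rightarrow> (('a \<Rightarrow> 'a) \<Rightarrow> 'k) \<Rightarrow> (('a \<Rightarrow> 'a) \<Rightarrow> 'k)"
  interpret vs: vector_space ?scale
    by unfold_locales (auto simp: algebra_simps fun_eq_iff)
  interpret vp: vector_space_pair ?scale ?scale ..
  define m where "m f = (\<lambda>x. grp_conv G f w x)" for f
  have lin_m: "Vector_Spaces.linear ?scale ?scale m"
    by (unfold_locales) (auto simp: m_def grp_conv_def fun_eq_iff algebra_simps sum.distrib sum_distrib_left)
  obtain g where lg: "Vector_Spaces.linear ?scale ?scale g" and g: "\<And>v. v \<in> range m \<Longrightarrow> m (g v) = v"
    using vp.linear_exists_right_inverse_on[OF lin_m vs.subspace_UNIV] by auto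
  interpret g: Vector_Spaces.linear ?scale ?scale g by (rule lg)
  \<comment> \<open>Left translations, with which right multiplication by \<open>w\<close> commutes.\<close>
  define lt where "lt s f = (\<lambda>x. f (s \<circ> x))" for s :: "'a \<Rightarrow> 'a" and f :: "('a \<Rightarrow> 'a) \<Rightarrow> 'k"
  have m_lt: "m (lt s f) = lt s (m f)" if "s \<in> G" for s f
  proof
    fix x
    have "m (lt s f) x = (\<Sum>a\<in>G. f (s \<circ> a) * w (pinv a \<circ> x))" by (simp add: m_def grp_conv_def lt_def)
    also have "\<dots> = (\<Sum>a\<in>G. f (s \<circ> a) * w (pinv (s \<circ> a) \<circ> (s \<circ> x)))"
      using that by (intro sum.cong) (auto simp: inv_comp inv_cancel comp_assoc)
    also have "\<dots> = (\<Sum>a\<in>G. f a * w (pinv a \<circ> (s \<circ> x)))" by (rule tr[OF that, of "\<lambda>a. f a * w (pinv a \<circ> (s \<circ> x))"])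
    finally show "m (lt s f) x = lt s (m f) x" by (simp add: m_def grp_conv_def lt_def)
  qed
  \<comment> \<open>Averaging the conjugates of the section makes it commute with left translations.\<close>
  define p where "p f = (\<lambda>x. (\<Sum>s\<in>G. lt s (g (lt (pinv s) f)) x) / N)" for f
  have lt_lt: "lt s (lt t f) = lt (t \<circ> s) f" for s t f by (simp add: lt_def o_assoc)
  have p_lt: "p (lt t f) = lt t (p f)" if t: "t \<in> G" for t f
  proof
    fix x
    have "(\<Sum>s\<in>G. lt s (g (lt (pinv s) (lt t f))) x)
        = (\<Sum>s\<in>G. lt (s \<circ> t) (g (lt (pinv (s \<circ> t)) (lt t f))) x)"
      using sum_permutes_translate_right[of t X "\<lambda>s. lt s (g (lt (pinv s) (lt t f))) x"] t
      by (simp add: G_def)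
    also have "\<dots> = (\<Sum>s\<in>G. lt s (g (lt (pinv s) f)) (t \<circ> x))"
    proof (rule sum.cong)
      fix s assume s: "s \<in> G"
      have "lt (pinv (s \<circ> t)) (lt t f) = lt (pinv s) f"
        using s t by (simp add: lt_lt inv_comp inv_cancel o_assoc)
      then show "lt (s \<circ> t) (g (lt (pinv (s \<circ> t)) (lt t f))) x = lt s (g (lt (pinv s) f)) (t \<circ> x)"
        by (simp add: lt_def comp_assoc)
    qed simp
    finally show "p (lt t f) x = lt t (p f) x" by (simp add: p_def lt_def)
  qed
  have lt_add: "lt s (f + f') = lt s f + lt s f'" "lt s (?scale c f) = ?scale c (lt s f)" for s f f' c
    by (auto simp: lt_def)
  have lp: "Vector_Spaces.linear ?scale ?scale p"
  proof unfold_locales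
    show "p (a + b) = p a + p b" for a b
      by (rule ext) (simp add: p_def lt_add g.add sum.distrib add_divide_distrib)
    show "p (?scale c b) = ?scale c (p b)" for c b
      by (rule ext) (simp add: p_def lt_add g.scale, simp add: lt_def sum_distrib_left)
  qed
  \<comment> \<open>The unit of the group algebra; \<open>p\<close> is right multiplication by \<open>p dl\<close>.\<close>
  define dl where "dl = (\<lambda>x. if x = (id :: 'a \<Rightarrow> 'a) then 1 else (0 :: 'k))"
  have m_dl: "m dl = w"
  proof
    fix x
    have "m dl x = (\<Sum>a\<in>G. if a = id then w (pinv a \<circ> x) else 0)"
      unfolding m_def grp_conv_def dl_def by (rule sum.cong) simp_all
    then show "m dl x = w x" using G id_G by simp
  qed
  have w_sum: "w = (\<Sum>a\<in>G. ?scale (w a) (lt (pinv a) dl))"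
  proof
    fix x
    have eq: "(pinv a \<circ> x = id) = (x = a)" if "a \<in> G" for a
      using inv_cancel[OF that] by (metis comp_id)
    have "(\<Sum>a\<in>G. ?scale (w a) (lt (pinv a) dl)) x = (\<Sum>a\<in>G. if x = a then w a else 0)"
      by (simp add: sum_fun_apply lt_def dl_def) (rule sum.cong, auto simp: eq)
    also have "\<dots> = w x" using G w[of x] by (auto simp: sum.delta G_def)
    finally show "w x = (\<Sum>a\<in>G. ?scale (w a) (lt (pinv a) dl)) x" by simp
  qed
  interpret p: Vector_Spaces.linear ?scale ?scale p by (rule lp)
  have "p w = p (\<Sum>a\<in>G. ?scale (w a) (lt (pinv a) dl))" using w_sum by simp
  also have "\<dots> = (\<Sum>a\<in>G. ?scale (w a) (lt (pinv a) (p dl)))"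
    by (simp add: p.sum p.scale p_lt inv_G)
  also have "\<dots> = grp_conv G w (p dl)"
    by (rule ext) (simp add: sum_fun_apply grp_conv_def lt_def)
  finally have pw: "p w = grp_conv G w (p dl)" .
  have "m (p w) = w"
  proof
    fix x
    have rng: "m (g (lt (pinv s) w)) = lt (pinv s) w" if "s \<in> G" for s
      using g[of "lt (pinv s) w"] m_lt[OF inv_G[OF that], of dl] m_dl by (metis rangeI)
    have "m (p w) x = (\<Sum>a\<in>G. (\<Sum>s\<in>G. lt s (g (lt (pinv s) w)) a * w (pinv a \<circ> x))) / N"
      by (simp add: m_def grp_conv_def p_def sum_divide_distrib sum_distrib_right)
    also have "\<dots> = (\<Sum>s\<in>G. m (lt s (g (lt (pinv s) w))) x) / N"
      by (subst sum.swap) (simp add: m_def grp_conv_def)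
    also have "\<dots> = (\<Sum>s\<in>G. w x) / N"
    proof -
      have "m (lt s (g (lt (pinv s) w))) x = w x" if "s \<in> G" for s
        unfolding m_lt[OF that] rng[OF that] using inv_cancel(4)[OF that] by (simp add: lt_def)
      then show ?thesis by simp
    qed
    also have "\<dots> = w x" using N by (simp add: N_def)
    finally show "m (p w) x = w x" .
  qed
  then show ?thesis using pw by (auto simp: m_def[abs_def])
qed

lemma group_algebra_regular:
  fixes w :: "('a \<Rightarrow> 'a) \<Rightarrow> 'k::field_char_0"
  assumes X: "finite X"
  defines "G \<equiv> {\<sigma>. \<sigma> permutes X}"
  shows "\<exists>h. \<forall>x\<in>G. grp_conv G (grp_conv G w h) w x = w x"
proof -
  define v where "v x = (if x permutes X then w x else 0)" for x
  have vw: "v x = w x" if "x \<in> G" for x using that by (simp add: v_def G_def)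
  obtain h where h: "grp_conv G (grp_conv G v h) v = v"
    using group_algebra_regular_supported[OF X, of v] unfolding G_def v_def by auto
  have "grp_conv G (grp_conv G w h) w x = w x" if x: "x \<in> G" for x
  proof -
    have "pinv g \<circ> x \<in> G" if "g \<in> G" for g
      using that x by (auto simp: G_def intro: permutes_compose permutes_inv)
    then have "grp_conv G (grp_conv G w h) w x = grp_conv G (grp_conv G v h) v x"
      by (simp add: grp_conv_def vw)
    then show ?thesis using h vw[OF x] by simp
  qed
  then show ?thesis by blast
qed

section \<open>Young subgroups and double cosets\<close>

lemma finite_compositions: "finite (compositions r n)"
proof (rule finite_subset)
  show "compositions r n \<subseteq> {xs. set xs \<subseteq> {0..r} \<and> length xs = n}"
    using member_le_sum_list by (fastforce simp: compositions_def)
qed (simp add: finite_lists_length_eq)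

lemma young_id: "id \<in> young \<mu>"
  by (simp add: young_def permutes_id)

lemma young_comp: "\<sigma> \<in> young \<mu> \<Longrightarrow> \<pi> \<in> young \<mu> \<Longrightarrow> \<sigma> \<circ> \<pi> \<in> young \<mu>"
  unfolding young_def by (simp add: permutes_compose image_comp[symmetric] del: o_apply)

lemma young_permutes: "\<sigma> \<in> young \<mu> \<Longrightarrow> \<sigma> permutes {1..sum_list \<mu>}"
  by (simp add: young_def)

lemma young_inv: "\<sigma> \<in> young \<mu> \<Longrightarrow> pinv \<sigma> \<in> young \<mu>"
  unfolding young_def
proof (clarsimp, intro conjI ballI)
  assume s: "\<sigma> permutes {Suc 0..sum_list \<mu>}" "\<forall>j\<in>{Suc 0..length \<mu>}. \<sigma> ` block \<mu> j = block \<mu> j"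
  show "pinv \<sigma> permutes {Suc 0..sum_list \<mu>}" using s permutes_inv by blast
  fix j assume "j \<in> {Suc 0..length \<mu>}"
  then have "block \<mu> j = \<sigma> ` block \<mu> j" using s by auto
  then show "pinv \<sigma> ` block \<mu> j = block \<mu> j"
    using s(1) by (metis image_inv_f_f permutes_inj)
qed

lemma young_inv_cancel:
  assumes "\<sigma> \<in> young \<mu>"
  shows "pinv \<sigma> \<circ> \<sigma> = id" "\<sigma> \<circ> pinv \<sigma> = id"
    "pinv \<sigma> \<circ> (\<sigma> \<circ> m) = m" "\<sigma> \<circ> (pinv \<sigma> \<circ> m) = m"
    "m' \<circ> \<sigma> \<circ> pinv \<sigma> = m'" "m' \<circ> pinv \<sigma> \<circ> \<sigma> = m'"
proof -
  note inv = permutes_inv_o[OF young_permutes[OF assms]]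
  show "pinv \<sigma> \<circ> \<sigma> = id" "\<sigma> \<circ> pinv \<sigma> = id" by (rule inv)+
  show "pinv \<sigma> \<circ> (\<sigma> \<circ> m) = m" "\<sigma> \<circ> (pinv \<sigma> \<circ> m) = m" by (simp_all only: o_assoc inv id_comp)
  show "m' \<circ> \<sigma> \<circ> pinv \<sigma> = m'" "m' \<circ> pinv \<sigma> \<circ> \<sigma> = m'" by (simp_all only: comp_assoc inv comp_id)
qed

lemma finite_young: "finite (young \<mu>)"
  by (rule finite_subset[of _ "{\<sigma>. \<sigma> permutes {1..sum_list \<mu>}}"])
    (auto simp: young_def finite_permutations)

lemma card_young_pos: "0 < card (young \<mu>)"
  using finite_young young_id by (metis card_gt_0_iff empty_iff)

lemma sum_young_translate:
  assumes "\<pi> \<in> young \<mu>"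
  shows "(\<Sum>\<sigma>\<in>young \<mu>. f (\<pi> \<circ> \<sigma>)) = (\<Sum>\<sigma>\<in>young \<mu>. f \<sigma>)"
  by (rule sum.reindex_bij_witness[where i = "\<lambda>\<sigma>. pinv \<pi> \<circ> \<sigma>" and j = "\<lambda>\<sigma>. \<pi> \<circ> \<sigma>"])
    (use assms in \<open>auto simp: young_comp young_inv young_inv_cancel\<close>)

lemma double_coset_self: "m \<in> double_coset \<mu> m \<nu>"
proof -
  have "m = id \<circ> m \<circ> id" by simp
  then show ?thesis unfolding double_coset_def using young_id by blast
qed

lemma double_coset_memI: "\<sigma> \<in> young \<mu> \<Longrightarrow> \<pi> \<in> young \<nu> \<Longrightarrow> \<sigma> \<circ> m \<circ> \<pi> \<in> double_coset \<mu> m \<nu>"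
  unfolding double_coset_def by blast

lemma double_coset_memE:
  assumes "m' \<in> double_coset \<mu> m \<nu>"
  obtains \<sigma> \<pi> where "\<sigma> \<in> young \<mu>" "\<pi> \<in> young \<nu>" "m' = \<sigma> \<circ> m \<circ> \<pi>"
  using assms unfolding double_coset_def by blast

lemma double_coset_subset:
  assumes "m' \<in> double_coset \<mu> m \<nu>"
  shows "double_coset \<mu> m' \<nu> \<subseteq> double_coset \<mu> m \<nu>"
proof
  fix x assume "x \<in> double_coset \<mu> m' \<nu>"
  then obtain \<sigma> \<pi> where x: "\<sigma> \<in> young \<mu>" "\<pi> \<in> young \<nu>" "x = \<sigma> \<circ> m' \<circ> \<pi>" by (rule double_coset_memE)
  from assms obtain \<sigma>' \<pi>' where m': "\<sigma>' \<in> young \<mu>" "\<pi>' \<in> young \<nu>" "m' = \<sigma>' \<circ> m \<circ> \<pi>'"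
    by (rule double_coset_memE)
  have "x = (\<sigma> \<circ> \<sigma>') \<circ> m \<circ> (\<pi>' \<circ> \<pi>)" using x m' by (simp add: comp_assoc)
  then show "x \<in> double_coset \<mu> m \<nu>" using x m' double_coset_memI[OF young_comp young_comp] by blast
qed

lemma double_coset_eq:
  assumes "m' \<in> double_coset \<mu> m \<nu>"
  shows "double_coset \<mu> m' \<nu> = double_coset \<mu> m \<nu>"
proof
  show "double_coset \<mu> m' \<nu> \<subseteq> double_coset \<mu> m \<nu>" by (rule double_coset_subset[OF assms])
  from assms obtain \<sigma> \<pi> where m': "\<sigma> \<in> young \<mu>" "\<pi> \<in> young \<nu>" "m' = \<sigma> \<circ> m \<circ> \<pi>"
    by (rule double_coset_memE)
  then have "m = pinv \<sigma> \<circ> m' \<circ> pinv \<pi>"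
    by (simp add: comp_assoc young_inv_cancel)
  then have "m \<in> double_coset \<mu> m' \<nu>" using m' double_coset_memI[OF young_inv young_inv] by metis
  then show "double_coset \<mu> m \<nu> \<subseteq> double_coset \<mu> m' \<nu>" by (rule double_coset_subset)
qed

lemma double_coset_translate:
  assumes "\<sigma> \<in> young \<mu>" "\<pi> \<in> young \<nu>"
  shows "double_coset \<mu> (\<sigma> \<circ> m \<circ> \<pi>) \<nu> = double_coset \<mu> m \<nu>"
  using assms by (intro double_coset_eq double_coset_memI)

lemma double_coset_unit: "double_coset \<mu> id \<mu> = young \<mu>"
proof
  show "double_coset \<mu> id \<mu> \<subseteq> young \<mu>" by (auto elim!: double_coset_memE simp: young_comp)
  show "young \<mu> \<subseteq> double_coset \<mu> id \<mu>"
    using double_coset_memI[of _ \<mu> id \<mu> id] young_id by fastforce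
qed

lemma double_cosets_mem_eq:
  assumes "D \<in> double_cosets M \<mu> \<nu>" "m \<in> D"
  shows "D = double_coset \<mu> m \<nu>"
proof -
  from assms(1) obtain m0 where "D = double_coset \<mu> m0 \<nu>" unfolding double_cosets_def by blast
  then show ?thesis using double_coset_eq[of m \<mu> m0 \<nu>] assms(2) by simp
qed

lemma double_cosets_some:
  assumes "D \<in> double_cosets M \<mu> \<nu>"
  shows "(SOME m. m \<in> D) \<in> D" "double_coset \<mu> (SOME m. m \<in> D) \<nu> = D"
proof -
  from assms obtain m where "D = double_coset \<mu> m \<nu>" by (auto simp: double_cosets_def)
  then have "m \<in> D" using double_coset_self by simp
  then show *: "(SOME m. m \<in> D) \<in> D" by (rule someI[of "\<lambda>m. m \<in> D"])
  show "double_coset \<mu> (SOME m. m \<in> D) \<nu> = D" using double_cosets_mem_eq[OF assms *] by simp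
qed

lemma some_double_coset:
  obtains \<sigma> \<pi> where "\<sigma> \<in> young \<mu>" "\<pi> \<in> young \<nu>"
    "(SOME x. x \<in> double_coset \<mu> m \<nu>) = \<sigma> \<circ> m \<circ> \<pi>"
  using someI[of "\<lambda>x. x \<in> double_coset \<mu> m \<nu>", OF double_coset_self] by (rule double_coset_memE)

section \<open>The twisted algebras as algebras of bi-invariant functions\<close>

text \<open>The properties of the normalization \<open>nf\<close> are those that make the twisted product integral and
  the sum of the basis elements of the Young subgroups an identity; \<open>n_L\<close> and \<open>n_R\<close> share them.  The last
  parameter names the coefficient field.\<close>

locale twisted =
  fixes r n :: nat and M :: "transf set" and nf :: "bidx \<Rightarrow> nat" and k_type :: "'k::field_char_0 itself"
  assumes finite_M: "finite M"
    and comp_M: "a \<in> M \<Longrightarrow> b \<in> M \<Longrightarrow> a \<circ> b \<in> M"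
    and young_M: "\<mu> \<in> compositions r n \<Longrightarrow> young \<mu> \<subseteq> M"
    and nf_pos: "\<lbrakk>\<mu> \<in> compositions r n; \<nu> \<in> compositions r n; D \<in> double_cosets M \<mu> \<nu>\<rbrakk>
      \<Longrightarrow> 0 < nf (\<mu>, \<nu>, D)"
    and nf_unit: "\<mu> \<in> compositions r n \<Longrightarrow> nf (\<mu>, \<mu>, young \<mu>) = card (young \<mu>)"
    and nf_dvd: "\<lbrakk>\<mu> \<in> compositions r n; \<pi> \<in> compositions r n; \<nu> \<in> compositions r n;
      D1 \<in> double_cosets M \<mu> \<pi>; D2 \<in> double_cosets M \<pi> \<nu>; D \<in> double_cosets M \<mu> \<nu>\<rbrakk>
      \<Longrightarrow> int (nf (\<mu>, \<pi>, D1)) * int (nf (\<pi>, \<nu>, D2)) dvd int (nf (\<mu>, \<nu>, D)) * a_coeff M D1 D2 D"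
begin

abbreviation "\<Lambda> \<equiv> compositions r n"

abbreviation A :: "('k, bidx \<Rightarrow> 'k) module" where "A \<equiv> twisted_algebra nf r n M"

text \<open>Replacing \<open>b\<^sub>D\<close> by \<open>X(D) / n(D)\<close> takes the twisted product to the product of \<open>k[M]\<close>.  This is the
  coefficient function of \<open>\<Sum> f(b\<^sub>D) X(D) / n(D)\<close>.\<close>

definition mfun :: "(bidx \<Rightarrow> 'k) \<Rightarrow> nat list \<Rightarrow> nat list \<Rightarrow> transf \<Rightarrow> 'k" where
  "mfun f \<mu> \<nu> m = (if \<mu> \<in> \<Lambda> \<and> \<nu> \<in> \<Lambda> \<and> m \<in> M
     then f (\<mu>, \<nu>, double_coset \<mu> m \<nu>) / of_nat (nf (\<mu>, \<nu>, double_coset \<mu> m \<nu>)) else 0)"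

definition bi_invariant :: "(nat list \<Rightarrow> nat list \<Rightarrow> transf \<Rightarrow> 'k) \<Rightarrow> bool" where
  "bi_invariant F \<longleftrightarrow>
     (\<forall>\<mu> \<nu> m. \<not> (\<mu> \<in> \<Lambda> \<and> \<nu> \<in> \<Lambda> \<and> m \<in> M) \<longrightarrow> F \<mu> \<nu> m = 0) \<and>
     (\<forall>\<mu>\<in>\<Lambda>. \<forall>\<nu>\<in>\<Lambda>. \<forall>m\<in>M. \<forall>\<sigma>\<in>young \<mu>. \<forall>\<pi>\<in>young \<nu>. F \<mu> \<nu> (\<sigma> \<circ> m \<circ> \<pi>) = F \<mu> \<nu> m)"

definition of_mfun :: "(nat list \<Rightarrow> nat list \<Rightarrow> transf \<Rightarrow> 'k) \<Rightarrow> bidx \<Rightarrow> 'k" where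
  "of_mfun F = (\<lambda>(\<mu>, \<nu>, D). if (\<mu>, \<nu>, D) \<in> basis_set r n M
     then of_nat (nf (\<mu>, \<nu>, D)) * F \<mu> \<nu> (SOME m. m \<in> D) else 0)"

text \<open>The product of the monoid algebra in terms of coefficient functions.\<close>

definition mconv :: "(transf \<Rightarrow> 'k) \<Rightarrow> (transf \<Rightarrow> 'k) \<Rightarrow> transf \<Rightarrow> 'k" where
  "mconv p q m = (\<Sum>a\<in>M. \<Sum>b\<in>M. if a \<circ> b = m then p a * q b else 0)"

text \<open>The matrix product built on it: the inner compositions have to agree.\<close>

definition conv :: "(nat list \<Rightarrow> nat list \<Rightarrow> transf \<Rightarrow> 'k) \<Rightarrow> (nat list \<Rightarrow> nat list \<Rightarrow> transf \<Rightarrow> 'k)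
    \<Rightarrow> nat list \<Rightarrow> nat list \<Rightarrow> transf \<Rightarrow> 'k" where
  "conv F G \<mu> \<nu> m = (\<Sum>\<pi>\<in>\<Lambda>. mconv (F \<mu> \<pi>) (G \<pi> \<nu>) m)"

lemma double_cosets_subset_M:
  assumes "\<mu> \<in> \<Lambda>" "\<nu> \<in> \<Lambda>" "D \<in> double_cosets M \<mu> \<nu>"
  shows "D \<subseteq> M"
proof
  fix x assume x: "x \<in> D"
  from assms obtain m where m: "m \<in> M" "D = double_coset \<mu> m \<nu>" by (auto simp: double_cosets_def)
  obtain \<sigma> \<pi> where "\<sigma> \<in> young \<mu>" "\<pi> \<in> young \<nu>" "x = \<sigma> \<circ> m \<circ> \<pi>"
    using x unfolding m(2) by (rule double_coset_memE)
  then show "x \<in> M" using assms m(1) young_M comp_M by blast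
qed

lemma finite_double_cosets: "finite (double_cosets M \<mu> \<nu>)"
  using finite_M by (simp add: double_cosets_def)

lemma translate_M: "\<mu> \<in> \<Lambda> \<Longrightarrow> \<nu> \<in> \<Lambda> \<Longrightarrow> \<sigma> \<in> young \<mu> \<Longrightarrow> \<pi> \<in> young \<nu> \<Longrightarrow> m \<in> M \<Longrightarrow> \<sigma> \<circ> m \<circ> \<pi> \<in> M"
  using young_M comp_M by blast

lemma mfun_bi_invariant: "bi_invariant (mfun f)"
  by (auto simp: bi_invariant_def mfun_def translate_M double_coset_translate)

lemma basis_set_Sigma: "basis_set r n M = (SIGMA \<mu>:\<Lambda>. SIGMA \<nu>:\<Lambda>. double_cosets M \<mu> \<nu>)"
  by (auto simp: basis_set_def)

lemma finite_basis_set: "finite (basis_set r n M)"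
  unfolding basis_set_Sigma using finite_compositions finite_double_cosets by (intro finite_SigmaI) auto

lemma sum_basis_set:
  "(\<Sum>b\<in>basis_set r n M. h b) = (\<Sum>\<mu>\<in>\<Lambda>. \<Sum>\<nu>\<in>\<Lambda>. \<Sum>D\<in>double_cosets M \<mu> \<nu>. h (\<mu>, \<nu>, D))"
  unfolding basis_set_Sigma
proof -
  have "(\<Sum>\<mu>\<in>\<Lambda>. \<Sum>\<nu>\<in>\<Lambda>. \<Sum>D\<in>double_cosets M \<mu> \<nu>. h (\<mu>, \<nu>, D))
      = (\<Sum>\<mu>\<in>\<Lambda>. \<Sum>y\<in>(SIGMA \<nu>:\<Lambda>. double_cosets M \<mu> \<nu>). h (\<mu>, y))"
    by (intro sum.cong refl, subst sum.Sigma) (auto simp: finite_compositions finite_double_cosets)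
  also have "\<dots> = (\<Sum>b\<in>(SIGMA \<mu>:\<Lambda>. SIGMA \<nu>:\<Lambda>. double_cosets M \<mu> \<nu>). h b)"
    by (subst sum.Sigma) (auto simp: finite_compositions finite_double_cosets)
  finally show "(\<Sum>b\<in>(SIGMA \<mu>:\<Lambda>. SIGMA \<nu>:\<Lambda>. double_cosets M \<mu> \<nu>). h b)
      = (\<Sum>\<mu>\<in>\<Lambda>. \<Sum>\<nu>\<in>\<Lambda>. \<Sum>D\<in>double_cosets M \<mu> \<nu>. h (\<mu>, \<nu>, D))" by simp
qed

lemma of_mfun_mfun:
  assumes "f \<in> carrier A"
  shows "of_mfun (mfun f) = f"
proof (rule ext, clarify)
  fix \<mu> \<nu> D
  show "of_mfun (mfun f) (\<mu>, \<nu>, D) = f (\<mu>, \<nu>, D)"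
  proof (cases "(\<mu>, \<nu>, D) \<in> basis_set r n M")
    case True
    then have D: "\<mu> \<in> \<Lambda>" "\<nu> \<in> \<Lambda>" "D \<in> double_cosets M \<mu> \<nu>" by (auto simp: basis_set_def)
    then have "(SOME m. m \<in> D) \<in> M" using double_cosets_some double_cosets_subset_M by blast
    then show ?thesis using True D nf_pos[OF D] double_cosets_some[OF D(3)]
      by (simp add: of_mfun_def mfun_def)
  next
    case False
    then show ?thesis using assms by (simp add: of_mfun_def twisted_algebra_def)
  qed
qed

lemma of_mfun_carrier: "of_mfun F \<in> carrier A"
  by (auto simp: of_mfun_def twisted_algebra_def)

lemma mfun_of_mfun:
  assumes "bi_invariant F"
  shows "mfun (of_mfun F) = F"
proof (intro ext)
  fix \<mu> \<nu> m
  show "mfun (of_mfun F) \<mu> \<nu> m = F \<mu> \<nu> m"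
  proof (cases "\<mu> \<in> \<Lambda> \<and> \<nu> \<in> \<Lambda> \<and> m \<in> M")
    case True
    obtain \<sigma> \<pi> where *: "\<sigma> \<in> young \<mu>" "\<pi> \<in> young \<nu>"
      "(SOME x. x \<in> double_coset \<mu> m \<nu>) = \<sigma> \<circ> m \<circ> \<pi>" by (rule some_double_coset)
    have D: "double_coset \<mu> m \<nu> \<in> double_cosets M \<mu> \<nu>" using True by (simp add: double_cosets_def)
    then have "(\<mu>, \<nu>, double_coset \<mu> m \<nu>) \<in> basis_set r n M" using True by (simp add: basis_set_def)
    moreover have "F \<mu> \<nu> (\<sigma> \<circ> m \<circ> \<pi>) = F \<mu> \<nu> m" using assms True * by (simp add: bi_invariant_def)
    ultimately show ?thesis using True * nf_pos[of \<mu> \<nu>, OF _ _ D]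
      by (simp add: mfun_def of_mfun_def)
  next
    case False
    then show ?thesis using assms by (auto simp: mfun_def bi_invariant_def)
  qed
qed

lemma mfun_inject:
  assumes "f \<in> carrier A" "g \<in> carrier A" "mfun f = mfun g"
  shows "f = g"
  using assms of_mfun_mfun by metis

lemma mfun_zero: "mfun \<zero>\<^bsub>A\<^esub> \<mu> \<nu> m = 0"
  by (simp add: mfun_def twisted_algebra_def)

lemma mfun_add: "mfun (f \<oplus>\<^bsub>A\<^esub> g) \<mu> \<nu> m = mfun f \<mu> \<nu> m + mfun g \<mu> \<nu> m"
  by (simp add: mfun_def twisted_algebra_def add_divide_distrib)

lemma mfun_smult: "mfun (c \<odot>\<^bsub>A\<^esub> f) \<mu> \<nu> m = c * mfun f \<mu> \<nu> m"
  by (simp add: mfun_def twisted_algebra_def)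

lemma add_carrier: "f \<in> carrier A \<Longrightarrow> g \<in> carrier A \<Longrightarrow> f \<oplus>\<^bsub>A\<^esub> g \<in> carrier A"
  and zero_carrier: "\<zero>\<^bsub>A\<^esub> \<in> carrier A"
  and smult_carrier: "f \<in> carrier A \<Longrightarrow> c \<odot>\<^bsub>A\<^esub> f \<in> carrier A"
  and mult_carrier: "f \<otimes>\<^bsub>A\<^esub> g \<in> carrier A"
  by (auto simp: twisted_algebra_def)

lemma one_carrier: "\<one>\<^bsub>A\<^esub> \<in> carrier A"
proof -
  have "(\<mu>, \<mu>, young \<mu>) \<in> basis_set r n M" if "\<mu> \<in> \<Lambda>" for \<mu>
  proof -
    have "double_coset \<mu> id \<mu> \<in> double_cosets M \<mu> \<mu>"
      unfolding double_cosets_def using young_M[OF that] young_id[of \<mu>] by blast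
    then show ?thesis using that by (simp add: basis_set_def double_coset_unit)
  qed
  then show ?thesis by (auto simp: twisted_algebra_def)
qed

lemma mfun_one: "mfun \<one>\<^bsub>A\<^esub> \<mu> \<nu> m
    = (if \<mu> \<in> \<Lambda> \<and> \<nu> = \<mu> \<and> m \<in> young \<mu> then 1 / of_nat (card (young \<mu>)) else 0)"
proof -
  have *: "double_coset \<mu> m \<mu> = young \<mu> \<longleftrightarrow> m \<in> young \<mu>" for m
    using double_coset_self[of m \<mu> \<mu>] double_coset_eq[of m \<mu> id \<mu>] unfolding double_coset_unit by blast
  show ?thesis
  proof (cases "\<mu> \<in> \<Lambda> \<and> \<nu> = \<mu> \<and> m \<in> young \<mu>")
    case True
    then have "double_coset \<mu> m \<mu> = young \<mu>" using * by blast
    then show ?thesis using True young_M[of \<mu>] nf_unit[of \<mu>]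
      by (auto simp: mfun_def twisted_algebra_def)
  next
    case False
    then show ?thesis using * by (auto simp: mfun_def twisted_algebra_def)
  qed
qed

lemma sum_cosets_mem:
  assumes "a \<in> M"
  shows "(\<Sum>D\<in>double_cosets M \<mu> \<nu>. if a \<in> D then h D else (0::'k)) = h (double_coset \<mu> a \<nu>)"
proof -
  have "(\<Sum>D\<in>double_cosets M \<mu> \<nu>. if a \<in> D then h D else 0)
      = (\<Sum>D\<in>double_cosets M \<mu> \<nu>. if D = double_coset \<mu> a \<nu> then h D else 0)"
  proof (intro sum.cong refl)
    fix D assume "D \<in> double_cosets M \<mu> \<nu>"
    then have "a \<in> D \<longleftrightarrow> D = double_coset \<mu> a \<nu>"
      using double_cosets_mem_eq[of D M \<mu> \<nu> a] double_coset_self[of a \<mu> \<nu>] by blast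
    then show "(if a \<in> D then h D else 0) = (if D = double_coset \<mu> a \<nu> then h D else 0)" by simp
  qed
  also have "\<dots> = h (double_coset \<mu> a \<nu>)"
    using assms finite_double_cosets by (auto simp: double_cosets_def)
  finally show ?thesis .
qed

lemma a_coeff_sum: "a_coeff M D1 D2 D =
    (\<Sum>a\<in>M. \<Sum>b\<in>M. if a \<circ> b = (SOME m. m \<in> D) \<and> a \<in> D1 \<and> b \<in> D2 then 1 else 0)"
proof -
  let ?m = "SOME m. m \<in> D"
  have "a_coeff M D1 D2 D = (\<Sum>(a, b) \<in> {(a, b) \<in> M \<times> M. a \<circ> b = ?m}. coset_sum D1 a * coset_sum D2 b)"
    by (simp add: a_coeff_def coset_coeff_def mring_mult_def)
  also have "\<dots> = (\<Sum>(a, b) \<in> M \<times> M. if a \<circ> b = ?m then coset_sum D1 a * coset_sum D2 b else 0)"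
    using finite_M by (intro sum.mono_neutral_cong_left) (auto split: if_splits)
  also have "\<dots> = (\<Sum>a\<in>M. \<Sum>b\<in>M. if a \<circ> b = ?m then coset_sum D1 a * coset_sum D2 b else 0)"
    by (simp add: sum.cartesian_product)
  also have "\<dots> = (\<Sum>a\<in>M. \<Sum>b\<in>M. if a \<circ> b = ?m \<and> a \<in> D1 \<and> b \<in> D2 then 1 else 0)"
    by (intro sum.cong) (auto simp: coset_sum_def)
  finally show ?thesis .
qed

text \<open>The integer quotient in the structure constant is exact, so it becomes a quotient in the field.\<close>

lemma struct_const_of_int:
  assumes "\<mu> \<in> \<Lambda>" "\<pi> \<in> \<Lambda>" "\<nu> \<in> \<Lambda>"
    "D1 \<in> double_cosets M \<mu> \<pi>" "D2 \<in> double_cosets M \<pi> \<nu>" "D \<in> double_cosets M \<mu> \<nu>"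
  shows "(of_int (struct_const nf M (\<mu>, \<pi>, D1) (\<pi>, \<nu>, D2) (\<mu>, \<nu>, D)) :: 'k)
    = of_nat (nf (\<mu>, \<nu>, D)) * of_int (a_coeff M D1 D2 D) /
        (of_nat (nf (\<mu>, \<pi>, D1)) * of_nat (nf (\<pi>, \<nu>, D2)))"
proof -
  obtain q where q: "int (nf (\<mu>, \<nu>, D)) * a_coeff M D1 D2 D
      = int (nf (\<mu>, \<pi>, D1)) * int (nf (\<pi>, \<nu>, D2)) * q"
    using nf_dvd[OF assms] by (rule dvdE)
  have p: "nf (\<mu>, \<pi>, D1) \<noteq> 0" "nf (\<pi>, \<nu>, D2) \<noteq> 0" using assms nf_pos by blast+
  have "of_nat (nf (\<mu>, \<nu>, D)) * of_int (a_coeff M D1 D2 D)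
      = (of_int (int (nf (\<mu>, \<nu>, D)) * a_coeff M D1 D2 D) :: 'k)" by simp
  also have "\<dots> = of_nat (nf (\<mu>, \<pi>, D1)) * of_nat (nf (\<pi>, \<nu>, D2)) * of_int q"
    unfolding q by simp
  finally show ?thesis using p by (simp add: q)
qed

text \<open>The factor \<open>n(D) / (n(D1) n(D2))\<close> of the structure constants is absorbed by the denominators
  in \<open>mfun\<close>.\<close>

lemma mult_formula:
  assumes b: "\<mu> \<in> \<Lambda>" "\<nu> \<in> \<Lambda>" "D \<in> double_cosets M \<mu> \<nu>"
  shows "(f \<otimes>\<^bsub>A\<^esub> g) (\<mu>, \<nu>, D) = of_nat (nf (\<mu>, \<nu>, D)) * conv (mfun f) (mfun g) \<mu> \<nu> (SOME m. m \<in> D)"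
proof -
  let ?m = "SOME m. m \<in> D"
  let ?N = "of_nat (nf (\<mu>, \<nu>, D)) :: 'k"
  have "(f \<otimes>\<^bsub>A\<^esub> g) (\<mu>, \<nu>, D) = (\<Sum>\<mu>1\<in>\<Lambda>. \<Sum>\<nu>1\<in>\<Lambda>. \<Sum>D1\<in>double_cosets M \<mu>1 \<nu>1.
      \<Sum>\<mu>2\<in>\<Lambda>. \<Sum>\<nu>2\<in>\<Lambda>. \<Sum>D2\<in>double_cosets M \<mu>2 \<nu>2.
        f (\<mu>1, \<nu>1, D1) * g (\<mu>2, \<nu>2, D2) * of_int (struct_const nf M (\<mu>1, \<nu>1, D1) (\<mu>2, \<nu>2, D2) (\<mu>, \<nu>, D)))"
    using b by (simp add: twisted_algebra_def basis_set_def[symmetric] sum_basis_set)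
       (simp add: basis_set_def)
  also have "\<dots> = (\<Sum>\<mu>1\<in>\<Lambda>. if \<mu>1 = \<mu> then (\<Sum>\<nu>1\<in>\<Lambda>. \<Sum>D1\<in>double_cosets M \<mu> \<nu>1.
      \<Sum>\<mu>2\<in>\<Lambda>. if \<mu>2 = \<nu>1 then (\<Sum>\<nu>2\<in>\<Lambda>. if \<nu>2 = \<nu> then (\<Sum>D2\<in>double_cosets M \<nu>1 \<nu>.
        f (\<mu>, \<nu>1, D1) * g (\<nu>1, \<nu>, D2) * of_int (struct_const nf M (\<mu>, \<nu>1, D1) (\<nu>1, \<nu>, D2) (\<mu>, \<nu>, D))) else 0) else 0) else 0)"
    by (intro sum.cong refl) (auto intro!: sum.cong sum.neutral)
  also have "\<dots> = (\<Sum>\<pi>\<in>\<Lambda>. \<Sum>D1\<in>double_cosets M \<mu> \<pi>. \<Sum>D2\<in>double_cosets M \<pi> \<nu>.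
        f (\<mu>, \<pi>, D1) * g (\<pi>, \<nu>, D2) * of_int (struct_const nf M (\<mu>, \<pi>, D1) (\<pi>, \<nu>, D2) (\<mu>, \<nu>, D)))"
    using b finite_compositions by (simp add: sum.delta)
  also have "\<dots> = (\<Sum>\<pi>\<in>\<Lambda>. ?N * (\<Sum>a\<in>M. \<Sum>b\<in>M. if a \<circ> b = ?m then mfun f \<mu> \<pi> a * mfun g \<pi> \<nu> b else 0))"
  proof (rule sum.cong)
    fix \<pi> assume p: "\<pi> \<in> \<Lambda>"
    let ?f = "\<lambda>D1. f (\<mu>, \<pi>, D1) / of_nat (nf (\<mu>, \<pi>, D1))"
    let ?g = "\<lambda>D2. g (\<pi>, \<nu>, D2) / of_nat (nf (\<pi>, \<nu>, D2))"
    have "(\<Sum>D1\<in>double_cosets M \<mu> \<pi>. \<Sum>D2\<in>double_cosets M \<pi> \<nu>.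
        f (\<mu>, \<pi>, D1) * g (\<pi>, \<nu>, D2) * of_int (struct_const nf M (\<mu>, \<pi>, D1) (\<pi>, \<nu>, D2) (\<mu>, \<nu>, D)))
      = (\<Sum>D1\<in>double_cosets M \<mu> \<pi>. \<Sum>D2\<in>double_cosets M \<pi> \<nu>. \<Sum>a\<in>M. \<Sum>b\<in>M.
          if a \<circ> b = ?m then ?N * ((if a \<in> D1 then ?f D1 else 0) * (if b \<in> D2 then ?g D2 else 0)) else 0)"
    proof (intro sum.cong refl)
      fix D1 D2 assume D: "D1 \<in> double_cosets M \<mu> \<pi>" "D2 \<in> double_cosets M \<pi> \<nu>"
      have "f (\<mu>, \<pi>, D1) * g (\<pi>, \<nu>, D2) * of_int (struct_const nf M (\<mu>, \<pi>, D1) (\<pi>, \<nu>, D2) (\<mu>, \<nu>, D))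
          = ?N * ?f D1 * ?g D2 * of_int (a_coeff M D1 D2 D)"
        unfolding struct_const_of_int[OF b(1) p b(2) D b(3)] by simp
      also have "\<dots> = (\<Sum>a\<in>M. \<Sum>b\<in>M. ?N * ?f D1 * ?g D2 *
          of_int (if a \<circ> b = ?m \<and> a \<in> D1 \<and> b \<in> D2 then 1 else 0))"
        by (simp only: a_coeff_sum of_int_sum sum_distrib_left)
      also have "\<dots> = (\<Sum>a\<in>M. \<Sum>b\<in>M.
          if a \<circ> b = ?m then ?N * ((if a \<in> D1 then ?f D1 else 0) * (if b \<in> D2 then ?g D2 else 0)) else 0)"
        by (intro sum.cong) auto
      finally show "f (\<mu>, \<pi>, D1) * g (\<pi>, \<nu>, D2) * of_int (struct_const nf M (\<mu>, \<pi>, D1) (\<pi>, \<nu>, D2) (\<mu>, \<nu>, D)) = \<dots>" .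
    qed
    also have "\<dots> = (\<Sum>a\<in>M. \<Sum>b\<in>M. \<Sum>D1\<in>double_cosets M \<mu> \<pi>. \<Sum>D2\<in>double_cosets M \<pi> \<nu>.
          if a \<circ> b = ?m then ?N * ((if a \<in> D1 then ?f D1 else 0) * (if b \<in> D2 then ?g D2 else 0)) else 0)"
    proof -
      have swap4: "(\<Sum>x\<in>X. \<Sum>y\<in>Y. \<Sum>a\<in>U. \<Sum>b\<in>V. h x y a b) = (\<Sum>a\<in>U. \<Sum>b\<in>V. \<Sum>x\<in>X. \<Sum>y\<in>Y. (h x y a b :: 'k))"
        for X :: "transf set set" and Y :: "transf set set" and U V :: "transf set" and h
      proof -
        have "(\<Sum>x\<in>X. \<Sum>y\<in>Y. \<Sum>a\<in>U. \<Sum>b\<in>V. h x y a b) = (\<Sum>x\<in>X. \<Sum>a\<in>U. \<Sum>b\<in>V. \<Sum>y\<in>Y. h x y a b)"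
          by (intro sum.cong refl) (simp add: sum.swap[of _ Y])
        also have "\<dots> = (\<Sum>a\<in>U. \<Sum>b\<in>V. \<Sum>x\<in>X. \<Sum>y\<in>Y. h x y a b)"
          by (simp add: sum.swap[of _ X])
        finally show ?thesis .
      qed
      show ?thesis by (rule swap4)
    qed
    also have "\<dots> = (\<Sum>a\<in>M. \<Sum>b\<in>M. if a \<circ> b = ?m then ?N * (mfun f \<mu> \<pi> a * mfun g \<pi> \<nu> b) else 0)"
    proof (intro sum.cong refl)
      fix a b' assume ab: "a \<in> M" "b' \<in> M"
      have "(\<Sum>D1\<in>double_cosets M \<mu> \<pi>. \<Sum>D2\<in>double_cosets M \<pi> \<nu>.
          ?N * ((if a \<in> D1 then ?f D1 else 0) * (if b' \<in> D2 then ?g D2 else 0)))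
        = ?N * ((\<Sum>D1\<in>double_cosets M \<mu> \<pi>. if a \<in> D1 then ?f D1 else 0) *
            (\<Sum>D2\<in>double_cosets M \<pi> \<nu>. if b' \<in> D2 then ?g D2 else 0))"
      proof -
        have dist: "(\<Sum>x\<in>X. \<Sum>y\<in>Y. ?N * (u x * v y)) = ?N * (sum u X * sum v Y)"
          for X Y :: "transf set set" and u v
          by (simp only: sum_product) (simp only: sum_distrib_left)
        show ?thesis by (rule dist)
      qed
      also have "\<dots> = ?N * (mfun f \<mu> \<pi> a * mfun g \<pi> \<nu> b')"
        using ab b p by (simp add: sum_cosets_mem mfun_def)
      finally show "(\<Sum>D1\<in>double_cosets M \<mu> \<pi>. \<Sum>D2\<in>double_cosets M \<pi> \<nu>.
          if a \<circ> b' = ?m then ?N * ((if a \<in> D1 then ?f D1 else 0) * (if b' \<in> D2 then ?g D2 else 0)) else 0)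
        = (if a \<circ> b' = ?m then ?N * (mfun f \<mu> \<pi> a * mfun g \<pi> \<nu> b') else 0)" by simp
    qed
    also have "\<dots> = ?N * (\<Sum>a\<in>M. \<Sum>b\<in>M. if a \<circ> b = ?m then mfun f \<mu> \<pi> a * mfun g \<pi> \<nu> b else 0)"
      by (simp add: sum_distrib_left if_distrib cong: if_cong)
    finally show "(\<Sum>D1\<in>double_cosets M \<mu> \<pi>. \<Sum>D2\<in>double_cosets M \<pi> \<nu>.
        f (\<mu>, \<pi>, D1) * g (\<pi>, \<nu>, D2) * of_int (struct_const nf M (\<mu>, \<pi>, D1) (\<pi>, \<nu>, D2) (\<mu>, \<nu>, D))) = \<dots>" .
  qed simp
  also have "\<dots> = ?N * conv (mfun f) (mfun g) \<mu> \<nu> ?m"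
    by (simp add: conv_def mconv_def sum_distrib_left)
  finally show ?thesis .
qed

lemma mconv_assoc: "mconv (mconv p q) h m = mconv p (mconv q h) m"
proof -
  have push: "(\<Sum>c\<in>M. \<Sum>a\<in>M. \<Sum>b\<in>M. if a \<circ> b = c then \<Psi> a b c else 0) = (\<Sum>a\<in>M. \<Sum>b\<in>M. \<Psi> a b (a \<circ> b))"
    for \<Psi> :: "transf \<Rightarrow> transf \<Rightarrow> transf \<Rightarrow> 'k"
  proof -
    have "(\<Sum>c\<in>M. \<Sum>a\<in>M. \<Sum>b\<in>M. if a \<circ> b = c then \<Psi> a b c else 0)
        = (\<Sum>a\<in>M. \<Sum>b\<in>M. \<Sum>c\<in>M. if a \<circ> b = c then \<Psi> a b c else 0)"
      by (rule trans[OF sum.swap], rule sum.cong[OF refl], rule sum.swap)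
    also have "\<dots> = (\<Sum>a\<in>M. \<Sum>b\<in>M. \<Psi> a b (a \<circ> b))"
      by (intro sum.cong refl) (simp add: finite_M comp_M)
    finally show ?thesis .
  qed
  have "mconv (mconv p q) h m
      = (\<Sum>c\<in>M. \<Sum>d\<in>M. \<Sum>a\<in>M. \<Sum>b\<in>M. if a \<circ> b = c then (if c \<circ> d = m then p a * q b * h d else 0) else 0)"
    unfolding mconv_def by (intro sum.cong refl) (auto simp: sum_distrib_right intro!: sum.cong sum.neutral)
  also have "\<dots> = (\<Sum>d\<in>M. \<Sum>a\<in>M. \<Sum>b\<in>M. if a \<circ> b \<circ> d = m then p a * q b * h d else 0)"
    by (subst sum.swap) (simp only: push)
  also have "\<dots> = (\<Sum>a\<in>M. \<Sum>b\<in>M. \<Sum>d\<in>M. if a \<circ> b \<circ> d = m then p a * q b * h d else 0)"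
    by (rule trans[OF sum.swap], rule sum.cong[OF refl], rule sum.swap)
  also have "\<dots> = (\<Sum>a\<in>M. \<Sum>c\<in>M. \<Sum>b\<in>M. \<Sum>d\<in>M. if b \<circ> d = c then (if a \<circ> c = m then p a * q b * h d else 0) else 0)"
    by (simp only: push comp_assoc)
  also have "\<dots> = mconv p (mconv q h) m"
    unfolding mconv_def by (intro sum.cong refl) (auto simp: sum_distrib_left mult.assoc intro!: sum.cong sum.neutral)
  finally show ?thesis .
qed

lemma mconv_sum_left: "mconv (\<lambda>x. \<Sum>i\<in>I. P i x) q m = (\<Sum>i\<in>I. mconv (P i) q m)"
proof -
  have "mconv (\<lambda>x. \<Sum>i\<in>I. P i x) q m = (\<Sum>a\<in>M. \<Sum>b\<in>M. \<Sum>i\<in>I. if a \<circ> b = m then P i a * q b else 0)"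
    unfolding mconv_def by (intro sum.cong refl) (simp add: sum_distrib_right)
  also have "\<dots> = (\<Sum>i\<in>I. mconv (P i) q m)"
    unfolding mconv_def by (subst sum.swap[of _ I], subst sum.swap[of _ I]) simp
  finally show ?thesis .
qed

lemma mconv_sum_right: "mconv q (\<lambda>x. \<Sum>i\<in>I. P i x) m = (\<Sum>i\<in>I. mconv q (P i) m)"
proof -
  have "mconv q (\<lambda>x. \<Sum>i\<in>I. P i x) m = (\<Sum>a\<in>M. \<Sum>b\<in>M. \<Sum>i\<in>I. if a \<circ> b = m then q a * P i b else 0)"
    unfolding mconv_def by (intro sum.cong refl) (simp add: sum_distrib_left)
  also have "\<dots> = (\<Sum>i\<in>I. mconv q (P i) m)"
    unfolding mconv_def by (subst sum.swap[of _ I], subst sum.swap[of _ I]) simp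
  finally show ?thesis .
qed

lemma conv_assoc: "conv (conv F G) H = conv F (conv G H)"
proof (intro ext)
  fix \<mu> \<nu> m
  have "conv (conv F G) H \<mu> \<nu> m = (\<Sum>\<rho>\<in>\<Lambda>. \<Sum>\<pi>\<in>\<Lambda>. mconv (mconv (F \<mu> \<pi>) (G \<pi> \<rho>)) (H \<rho> \<nu>) m)"
    unfolding conv_def[abs_def] by (simp add: mconv_sum_left)
  also have "\<dots> = (\<Sum>\<pi>\<in>\<Lambda>. \<Sum>\<rho>\<in>\<Lambda>. mconv (F \<mu> \<pi>) (mconv (G \<pi> \<rho>) (H \<rho> \<nu>)) m)"
    by (subst sum.swap) (simp add: mconv_assoc)
  also have "\<dots> = conv F (conv G H) \<mu> \<nu> m"
    unfolding conv_def[abs_def] by (simp add: mconv_sum_right)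
  finally show "conv (conv F G) H \<mu> \<nu> m = conv F (conv G H) \<mu> \<nu> m" .
qed

lemma bi_invariantD:
  assumes "bi_invariant F"
  shows "\<mu> \<notin> \<Lambda> \<Longrightarrow> F \<mu> \<nu> m = 0" "\<nu> \<notin> \<Lambda> \<Longrightarrow> F \<mu> \<nu> m = 0" "m \<notin> M \<Longrightarrow> F \<mu> \<nu> m = 0"
  using assms by (auto simp: bi_invariant_def)

lemma bi_invariant_left:
  assumes "bi_invariant F" "\<sigma> \<in> young \<mu>"
  shows "F \<mu> \<nu> (\<sigma> \<circ> m) = F \<mu> \<nu> m"
proof (cases "\<mu> \<in> \<Lambda> \<and> \<nu> \<in> \<Lambda>")
  case True
  have "m \<in> M" if "\<sigma> \<circ> m \<in> M"
  proof -
    have "pinv \<sigma> \<circ> (\<sigma> \<circ> m) \<in> M" using that assms(2) True young_inv young_M comp_M by blast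
    then show ?thesis by (simp add: young_inv_cancel[OF assms(2)])
  qed
  moreover have "F \<mu> \<nu> (\<sigma> \<circ> m \<circ> id) = F \<mu> \<nu> m" if "m \<in> M"
    using assms that True young_id[of \<nu>] unfolding bi_invariant_def by blast
  ultimately show ?thesis using bi_invariantD(3)[OF assms(1)] by (metis comp_id)
next
  case False
  then show ?thesis using bi_invariantD(1,2)[OF assms(1)] by metis
qed

lemma bi_invariant_right:
  assumes "bi_invariant F" "\<pi> \<in> young \<nu>"
  shows "F \<mu> \<nu> (m \<circ> \<pi>) = F \<mu> \<nu> m"
proof (cases "\<mu> \<in> \<Lambda> \<and> \<nu> \<in> \<Lambda>")
  case True
  have "m \<in> M" if "m \<circ> \<pi> \<in> M"
  proof -
    have "m \<circ> \<pi> \<circ> pinv \<pi> \<in> M" using that assms(2) True young_inv young_M comp_M by blast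
    then show ?thesis by (simp add: young_inv_cancel[OF assms(2)])
  qed
  moreover have "F \<mu> \<nu> (id \<circ> m \<circ> \<pi>) = F \<mu> \<nu> m" if "m \<in> M"
    using assms that True young_id[of \<mu>] unfolding bi_invariant_def by blast
  ultimately show ?thesis using bi_invariantD(3)[OF assms(1)] by (metis id_comp)
next
  case False
  then show ?thesis using bi_invariantD(1,2)[OF assms(1)] by metis
qed

lemma bi_invariantI:
  assumes "\<And>\<mu> \<nu> m. \<not> (\<mu> \<in> \<Lambda> \<and> \<nu> \<in> \<Lambda> \<and> m \<in> M) \<Longrightarrow> F \<mu> \<nu> m = 0"
    "\<And>\<mu> \<nu> m \<sigma>. \<mu> \<in> \<Lambda> \<Longrightarrow> \<nu> \<in> \<Lambda> \<Longrightarrow> m \<in> M \<Longrightarrow> \<sigma> \<in> young \<mu> \<Longrightarrow> F \<mu> \<nu> (\<sigma> \<circ> m) = F \<mu> \<nu> m"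
    "\<And>\<mu> \<nu> m \<pi>. \<mu> \<in> \<Lambda> \<Longrightarrow> \<nu> \<in> \<Lambda> \<Longrightarrow> m \<in> M \<Longrightarrow> \<pi> \<in> young \<nu> \<Longrightarrow> F \<mu> \<nu> (m \<circ> \<pi>) = F \<mu> \<nu> m"
  shows "bi_invariant F"
  unfolding bi_invariant_def
proof (intro conjI allI ballI impI)
  fix \<mu> \<nu> m \<sigma> \<pi> assume *: "\<mu> \<in> \<Lambda>" "\<nu> \<in> \<Lambda>" "m \<in> M" "\<sigma> \<in> young \<mu>" "\<pi> \<in> young \<nu>"
  then have "\<sigma> \<circ> m \<in> M" using young_M comp_M by blast
  then show "F \<mu> \<nu> (\<sigma> \<circ> m \<circ> \<pi>) = F \<mu> \<nu> m" using * assms(2,3) by metis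
qed (use assms(1) in auto)

lemma conv_bi_invariant:
  assumes F: "bi_invariant F" and G: "bi_invariant G"
  shows "bi_invariant (conv F G)"
proof (rule bi_invariantI)
  fix \<mu> \<nu> m assume n: "\<not> (\<mu> \<in> \<Lambda> \<and> \<nu> \<in> \<Lambda> \<and> m \<in> M)"
  have "(if a \<circ> b = m then F \<mu> \<pi> a * G \<pi> \<nu> b else 0) = 0" if "a \<in> M" "b \<in> M" for \<pi> a b
    using n comp_M[OF that] bi_invariantD(1)[OF F, of \<mu> \<pi> a] bi_invariantD(2)[OF G, of \<nu> \<pi> b] by auto
  then show "conv F G \<mu> \<nu> m = 0" by (simp add: conv_def mconv_def)
next
  fix \<mu> \<nu> m \<sigma> assume h: "\<mu> \<in> \<Lambda>" "\<nu> \<in> \<Lambda>" "m \<in> M" "\<sigma> \<in> young \<mu>"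
  note c = young_inv_cancel[OF h(4)]
  have in_M: "\<sigma> \<circ> a \<in> M" "pinv \<sigma> \<circ> a \<in> M" if "a \<in> M" for a
    using that h young_M young_inv comp_M by blast+
  have "mconv (F \<mu> \<pi>) (G \<pi> \<nu>) (\<sigma> \<circ> m) = mconv (F \<mu> \<pi>) (G \<pi> \<nu>) m" for \<pi>
    unfolding mconv_def
  proof (rule sum.reindex_bij_witness[where i = "\<lambda>a. \<sigma> \<circ> a" and j = "\<lambda>a. pinv \<sigma> \<circ> a"])
    fix a :: transf
    have "(pinv \<sigma> \<circ> a) \<circ> b = m \<longleftrightarrow> a \<circ> b = \<sigma> \<circ> m" for b using c by (metis comp_assoc)
    moreover have "F \<mu> \<pi> (pinv \<sigma> \<circ> a) = F \<mu> \<pi> a"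
      using bi_invariant_left[OF F young_inv[OF h(4)]] .
    ultimately show "(\<Sum>b\<in>M. if pinv \<sigma> \<circ> a \<circ> b = m then F \<mu> \<pi> (pinv \<sigma> \<circ> a) * G \<pi> \<nu> b else 0) =
        (\<Sum>b\<in>M. if a \<circ> b = \<sigma> \<circ> m then F \<mu> \<pi> a * G \<pi> \<nu> b else 0)" by (simp cong: if_cong)
  qed (use c in_M in auto)
  then show "conv F G \<mu> \<nu> (\<sigma> \<circ> m) = conv F G \<mu> \<nu> m" by (simp add: conv_def)
next
  fix \<mu> \<nu> m \<sigma> assume h: "\<mu> \<in> \<Lambda>" "\<nu> \<in> \<Lambda>" "m \<in> M" "\<sigma> \<in> young \<nu>"
  note c = young_inv_cancel[OF h(4)]
  have in_M: "a \<circ> \<sigma> \<in> M" "a \<circ> pinv \<sigma> \<in> M" if "a \<in> M" for a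
    using that h young_M young_inv comp_M by blast+
  have "(\<Sum>b\<in>M. if a \<circ> b = m \<circ> \<sigma> then F \<mu> \<pi> a * G \<pi> \<nu> b else 0)
      = (\<Sum>b\<in>M. if a \<circ> b = m then F \<mu> \<pi> a * G \<pi> \<nu> b else 0)" for \<pi> a
  proof (rule sum.reindex_bij_witness[where i = "\<lambda>b. b \<circ> \<sigma>" and j = "\<lambda>b. b \<circ> pinv \<sigma>"])
    fix b :: transf
    have "a \<circ> (b \<circ> pinv \<sigma>) = m \<longleftrightarrow> a \<circ> b = m \<circ> \<sigma>" using c by (metis comp_assoc)
    moreover have "G \<pi> \<nu> (b \<circ> pinv \<sigma>) = G \<pi> \<nu> b"
      using bi_invariant_right[OF G young_inv[OF h(4)]] .
    ultimately show "(if a \<circ> (b \<circ> pinv \<sigma>) = m then F \<mu> \<pi> a * G \<pi> \<nu> (b \<circ> pinv \<sigma>) else 0) =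
        (if a \<circ> b = m \<circ> \<sigma> then F \<mu> \<pi> a * G \<pi> \<nu> b else 0)" by simp
  qed (use c in_M in auto)
  then show "conv F G \<mu> \<nu> (m \<circ> \<sigma>) = conv F G \<mu> \<nu> m" by (simp add: conv_def mconv_def)
qed

lemma mult_of_mfun: "f \<otimes>\<^bsub>A\<^esub> g = of_mfun (conv (mfun f) (mfun g))"
proof (rule ext, clarify)
  fix \<mu> \<nu> D
  show "(f \<otimes>\<^bsub>A\<^esub> g) (\<mu>, \<nu>, D) = of_mfun (conv (mfun f) (mfun g)) (\<mu>, \<nu>, D)"
  proof (cases "(\<mu>, \<nu>, D) \<in> basis_set r n M")
    case True
    then show ?thesis using mult_formula[of \<mu> \<nu> D f g] by (simp add: of_mfun_def basis_set_def)
  next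
    case False
    then show ?thesis by (simp add: of_mfun_def twisted_algebra_def)
  qed
qed

lemma mfun_mult: "mfun (f \<otimes>\<^bsub>A\<^esub> g) = conv (mfun f) (mfun g)"
  by (simp add: mult_of_mfun mfun_of_mfun conv_bi_invariant mfun_bi_invariant)

text \<open>The averages over the Young subgroups fix invariant functions.  They are the coefficient functions of
  the identity of the twisted algebra.\<close>

lemma mconv_young_left:
  assumes "\<mu> \<in> \<Lambda>" "\<And>a. a \<in> young \<mu> \<Longrightarrow> q (pinv a \<circ> m) = q m" "m \<in> M"
  shows "mconv (\<lambda>a. if a \<in> young \<mu> then 1 / of_nat (card (young \<mu>)) else 0) q m = q m"
proof -
  let ?c = "of_nat (card (young \<mu>)) :: 'k"
  have c: "?c \<noteq> 0" using card_young_pos[of \<mu>] by simp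
  have "mconv (\<lambda>a. if a \<in> young \<mu> then 1 / ?c else 0) q m
      = (\<Sum>a\<in>M. if a \<in> young \<mu> then (\<Sum>b\<in>M. if a \<circ> b = m then q b / ?c else 0) else 0)"
    unfolding mconv_def by (intro sum.cong refl) (auto intro!: sum.cong sum.neutral)
  also have "\<dots> = (\<Sum>a\<in>young \<mu>. \<Sum>b\<in>M. if a \<circ> b = m then q b / ?c else 0)"
    using finite_M young_M[OF assms(1)] by (intro sum.mono_neutral_cong_right) auto
  also have "\<dots> = (\<Sum>a\<in>young \<mu>. q m / ?c)"
  proof (intro sum.cong refl)
    fix a assume a: "a \<in> young \<mu>"
    have "a \<circ> b = m \<longleftrightarrow> pinv a \<circ> m = b" for b using young_inv_cancel[OF a] by metis
    moreover have "pinv a \<circ> m \<in> M" using a young_inv young_M[OF assms(1)] comp_M assms(3) by blast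
    ultimately show "(\<Sum>b\<in>M. if a \<circ> b = m then q b / ?c else 0) = q m / ?c"
      using assms(2)[OF a] finite_M by simp
  qed
  also have "\<dots> = q m" using c by simp
  finally show ?thesis .
qed

lemma mconv_young_right:
  assumes "\<mu> \<in> \<Lambda>" "\<And>a. a \<in> young \<mu> \<Longrightarrow> q (m \<circ> pinv a) = q m" "m \<in> M"
  shows "mconv q (\<lambda>a. if a \<in> young \<mu> then 1 / of_nat (card (young \<mu>)) else 0) m = q m"
proof -
  let ?c = "of_nat (card (young \<mu>)) :: 'k"
  have c: "?c \<noteq> 0" using card_young_pos[of \<mu>] by simp
  have "mconv q (\<lambda>a. if a \<in> young \<mu> then 1 / ?c else 0) m
      = (\<Sum>b\<in>M. if b \<in> young \<mu> then (\<Sum>a\<in>M. if a \<circ> b = m then q a / ?c else 0) else 0)"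
    unfolding mconv_def by (subst sum.swap, intro sum.cong refl) (auto intro!: sum.cong sum.neutral)
  also have "\<dots> = (\<Sum>b\<in>young \<mu>. \<Sum>a\<in>M. if a \<circ> b = m then q a / ?c else 0)"
    using finite_M young_M[OF assms(1)] by (intro sum.mono_neutral_cong_right) auto
  also have "\<dots> = (\<Sum>b\<in>young \<mu>. q m / ?c)"
  proof (intro sum.cong refl)
    fix b assume b: "b \<in> young \<mu>"
    have "a \<circ> b = m \<longleftrightarrow> m \<circ> pinv b = a" for a using young_inv_cancel[OF b] by metis
    moreover have "m \<circ> pinv b \<in> M" using b young_inv young_M[OF assms(1)] comp_M assms(3) by blast
    ultimately show "(\<Sum>a\<in>M. if a \<circ> b = m then q a / ?c else 0) = q m / ?c"
      using assms(2)[OF b] finite_M by simp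
  qed
  also have "\<dots> = q m" using c by simp
  finally show ?thesis .
qed

lemma one_left:
  assumes f: "f \<in> carrier A"
  shows "\<one>\<^bsub>A\<^esub> \<otimes>\<^bsub>A\<^esub> f = f"
proof (rule mfun_inject[OF mult_carrier f], intro ext)
  fix \<mu> \<nu> m
  note inv = mfun_bi_invariant[of f]
  show "mfun (\<one>\<^bsub>A\<^esub> \<otimes>\<^bsub>A\<^esub> f) \<mu> \<nu> m = mfun f \<mu> \<nu> m"
  proof (cases "\<mu> \<in> \<Lambda> \<and> m \<in> M")
    case True
    let ?y = "\<lambda>a. if a \<in> young \<mu> then 1 / of_nat (card (young \<mu>)) else 0 :: 'k"
    have "conv (mfun \<one>\<^bsub>A\<^esub>) (mfun f) \<mu> \<nu> m = (\<Sum>\<pi>\<in>\<Lambda>. if \<pi> = \<mu> then mconv ?y (mfun f \<mu> \<nu>) m else 0)"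
      unfolding conv_def using True
      by (intro sum.cong refl) (auto simp: mfun_one[abs_def] mconv_def intro!: sum.neutral sum.cong)
    also have "\<dots> = mconv ?y (mfun f \<mu> \<nu>) m" using True finite_compositions by simp
    also have "\<dots> = mfun f \<mu> \<nu> m"
      using True bi_invariant_left[OF inv young_inv] by (intro mconv_young_left) auto
    finally show ?thesis by (simp add: mfun_mult)
  next
    case False
    then show ?thesis using bi_invariantD[OF inv] bi_invariantD[OF mfun_bi_invariant[of "\<one>\<^bsub>A\<^esub> \<otimes>\<^bsub>A\<^esub> f"]]
      by metis
  qed
qed

lemma one_right:
  assumes f: "f \<in> carrier A"
  shows "f \<otimes>\<^bsub>A\<^esub> \<one>\<^bsub>A\<^esub> = f"
proof (rule mfun_inject[OF mult_carrier f], intro ext)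
  fix \<mu> \<nu> m
  note inv = mfun_bi_invariant[of f]
  show "mfun (f \<otimes>\<^bsub>A\<^esub> \<one>\<^bsub>A\<^esub>) \<mu> \<nu> m = mfun f \<mu> \<nu> m"
  proof (cases "\<nu> \<in> \<Lambda> \<and> m \<in> M")
    case True
    let ?y = "\<lambda>a. if a \<in> young \<nu> then 1 / of_nat (card (young \<nu>)) else 0 :: 'k"
    have "conv (mfun f) (mfun \<one>\<^bsub>A\<^esub>) \<mu> \<nu> m = (\<Sum>\<pi>\<in>\<Lambda>. if \<pi> = \<nu> then mconv (mfun f \<mu> \<nu>) ?y m else 0)"
      unfolding conv_def using True
      by (intro sum.cong refl) (auto simp: mfun_one[abs_def] mconv_def intro!: sum.neutral sum.cong)
    also have "\<dots> = mconv (mfun f \<mu> \<nu>) ?y m" using True finite_compositions by simp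
    also have "\<dots> = mfun f \<mu> \<nu> m"
      using True bi_invariant_right[OF inv young_inv] by (intro mconv_young_right) auto
    finally show ?thesis by (simp add: mfun_mult)
  next
    case False
    then show ?thesis using bi_invariantD[OF inv] bi_invariantD[OF mfun_bi_invariant[of "f \<otimes>\<^bsub>A\<^esub> \<one>\<^bsub>A\<^esub>"]]
      by metis
  qed
qed

lemma mconv_add_left: "mconv (\<lambda>x. p x + p' x) q m = mconv p q m + mconv p' q m"
  and mconv_add_right: "mconv q (\<lambda>x. p x + p' x) m = mconv q p m + mconv q p' m"
  and mconv_scale_left: "mconv (\<lambda>x. c * p x) q m = c * mconv p q m"
  and mconv_scale_right: "mconv q (\<lambda>x. c * p x) m = c * mconv q p m"
  unfolding mconv_def
  by (simp_all only: sum.distrib[symmetric] sum_distrib_left)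
    (auto intro!: sum.cong simp: algebra_simps)

sublocale alg: ring A
proof (rule ringI)
  show "abelian_group A"
  proof (rule abelian_groupI)
    fix x assume x: "x \<in> carrier A"
    show "\<exists>y\<in>carrier A. y \<oplus>\<^bsub>A\<^esub> x = \<zero>\<^bsub>A\<^esub>"
      using x by (intro bexI[of _ "\<lambda>b. - x b"]) (auto simp: twisted_algebra_def)
  qed (auto simp: twisted_algebra_def algebra_simps)
  show "Group.monoid A"
  proof (rule Group.monoidI)
    fix x y z
    show "(x \<otimes>\<^bsub>A\<^esub> y) \<otimes>\<^bsub>A\<^esub> z = x \<otimes>\<^bsub>A\<^esub> (y \<otimes>\<^bsub>A\<^esub> z)"
      by (rule mfun_inject[OF mult_carrier mult_carrier]) (simp only: mfun_mult conv_assoc)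
  qed (simp_all only: mult_carrier one_carrier one_left one_right)
next
  fix x y z
  show "(x \<oplus>\<^bsub>A\<^esub> y) \<otimes>\<^bsub>A\<^esub> z = x \<otimes>\<^bsub>A\<^esub> z \<oplus>\<^bsub>A\<^esub> y \<otimes>\<^bsub>A\<^esub> z"
    by (intro mfun_inject add_carrier mult_carrier ext)
      (simp add: mfun_mult mfun_add conv_def mconv_add_left sum.distrib mfun_add[abs_def])
  show "z \<otimes>\<^bsub>A\<^esub> (x \<oplus>\<^bsub>A\<^esub> y) = z \<otimes>\<^bsub>A\<^esub> x \<oplus>\<^bsub>A\<^esub> z \<otimes>\<^bsub>A\<^esub> y"
    by (intro mfun_inject add_carrier mult_carrier ext)
      (simp add: mfun_mult mfun_add conv_def mconv_add_right sum.distrib mfun_add[abs_def])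
qed

lemma finsum_apply:
  assumes "\<And>i. i \<in> I \<Longrightarrow> g i \<in> carrier A"
  shows "(\<Oplus>\<^bsub>A\<^esub>i\<in>I. g i) b = (\<Sum>i\<in>I. g i b)"
  using assms
proof (induction I rule: infinite_finite_induct)
  case (infinite I)
  then show ?case by (simp add: finsum_def finprod_def twisted_algebra_def)
next
  case empty
  show ?case by simp (simp add: twisted_algebra_def)
next
  case (insert i I)
  then show ?case
    by (subst alg.finsum_insert) (auto, simp add: twisted_algebra_def)
qed

lemma k_span_unit_vectors: "\<exists>B. finite B \<and> B \<subseteq> carrier A \<and> k_span A B = carrier A"
proof -
  define u where "u b = (\<lambda>b'. if b' = b then 1 else (0::'k))" for b :: bidx
  define B where "B = u ` basis_set r n M"
  have B: "finite B" "B \<subseteq> carrier A"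
    by (auto simp: B_def u_def finite_basis_set twisted_algebra_def)
  have inj: "inj_on u (basis_set r n M)" by (auto simp: inj_on_def u_def fun_eq_iff split: if_splits)
  have "f \<in> k_span A B" if f: "f \<in> carrier A" for f
  proof -
    define c where "c x = (\<Sum>b\<in>basis_set r n M. x b * f b)" for x :: "bidx \<Rightarrow> 'k"
    have c: "c (u b) = f b" if "b \<in> basis_set r n M" for b
      using that finite_basis_set by (simp add: c_def u_def if_distrib[of "\<lambda>x. x * _"] cong: if_cong)
    have "f = (\<Oplus>\<^bsub>A\<^esub>b\<in>B. c b \<odot>\<^bsub>A\<^esub> b)"
    proof
      fix b'
      have "(\<Oplus>\<^bsub>A\<^esub>b\<in>B. c b \<odot>\<^bsub>A\<^esub> b) b' = (\<Sum>b\<in>B. c b * b b')"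
        using B(2) smult_carrier by (subst finsum_apply) (auto simp: twisted_algebra_def)
      also have "\<dots> = (\<Sum>b\<in>basis_set r n M. c (u b) * u b b')"
        unfolding B_def using inj by (simp add: sum.reindex)
      also have "\<dots> = (\<Sum>b\<in>basis_set r n M. if b = b' then f b else 0)"
        by (intro sum.cong refl) (simp add: c, simp add: u_def)
      also have "\<dots> = f b'"
        using f finite_basis_set by (cases b') (auto simp: twisted_algebra_def)
      finally show "f b' = (\<Oplus>\<^bsub>A\<^esub>b\<in>B. c b \<odot>\<^bsub>A\<^esub> b) b'" by simp
    qed
    then show ?thesis using B(1) unfolding k_span_def by blast
  qed
  moreover have "k_span A B \<subseteq> carrier A"
    using B(2) smult_carrier by (auto simp: k_span_def intro!: alg.finsum_closed)
  ultimately show ?thesis using B by blast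
qed

lemma fd_algebra_A: "fd_algebra A"
proof
  show "\<exists>B. finite B \<and> B \<subseteq> carrier A \<and> k_span A B = carrier A" by (rule k_span_unit_vectors)
  fix x y :: "bidx \<Rightarrow> 'k" and c
  show "(c \<odot>\<^bsub>A\<^esub> x) \<otimes>\<^bsub>A\<^esub> y = c \<odot>\<^bsub>A\<^esub> (x \<otimes>\<^bsub>A\<^esub> y)"
    by (intro mfun_inject smult_carrier mult_carrier ext)
      (simp add: mfun_mult mfun_smult conv_def mconv_scale_left sum_distrib_left mfun_smult[abs_def])
  show "x \<otimes>\<^bsub>A\<^esub> (c \<odot>\<^bsub>A\<^esub> y) = c \<odot>\<^bsub>A\<^esub> (x \<otimes>\<^bsub>A\<^esub> y)"
    by (intro mfun_inject smult_carrier mult_carrier ext)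
      (simp add: mfun_mult mfun_smult conv_def mconv_scale_right sum_distrib_left mfun_smult[abs_def])
qed (auto simp: twisted_algebra_def algebra_simps)

end

section \<open>Full transformation monoids\<close>

lemma full_transf_iff:
  "m \<in> full_transf r \<longleftrightarrow> m 0 = 0 \<and> (\<forall>x\<in>{1..r}. m x \<in> {1..r}) \<and> (\<forall>x>r. m x = x)"
proof
  assume m: "m \<in> full_transf r"
  then have v: "m -` {0} = {0}" and t: "m \<in> tau r" by (auto simp: full_transf_def)
  have "m x \<noteq> 0" if "x \<in> {1..r}" for x
  proof
    assume "m x = 0"
    then have "x \<in> m -` {0}" by simp
    then show False using v that by simp
  qed
  then show "m 0 = 0 \<and> (\<forall>x\<in>{1..r}. m x \<in> {1..r}) \<and> (\<forall>x>r. m x = x)"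
    using t by (auto simp: tau_def Suc_le_eq)
next
  assume m: "m 0 = 0 \<and> (\<forall>x\<in>{1..r}. m x \<in> {1..r}) \<and> (\<forall>x>r. m x = x)"
  have "x = 0" if "m x = 0" for x
  proof (rule ccontr)
    assume "x \<noteq> 0"
    then consider "x \<in> {1..r}" | "x > r" by fastforce
    then have "m x \<noteq> 0" using m by cases fastforce+
    then show False using that by simp
  qed
  then have "m -` {0} = {0}" using m by auto
  moreover have "m \<in> tau r" unfolding tau_def using m by auto
  ultimately show "m \<in> full_transf r" by (simp add: full_transf_def)
qed

lemma full_transf_comp: "a \<in> full_transf r \<Longrightarrow> b \<in> full_transf r \<Longrightarrow> a \<circ> b \<in> full_transf r"
  by (simp add: full_transf_iff)

lemma full_transf_eqI:
  assumes "a \<in> full_transf r" "b \<in> full_transf r" "\<And>x. x \<in> {1..r} \<Longrightarrow> a x = b x"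
  shows "a = b"
proof
  fix x
  consider "x = 0" | "x \<in> {1..r}" | "x > r" by fastforce
  then show "a x = b x" using assms by cases (auto simp: full_transf_iff)
qed

lemma finite_full_transf: "finite (full_transf r)"
proof (rule finite_subset)
  show "full_transf r \<subseteq> (\<lambda>g x. if x \<in> {1..r} then g x else x) ` ({1..r} \<rightarrow>\<^sub>E {1..r})"
  proof
    fix m assume m: "m \<in> full_transf r"
    have "m = (\<lambda>x. if x \<in> {1..r} then restrict m {1..r} x else x)"
    proof
      fix x
      consider "x = 0" | "x \<in> {1..r}" | "x > r" by fastforce
      then show "m x = (if x \<in> {1..r} then restrict m {1..r} x else x)"
        using m by cases (auto simp: full_transf_iff)
    qed
    moreover have "restrict m {1..r} \<in> {1..r} \<rightarrow>\<^sub>E {1..r}" using m by (auto simp: full_transf_iff)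
    ultimately show "m \<in> (\<lambda>g x. if x \<in> {1..r} then g x else x) ` ({1..r} \<rightarrow>\<^sub>E {1..r})" by blast
  qed
qed (intro finite_imageI finite_PiE, auto)

lemma permutes_full_transf:
  assumes "\<sigma> permutes {1..i}" "i \<le> r"
  shows "\<sigma> \<in> full_transf r"
  unfolding full_transf_iff
proof (intro conjI ballI allI impI)
  show "\<sigma> 0 = 0" using assms by (auto simp: permutes_def)
  fix x assume x: "x \<in> {1..r}"
  show "\<sigma> x \<in> {1..r}"
  proof (cases "x \<le> i")
    case True
    then have "\<sigma> x \<in> {1..i}" using x permutes_in_image[OF assms(1), of x] by auto
    then show ?thesis using assms(2) by auto
  next
    case False
    then show ?thesis using x permutes_not_in[OF assms(1), of x] by auto
  qed
next
  fix x assume "r < x"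
  then show "\<sigma> x = x" using permutes_not_in[OF assms(1), of x] assms(2) by auto
qed

lemma young_full_transf: "\<mu> \<in> compositions r n \<Longrightarrow> young \<mu> \<subseteq> full_transf r"
  using permutes_full_transf[of _ r r] by (auto simp: young_def compositions_def)

definition rank :: "nat \<Rightarrow> transf \<Rightarrow> nat" where
  "rank r m = card (m ` {1..r})"

lemma full_transf_image: "m \<in> full_transf r \<Longrightarrow> m ` {1..r} \<subseteq> {1..r}"
  by (auto simp: full_transf_iff)

lemma rank_index: "m \<in> full_transf r \<Longrightarrow> transf_index r m = rank r m"
proof -
  assume m: "m \<in> full_transf r"
  have "{0..r} = insert 0 {1..r}" by auto
  then have "m ` {0..r} - {0} = m ` {1..r}" using m by (auto simp: full_transf_iff)
  then show ?thesis by (simp add: transf_index_def rank_def)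
qed

lemma rank_comp_left: "b \<in> full_transf r \<Longrightarrow> rank r (a \<circ> b) \<le> rank r a"
proof -
  assume b: "b \<in> full_transf r"
  have "(a \<circ> b) ` {1..r} \<subseteq> a ` {1..r}" using full_transf_image[OF b] by (auto simp: image_subset_iff)
  then show ?thesis unfolding rank_def by (intro card_mono) auto
qed

lemma rank_comp_right: "rank r (a \<circ> b) \<le> rank r b"
proof -
  have "(a \<circ> b) ` {1..r} = a ` (b ` {1..r})" by (rule image_comp[symmetric])
  then show ?thesis unfolding rank_def by (simp only: card_image_le finite_imageI finite_atLeastAtMost)
qed

lemma rank_le: "rank r m \<le> r"
  unfolding rank_def using card_image_le[of "{1..r}" m] by simp

lemma rank_pos: "1 \<le> r \<Longrightarrow> 0 < rank r m"
  by (simp add: rank_def card_gt_0_iff)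

lemma phi_bij: "finite C \<Longrightarrow> bij_betw (phi C) {1..card C} C"
proof -
  assume C: "finite C"
  have "bij_betw ((!) (sorted_list_of_set C)) {..<card C} C"
    using C by (intro bij_betw_nth) auto
  moreover have "bij_betw (\<lambda>j. j - 1) {1..card C} {..<card C}"
    by (rule bij_betwI[of _ _ _ Suc]) auto
  ultimately have "bij_betw ((!) (sorted_list_of_set C) \<circ> (\<lambda>j. j - 1)) {1..card C} C"
    by (rule bij_betw_trans[rotated])
  then show ?thesis
    by (rule bij_betw_cong[THEN iffD1, rotated]) (auto simp: phi_def)
qed

lemma phi_outside: "x \<notin> {1..card C} \<Longrightarrow> phi C x = x"
  unfolding phi_def by (rule if_not_P)

text \<open>The idempotent map of rank \<open>i\<close> through which the maps of rank \<open>i\<close> will be factored.\<close>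

definition collapse :: "nat \<Rightarrow> nat \<Rightarrow> transf" where
  "collapse r i x = (if x \<in> {1..r} then min x i else x)"

lemma collapse_full: "1 \<le> i \<Longrightarrow> i \<le> r \<Longrightarrow> collapse r i \<in> full_transf r"
  by (auto simp: full_transf_iff collapse_def)

lemma collapse_image: "1 \<le> i \<Longrightarrow> i \<le> r \<Longrightarrow> collapse r i ` {1..r} = {1..i}"
proof (intro equalityI subsetI)
  fix x assume "1 \<le> i" "i \<le> r" "x \<in> {1..i}"
  then have "x = collapse r i x" "x \<in> {1..r}" by (auto simp: collapse_def)
  then show "x \<in> collapse r i ` {1..r}" by blast
qed (auto simp: collapse_def)

lemma collapse_comp:
  assumes "b \<in> full_transf r" "b ` {1..r} \<subseteq> {1..i}"
  shows "collapse r i \<circ> b = b"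
proof
  fix x
  have "b x \<le> i" if "x \<in> {1..r}"
  proof -
    have "b x \<in> {1..i}" using assms(2) that by blast
    then show ?thesis by simp
  qed
  moreover have "b x = x" if "x \<notin> {1..r}" using assms(1) that by (cases "x = 0") (auto simp: full_transf_iff)
  ultimately show "(collapse r i \<circ> b) x = b x"
    by (cases "x \<in> {1..r}") (auto simp: collapse_def min_def)
qed

text \<open>On \<open>{1..i}\<close> the map \<open>phi C\<close> is the increasing bijection to \<open>C\<close>, so it can be split off from a map with
  image \<open>C\<close>.\<close>

lemma phi_comp_bij:
  assumes C: "C \<in> C_sets i r"
  shows "bij_betw (\<lambda>b. phi C \<circ> b) {b \<in> full_transf r. b ` {1..r} = {1..i}}
    {m \<in> full_transf r. m ` {1..r} = C}"
proof -
  have Cr: "C \<subseteq> {1..r}" "card C = i" and fC: "finite C"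
    using C finite_subset by (auto simp: C_sets_def)
  have ir: "i \<le> r" using card_mono[OF _ Cr(1)] Cr(2) by simp
  have bij: "bij_betw (phi C) {1..i} C" using phi_bij[OF fC] Cr(2) by simp
  have out: "phi C x = x" if "x = 0 \<or> x > r" for x using that phi_outside[of x C] Cr(2) ir by auto
  define g where "g m x = (if x \<in> {1..r} then inv_into {1..i} (phi C) (m x) else x)" for m x
  show ?thesis
  proof (rule bij_betwI[where g = g])
    show "(\<lambda>b. phi C \<circ> b) \<in> {b \<in> full_transf r. b ` {1..r} = {1..i}} \<rightarrow> {m \<in> full_transf r. m ` {1..r} = C}"
    proof
      fix b assume b: "b \<in> {b \<in> full_transf r. b ` {1..r} = {1..i}}"
      have im: "(phi C \<circ> b) ` {1..r} = C" using b bij unfolding image_comp[symmetric] by (simp add: bij_betw_def)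
      have "(phi C \<circ> b) x \<in> {1..r}" if "x \<in> {1..r}" for x using im that Cr(1) by blast
      then have "phi C \<circ> b \<in> full_transf r" using b out by (auto simp: full_transf_iff)
      then show "phi C \<circ> b \<in> {m \<in> full_transf r. m ` {1..r} = C}" using im by simp
    qed
    show "g \<in> {m \<in> full_transf r. m ` {1..r} = C} \<rightarrow> {b \<in> full_transf r. b ` {1..r} = {1..i}}"
    proof
      fix m assume m: "m \<in> {m \<in> full_transf r. m ` {1..r} = C}"
      have "g m ` {1..r} = inv_into {1..i} (phi C) ` (m ` {1..r})" by (auto simp: g_def)
      also have "\<dots> = {1..i}" using m bij_betw_inv_into[OF bij] by (simp add: bij_betw_def)
      finally have im: "g m ` {1..r} = {1..i}" .
      have "g m x \<in> {1..r}" if "x \<in> {1..r}" for x proof -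
        have "g m x \<in> {1..i}" using im that by blast
        then show ?thesis using ir by simp
      qed
      then have "g m \<in> full_transf r" by (auto simp: full_transf_iff g_def)
      then show "g m \<in> {b \<in> full_transf r. b ` {1..r} = {1..i}}" using im by simp
    qed
    show "g (phi C \<circ> b) = b" if "b \<in> {b \<in> full_transf r. b ` {1..r} = {1..i}}" for b
    proof
      fix x
      have "b x = x" if "x \<notin> {1..r}"
        using that \<open>b \<in> _\<close> by (cases "x = 0") (auto simp: full_transf_iff)
      moreover have "b x \<in> {1..i}" if "x \<in> {1..r}" using that \<open>b \<in> _\<close> by blast
      ultimately show "g (phi C \<circ> b) x = b x"
        using bij by (simp add: g_def bij_betw_def)
    qed
    show "phi C \<circ> g m = m" if "m \<in> {m \<in> full_transf r. m ` {1..r} = C}" for m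
    proof
      fix x
      have "m x = x" if "x \<notin> {1..r}"
        using that \<open>m \<in> _\<close> by (cases "x = 0") (auto simp: full_transf_iff)
      moreover have "m x \<in> phi C ` {1..i}" if "x \<in> {1..r}"
        using that \<open>m \<in> _\<close> bij by (auto simp: bij_betw_def)
      moreover have "phi C x = x" if "x \<notin> {1..r}" using out[of x] that by auto
      ultimately show "(phi C \<circ> g m) x = m x"
        by (simp add: g_def f_inv_into_f)
    qed
  qed
qed

lemma phi_comp_inj:
  assumes "finite C" "a \<in> full_transf r" "b \<in> full_transf r" "a ` {1..r} \<subseteq> {1..card C}" "b ` {1..r} \<subseteq> {1..card C}"
    "phi C \<circ> a = phi C \<circ> b"
  shows "a = b"
proof (rule full_transf_eqI[OF assms(2,3)])
  fix x assume x: "x \<in> {1..r}"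
  then have "a x \<in> {1..card C}" "b x \<in> {1..card C}" using assms(4,5) by blast+
  moreover have "phi C (a x) = phi C (b x)" using assms(6) by (metis comp_apply)
  ultimately show "a x = b x"
    using inj_onD[OF bij_betw_imp_inj_on[OF phi_bij[OF assms(1)]]] by blast
qed

text \<open>The composition \<open>(1,\<dots>,1,0,\<dots>,0)\<close>.  As its Young subgroup is trivial, its block in the twisted
  algebra is the whole monoid algebra.\<close>

definition regular_comp :: "nat \<Rightarrow> nat \<Rightarrow> nat list" where
  "regular_comp r n = replicate r 1 @ replicate (n - r) 0"

lemma regular_comp_mem: "r \<le> n \<Longrightarrow> regular_comp r n \<in> compositions r n"
  by (simp add: regular_comp_def compositions_def sum_list_replicate)

lemma regular_comp_block: "j \<in> {1..r} \<Longrightarrow> block (regular_comp r n) j = {j}"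
proof -
  assume j: "j \<in> {1..r}"
  have "sum_list (take k (regular_comp r n)) = k" if "k \<le> r" for k
    using that by (simp add: regular_comp_def sum_list_replicate)
  moreover have "j - 1 \<le> r" "j \<le> r" using j by auto
  ultimately have "block (regular_comp r n) j = {j - 1<..j}"
    by (simp add: block_def)
  also have "\<dots> = {j}" using j by auto
  finally show ?thesis .
qed

lemma young_regular_comp: "r \<le> n \<Longrightarrow> young (regular_comp r n) = {id}"
proof (intro equalityI subsetI)
  fix \<sigma> assume n: "r \<le> n" and s: "\<sigma> \<in> young (regular_comp r n)"
  have len: "length (regular_comp r n) = n" using n by (simp add: regular_comp_def)
  have sum: "sum_list (regular_comp r n) = r" by (simp add: regular_comp_def sum_list_replicate)
  have "\<sigma> x = x" for x
  proof (cases "x \<in> {1..r}")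
    case True
    then have "\<sigma> ` block (regular_comp r n) x = block (regular_comp r n) x"
      using s n len by (auto simp: young_def)
    then show ?thesis using regular_comp_block[OF True] by simp
  next
    case False
    then show ?thesis using s sum by (auto simp: young_def permutes_def)
  qed
  then show "\<sigma> \<in> {id}" by auto
qed (simp add: young_id)

section \<open>The rank filtration is a heredity chain\<close>

locale full_twisted = twisted r n "full_transf r" nf k_type
  for r n nf and k_type :: "'k::field_char_0 itself" +
  assumes r_pos: "1 \<le> r" and r_le_n: "r \<le> n"
begin

abbreviation "T \<equiv> full_transf r"

abbreviation "reg \<equiv> regular_comp r n"

lemma reg_mem: "reg \<in> \<Lambda>"
  using r_le_n by (rule regular_comp_mem)

lemma young_reg: "young reg = {id}"
  using r_le_n by (rule young_regular_comp)

text \<open>Composition does not increase the rank, so this is an ideal.\<close>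

definition rank_ideal :: "nat \<Rightarrow> (bidx \<Rightarrow> 'k) set" where
  "rank_ideal t = {f \<in> carrier A. \<forall>\<mu> \<nu> m. t < rank r m \<longrightarrow> mfun f \<mu> \<nu> m = 0}"

lemma mfun_minus: "f \<in> carrier A \<Longrightarrow> mfun (\<ominus>\<^bsub>A\<^esub> f) \<mu> \<nu> m = - mfun f \<mu> \<nu> m"
  using alg.r_neg[of f] mfun_add[of f "\<ominus>\<^bsub>A\<^esub> f" \<mu> \<nu> m] mfun_zero[of \<mu> \<nu> m]
  by (simp add: eq_neg_iff_add_eq_0 add.commute)

lemma mfun_diff: "f \<in> carrier A \<Longrightarrow> g \<in> carrier A \<Longrightarrow> mfun (f \<ominus>\<^bsub>A\<^esub> g) \<mu> \<nu> m = mfun f \<mu> \<nu> m - mfun g \<mu> \<nu> m"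
  by (simp only: a_minus_def mfun_add mfun_minus) simp

lemma mfun_finsum:
  assumes "\<And>i. i \<in> I \<Longrightarrow> g i \<in> carrier A"
  shows "mfun (\<Oplus>\<^bsub>A\<^esub>i\<in>I. g i) \<mu> \<nu> m = (\<Sum>i\<in>I. mfun (g i) \<mu> \<nu> m)"
  using assms by (auto simp: mfun_def finsum_apply sum_divide_distrib intro!: sum.neutral)

lemma mconv_rank_zero:
  assumes "(\<forall>a\<in>T. t < rank r a \<longrightarrow> p a = 0) \<or> (\<forall>b\<in>T. t < rank r b \<longrightarrow> q b = 0)"
    "t < rank r m"
  shows "mconv p q m = 0"
  unfolding mconv_def
proof (intro sum.neutral ballI)
  fix a b assume ab: "a \<in> T" "b \<in> T"
  show "(if a \<circ> b = m then p a * q b else 0) = 0"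
    using assms ab rank_comp_left[OF ab(2), of a] rank_comp_right[of r a b] by fastforce
qed

lemma rank_ideal_mult:
  assumes "f \<in> carrier A" "g \<in> carrier A" "f \<in> rank_ideal t \<or> g \<in> rank_ideal t"
  shows "f \<otimes>\<^bsub>A\<^esub> g \<in> rank_ideal t"
  using assms mult_carrier unfolding rank_ideal_def
  by (auto simp: mfun_mult conv_def intro!: sum.neutral mconv_rank_zero)

lemma rank_ideal_is_ideal: "ideal (rank_ideal t) A"
proof (rule idealI)
  show "ring A" by (rule alg.ring_axioms)
  show "subgroup (rank_ideal t) (add_monoid A)"
  proof (rule alg.add.subgroupI)
    show "rank_ideal t \<noteq> {}" using zero_carrier mfun_zero by (auto simp: rank_ideal_def)
  qed (auto simp: rank_ideal_def mfun_minus mfun_add)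
  fix a x assume "a \<in> rank_ideal t" "x \<in> carrier A"
  moreover from this have "a \<in> carrier A" by (simp add: rank_ideal_def)
  ultimately show "x \<otimes>\<^bsub>A\<^esub> a \<in> rank_ideal t" "a \<otimes>\<^bsub>A\<^esub> x \<in> rank_ideal t"
    using rank_ideal_mult by blast+
qed

lemma mconv_delta_left:
  assumes "a \<in> T"
  shows "mconv (\<lambda>x. if x = a then c else 0) q m = (\<Sum>b\<in>T. if a \<circ> b = m then c * q b else 0)"
proof -
  have "mconv (\<lambda>x. if x = a then c else 0) q m
      = (\<Sum>x\<in>T. if x = a then (\<Sum>b\<in>T. if a \<circ> b = m then c * q b else 0) else 0)"
    unfolding mconv_def by (intro sum.cong refl) (auto intro!: sum.neutral sum.cong)
  then show ?thesis using assms finite_M by simp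
qed

lemma mconv_delta_delta:
  assumes "a \<in> T" "b \<in> T"
  shows "mconv (\<lambda>x. if x = a then c else 0) (\<lambda>x. if x = b then d else 0) m = (if a \<circ> b = m then c * d else 0)"
proof -
  have "mconv (\<lambda>x. if x = a then c else 0) (\<lambda>x. if x = b then d else 0) m
      = (\<Sum>x\<in>T. if x = b then (if a \<circ> b = m then c * d else 0) else 0)"
    unfolding mconv_delta_left[OF assms(1)] by (intro sum.cong) auto
  then show ?thesis using assms finite_M by simp
qed

lemma mconv_cong_rank:
  assumes "\<And>a. a \<in> T \<Longrightarrow> i \<le> rank r a \<Longrightarrow> p a = p' a" "\<And>a. a \<in> T \<Longrightarrow> i \<le> rank r a \<Longrightarrow> q a = q' a" "i \<le> rank r m"
  shows "mconv p q m = mconv p' q' m"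
  unfolding mconv_def
proof (intro sum.cong refl)
  fix a b assume ab: "a \<in> T" "b \<in> T"
  show "(if a \<circ> b = m then p a * q b else 0) = (if a \<circ> b = m then p' a * q' b else 0)"
    using assms ab rank_comp_left[OF ab(2), of a] rank_comp_right[of r a b] by auto
qed

lemma conv_reg_left:
  assumes "\<And>\<pi> a. \<pi> \<noteq> reg \<Longrightarrow> F \<mu> \<pi> a = 0"
  shows "conv F G \<mu> \<nu> m = mconv (F \<mu> reg) (G reg \<nu>) m"
proof -
  have "conv F G \<mu> \<nu> m = (\<Sum>\<pi>\<in>\<Lambda>. if \<pi> = reg then mconv (F \<mu> reg) (G reg \<nu>) m else 0)"
    unfolding conv_def using assms by (intro sum.cong refl) (auto simp: mconv_def intro!: sum.neutral)
  then show ?thesis using reg_mem finite_compositions by simp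
qed

lemma conv_reg_right:
  assumes "\<And>\<pi> a. \<pi> \<noteq> reg \<Longrightarrow> G \<pi> \<nu> a = 0"
  shows "conv F G \<mu> \<nu> m = mconv (F \<mu> reg) (G reg \<nu>) m"
proof -
  have "conv F G \<mu> \<nu> m = (\<Sum>\<pi>\<in>\<Lambda>. if \<pi> = reg then mconv (F \<mu> reg) (G reg \<nu>) m else 0)"
    unfolding conv_def using assms by (intro sum.cong refl) (auto simp: mconv_def intro!: sum.neutral)
  then show ?thesis using reg_mem finite_compositions by simp
qed

text \<open>For a fixed rank \<open>i\<close>: the idempotent, the generators and the coordinate functionals of the
  layer of maps of rank \<open>i\<close>.  The functional belonging to \<open>(\<mu>, C)\<close> cuts out the maps with
  image \<open>C\<close> and identifies \<open>C\<close> with \<open>{1..i}\<close>; the generator puts the image back and averages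
  over the Young subgroup.  Finally, \<open>group_fun\<close> embeds the group algebra into the corner of the idempotent.\<close>

definition unit_fun :: "nat \<Rightarrow> nat list \<Rightarrow> nat list \<Rightarrow> transf \<Rightarrow> 'k" where
  "unit_fun i \<alpha> \<beta> m = (if \<alpha> = reg \<and> \<beta> = reg \<and> m = collapse r i then 1 else 0)"

definition gen_fun :: "nat \<Rightarrow> nat list \<Rightarrow> nat set \<Rightarrow> nat list \<Rightarrow> nat list \<Rightarrow> transf \<Rightarrow> 'k" where
  "gen_fun i \<mu> C \<alpha> \<beta> m = (if \<alpha> = \<mu> \<and> \<beta> = reg
     then (\<Sum>\<sigma>\<in>young \<mu>. if m = \<sigma> \<circ> phi C \<circ> collapse r i then 1 / of_nat (card (young \<mu>)) else 0) else 0)"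

definition coord_fun :: "nat \<Rightarrow> nat list \<Rightarrow> nat set \<Rightarrow> (bidx \<Rightarrow> 'k) \<Rightarrow> nat list \<Rightarrow> nat list \<Rightarrow> transf \<Rightarrow> 'k" where
  "coord_fun i \<mu> C y \<alpha> \<beta> m = (if \<alpha> = reg \<and> m \<in> T \<and> m ` {1..r} = {1..i} then mfun y \<mu> \<beta> (phi C \<circ> m) else 0)"

definition group_fun :: "nat \<Rightarrow> (transf \<Rightarrow> 'k) \<Rightarrow> nat list \<Rightarrow> nat list \<Rightarrow> transf \<Rightarrow> 'k" where
  "group_fun i w \<alpha> \<beta> m = (if \<alpha> = reg \<and> \<beta> = reg
     then (\<Sum>\<sigma> | \<sigma> permutes {1..i}. if m = \<sigma> \<circ> collapse r i then w \<sigma> else 0) else 0)"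

context
  fixes i assumes i: "1 \<le> i" "i \<le> r"
begin

lemma collapse_T: "collapse r i \<in> T"
  using i by (rule collapse_full)

lemma phi_collapse_T:
  assumes "C \<in> C_sets i r"
  shows "phi C \<circ> collapse r i \<in> T" "(phi C \<circ> collapse r i) ` {1..r} = C"
  using bij_betwE[OF phi_comp_bij[OF assms]] collapse_T collapse_image[OF i] by auto

lemma unit_fun_inv: "bi_invariant (unit_fun i)"
  by (rule bi_invariantI) (use reg_mem collapse_T in \<open>auto simp: unit_fun_def young_reg\<close>)

lemma gen_fun_inv:
  assumes "\<mu> \<in> \<Lambda>" "C \<in> C_sets i r"
  shows "bi_invariant (gen_fun i \<mu> C)"
proof (rule bi_invariantI)
  fix \<alpha> \<beta> m assume n: "\<not> (\<alpha> \<in> \<Lambda> \<and> \<beta> \<in> \<Lambda> \<and> m \<in> T)"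
  have "\<sigma> \<circ> phi C \<circ> collapse r i \<in> T" if "\<sigma> \<in> young \<mu>" for \<sigma>
    using that phi_collapse_T(1)[OF assms(2)] young_M[OF assms(1)] comp_M[of \<sigma>]
    by (auto simp: comp_assoc)
  then show "gen_fun i \<mu> C \<alpha> \<beta> m = 0"
    using n assms reg_mem by (auto simp: gen_fun_def intro!: sum.neutral)
next
  fix \<alpha> \<beta> m \<sigma> assume h: "\<alpha> \<in> \<Lambda>" "\<beta> \<in> \<Lambda>" "m \<in> T" "\<sigma> \<in> young \<alpha>"
  show "gen_fun i \<mu> C \<alpha> \<beta> (\<sigma> \<circ> m) = gen_fun i \<mu> C \<alpha> \<beta> m"
  proof (cases "\<alpha> = \<mu> \<and> \<beta> = reg")
    case True
    let ?c = "1 / of_nat (card (young \<mu>)) :: 'k"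
    have "(\<Sum>\<tau>\<in>young \<mu>. if \<sigma> \<circ> m = \<tau> \<circ> phi C \<circ> collapse r i then ?c else 0)
       = (\<Sum>\<tau>\<in>young \<mu>. if \<sigma> \<circ> m = (\<sigma> \<circ> \<tau>) \<circ> phi C \<circ> collapse r i then ?c else 0)"
      using sum_young_translate[of \<sigma> \<mu> "\<lambda>\<tau>. if \<sigma> \<circ> m = \<tau> \<circ> phi C \<circ> collapse r i then ?c else 0"] h True
      by simp
    also have "\<dots> = (\<Sum>\<tau>\<in>young \<mu>. if m = \<tau> \<circ> phi C \<circ> collapse r i then ?c else 0)"
    proof (intro sum.cong refl)
      fix \<tau>
      have "\<sigma> \<circ> m = (\<sigma> \<circ> \<tau>) \<circ> phi C \<circ> collapse r i \<longleftrightarrow> m = \<tau> \<circ> phi C \<circ> collapse r i"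
        using young_inv_cancel(3)[OF h(4)] by (metis comp_assoc)
      then show "(if \<sigma> \<circ> m = (\<sigma> \<circ> \<tau>) \<circ> phi C \<circ> collapse r i then ?c else 0)
         = (if m = \<tau> \<circ> phi C \<circ> collapse r i then ?c else 0)" by simp
    qed
    finally show ?thesis using True by (simp add: gen_fun_def)
  qed (auto simp: gen_fun_def)
qed (auto simp: gen_fun_def young_reg)

lemma image_comp_young:
  assumes "\<beta> \<in> \<Lambda>" "\<pi> \<in> young \<beta>"
  shows "(m \<circ> \<pi>) ` {1..r} = m ` {1..r}"
proof -
  have "\<pi> ` {1..r} = {1..r}"
    using assms permutes_image[OF young_permutes[OF assms(2)]] by (simp add: compositions_def)
  then show ?thesis by (simp only: image_comp[symmetric])
qed

lemma coord_fun_inv: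
  assumes "C \<in> C_sets i r"
  shows "bi_invariant (coord_fun i \<mu> C y)"
proof (rule bi_invariantI)
  fix \<alpha> \<beta> m assume n: "\<not> (\<alpha> \<in> \<Lambda> \<and> \<beta> \<in> \<Lambda> \<and> m \<in> T)"
  then show "coord_fun i \<mu> C y \<alpha> \<beta> m = 0"
    using reg_mem bi_invariantD(2)[OF mfun_bi_invariant] by (auto simp: coord_fun_def)
next
  fix \<alpha> \<beta> m \<pi> assume h: "\<alpha> \<in> \<Lambda>" "\<beta> \<in> \<Lambda>" "m \<in> T" "\<pi> \<in> young \<beta>"
  then have "m \<circ> \<pi> \<in> T" using young_M comp_M by blast
  moreover have "mfun y \<mu> \<beta> (phi C \<circ> (m \<circ> \<pi>)) = mfun y \<mu> \<beta> (phi C \<circ> m)"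
    using bi_invariant_right[OF mfun_bi_invariant h(4), of y \<mu> "phi C \<circ> m"] by (simp add: comp_assoc)
  ultimately show "coord_fun i \<mu> C y \<alpha> \<beta> (m \<circ> \<pi>) = coord_fun i \<mu> C y \<alpha> \<beta> m"
    using h image_comp_young[of \<beta> \<pi> m] by (simp add: coord_fun_def)
qed (auto simp: coord_fun_def young_reg)

lemma group_fun_inv: "bi_invariant (group_fun i w)"
proof (rule bi_invariantI)
  fix \<alpha> \<beta> m assume n: "\<not> (\<alpha> \<in> \<Lambda> \<and> \<beta> \<in> \<Lambda> \<and> m \<in> T)"
  have "\<sigma> \<circ> collapse r i \<in> T" if "\<sigma> permutes {1..i}" for \<sigma>
    using permutes_full_transf[OF that] i collapse_T comp_M by blast
  then show "group_fun i w \<alpha> \<beta> m = 0"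
    using n reg_mem by (auto simp: group_fun_def intro!: sum.neutral)
qed (auto simp: group_fun_def young_reg)

lemma mconv_gen:
  assumes "\<mu> \<in> \<Lambda>" "C \<in> C_sets i r"
  shows "mconv (gen_fun i \<mu> C \<mu> reg) q m
    = (\<Sum>\<sigma>\<in>young \<mu>. \<Sum>b\<in>T. if \<sigma> \<circ> phi C \<circ> collapse r i \<circ> b = m then q b / of_nat (card (young \<mu>)) else 0)"
proof -
  have "\<sigma> \<circ> phi C \<circ> collapse r i \<in> T" if "\<sigma> \<in> young \<mu>" for \<sigma>
    using that phi_collapse_T(1)[OF assms(2)] young_M[OF assms(1)] comp_M[of \<sigma>]
    by (auto simp: comp_assoc)
  then have "mconv (\<lambda>x. if x = \<sigma> \<circ> phi C \<circ> collapse r i then 1 / of_nat (card (young \<mu>)) else 0) q m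
      = (\<Sum>b\<in>T. if \<sigma> \<circ> phi C \<circ> collapse r i \<circ> b = m then q b / of_nat (card (young \<mu>)) else 0)"
    if "\<sigma> \<in> young \<mu>" for \<sigma>
    using that by (subst mconv_delta_left) (auto intro!: sum.cong)
  then show ?thesis
    by (simp add: gen_fun_def[abs_def] mconv_sum_left)
qed

lemma gen_unit:
  assumes "\<mu> \<in> \<Lambda>" "C \<in> C_sets i r"
  shows "conv (gen_fun i \<mu> C) (unit_fun i) = gen_fun i \<mu> C"
proof (intro ext)
  fix \<alpha> \<beta> m
  have col: "collapse r i \<circ> collapse r i = collapse r i"
    using collapse_comp[OF collapse_T] collapse_image[OF i] by simp
  show "conv (gen_fun i \<mu> C) (unit_fun i) \<alpha> \<beta> m = gen_fun i \<mu> C \<alpha> \<beta> m"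
  proof (cases "\<alpha> = \<mu> \<and> \<beta> = reg")
    case True
    have "conv (gen_fun i \<mu> C) (unit_fun i) \<mu> reg m = mconv (gen_fun i \<mu> C \<mu> reg) (unit_fun i reg reg) m"
      by (rule conv_reg_left) (simp add: gen_fun_def)
    also have "\<dots> = (\<Sum>\<sigma>\<in>young \<mu>. if m = \<sigma> \<circ> phi C \<circ> collapse r i then 1 / of_nat (card (young \<mu>)) else 0)"
      unfolding mconv_gen[OF assms]
    proof (intro sum.cong refl)
      fix \<sigma>
      have "(\<Sum>b\<in>T. if \<sigma> \<circ> phi C \<circ> collapse r i \<circ> b = m then unit_fun i reg reg b / of_nat (card (young \<mu>)) else 0)
          = (\<Sum>b\<in>T. if b = collapse r i then (if \<sigma> \<circ> phi C \<circ> collapse r i \<circ> collapse r i = m then 1 / of_nat (card (young \<mu>)) else 0) else 0)"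
        by (intro sum.cong) (auto simp: unit_fun_def)
      also have "\<dots> = (if m = \<sigma> \<circ> phi C \<circ> collapse r i then 1 / of_nat (card (young \<mu>)) else 0)"
        using finite_M collapse_T by (auto simp: comp_assoc col)
      finally show "(\<Sum>b\<in>T. if \<sigma> \<circ> phi C \<circ> collapse r i \<circ> b = m then unit_fun i reg reg b / of_nat (card (young \<mu>)) else 0) = \<dots>" .
    qed
    finally show ?thesis using True by (simp add: gen_fun_def)
  next
    case False
    have "gen_fun i \<mu> C \<alpha> \<pi> a * unit_fun i \<pi> \<beta> b = 0" for \<pi> a b
      using False by (auto simp: gen_fun_def unit_fun_def)
    then show ?thesis using False by (auto simp: conv_def mconv_def gen_fun_def intro!: sum.neutral)
  qed
qed

lemma unit_coord: "conv (unit_fun i) (coord_fun i \<mu> C y) = coord_fun i \<mu> C y"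
proof (intro ext)
  fix \<alpha> \<beta> m
  show "conv (unit_fun i) (coord_fun i \<mu> C y) \<alpha> \<beta> m = coord_fun i \<mu> C y \<alpha> \<beta> m"
  proof (cases "\<alpha> = reg")
    case True
    have "conv (unit_fun i) (coord_fun i \<mu> C y) reg \<beta> m = mconv (unit_fun i reg reg) (coord_fun i \<mu> C y reg \<beta>) m"
      by (rule conv_reg_left) (simp add: unit_fun_def)
    also have "\<dots> = mconv (\<lambda>x. if x = collapse r i then 1 else 0) (coord_fun i \<mu> C y reg \<beta>) m"
      by (simp add: unit_fun_def[abs_def])
    also have "\<dots> = (\<Sum>b\<in>T. if collapse r i \<circ> b = m then coord_fun i \<mu> C y reg \<beta> b else 0)"
      by (simp add: mconv_delta_left[OF collapse_T] cong: if_cong)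
    also have "\<dots> = (\<Sum>b\<in>T. if b = m then coord_fun i \<mu> C y reg \<beta> b else 0)"
    proof (intro sum.cong refl)
      fix b assume b: "b \<in> T"
      show "(if collapse r i \<circ> b = m then coord_fun i \<mu> C y reg \<beta> b else 0) = (if b = m then coord_fun i \<mu> C y reg \<beta> b else 0)"
      proof (cases "b ` {1..r} = {1..i}")
        case True
        then show ?thesis using collapse_comp[OF b, of i] by simp
      next
        case False
        then have "coord_fun i \<mu> C y reg \<beta> b = 0" by (simp add: coord_fun_def)
        then show ?thesis by auto
      qed
    qed
    also have "\<dots> = coord_fun i \<mu> C y reg \<beta> m" using finite_M by (simp add: coord_fun_def)
    finally show ?thesis using True by simp
  next
    case False
    then have "unit_fun i \<alpha> \<pi> a = 0" for \<pi> a by (simp add: unit_fun_def)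
    then show ?thesis using False by (auto simp: conv_def mconv_def coord_fun_def intro!: sum.neutral)
  qed
qed

text \<open>The idempotent \<open>collapse\<close> fixes \<open>{1..i}\<close>, so the maps \<open>\<sigma> \<circ> collapse r i\<close> multiply like the
  permutations \<open>\<sigma>\<close>.\<close>

lemma mconv_group:
  fixes w h :: "transf \<Rightarrow> 'k"
  shows "mconv (group_fun i w reg reg) (group_fun i h reg reg) m
    = group_fun i (grp_conv {\<sigma>. \<sigma> permutes {1..i}} w h) reg reg m"
proof -
  let ?G = "{\<sigma>. \<sigma> permutes {1..i}}" and ?e = "collapse r i"
  have G_T: "\<sigma> \<circ> ?e \<in> T" if "\<sigma> \<in> ?G" for \<sigma>
    using permutes_full_transf[of \<sigma> i r] that i collapse_T comp_M by blast
  have absorb: "\<sigma> \<circ> ?e \<circ> (\<tau> \<circ> ?e) = \<sigma> \<circ> \<tau> \<circ> ?e" if "\<tau> \<in> ?G" for \<sigma> \<tau> :: transf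
  proof -
    have "(\<tau> \<circ> ?e) ` {1..r} = {1..i}"
      using that collapse_image[OF i] permutes_image[of \<tau> "{1..i}"] by (simp only: image_comp[symmetric]) simp
    then have "?e \<circ> (\<tau> \<circ> ?e) = \<tau> \<circ> ?e" using collapse_comp[OF G_T[OF that], of i] by blast
    then show ?thesis by (metis comp_assoc)
  qed
  have "mconv (group_fun i w reg reg) (group_fun i h reg reg) m
     = (\<Sum>\<sigma>\<in>?G. \<Sum>\<tau>\<in>?G. mconv (\<lambda>x. if x = \<sigma> \<circ> ?e then w \<sigma> else 0) (\<lambda>x. if x = \<tau> \<circ> ?e then h \<tau> else 0) m)"
    by (simp add: group_fun_def[abs_def] mconv_sum_left mconv_sum_right)
  also have "\<dots> = (\<Sum>\<sigma>\<in>?G. \<Sum>\<tau>\<in>?G. if \<sigma> \<circ> \<tau> \<circ> ?e = m then w \<sigma> * h \<tau> else 0)"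
    by (intro sum.cong refl) (simp only: mconv_delta_delta[OF G_T G_T] absorb)
  also have "\<dots> = (\<Sum>\<sigma>\<in>?G. \<Sum>\<rho>\<in>?G. if \<rho> \<circ> ?e = m then w \<sigma> * h (pinv \<sigma> \<circ> \<rho>) else 0)"
  proof (rule sum.cong[OF refl])
    fix \<sigma> assume s: "\<sigma> \<in> ?G"
    then have "(\<Sum>\<rho>\<in>?G. if \<rho> \<circ> ?e = m then w \<sigma> * h (pinv \<sigma> \<circ> \<rho>) else 0)
        = (\<Sum>\<tau>\<in>?G. if \<sigma> \<circ> \<tau> \<circ> ?e = m then w \<sigma> * h (pinv \<sigma> \<circ> (\<sigma> \<circ> \<tau>)) else 0)"
      using sum_permutes_translate[of \<sigma> "{1..i}" "\<lambda>\<rho>. if \<rho> \<circ> ?e = m then w \<sigma> * h (pinv \<sigma> \<circ> \<rho>) else 0"]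
      by simp
    moreover have "pinv \<sigma> \<circ> (\<sigma> \<circ> \<tau>) = \<tau>" for \<tau> :: transf using s permutes_inv_o(2)[of \<sigma> "{1..i}"]
      by (simp only: o_assoc mem_Collect_eq id_comp)
    ultimately show "(\<Sum>\<tau>\<in>?G. if \<sigma> \<circ> \<tau> \<circ> ?e = m then w \<sigma> * h \<tau> else 0)
        = (\<Sum>\<rho>\<in>?G. if \<rho> \<circ> ?e = m then w \<sigma> * h (pinv \<sigma> \<circ> \<rho>) else 0)" by (simp cong: if_cong)
  qed
  also have "\<dots> = (\<Sum>\<rho>\<in>?G. \<Sum>\<sigma>\<in>?G. if \<rho> \<circ> ?e = m then w \<sigma> * h (pinv \<sigma> \<circ> \<rho>) else 0)"
    by (rule sum.swap)
  also have "\<dots> = group_fun i (grp_conv ?G w h) reg reg m"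
    by (auto simp: group_fun_def grp_conv_def intro!: sum.cong)
  finally show ?thesis .
qed

lemma group_fun_cong:
  "(\<And>\<sigma>. \<sigma> permutes {1..i} \<Longrightarrow> w \<sigma> = w' \<sigma>) \<Longrightarrow> group_fun i w = group_fun i w'"
  by (auto simp: group_fun_def fun_eq_iff intro!: sum.cong)

text \<open>Modulo smaller rank, \<open>e A e\<close> is the group algebra of the symmetric group on \<open>{1..i}\<close>: with \<open>e\<close> for
  \<open>collapse r i\<close>, a map \<open>e \<circ> a \<circ> e\<close> of rank \<open>i\<close> permutes \<open>{1..i}\<close> and is determined by this permutation.\<close>

lemma corner_group_fun:
  assumes E: "E = conv (conv (unit_fun i) F) (unit_fun i)" and m: "i \<le> rank r m"
  shows "E reg reg m = group_fun i (\<lambda>\<sigma>. E reg reg (\<sigma> \<circ> collapse r i)) reg reg m"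
proof -
  let ?G = "{\<sigma>. \<sigma> permutes {1..i}}" and ?e = "collapse r i"
  have inj: "\<sigma> = \<tau>" if "\<sigma> \<in> ?G" "\<tau> \<in> ?G" "\<sigma> \<circ> ?e = \<tau> \<circ> ?e" for \<sigma> \<tau>
  proof
    fix x show "\<sigma> x = \<tau> x"
    proof (cases "x \<in> {1..i}")
      case True
      then have "?e x = x" using i by (auto simp: collapse_def)
      then show ?thesis using that(3) by (metis comp_apply)
    next
      case False
      then show ?thesis using that(1,2) by (simp add: permutes_def)
    qed
  qed
  have finG: "finite ?G" by (simp add: finite_permutations)
  have ev: "E reg reg m = (\<Sum>a\<in>T. \<Sum>c\<in>T. if ?e \<circ> a = c \<and> c \<circ> ?e = m then F reg reg a else 0)"
  proof -
    have 1: "conv (unit_fun i) F reg reg c = (\<Sum>a\<in>T. if ?e \<circ> a = c then F reg reg a else 0)" for c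
    proof -
      have "conv (unit_fun i) F reg reg c = mconv (unit_fun i reg reg) (F reg reg) c"
        by (rule conv_reg_left) (simp add: unit_fun_def)
      also have "\<dots> = mconv (\<lambda>x. if x = ?e then 1 else 0) (F reg reg) c" by (simp add: unit_fun_def[abs_def])
      finally show ?thesis by (simp add: mconv_delta_left[OF collapse_T] cong: if_cong)
    qed
    have "E reg reg m = mconv (conv (unit_fun i) F reg reg) (unit_fun i reg reg) m"
      unfolding E by (rule conv_reg_right) (simp add: unit_fun_def)
    also have "\<dots> = (\<Sum>c\<in>T. \<Sum>b\<in>T. if b = ?e then (if c \<circ> ?e = m then conv (unit_fun i) F reg reg c else 0) else 0)"
      unfolding mconv_def by (intro sum.cong refl) (auto simp: unit_fun_def)
    also have "\<dots> = (\<Sum>c\<in>T. if c \<circ> ?e = m then conv (unit_fun i) F reg reg c else 0)"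
      using collapse_T finite_M by simp
    also have "\<dots> = (\<Sum>c\<in>T. \<Sum>a\<in>T. if ?e \<circ> a = c \<and> c \<circ> ?e = m then F reg reg a else 0)"
      by (intro sum.cong refl) (auto simp: 1 intro!: sum.cong)
    finally show ?thesis by (subst sum.swap) simp
  qed
  have "E reg reg m = 0 \<or> (\<exists>\<sigma>\<in>?G. m = \<sigma> \<circ> ?e)"
  proof (rule disjCI)
    assume no: "\<not> (\<exists>\<sigma>\<in>?G. m = \<sigma> \<circ> ?e)"
    have "?e \<circ> a \<circ> ?e \<noteq> m" if a: "a \<in> T" for a
    proof
      assume eq: "?e \<circ> a \<circ> ?e = m"
      define \<sigma> where "\<sigma> x = (if x \<in> {1..i} then m x else x)" for x
      have me: "m x = m (?e x)" for x
      proof -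
        have "?e (?e x) = ?e x" using i by (auto simp: collapse_def)
        then show ?thesis using eq by (metis comp_apply)
      qed
      have mT: "m \<in> T" using eq a collapse_T comp_M by blast
      have "m ` {1..r} \<subseteq> {1..i}"
      proof -
        have "(a \<circ> ?e) ` {1..r} \<subseteq> {1..r}" using a collapse_T comp_M by (intro full_transf_image) blast
        then have "?e ` ((a \<circ> ?e) ` {1..r}) \<subseteq> ?e ` {1..r}" by (rule image_mono)
        then show ?thesis using collapse_image[OF i] eq by (simp only: image_comp o_assoc)
      qed
      moreover have "card (m ` {1..r}) \<ge> card {1..i}" using m by (simp add: rank_def)
      ultimately have im: "m ` {1..r} = {1..i}" by (intro card_seteq) auto
      have "m ` {1..r} = m ` {1..i}"
      proof -
        have "m ` {1..r} = m ` (?e ` {1..r})" unfolding image_image using me by (intro image_cong) auto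
        then show ?thesis using collapse_image[OF i] by simp
      qed
      then have im2: "m ` {1..i} = {1..i}" using im by simp
      have "\<sigma> permutes {1..i}"
      proof (rule bij_imp_permutes)
        have "card (m ` {1..i}) = card {1..i}" using im2 by (rule arg_cong)
        then have "inj_on m {1..i}" by (rule eq_card_imp_inj_on[rotated]) simp
        then have "bij_betw m {1..i} {1..i}" using im2 by (simp add: bij_betw_def)
        then show "bij_betw \<sigma> {1..i} {1..i}"
          by (rule bij_betw_cong[THEN iffD1, rotated]) (simp add: \<sigma>_def)
      qed (simp only: \<sigma>_def if_False)
      moreover have "m = \<sigma> \<circ> ?e"
      proof
        fix x
        have "?e x \<in> {1..i} \<or> ?e x \<notin> {1..r}" using i by (auto simp: collapse_def)
        moreover have "m y = y" if "y \<notin> {1..r}" for y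
          using mT that by (cases "y = 0") (auto simp: full_transf_iff)
        moreover have "y \<notin> {1..i}" if "y \<notin> {1..r}" for y using that i by auto
        ultimately show "m x = (\<sigma> \<circ> ?e) x" using me[of x] by (auto simp: \<sigma>_def)
      qed
      ultimately show False using no by blast
    qed
    then have "\<not> (?e \<circ> a = c \<and> c \<circ> ?e = m)" if "a \<in> T" for a c using that by blast
    then show "E reg reg m = 0" unfolding ev by (intro sum.neutral ballI) (simp only: if_False)
  qed
  then show ?thesis
  proof
    assume z: "E reg reg m = 0"
    have "group_fun i (\<lambda>\<sigma>. E reg reg (\<sigma> \<circ> ?e)) reg reg m = 0"
      using z by (auto simp: group_fun_def intro!: sum.neutral)
    then show ?thesis using z by simp
  next
    assume "\<exists>\<sigma>\<in>?G. m = \<sigma> \<circ> ?e"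
    then obtain \<sigma> where s: "\<sigma> \<in> ?G" "m = \<sigma> \<circ> ?e" by blast
    have "group_fun i (\<lambda>\<sigma>. E reg reg (\<sigma> \<circ> ?e)) reg reg m = (\<Sum>\<tau>\<in>?G. if \<tau> = \<sigma> then E reg reg (\<sigma> \<circ> ?e) else 0)"
      unfolding group_fun_def using s inj by (auto intro!: sum.cong)
    then show ?thesis using s finG by simp
  qed
qed

text \<open>Regularity is inherited from the group algebra, since \<open>corner_group_fun\<close> identifies \<open>e z e\<close> with an
  element of it up to terms of smaller rank.\<close>

lemma corner_regular:
  assumes z: "z \<in> carrier A"
  defines "e \<equiv> of_mfun (unit_fun i)"
  shows "\<exists>h\<in>carrier A. (e \<otimes>\<^bsub>A\<^esub> z \<otimes>\<^bsub>A\<^esub> e) \<otimes>\<^bsub>A\<^esub> h \<otimes>\<^bsub>A\<^esub> (e \<otimes>\<^bsub>A\<^esub> z \<otimes>\<^bsub>A\<^esub> e) \<ominus>\<^bsub>A\<^esub> e \<otimes>\<^bsub>A\<^esub> z \<otimes>\<^bsub>A\<^esub> e \<in> rank_ideal (i - 1)"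
proof -
  define x where "x = e \<otimes>\<^bsub>A\<^esub> z \<otimes>\<^bsub>A\<^esub> e"
  have xc: "x \<in> carrier A" unfolding x_def by (rule mult_carrier)
  define E where "E = mfun x"
  have E: "E = conv (conv (unit_fun i) (mfun z)) (unit_fun i)"
    by (simp add: E_def x_def e_def mfun_mult mfun_of_mfun unit_fun_inv)
  have E0: "E \<alpha> \<beta> m = 0" if "\<not> (\<alpha> = reg \<and> \<beta> = reg)" for \<alpha> \<beta> m
  proof -
    have "conv (unit_fun i) (mfun z) \<alpha> \<pi> a = 0" if "\<alpha> \<noteq> reg" for \<pi> a
      using that by (auto simp: conv_def mconv_def unit_fun_def intro!: sum.neutral)
    then show ?thesis using that unfolding E
      by (auto simp: conv_def[of _ "unit_fun i"] mconv_def unit_fun_def intro!: sum.neutral)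
  qed
  define w where "w \<sigma> = E reg reg (\<sigma> \<circ> collapse r i)" for \<sigma>
  let ?G = "{\<sigma>. \<sigma> permutes {1..i}}"
  obtain h where h: "\<And>\<sigma>. \<sigma> \<in> ?G \<Longrightarrow> grp_conv ?G (grp_conv ?G w h) w \<sigma> = w \<sigma>"
    using group_algebra_regular[of "{1..i}" w] by auto
  define y where "y = of_mfun (group_fun i h)"
  have yc: "y \<in> carrier A" unfolding y_def by (rule of_mfun_carrier)
  have my: "mfun y = group_fun i h" by (simp add: y_def mfun_of_mfun group_fun_inv)
  have Ew: "E reg reg m = group_fun i w reg reg m" if "i \<le> rank r m" for m
    using corner_group_fun[OF E that] by (simp add: w_def[abs_def])
  have "mfun (x \<otimes>\<^bsub>A\<^esub> y \<otimes>\<^bsub>A\<^esub> x) \<alpha> \<beta> m = E \<alpha> \<beta> m" if m: "i \<le> rank r m" for \<alpha> \<beta> m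
  proof (cases "\<alpha> = reg \<and> \<beta> = reg")
    case True
    have 1: "conv E (group_fun i h) reg reg a = mconv (E reg reg) (group_fun i h reg reg) a" for a
      by (rule conv_reg_left) (simp add: E0)
    have "mfun (x \<otimes>\<^bsub>A\<^esub> y \<otimes>\<^bsub>A\<^esub> x) reg reg m = conv (conv E (group_fun i h)) E reg reg m"
      by (simp add: mfun_mult my E_def)
    also have "\<dots> = mconv (conv E (group_fun i h) reg reg) (E reg reg) m"
      by (rule conv_reg_right) (simp add: E0)
    also have "\<dots> = mconv (group_fun i (grp_conv ?G w h) reg reg) (group_fun i w reg reg) m"
    proof (rule mconv_cong_rank[OF _ _ m])
      fix a assume a: "i \<le> rank r a"
      show "conv E (group_fun i h) reg reg a = group_fun i (grp_conv ?G w h) reg reg a"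
        unfolding 1 mconv_group[symmetric] by (rule mconv_cong_rank[OF _ _ a]) (auto simp: Ew)
    qed (auto simp: Ew)
    also have "\<dots> = group_fun i (grp_conv ?G (grp_conv ?G w h) w) reg reg m" by (rule mconv_group)
    also have "\<dots> = group_fun i w reg reg m"
      using group_fun_cong[of "grp_conv ?G (grp_conv ?G w h) w" w] h by simp
    finally show ?thesis using True Ew[OF m] by simp
  next
    case False
    have "conv E (mfun y) \<alpha> \<pi> a = 0" if "\<alpha> \<noteq> reg" for \<pi> a
      using that by (auto simp: conv_def mconv_def E0 intro!: sum.neutral)
    then show ?thesis using False
      by (auto simp: mfun_mult E_def[symmetric] conv_def[of _ E] mconv_def E0 intro!: sum.neutral)
  qed
  then have "x \<otimes>\<^bsub>A\<^esub> y \<otimes>\<^bsub>A\<^esub> x \<ominus>\<^bsub>A\<^esub> x \<in> rank_ideal (i - 1)"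
    using i xc by (auto simp: rank_ideal_def mfun_diff mult_carrier E_def)
  then show ?thesis using yc unfolding x_def by blast
qed

text \<open>For each \<open>\<sigma>\<close> in the Young subgroup exactly one \<open>C\<close> contributes, namely the image of \<open>\<sigma>\<^sup>-\<^sup>1 \<circ> m\<close>, and by
  invariance it contributes the value of \<open>y\<close> at \<open>m\<close>, which the generator then averages.\<close>

lemma gen_coord_sum:
  assumes y: "y \<in> rank_ideal i" and m: "m \<in> T" "i \<le> rank r m" and \<mu>: "\<mu> \<in> \<Lambda>"
  shows "(\<Sum>C\<in>C_sets i r. conv (gen_fun i \<mu> C) (coord_fun i \<mu> C y) \<mu> \<nu> m) = mfun y \<mu> \<nu> m"
proof (cases "rank r m = i")
  case False
  then have gt: "i < rank r m" using m by simp
  have "conv (gen_fun i \<mu> C) (coord_fun i \<mu> C y) \<mu> \<nu> m = 0" for C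
    unfolding conv_def
  proof (intro sum.neutral ballI mconv_rank_zero[OF _ gt] disjI2 impI)
    fix \<pi> b assume "b \<in> T" "i < rank r b"
    then show "coord_fun i \<mu> C y \<pi> \<nu> b = 0" by (auto simp: coord_fun_def rank_def)
  qed
  then show ?thesis using y gt by (simp add: rank_ideal_def)
next
  case True
  let ?Y = "mfun y \<mu> \<nu>" and ?N = "of_nat (card (young \<mu>)) :: 'k"
  have N: "?N \<noteq> 0" using card_young_pos[of \<mu>] by simp
  have fC: "finite (C_sets i r)" by (rule finite_subset[of _ "Pow {1..r}"]) (auto simp: C_sets_def)
  have "conv (gen_fun i \<mu> C) (coord_fun i \<mu> C y) \<mu> \<nu> m
      = (\<Sum>\<sigma>\<in>young \<mu>. if (pinv \<sigma> \<circ> m) ` {1..r} = C then ?Y m / ?N else 0)"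
    if C: "C \<in> C_sets i r" for C
  proof -
    have "conv (gen_fun i \<mu> C) (coord_fun i \<mu> C y) \<mu> \<nu> m
        = mconv (gen_fun i \<mu> C \<mu> reg) (coord_fun i \<mu> C y reg \<nu>) m"
      by (rule conv_reg_left) (simp add: gen_fun_def)
    also have "\<dots> = (\<Sum>\<sigma>\<in>young \<mu>. \<Sum>b\<in>T. if \<sigma> \<circ> phi C \<circ> collapse r i \<circ> b = m
        then coord_fun i \<mu> C y reg \<nu> b / ?N else 0)" by (rule mconv_gen[OF \<mu> C])
    also have "\<dots> = (\<Sum>\<sigma>\<in>young \<mu>. if (pinv \<sigma> \<circ> m) ` {1..r} = C then ?Y m / ?N else 0)"
    proof (intro sum.cong refl)
      fix \<sigma> assume s: "\<sigma> \<in> young \<mu>"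
      let ?B = "{b \<in> T. b ` {1..r} = {1..i}}"
      have sm: "pinv \<sigma> \<circ> m \<in> T" using young_inv[OF s] young_M[OF \<mu>] m(1) comp_M by blast
      have Ym: "?Y (pinv \<sigma> \<circ> m) = ?Y m" by (rule bi_invariant_left[OF mfun_bi_invariant young_inv[OF s]])
      have bij: "bij_betw (\<lambda>b. phi C \<circ> b) ?B {m \<in> T. m ` {1..r} = C}" by (rule phi_comp_bij[OF C])
      have "(\<Sum>b\<in>T. if \<sigma> \<circ> phi C \<circ> collapse r i \<circ> b = m then coord_fun i \<mu> C y reg \<nu> b / ?N else 0)
          = (\<Sum>b\<in>?B. if phi C \<circ> b = pinv \<sigma> \<circ> m then ?Y m / ?N else 0)"
      proof (rule sum.mono_neutral_cong_right)
        show "\<forall>b\<in>T - ?B. (if \<sigma> \<circ> phi C \<circ> collapse r i \<circ> b = m then coord_fun i \<mu> C y reg \<nu> b / ?N else 0) = 0"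
          by (auto simp: coord_fun_def)
        fix b assume b: "b \<in> ?B"
        then have eb: "collapse r i \<circ> b = b" using collapse_comp[of b r i] by auto
        have "\<sigma> \<circ> phi C \<circ> collapse r i \<circ> b = \<sigma> \<circ> (phi C \<circ> b)" by (simp only: comp_assoc eb)
        then have "\<sigma> \<circ> phi C \<circ> collapse r i \<circ> b = m \<longleftrightarrow> phi C \<circ> b = pinv \<sigma> \<circ> m"
          using young_inv_cancel(3,4)[OF s] by metis
        then show "(if \<sigma> \<circ> phi C \<circ> collapse r i \<circ> b = m then coord_fun i \<mu> C y reg \<nu> b / ?N else 0)
            = (if phi C \<circ> b = pinv \<sigma> \<circ> m then ?Y m / ?N else 0)"
          using b Ym by (auto simp: coord_fun_def)
      qed (use finite_M in auto)
      also have "\<dots> = (\<Sum>m'\<in>{m \<in> T. m ` {1..r} = C}. if m' = pinv \<sigma> \<circ> m then ?Y m / ?N else 0)"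
        using sum.reindex_bij_betw[OF bij, of "\<lambda>m'. if m' = pinv \<sigma> \<circ> m then ?Y m / ?N else 0"] by simp
      also have "\<dots> = (if (pinv \<sigma> \<circ> m) ` {1..r} = C then ?Y m / ?N else 0)"
        using finite_M sm by simp
      finally show "(\<Sum>b\<in>T. if \<sigma> \<circ> phi C \<circ> collapse r i \<circ> b = m then coord_fun i \<mu> C y reg \<nu> b / ?N else 0)
          = (if (pinv \<sigma> \<circ> m) ` {1..r} = C then ?Y m / ?N else 0)" .
    qed
    finally show ?thesis .
  qed
  then have "(\<Sum>C\<in>C_sets i r. conv (gen_fun i \<mu> C) (coord_fun i \<mu> C y) \<mu> \<nu> m)
      = (\<Sum>\<sigma>\<in>young \<mu>. \<Sum>C\<in>C_sets i r. if (pinv \<sigma> \<circ> m) ` {1..r} = C then ?Y m / ?N else 0)"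
    by (simp add: sum.swap[of _ "young \<mu>"])
  also have "\<dots> = (\<Sum>\<sigma>\<in>young \<mu>. ?Y m / ?N)"
  proof (intro sum.cong refl)
    fix \<sigma> assume s: "\<sigma> \<in> young \<mu>"
    have sm: "pinv \<sigma> \<circ> m \<in> T" using young_inv[OF s] young_M[OF \<mu>] m(1) comp_M by blast
    have "inj (pinv \<sigma>)" using young_permutes[OF young_inv[OF s]] by (rule permutes_inj)
    then have "card ((pinv \<sigma> \<circ> m) ` {1..r}) = card (m ` {1..r})"
      unfolding image_comp[symmetric] by (intro card_image) (auto intro: inj_on_subset)
    then have "(pinv \<sigma> \<circ> m) ` {1..r} \<in> C_sets i r"
      using True full_transf_image[OF sm] by (simp add: C_sets_def rank_def)
    then show "(\<Sum>C\<in>C_sets i r. if (pinv \<sigma> \<circ> m) ` {1..r} = C then ?Y m / ?N else 0) = ?Y m / ?N"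
      using fC by simp
  qed
  also have "\<dots> = ?Y m" using N by simp
  finally show ?thesis .
qed

text \<open>If \<open>p\<close> has rank at most \<open>i\<close> and \<open>p \<circ> q = phi C \<circ> m\<close> has image \<open>C\<close>, then \<open>p\<close> has image \<open>C\<close> as well.
  Hence \<open>p\<close> factors through \<open>phi C\<close>, which can be cancelled.\<close>

lemma coord_fun_mult:
  assumes y: "y \<in> rank_ideal i" and C: "C \<in> C_sets i r" and m: "i \<le> rank r m"
  shows "coord_fun i \<mu> C (y \<otimes>\<^bsub>A\<^esub> a) \<alpha> \<beta> m = conv (coord_fun i \<mu> C y) (mfun a) \<alpha> \<beta> m"
proof (cases "\<alpha> = reg \<and> m \<in> T \<and> m ` {1..r} = {1..i}")
  case False
  have "(if p \<circ> q = m then coord_fun i \<mu> C y \<alpha> \<pi> p * mfun a \<pi> \<beta> q else 0) = 0"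
    if pq: "p \<in> T" "q \<in> T" for \<pi> p q
  proof (rule ccontr)
    assume "\<not> ?thesis"
    then have eq: "p \<circ> q = m" and p: "\<alpha> = reg" "p ` {1..r} = {1..i}"
      by (auto simp: coord_fun_def split: if_splits)
    have "m \<in> T" using eq pq comp_M by blast
    have "m ` {1..r} \<subseteq> {1..i}"
      using full_transf_image[OF pq(2)] p(2) unfolding eq[symmetric] image_comp[symmetric] by blast
    moreover have "card {1..i} \<le> card (m ` {1..r})" using m by (simp add: rank_def)
    ultimately have "m ` {1..r} = {1..i}" by (intro card_seteq) auto
    then show False using False p(1) \<open>m \<in> T\<close> by simp
  qed
  then show ?thesis using False by (auto simp: conv_def mconv_def coord_fun_def intro!: sum.neutral)
next
  case True
  have Cr: "card C = i" and fC: "finite C" using C finite_subset by (auto simp: C_sets_def)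
  let ?B = "{b \<in> T. b ` {1..r} = {1..i}}"
  have bij: "bij_betw (\<lambda>b. phi C \<circ> b) ?B {m \<in> T. m ` {1..r} = C}" by (rule phi_comp_bij[OF C])
  have pm: "(phi C \<circ> m) ` {1..r} = C" using bij_betwE[OF bij] True by blast
  have "mconv (mfun y \<mu> \<pi>) (mfun a \<pi> \<beta>) (phi C \<circ> m) = mconv (coord_fun i \<mu> C y reg \<pi>) (mfun a \<pi> \<beta>) m" for \<pi>
  proof -
    let ?h = "\<lambda>p. \<Sum>q\<in>T. if p \<circ> q = phi C \<circ> m then mfun y \<mu> \<pi> p * mfun a \<pi> \<beta> q else 0"
    have "mconv (mfun y \<mu> \<pi>) (mfun a \<pi> \<beta>) (phi C \<circ> m) = (\<Sum>p\<in>{p \<in> T. p ` {1..r} = C}. ?h p)"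
      unfolding mconv_def
    proof (rule sum.mono_neutral_right)
      show "\<forall>p\<in>T - {p \<in> T. p ` {1..r} = C}. ?h p = 0"
      proof (intro ballI sum.neutral)
        fix p q assume p: "p \<in> T - {p \<in> T. p ` {1..r} = C}" and q: "q \<in> T"
        show "(if p \<circ> q = phi C \<circ> m then mfun y \<mu> \<pi> p * mfun a \<pi> \<beta> q else 0) = 0"
        proof (rule ccontr)
          assume "\<not> ?thesis"
          then have eq: "p \<circ> q = phi C \<circ> m" and yp: "mfun y \<mu> \<pi> p \<noteq> 0" by (auto split: if_splits)
          have "C \<subseteq> p ` {1..r}"
            using full_transf_image[OF q] pm unfolding eq[symmetric] image_comp[symmetric] by blast
          moreover have "card (p ` {1..r}) \<le> card C"
            using y yp Cr by (auto simp: rank_ideal_def rank_def not_less[symmetric])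
          ultimately have "C = p ` {1..r}" by (intro card_seteq) auto
          then show False using p by auto
        qed
      qed
    qed (use finite_M in auto)
    also have "\<dots> = (\<Sum>b\<in>?B. ?h (phi C \<circ> b))"
      by (rule sum.reindex_bij_betw[OF bij, symmetric])
    also have "\<dots> = (\<Sum>b\<in>?B. \<Sum>q\<in>T. if b \<circ> q = m then coord_fun i \<mu> C y reg \<pi> b * mfun a \<pi> \<beta> q else 0)"
    proof (intro sum.cong refl)
      fix b q assume b: "b \<in> ?B" and q: "q \<in> T"
      have bq: "b \<circ> q \<in> T" using b q comp_M by blast
      have "(b \<circ> q) ` {1..r} \<subseteq> {1..i}"
        using full_transf_image[OF q] b unfolding image_comp[symmetric] by blast
      then have "phi C \<circ> b \<circ> q = phi C \<circ> m \<longleftrightarrow> b \<circ> q = m"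
        using phi_comp_inj[OF fC bq, of m] True Cr by (auto simp only: comp_assoc)
      then show "(if phi C \<circ> b \<circ> q = phi C \<circ> m then mfun y \<mu> \<pi> (phi C \<circ> b) * mfun a \<pi> \<beta> q else 0)
          = (if b \<circ> q = m then coord_fun i \<mu> C y reg \<pi> b * mfun a \<pi> \<beta> q else 0)"
        using b by (auto simp: coord_fun_def)
    qed
    also have "\<dots> = mconv (coord_fun i \<mu> C y reg \<pi>) (mfun a \<pi> \<beta>) m"
      unfolding mconv_def
    proof (rule sum.mono_neutral_left)
      show "\<forall>b\<in>T - ?B. (\<Sum>q\<in>T. if b \<circ> q = m then coord_fun i \<mu> C y reg \<pi> b * mfun a \<pi> \<beta> q else 0) = 0"
      proof (intro ballI sum.neutral)
        fix b q assume "b \<in> T - ?B"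
        then have "b ` {1..r} \<noteq> {1..i}" by blast
        then have "coord_fun i \<mu> C y reg \<pi> b = 0" by (simp only: coord_fun_def if_False simp_thms)
        then show "(if b \<circ> q = m then coord_fun i \<mu> C y reg \<pi> b * mfun a \<pi> \<beta> q else 0) = 0" by simp
      qed
    qed (use finite_M in auto)
    finally show ?thesis .
  qed
  then show ?thesis using True by (simp add: coord_fun_def mfun_mult conv_def)
qed

text \<open>The coordinates are right linear and dual to the generators only up to maps of rank below \<open>i\<close>, which is
  why the criterion is applied to the quotient.\<close>

lemma heredity_layer:
  "heredity_ideal (A Quot rank_ideal (i - 1)) ((\<lambda>x. rank_ideal (i - 1) +>\<^bsub>A\<^esub> x) ` rank_ideal i)"
proof (rule alg.heredity_ideal_quotient[where K = "\<Lambda> \<times> C_sets i r" and e = "of_mfun (unit_fun i)"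
      and x = "\<lambda>(\<mu>, C). of_mfun (gen_fun i \<mu> C)" and f = "\<lambda>(\<mu>, C) y. of_mfun (coord_fun i \<mu> C y)"])
  show "ideal (rank_ideal (i - 1)) A" "ideal (rank_ideal i) A" by (rule rank_ideal_is_ideal)+
  show "rank_ideal (i - 1) \<subseteq> rank_ideal i" by (auto simp: rank_ideal_def)
  have fC: "finite (C_sets i r)" by (rule finite_subset[of _ "Pow {1..r}"]) (auto simp: C_sets_def)
  then show fK: "finite (\<Lambda> \<times> C_sets i r)" using finite_compositions by simp
  have Y: "y \<in> carrier A" if "y \<in> rank_ideal i" for y using that by (simp add: rank_ideal_def)
  note mf = mfun_of_mfun[OF coord_fun_inv] mfun_of_mfun[OF gen_fun_inv] mfun_of_mfun[OF unit_fun_inv]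
  show "(case k of (\<mu>, C) \<Rightarrow> of_mfun (gen_fun i \<mu> C)) \<in> rank_ideal i" if "k \<in> \<Lambda> \<times> C_sets i r" for k
  proof -
    from that obtain \<mu> C where k: "k = (\<mu>, C)" "\<mu> \<in> \<Lambda>" "C \<in> C_sets i r" by blast
    have "rank r (\<sigma> \<circ> phi C \<circ> collapse r i) \<le> i" for \<sigma>
      using rank_comp_right[of r \<sigma> "phi C \<circ> collapse r i"] phi_collapse_T(2)[OF k(3)] k(3)
      by (simp add: rank_def comp_assoc C_sets_def)
    then have "gen_fun i \<mu> C \<alpha> \<beta> m = 0" if "i < rank r m" for \<alpha> \<beta> m
      using that by (auto simp: gen_fun_def not_le[symmetric] intro!: sum.neutral)
    then show ?thesis using k by (simp add: rank_ideal_def of_mfun_carrier mf)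
  qed
  show "(case k of (\<mu>, C) \<Rightarrow> \<lambda>y. of_mfun (coord_fun i \<mu> C y)) y \<in> rank_ideal i" if "k \<in> \<Lambda> \<times> C_sets i r" for k y
    using that by (auto simp: rank_ideal_def of_mfun_carrier mf coord_fun_def rank_def split: prod.splits)
  show "(case k of (\<mu>, C) \<Rightarrow> \<lambda>y. of_mfun (coord_fun i \<mu> C y)) y \<in> rank_ideal (i - 1)"
    if "k \<in> \<Lambda> \<times> C_sets i r" "y \<in> rank_ideal (i - 1)" for k y
  proof -
    from that obtain \<mu> C where k: "k = (\<mu>, C)" "\<mu> \<in> \<Lambda>" "C \<in> C_sets i r" by blast
    have "mfun y \<mu> \<beta> (phi C \<circ> m) = 0" if "m \<in> T" "m ` {1..r} = {1..i}" for m \<beta>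
    proof -
      have "(phi C \<circ> m) ` {1..r} = C" using bij_betwE[OF phi_comp_bij[OF k(3)]] that by blast
      then have "rank r (phi C \<circ> m) = i" using k by (simp add: rank_def C_sets_def)
      then show ?thesis using \<open>y \<in> rank_ideal (i - 1)\<close> i by (simp add: rank_ideal_def)
    qed
    then have "coord_fun i \<mu> C y \<alpha> \<beta> m = 0" for \<alpha> \<beta> m by (auto simp: coord_fun_def)
    then show ?thesis using k by (simp add: rank_ideal_def of_mfun_carrier mf)
  qed
  show "(case k of (\<mu>, C) \<Rightarrow> \<lambda>y. of_mfun (coord_fun i \<mu> C y)) (y \<oplus>\<^bsub>A\<^esub> y')
      = (case k of (\<mu>, C) \<Rightarrow> \<lambda>y. of_mfun (coord_fun i \<mu> C y)) y \<oplus>\<^bsub>A\<^esub> (case k of (\<mu>, C) \<Rightarrow> \<lambda>y. of_mfun (coord_fun i \<mu> C y)) y'"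
    if "k \<in> \<Lambda> \<times> C_sets i r" for k y y'
    using that
    by (clarsimp split: prod.splits, intro mfun_inject of_mfun_carrier add_carrier ext)
      (simp add: mf mfun_add coord_fun_def)
  show "(case k of (\<mu>, C) \<Rightarrow> \<lambda>y. of_mfun (coord_fun i \<mu> C y)) (y \<otimes>\<^bsub>A\<^esub> a)
      \<ominus>\<^bsub>A\<^esub> (case k of (\<mu>, C) \<Rightarrow> \<lambda>y. of_mfun (coord_fun i \<mu> C y)) y \<otimes>\<^bsub>A\<^esub> a \<in> rank_ideal (i - 1)"
    if "k \<in> \<Lambda> \<times> C_sets i r" "y \<in> rank_ideal i" for k y a
  proof -
    from that obtain \<mu> C where k: "k = (\<mu>, C)" "\<mu> \<in> \<Lambda>" "C \<in> C_sets i r" by blast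
    have "mfun (of_mfun (coord_fun i \<mu> C (y \<otimes>\<^bsub>A\<^esub> a)) \<ominus>\<^bsub>A\<^esub> of_mfun (coord_fun i \<mu> C y) \<otimes>\<^bsub>A\<^esub> a) \<alpha> \<beta> m = 0"
      if "i - 1 < rank r m" for \<alpha> \<beta> m
    proof -
      have "i \<le> rank r m" using that i by simp
      then show ?thesis using coord_fun_mult[OF \<open>y \<in> rank_ideal i\<close> k(3), of m \<mu> a]
        by (simp add: mfun_diff of_mfun_carrier mult_carrier mfun_mult mf k)
    qed
    then show ?thesis using k by (simp add: rank_ideal_def of_mfun_carrier mult_carrier)
  qed
  show "(\<Oplus>\<^bsub>A\<^esub>k\<in>\<Lambda> \<times> C_sets i r. (case k of (\<mu>, C) \<Rightarrow> of_mfun (gen_fun i \<mu> C)) \<otimes>\<^bsub>A\<^esub>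
      (case k of (\<mu>, C) \<Rightarrow> \<lambda>y. of_mfun (coord_fun i \<mu> C y)) y) \<ominus>\<^bsub>A\<^esub> y \<in> rank_ideal (i - 1)"
    if y: "y \<in> rank_ideal i" for y
  proof -
    let ?x = "\<lambda>k. (case k of (\<mu>, C) \<Rightarrow> of_mfun (gen_fun i \<mu> C)) \<otimes>\<^bsub>A\<^esub>
      (case k of (\<mu>, C) \<Rightarrow> \<lambda>y. of_mfun (coord_fun i \<mu> C y)) y"
    have sc: "(\<Oplus>\<^bsub>A\<^esub>k\<in>\<Lambda> \<times> C_sets i r. ?x k) \<in> carrier A"
      using mult_carrier by (intro alg.finsum_closed) auto
    have "mfun (\<Oplus>\<^bsub>A\<^esub>k\<in>\<Lambda> \<times> C_sets i r. ?x k) \<alpha> \<beta> m = mfun y \<alpha> \<beta> m" if m: "i - 1 < rank r m" for \<alpha> \<beta> m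
    proof (cases "\<alpha> \<in> \<Lambda> \<and> m \<in> T")
      case True
      have "mfun (\<Oplus>\<^bsub>A\<^esub>k\<in>\<Lambda> \<times> C_sets i r. ?x k) \<alpha> \<beta> m
          = (\<Sum>k\<in>\<Lambda> \<times> C_sets i r. mfun (?x k) \<alpha> \<beta> m)"
        using mult_carrier by (intro mfun_finsum) auto
      also have "\<dots> = (\<Sum>\<mu>\<in>\<Lambda>. \<Sum>C\<in>C_sets i r. conv (gen_fun i \<mu> C) (coord_fun i \<mu> C y) \<alpha> \<beta> m)"
        unfolding sum.cartesian_product by (intro sum.cong) (auto simp: mfun_mult mf)
      also have "\<dots> = (\<Sum>\<mu>\<in>\<Lambda>. if \<mu> = \<alpha> then (\<Sum>C\<in>C_sets i r. conv (gen_fun i \<alpha> C) (coord_fun i \<alpha> C y) \<alpha> \<beta> m) else 0)"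
        by (intro sum.cong refl) (auto simp: conv_def mconv_def gen_fun_def intro!: sum.neutral)
      also have "\<dots> = (\<Sum>C\<in>C_sets i r. conv (gen_fun i \<alpha> C) (coord_fun i \<alpha> C y) \<alpha> \<beta> m)"
        using True finite_compositions by simp
      also have "\<dots> = mfun y \<alpha> \<beta> m" using m i True by (intro gen_coord_sum[OF y]) auto
      finally show ?thesis .
    next
      case False
      then have "mfun g \<alpha> \<beta> m = 0" for g by (auto simp: mfun_def)
      then show ?thesis by simp
    qed
    then show ?thesis using sc y by (simp add: rank_ideal_def mfun_diff)
  qed
  show "of_mfun (unit_fun i) \<in> carrier A" by (rule of_mfun_carrier)
  show "(case k of (\<mu>, C) \<Rightarrow> of_mfun (gen_fun i \<mu> C)) \<otimes>\<^bsub>A\<^esub> of_mfun (unit_fun i)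
      = (case k of (\<mu>, C) \<Rightarrow> of_mfun (gen_fun i \<mu> C))" if "k \<in> \<Lambda> \<times> C_sets i r" for k
    using that by (auto simp: mult_of_mfun mf gen_unit)
  show "of_mfun (unit_fun i) \<otimes>\<^bsub>A\<^esub> (case k of (\<mu>, C) \<Rightarrow> \<lambda>y. of_mfun (coord_fun i \<mu> C y)) y
      = (case k of (\<mu>, C) \<Rightarrow> \<lambda>y. of_mfun (coord_fun i \<mu> C y)) y" if "k \<in> \<Lambda> \<times> C_sets i r" for k y
    using that by (auto simp: mult_of_mfun mf unit_coord)
qed (rule corner_regular)

end

theorem quasi_hereditary_A: "quasi_hereditary A"
  unfolding quasi_hereditary_def
proof (intro conjI exI[of _ r] exI[of _ rank_ideal] allI impI)
  show "fd_algebra A" by (rule fd_algebra_A)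
  show "rank_ideal 0 = {\<zero>\<^bsub>A\<^esub>}"
  proof (intro equalityI subsetI)
    fix f assume "f \<in> rank_ideal 0"
    then have f: "f \<in> carrier A" "mfun f \<mu> \<nu> m = 0" for \<mu> \<nu> m
      using rank_pos[OF r_pos, of m] by (auto simp: rank_ideal_def)
    have "f = \<zero>\<^bsub>A\<^esub>" by (rule mfun_inject[OF f(1) zero_carrier]) (simp add: fun_eq_iff f(2) mfun_zero)
    then show "f \<in> {\<zero>\<^bsub>A\<^esub>}" by simp
  qed (use zero_carrier mfun_zero in \<open>auto simp: rank_ideal_def\<close>)
  have "\<not> r < rank r m" for m using rank_le[of r m] by simp
  then show "rank_ideal r = carrier A" by (simp add: rank_ideal_def)
  show "ideal (rank_ideal t) A" for t by (rule rank_ideal_is_ideal)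
  fix t assume t: "t < r"
  show "rank_ideal t \<subseteq> rank_ideal (Suc t)" by (auto simp: rank_ideal_def)
  show "heredity_ideal (A Quot rank_ideal t) ((+>\<^bsub>A\<^esub>) (rank_ideal t) ` rank_ideal (Suc t))"
    using heredity_layer[of "Suc t"] t by simp
qed

end

section \<open>Integrality of the structure constants\<close>

text \<open>The summands are constant on the classes \<open>cl x\<close>, and every class has \<open>N\<close> elements.\<close>

lemma sum_orbits_dvd:
  fixes g :: "'a \<Rightarrow> nat"
  assumes fin: "finite X" and cls: "\<And>x. x \<in> X \<Longrightarrow> x \<in> cl x \<and> cl x \<subseteq> X \<and> card (cl x) = N"
    and eq: "\<And>x y. x \<in> X \<Longrightarrow> y \<in> cl x \<Longrightarrow> cl y = cl x"
    and g: "\<And>x y. x \<in> X \<Longrightarrow> y \<in> cl x \<Longrightarrow> g y = g x" and q: "\<And>x. x \<in> X \<Longrightarrow> q dvd g x"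
  shows "N * q dvd (\<Sum>x\<in>X. g x)"
proof -
  have X: "X = \<Union>(cl ` X)" using cls by blast
  have "(\<Sum>x\<in>\<Union>(cl ` X). g x) = (\<Sum>c\<in>cl ` X. \<Sum>x\<in>c. g x)"
  proof (rule sum.Union_disjoint[unfolded comp_def])
    show "\<forall>c\<in>cl ` X. finite c" using cls fin by (auto intro: finite_subset)
    show "\<forall>c1\<in>cl ` X. \<forall>c2\<in>cl ` X. c1 \<noteq> c2 \<longrightarrow> c1 \<inter> c2 = {}"
    proof (intro ballI impI)
      fix c1 c2 assume "c1 \<in> cl ` X" "c2 \<in> cl ` X" "c1 \<noteq> c2"
      then show "c1 \<inter> c2 = {}" using eq by (metis disjoint_iff imageE)
    qed
  qed
  also have "N * q dvd \<dots>"
  proof (rule dvd_sum)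
    fix c assume "c \<in> cl ` X"
    then obtain x where x: "x \<in> X" "c = cl x" by blast
    have "(\<Sum>y\<in>c. g y) = (\<Sum>y\<in>c. g x)" using g[OF x(1)] x(2) by (intro sum.cong) auto
    also have "\<dots> = N * g x" using cls[OF x(1)] x(2) by simp
    finally show "N * q dvd (\<Sum>y\<in>c. g y)" using q[OF x(1)] by simp
  qed
  finally show ?thesis using X by simp
qed

lemma card_orbits_dvd:
  assumes "finite X" "\<And>x. x \<in> X \<Longrightarrow> x \<in> cl x \<and> cl x \<subseteq> X \<and> card (cl x) = N"
    and "\<And>x y. x \<in> X \<Longrightarrow> y \<in> cl x \<Longrightarrow> cl y = cl x"
  shows "N dvd card X"
  using sum_orbits_dvd[OF assms, of "\<lambda>_. 1" 1] by simp

text \<open>Multiplication by \<open>\<pi>\<close> from the right is a bijection between the left orbits of \<open>\<sigma> \<circ> m\<close> and \<open>\<sigma> \<circ> m \<circ> \<pi>\<close>, and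
  similarly on the other side.  The normalizations thus do not depend on the chosen representatives.\<close>

lemma left_orbit_card:
  assumes "m' \<in> double_coset \<mu> m \<nu>"
  shows "card ((\<lambda>\<sigma>. \<sigma> \<circ> m') ` young \<mu>) = card ((\<lambda>\<sigma>. \<sigma> \<circ> m) ` young \<mu>)"
proof -
  from assms obtain \<sigma> \<pi> where s: "\<sigma> \<in> young \<mu>" "\<pi> \<in> young \<nu>" "m' = \<sigma> \<circ> m \<circ> \<pi>" by (rule double_coset_memE)
  have "bij_betw (\<lambda>x. x \<circ> \<pi>) ((\<lambda>\<sigma>. \<sigma> \<circ> m) ` young \<mu>) ((\<lambda>\<sigma>. \<sigma> \<circ> m') ` young \<mu>)"
  proof (rule bij_betwI[where g = "\<lambda>x. x \<circ> pinv \<pi>"])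
    show "(\<lambda>x. x \<circ> \<pi>) \<in> (\<lambda>\<sigma>. \<sigma> \<circ> m) ` young \<mu> \<rightarrow> (\<lambda>\<sigma>. \<sigma> \<circ> m') ` young \<mu>"
    proof
      fix x assume "x \<in> (\<lambda>\<sigma>. \<sigma> \<circ> m) ` young \<mu>"
      then obtain \<tau> where t: "\<tau> \<in> young \<mu>" "x = \<tau> \<circ> m" by blast
      have "x \<circ> \<pi> = (\<tau> \<circ> pinv \<sigma>) \<circ> m'"
        using t s by (simp add: comp_assoc young_inv_cancel[OF s(1)])
      then show "x \<circ> \<pi> \<in> (\<lambda>\<sigma>. \<sigma> \<circ> m') ` young \<mu>" using t s young_comp young_inv by blast
    qed
    show "(\<lambda>x. x \<circ> pinv \<pi>) \<in> (\<lambda>\<sigma>. \<sigma> \<circ> m') ` young \<mu> \<rightarrow> (\<lambda>\<sigma>. \<sigma> \<circ> m) ` young \<mu>"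
    proof
      fix x assume "x \<in> (\<lambda>\<sigma>. \<sigma> \<circ> m') ` young \<mu>"
      then obtain \<tau> where t: "\<tau> \<in> young \<mu>" "x = \<tau> \<circ> m'" by blast
      have "x \<circ> pinv \<pi> = (\<tau> \<circ> \<sigma>) \<circ> m"
        using t s young_inv_cancel(2)[OF s(2)] by (simp add: comp_assoc)
      then show "x \<circ> pinv \<pi> \<in> (\<lambda>\<sigma>. \<sigma> \<circ> m) ` young \<mu>" using t s young_comp by blast
    qed
  qed (simp_all add: young_inv_cancel[OF s(2)])
  then show ?thesis by (simp add: bij_betw_same_card)
qed

lemma right_orbit_card:
  assumes "m' \<in> double_coset \<mu> m \<nu>"
  shows "card ((\<lambda>\<pi>. m' \<circ> \<pi>) ` young \<nu>) = card ((\<lambda>\<pi>. m \<circ> \<pi>) ` young \<nu>)"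
proof -
  from assms obtain \<sigma> \<pi> where s: "\<sigma> \<in> young \<mu>" "\<pi> \<in> young \<nu>" "m' = \<sigma> \<circ> m \<circ> \<pi>" by (rule double_coset_memE)
  have "bij_betw (\<lambda>x. \<sigma> \<circ> x) ((\<lambda>\<pi>. m \<circ> \<pi>) ` young \<nu>) ((\<lambda>\<pi>. m' \<circ> \<pi>) ` young \<nu>)"
  proof (rule bij_betwI[where g = "\<lambda>x. pinv \<sigma> \<circ> x"])
    show "(\<lambda>x. \<sigma> \<circ> x) \<in> (\<lambda>\<pi>. m \<circ> \<pi>) ` young \<nu> \<rightarrow> (\<lambda>\<pi>. m' \<circ> \<pi>) ` young \<nu>"
    proof
      fix x assume "x \<in> (\<lambda>\<pi>. m \<circ> \<pi>) ` young \<nu>"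
      then obtain \<tau> where t: "\<tau> \<in> young \<nu>" "x = m \<circ> \<tau>" by blast
      have "\<sigma> \<circ> x = m' \<circ> (pinv \<pi> \<circ> \<tau>)"
        using t s by (simp add: comp_assoc young_inv_cancel[OF s(2)])
      then show "\<sigma> \<circ> x \<in> (\<lambda>\<pi>. m' \<circ> \<pi>) ` young \<nu>" using t s young_comp young_inv by blast
    qed
    show "(\<lambda>x. pinv \<sigma> \<circ> x) \<in> (\<lambda>\<pi>. m' \<circ> \<pi>) ` young \<nu> \<rightarrow> (\<lambda>\<pi>. m \<circ> \<pi>) ` young \<nu>"
    proof
      fix x assume "x \<in> (\<lambda>\<pi>. m' \<circ> \<pi>) ` young \<nu>"
      then obtain \<tau> where t: "\<tau> \<in> young \<nu>" "x = m' \<circ> \<tau>" by blast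
      have "pinv \<sigma> \<circ> x = m \<circ> (\<pi> \<circ> \<tau>)"
        using t s young_inv_cancel(3)[OF s(1)] by (simp add: comp_assoc)
      then show "pinv \<sigma> \<circ> x \<in> (\<lambda>\<pi>. m \<circ> \<pi>) ` young \<nu>" using t s young_comp by blast
    qed
  qed (simp_all add: young_inv_cancel[OF s(1)])
  then show ?thesis by (simp add: bij_betw_same_card)
qed

lemma n_L_eq:
  assumes "D \<in> double_cosets M \<mu> \<nu>" "m \<in> D"
  shows "n_L (\<mu>, \<nu>, D) = card ((\<lambda>\<sigma>. \<sigma> \<circ> m) ` young \<mu>)"
  using left_orbit_card[of "SOME m. m \<in> D" \<mu> m \<nu>] double_cosets_mem_eq[OF assms] double_cosets_some(1)[OF assms(1)]
  by simp

lemma n_R_eq: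
  assumes "D \<in> double_cosets M \<mu> \<nu>" "m \<in> D"
  shows "n_R (\<mu>, \<nu>, D) = card ((\<lambda>\<pi>. m \<circ> \<pi>) ` young \<nu>)"
  using right_orbit_card[of "SOME m. m \<in> D" \<mu> m \<nu>] double_cosets_mem_eq[OF assms] double_cosets_some(1)[OF assms(1)]
  by simp

lemma left_orbit_eq:
  fixes x :: transf
  assumes "y \<in> (\<lambda>\<sigma>. \<sigma> \<circ> x) ` young \<mu>"
  shows "(\<lambda>\<sigma>. \<sigma> \<circ> y) ` young \<mu> = (\<lambda>\<sigma>. \<sigma> \<circ> x) ` young \<mu>"
proof -
  from assms obtain \<tau> where t: "\<tau> \<in> young \<mu>" "y = \<tau> \<circ> x" by blast
  have 1: "\<sigma> \<circ> y = (\<sigma> \<circ> \<tau>) \<circ> x" "\<sigma> \<circ> x = (\<sigma> \<circ> pinv \<tau>) \<circ> y" for \<sigma> :: transf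
    unfolding t(2) by (simp_all only: comp_assoc young_inv_cancel(3)[OF t(1)])
  show ?thesis
  proof (intro equalityI subsetI)
    fix z assume "z \<in> (\<lambda>\<sigma>. \<sigma> \<circ> y) ` young \<mu>"
    then obtain \<sigma> where s: "\<sigma> \<in> young \<mu>" "z = \<sigma> \<circ> y" by blast
    have "z = (\<sigma> \<circ> \<tau>) \<circ> x" using s(2) 1(1)[of \<sigma>] by (rule trans)
    moreover have "\<sigma> \<circ> \<tau> \<in> young \<mu>" using s(1) t(1) by (intro young_comp)
    ultimately show "z \<in> (\<lambda>\<sigma>. \<sigma> \<circ> x) ` young \<mu>" by blast
  next
    fix z assume "z \<in> (\<lambda>\<sigma>. \<sigma> \<circ> x) ` young \<mu>"
    then obtain \<sigma> where s: "\<sigma> \<in> young \<mu>" "z = \<sigma> \<circ> x" by blast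
    have "z = (\<sigma> \<circ> pinv \<tau>) \<circ> y" using s(2) 1(2)[of \<sigma>] by (rule trans)
    moreover have "\<sigma> \<circ> pinv \<tau> \<in> young \<mu>" using s(1) t(1) by (intro young_comp young_inv)
    ultimately show "z \<in> (\<lambda>\<sigma>. \<sigma> \<circ> y) ` young \<mu>" by blast
  qed
qed

lemma right_orbit_eq:
  fixes x :: transf
  assumes "y \<in> (\<lambda>\<pi>. x \<circ> \<pi>) ` young \<nu>"
  shows "(\<lambda>\<pi>. y \<circ> \<pi>) ` young \<nu> = (\<lambda>\<pi>. x \<circ> \<pi>) ` young \<nu>"
proof -
  from assms obtain \<tau> where t: "\<tau> \<in> young \<nu>" "y = x \<circ> \<tau>" by blast
  have 1: "y \<circ> \<sigma> = x \<circ> (\<tau> \<circ> \<sigma>)" "x \<circ> \<sigma> = y \<circ> (pinv \<tau> \<circ> \<sigma>)" for \<sigma> :: transf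
    unfolding t(2) by (simp_all only: comp_assoc young_inv_cancel(4)[OF t(1)])
  show ?thesis
  proof (intro equalityI subsetI)
    fix z assume "z \<in> (\<lambda>\<sigma>. y \<circ> \<sigma>) ` young \<nu>"
    then obtain \<sigma> where s: "\<sigma> \<in> young \<nu>" "z = y \<circ> \<sigma>" by blast
    have "z = x \<circ> (\<tau> \<circ> \<sigma>)" using s(2) 1(1)[of \<sigma>] by (rule trans)
    moreover have "\<tau> \<circ> \<sigma> \<in> young \<nu>" using s(1) t(1) by (intro young_comp)
    ultimately show "z \<in> (\<lambda>\<sigma>. x \<circ> \<sigma>) ` young \<nu>" by blast
  next
    fix z assume "z \<in> (\<lambda>\<sigma>. x \<circ> \<sigma>) ` young \<nu>"
    then obtain \<sigma> where s: "\<sigma> \<in> young \<nu>" "z = x \<circ> \<sigma>" by blast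
    have "z = y \<circ> (pinv \<tau> \<circ> \<sigma>)" using s(2) 1(2)[of \<sigma>] by (rule trans)
    moreover have "pinv \<tau> \<circ> \<sigma> \<in> young \<nu>" using s(1) t(1) by (intro young_comp young_inv)
    ultimately show "z \<in> (\<lambda>\<sigma>. y \<circ> \<sigma>) ` young \<nu>" by blast
  qed
qed

lemma orbit_self: "x \<in> (\<lambda>\<sigma>. \<sigma> \<circ> x) ` young \<mu>" "x \<in> (\<lambda>\<pi>. x \<circ> \<pi>) ` young \<mu>"
  using young_id[of \<mu>] by (auto simp: image_iff intro!: bexI[of _ id])

lemma card_sum_fibres:
  assumes "finite P" "finite X" "\<And>p. p \<in> P \<Longrightarrow> f p \<in> X"
  shows "card P = (\<Sum>x\<in>X. card {p \<in> P. f p = x})"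
  using sum.group[OF assms(1,2), of f "\<lambda>_. 1::nat"] assms(3) by (auto simp: image_subset_iff)

lemma a_coeff_card:
  assumes "finite M" "D1 \<subseteq> M" "D2 \<subseteq> M"
  shows "a_coeff M D1 D2 D = int (card {(a, b). a \<in> D1 \<and> b \<in> D2 \<and> a \<circ> b = (SOME m. m \<in> D)})"
proof -
  let ?m = "SOME m. m \<in> D"
  have "a_coeff M D1 D2 D = (\<Sum>(a, b) \<in> {(a, b) \<in> M \<times> M. a \<circ> b = ?m}. coset_sum D1 a * coset_sum D2 b)"
    by (simp add: a_coeff_def coset_coeff_def mring_mult_def)
  also have "\<dots> = (\<Sum>p \<in> {(a, b). a \<in> D1 \<and> b \<in> D2 \<and> a \<circ> b = ?m}. 1)"
  proof (rule sum.mono_neutral_cong_right)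
    show "finite {(a, b) \<in> M \<times> M. a \<circ> b = ?m}"
      by (rule finite_subset[of _ "M \<times> M"]) (use assms(1) in auto)
  qed (use assms(2,3) in \<open>auto simp: coset_sum_def split: if_splits\<close>)
  finally show ?thesis by simp
qed

lemma double_coset_closed:
  assumes "D \<in> double_cosets M \<mu> \<nu>" "m \<in> D" "\<sigma> \<in> young \<mu>" "\<pi> \<in> young \<nu>"
  shows "\<sigma> \<circ> m \<in> D" "m \<circ> \<pi> \<in> D"
proof -
  have "\<sigma> \<circ> m \<circ> id \<in> double_coset \<mu> m \<nu>" "id \<circ> m \<circ> \<pi> \<in> double_coset \<mu> m \<nu>"
    by (rule double_coset_memI[OF assms(3) young_id], rule double_coset_memI[OF young_id assms(4)])
  then show "\<sigma> \<circ> m \<in> D" "m \<circ> \<pi> \<in> D"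
    using double_cosets_mem_eq[OF assms(1,2)] by simp_all
qed

text \<open>The right-hand side counts the pairs \<open>(a, b)\<close> in \<open>D1 \<times> D2\<close> with \<open>a \<circ> b\<close> in the left orbit of a fixed
  element of \<open>D\<close>.  For fixed \<open>b\<close> the elements \<open>a\<close> fill left orbits of size \<open>n_L(D1)\<close>, and their number
  depends only on the left orbit of \<open>b\<close>, since a factor from the middle Young subgroup can be moved
  from \<open>b\<close> to \<open>a\<close>.\<close>

lemma n_L_dvd:
  assumes M: "finite M" and D1: "D1 \<in> double_cosets M \<mu> \<pi>" "D1 \<subseteq> M"
    and D2: "D2 \<in> double_cosets M \<pi> \<nu>" "D2 \<subseteq> M" and D: "D \<in> double_cosets M \<mu> \<nu>"
  shows "int (n_L (\<mu>, \<pi>, D1)) * int (n_L (\<pi>, \<nu>, D2)) dvd int (n_L (\<mu>, \<nu>, D)) * a_coeff M D1 D2 D"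
proof -
  define m0 where "m0 = (SOME m. m \<in> D)"
  have m0: "m0 \<in> D" unfolding m0_def by (rule double_cosets_some(1)[OF D])
  define U where "U = (\<lambda>\<sigma>. \<sigma> \<circ> m0) ` young \<mu>"
  have fin: "finite D1" "finite D2" using finite_subset[OF _ M] D1 D2 by auto
  have fU: "finite U" by (simp add: U_def finite_young)
  define P where "P = {(a, b). a \<in> D1 \<and> b \<in> D2 \<and> a \<circ> b \<in> U}"
  have fP: "finite P" by (rule finite_subset[of _ "D1 \<times> D2"]) (use fin in \<open>auto simp: P_def\<close>)
  define F where "F x = {(a, b). a \<in> D1 \<and> b \<in> D2 \<and> a \<circ> b = x}" for x
  have "card (F x) = card (F m0)" if "x \<in> U" for x
  proof -
    from that obtain \<sigma> where s: "\<sigma> \<in> young \<mu>" "x = \<sigma> \<circ> m0" by (auto simp: U_def)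
    have "bij_betw (\<lambda>(a, b). (\<sigma> \<circ> a, b)) (F m0) (F x)"
    proof (rule bij_betwI[where g = "\<lambda>(a, b). (pinv \<sigma> \<circ> a, b)"])
      show "(\<lambda>(a, b). (\<sigma> \<circ> a, b)) \<in> F m0 \<rightarrow> F x"
        using double_coset_closed(1)[OF D1(1) _ s(1) young_id] by (auto simp: F_def s comp_assoc)
      show "(\<lambda>(a, b). (pinv \<sigma> \<circ> a, b)) \<in> F x \<rightarrow> F m0"
        using double_coset_closed(1)[OF D1(1) _ young_inv[OF s(1)] young_id]
        by (auto simp: F_def s comp_assoc young_inv_cancel[OF s(1)])
    qed (auto simp: F_def young_inv_cancel[OF s(1)])
    then show ?thesis by (simp add: bij_betw_same_card)
  qed
  moreover have "card P = (\<Sum>x\<in>U. card {p \<in> P. (\<lambda>(a, b). a \<circ> b) p = x})"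
    by (rule card_sum_fibres[OF fP fU]) (auto simp: P_def)
  moreover have "{p \<in> P. (\<lambda>(a, b). a \<circ> b) p = x} = F x" if "x \<in> U" for x
    using that by (auto simp: P_def F_def)
  ultimately have cP: "card P = card U * card (F m0)" by simp
  have cU: "card U = n_L (\<mu>, \<nu>, D)" unfolding U_def by (rule n_L_eq[OF D m0, symmetric])
  define g where "g b = card {a \<in> D1. a \<circ> b \<in> U}" for b
  have "card P = (\<Sum>b\<in>D2. card {p \<in> P. snd p = b})"
    by (rule card_sum_fibres[OF fP fin(2)]) (auto simp: P_def)
  also have "\<dots> = (\<Sum>b\<in>D2. g b)"
  proof (rule sum.cong[OF refl])
    fix b assume "b \<in> D2"
    then have "bij_betw fst {p \<in> P. snd p = b} {a \<in> D1. a \<circ> b \<in> U}"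
      by (intro bij_betwI[where g = "\<lambda>a. (a, b)"]) (auto simp: P_def)
    then show "card {p \<in> P. snd p = b} = g b" by (simp add: g_def bij_betw_same_card)
  qed
  finally have cP': "card P = (\<Sum>b\<in>D2. g b)" .
  have "n_L (\<pi>, \<nu>, D2) * n_L (\<mu>, \<pi>, D1) dvd (\<Sum>b\<in>D2. g b)"
  proof (rule sum_orbits_dvd[OF fin(2), where cl = "\<lambda>b. (\<lambda>\<sigma>. \<sigma> \<circ> b) ` young \<pi>"])
    fix b assume b: "b \<in> D2"
    show "b \<in> (\<lambda>\<sigma>. \<sigma> \<circ> b) ` young \<pi> \<and> (\<lambda>\<sigma>. \<sigma> \<circ> b) ` young \<pi> \<subseteq> D2 \<and>
        card ((\<lambda>\<sigma>. \<sigma> \<circ> b) ` young \<pi>) = n_L (\<pi>, \<nu>, D2)"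
      using orbit_self(1) n_L_eq[OF D2(1) b] double_coset_closed(1)[OF D2(1) b _ young_id] by auto
    show "n_L (\<mu>, \<pi>, D1) dvd g b"
      unfolding g_def
    proof (rule card_orbits_dvd[where cl = "\<lambda>a. (\<lambda>\<sigma>. \<sigma> \<circ> a) ` young \<mu>"])
      fix a assume a: "a \<in> {a \<in> D1. a \<circ> b \<in> U}"
      have "\<sigma> \<circ> a \<circ> b \<in> U" if "\<sigma> \<in> young \<mu>" for \<sigma>
      proof -
        from a obtain \<tau> where "\<tau> \<in> young \<mu>" "a \<circ> b = \<tau> \<circ> m0" by (auto simp: U_def)
        then have "\<sigma> \<circ> a \<circ> b = (\<sigma> \<circ> \<tau>) \<circ> m0" "\<sigma> \<circ> \<tau> \<in> young \<mu>"
          using young_comp[OF that] by (simp_all add: comp_assoc)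
        then show ?thesis unfolding U_def by blast
      qed
      then show "a \<in> (\<lambda>\<sigma>. \<sigma> \<circ> a) ` young \<mu> \<and> (\<lambda>\<sigma>. \<sigma> \<circ> a) ` young \<mu> \<subseteq> {a \<in> D1. a \<circ> b \<in> U} \<and>
          card ((\<lambda>\<sigma>. \<sigma> \<circ> a) ` young \<mu>) = n_L (\<mu>, \<pi>, D1)"
        using a orbit_self(1) n_L_eq[OF D1(1), of a] double_coset_closed(1)[OF D1(1) _ _ young_id, of a] by auto
    qed (use fin left_orbit_eq in auto)
    fix b' assume b': "b' \<in> (\<lambda>\<sigma>. \<sigma> \<circ> b) ` young \<pi>"
    then show "(\<lambda>\<sigma>. \<sigma> \<circ> b') ` young \<pi> = (\<lambda>\<sigma>. \<sigma> \<circ> b) ` young \<pi>" by (rule left_orbit_eq)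
    from b' obtain \<tau> where t: "\<tau> \<in> young \<pi>" "b' = \<tau> \<circ> b" by blast
    have "bij_betw (\<lambda>a. a \<circ> \<tau>) {a \<in> D1. a \<circ> b' \<in> U} {a \<in> D1. a \<circ> b \<in> U}"
    proof (rule bij_betwI[where g = "\<lambda>a. a \<circ> pinv \<tau>"])
      show "(\<lambda>a. a \<circ> \<tau>) \<in> {a \<in> D1. a \<circ> b' \<in> U} \<rightarrow> {a \<in> D1. a \<circ> b \<in> U}"
        using double_coset_closed(2)[OF D1(1) _ young_id t(1)] by (auto simp: t comp_assoc)
      show "(\<lambda>a. a \<circ> pinv \<tau>) \<in> {a \<in> D1. a \<circ> b \<in> U} \<rightarrow> {a \<in> D1. a \<circ> b' \<in> U}"
        using double_coset_closed(2)[OF D1(1) _ young_id young_inv[OF t(1)]]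
        by (auto simp: t comp_assoc young_inv_cancel[OF t(1)])
    qed (simp_all add: young_inv_cancel[OF t(1)])
    then show "g b' = g b" by (simp add: g_def bij_betw_same_card)
  qed
  then have "n_L (\<mu>, \<pi>, D1) * n_L (\<pi>, \<nu>, D2) dvd n_L (\<mu>, \<nu>, D) * card (F m0)"
    using cP cP' cU by (simp add: mult.commute)
  moreover have "a_coeff M D1 D2 D = int (card (F m0))"
    using a_coeff_card[OF M D1(2) D2(2)] by (simp add: F_def m0_def)
  ultimately show ?thesis by (simp only: of_nat_mult[symmetric] of_nat_dvd_iff)
qed

text \<open>The mirror image of the preceding count: for fixed \<open>a\<close> the elements \<open>b\<close> fill right orbits of size
  \<open>n_R(D2)\<close>, and their number depends only on the right orbit of \<open>a\<close>.\<close>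

lemma n_R_dvd:
  assumes M: "finite M" and D1: "D1 \<in> double_cosets M \<mu> \<pi>" "D1 \<subseteq> M"
    and D2: "D2 \<in> double_cosets M \<pi> \<nu>" "D2 \<subseteq> M" and D: "D \<in> double_cosets M \<mu> \<nu>"
  shows "int (n_R (\<mu>, \<pi>, D1)) * int (n_R (\<pi>, \<nu>, D2)) dvd int (n_R (\<mu>, \<nu>, D)) * a_coeff M D1 D2 D"
proof -
  define m0 where "m0 = (SOME m. m \<in> D)"
  have m0: "m0 \<in> D" unfolding m0_def by (rule double_cosets_some(1)[OF D])
  define U where "U = (\<lambda>\<rho>. m0 \<circ> \<rho>) ` young \<nu>"
  have fin: "finite D1" "finite D2" using finite_subset[OF _ M] D1 D2 by auto
  have fU: "finite U" by (simp add: U_def finite_young)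
  define P where "P = {(a, b). a \<in> D1 \<and> b \<in> D2 \<and> a \<circ> b \<in> U}"
  have fP: "finite P" by (rule finite_subset[of _ "D1 \<times> D2"]) (use fin in \<open>auto simp: P_def\<close>)
  define F where "F x = {(a, b). a \<in> D1 \<and> b \<in> D2 \<and> a \<circ> b = x}" for x
  have "card (F x) = card (F m0)" if "x \<in> U" for x
  proof -
    from that obtain \<sigma> where s: "\<sigma> \<in> young \<nu>" "x = m0 \<circ> \<sigma>" by (auto simp: U_def)
    have "bij_betw (\<lambda>(a, b). (a, b \<circ> \<sigma>)) (F m0) (F x)"
    proof (rule bij_betwI[where g = "\<lambda>(a, b). (a, b \<circ> pinv \<sigma>)"])
      show "(\<lambda>(a, b). (a, b \<circ> \<sigma>)) \<in> F m0 \<rightarrow> F x"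
        using double_coset_closed(2)[OF D2(1) _ young_id s(1)] by (auto simp: F_def s o_assoc)
      show "(\<lambda>(a, b). (a, b \<circ> pinv \<sigma>)) \<in> F x \<rightarrow> F m0"
        using double_coset_closed(2)[OF D2(1) _ young_id young_inv[OF s(1)]]
        by (auto simp: F_def s o_assoc young_inv_cancel[OF s(1)])
    qed (auto simp: F_def young_inv_cancel[OF s(1)])
    then show ?thesis by (simp add: bij_betw_same_card)
  qed
  moreover have "card P = (\<Sum>x\<in>U. card {p \<in> P. (\<lambda>(a, b). a \<circ> b) p = x})"
    by (rule card_sum_fibres[OF fP fU]) (auto simp: P_def)
  moreover have "{p \<in> P. (\<lambda>(a, b). a \<circ> b) p = x} = F x" if "x \<in> U" for x
    using that by (auto simp: P_def F_def)
  ultimately have cP: "card P = card U * card (F m0)" by simp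
  have cU: "card U = n_R (\<mu>, \<nu>, D)" unfolding U_def by (rule n_R_eq[OF D m0, symmetric])
  define g where "g a = card {b \<in> D2. a \<circ> b \<in> U}" for a
  have "card P = (\<Sum>a\<in>D1. card {p \<in> P. fst p = a})"
    by (rule card_sum_fibres[OF fP fin(1)]) (auto simp: P_def)
  also have "\<dots> = (\<Sum>a\<in>D1. g a)"
  proof (rule sum.cong[OF refl])
    fix a assume "a \<in> D1"
    then have "bij_betw snd {p \<in> P. fst p = a} {b \<in> D2. a \<circ> b \<in> U}"
      by (intro bij_betwI[where g = "\<lambda>b. (a, b)"]) (auto simp: P_def)
    then show "card {p \<in> P. fst p = a} = g a" by (simp add: g_def bij_betw_same_card)
  qed
  finally have cP': "card P = (\<Sum>a\<in>D1. g a)" .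
  have "n_R (\<mu>, \<pi>, D1) * n_R (\<pi>, \<nu>, D2) dvd (\<Sum>a\<in>D1. g a)"
  proof (rule sum_orbits_dvd[OF fin(1), where cl = "\<lambda>a. (\<lambda>\<sigma>. a \<circ> \<sigma>) ` young \<pi>"])
    fix a assume a: "a \<in> D1"
    show "a \<in> (\<lambda>\<sigma>. a \<circ> \<sigma>) ` young \<pi> \<and> (\<lambda>\<sigma>. a \<circ> \<sigma>) ` young \<pi> \<subseteq> D1 \<and>
        card ((\<lambda>\<sigma>. a \<circ> \<sigma>) ` young \<pi>) = n_R (\<mu>, \<pi>, D1)"
      using orbit_self(2) n_R_eq[OF D1(1) a] double_coset_closed(2)[OF D1(1) a young_id] by auto
    show "n_R (\<pi>, \<nu>, D2) dvd g a"
      unfolding g_def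
    proof (rule card_orbits_dvd[where cl = "\<lambda>b. (\<lambda>\<sigma>. b \<circ> \<sigma>) ` young \<nu>"])
      fix b assume b: "b \<in> {b \<in> D2. a \<circ> b \<in> U}"
      have "a \<circ> (b \<circ> \<sigma>) \<in> U" if "\<sigma> \<in> young \<nu>" for \<sigma>
      proof -
        from b obtain \<tau> where "\<tau> \<in> young \<nu>" "a \<circ> b = m0 \<circ> \<tau>" by (auto simp: U_def)
        then have "a \<circ> (b \<circ> \<sigma>) = m0 \<circ> (\<tau> \<circ> \<sigma>)" "\<tau> \<circ> \<sigma> \<in> young \<nu>"
          using young_comp[OF _ that] by (simp_all add: o_assoc)
        then show ?thesis unfolding U_def by blast
      qed
      then show "b \<in> (\<lambda>\<sigma>. b \<circ> \<sigma>) ` young \<nu> \<and> (\<lambda>\<sigma>. b \<circ> \<sigma>) ` young \<nu> \<subseteq> {b \<in> D2. a \<circ> b \<in> U} \<and>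
          card ((\<lambda>\<sigma>. b \<circ> \<sigma>) ` young \<nu>) = n_R (\<pi>, \<nu>, D2)"
        using b orbit_self(2) n_R_eq[OF D2(1), of b] double_coset_closed(2)[OF D2(1) _ young_id, of b] by auto
    qed (use fin right_orbit_eq in auto)
    fix a' assume a': "a' \<in> (\<lambda>\<sigma>. a \<circ> \<sigma>) ` young \<pi>"
    then show "(\<lambda>\<sigma>. a' \<circ> \<sigma>) ` young \<pi> = (\<lambda>\<sigma>. a \<circ> \<sigma>) ` young \<pi>" by (rule right_orbit_eq)
    from a' obtain \<tau> where t: "\<tau> \<in> young \<pi>" "a' = a \<circ> \<tau>" by blast
    have "bij_betw (\<lambda>b. \<tau> \<circ> b) {b \<in> D2. a' \<circ> b \<in> U} {b \<in> D2. a \<circ> b \<in> U}"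
    proof (rule bij_betwI[where g = "\<lambda>b. pinv \<tau> \<circ> b"])
      show "(\<lambda>b. \<tau> \<circ> b) \<in> {b \<in> D2. a' \<circ> b \<in> U} \<rightarrow> {b \<in> D2. a \<circ> b \<in> U}"
        using double_coset_closed(1)[OF D2(1) _ t(1) young_id] by (auto simp: t o_assoc)
      show "(\<lambda>b. pinv \<tau> \<circ> b) \<in> {b \<in> D2. a \<circ> b \<in> U} \<rightarrow> {b \<in> D2. a' \<circ> b \<in> U}"
        using double_coset_closed(1)[OF D2(1) _ young_inv[OF t(1)] young_id]
        by (auto simp: t o_assoc young_inv_cancel[OF t(1)])
    qed (simp_all add: young_inv_cancel[OF t(1)])
    then show "g a' = g a" by (simp add: g_def bij_betw_same_card)
  qed
  then have "n_R (\<mu>, \<pi>, D1) * n_R (\<pi>, \<nu>, D2) dvd n_R (\<mu>, \<nu>, D) * card (F m0)"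
    using cP cP' cU by simp
  moreover have "a_coeff M D1 D2 D = int (card (F m0))"
    using a_coeff_card[OF M D1(2) D2(2)] by (simp add: F_def m0_def)
  ultimately show ?thesis by (simp only: of_nat_mult[symmetric] of_nat_dvd_iff)
qed

section \<open>Blocks and tableaux\<close>

lemma sum_list_take_mono: "j \<le> k \<Longrightarrow> sum_list (take j \<rho>) \<le> sum_list (take k (\<rho> :: nat list))"
proof -
  assume "j \<le> k"
  then have "take k \<rho> = take j \<rho> @ take (k - j) (drop j \<rho>)"
    by (metis le_add_diff_inverse take_add)
  then show ?thesis by simp
qed

lemma sum_list_take_le: "sum_list (take j \<rho>) \<le> sum_list (\<rho> :: nat list)"
  using sum_list_take_mono[of j "max j (length \<rho>)" \<rho>] by simp

lemma block_no_unique: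
  assumes "j \<in> {1..length \<rho>}" "x \<in> block \<rho> j"
  shows "block_no \<rho> x = j"
  unfolding block_no_def
proof (rule the_equality)
  fix k assume k: "k \<in> {1..length \<rho>} \<and> x \<in> block \<rho> k"
  show "k = j"
  proof (rule ccontr)
    assume "k \<noteq> j"
    then consider "k \<le> j - 1" | "j \<le> k - 1" using k assms by fastforce
    then show False
    proof cases
      case 1
      then show ?thesis using sum_list_take_mono[of k "j - 1" \<rho>] k assms by (simp add: block_def)
    next
      case 2
      then show ?thesis using sum_list_take_mono[of j "k - 1" \<rho>] k assms by (simp add: block_def)
    qed
  qed
qed (use assms in simp)

lemma block_no_mem:
  assumes "x \<in> {1..sum_list \<rho>}"
  shows "block_no \<rho> x \<in> {1..length \<rho>}" "x \<in> block \<rho> (block_no \<rho> x)"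
proof -
  define j where "j = (LEAST j. x \<le> sum_list (take j \<rho>))"
  have ex: "x \<le> sum_list (take (length \<rho>) \<rho>)" using assms by simp
  then have 1: "x \<le> sum_list (take j \<rho>)" and le: "j \<le> length \<rho>"
    unfolding j_def by (rule LeastI, rule Least_le)
  have "j \<noteq> 0"
  proof
    assume "j = 0"
    then show False using 1 assms by simp
  qed
  then have "\<not> x \<le> sum_list (take (j - 1) \<rho>)"
    unfolding j_def by (intro not_less_Least) simp
  then have j: "j \<in> {1..length \<rho>}" "x \<in> block \<rho> j" using 1 le \<open>j \<noteq> 0\<close> by (auto simp: block_def)
  then show "block_no \<rho> x \<in> {1..length \<rho>}" "x \<in> block \<rho> (block_no \<rho> x)"
    using block_no_unique[OF j] by simp_all
qed

lemma block_subset: "block \<rho> j \<subseteq> {1..sum_list \<rho>}"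
  using sum_list_take_le[of j \<rho>] by (auto simp: block_def)

lemma block_no_mono:
  assumes "x \<in> {1..sum_list \<rho>}" "y \<in> {1..sum_list \<rho>}" "x \<le> y"
  shows "block_no \<rho> x \<le> block_no \<rho> y"
proof (rule ccontr)
  assume "\<not> ?thesis"
  then have "block_no \<rho> y \<le> block_no \<rho> x - 1" by simp
  then have "sum_list (take (block_no \<rho> y) \<rho>) \<le> sum_list (take (block_no \<rho> x - 1) \<rho>)"
    by (rule sum_list_take_mono)
  then show False using block_no_mem(2)[OF assms(1)] block_no_mem(2)[OF assms(2)] assms(3)
    by (simp add: block_def)
qed

lemma block_eq_block_no:
  "j \<in> {1..length \<rho>} \<Longrightarrow> block \<rho> j = {x \<in> {1..sum_list \<rho>}. block_no \<rho> x = j}"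
  using block_no_unique block_no_mem(2) block_subset by blast

lemma young_iff:
  "\<sigma> \<in> young \<rho> \<longleftrightarrow> \<sigma> permutes {1..sum_list \<rho>} \<and> (\<forall>x\<in>{1..sum_list \<rho>}. block_no \<rho> (\<sigma> x) = block_no \<rho> x)"
proof (intro iffI conjI ballI)
  assume s: "\<sigma> \<in> young \<rho>"
  then show "\<sigma> permutes {1..sum_list \<rho>}" by (rule young_permutes)
  fix x assume x: "x \<in> {1..sum_list \<rho>}"
  have "\<sigma> x \<in> block \<rho> (block_no \<rho> x)" using s block_no_mem[OF x] unfolding young_def by blast
  then show "block_no \<rho> (\<sigma> x) = block_no \<rho> x" using block_no_unique block_no_mem(1)[OF x] by blast
next
  assume s: "\<sigma> permutes {1..sum_list \<rho>} \<and> (\<forall>x\<in>{1..sum_list \<rho>}. block_no \<rho> (\<sigma> x) = block_no \<rho> x)"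
  have "\<sigma> ` block \<rho> j = block \<rho> j" if "j \<in> {1..length \<rho>}" for j
  proof (rule card_subset_eq)
    show "finite (block \<rho> j)" using finite_subset[OF block_subset] by blast
    show "\<sigma> ` block \<rho> j \<subseteq> block \<rho> j"
      using s permutes_in_image[of \<sigma> "{1..sum_list \<rho>}"] unfolding block_eq_block_no[OF that] by auto
    show "card (\<sigma> ` block \<rho> j) = card (block \<rho> j)"
      using s permutes_inj by (intro card_image) (auto intro: inj_on_subset)
  qed
  then show "\<sigma> \<in> young \<rho>" using s by (simp add: young_def)
qed

lemma sorted_filter_prefix:
  "sorted ys \<Longrightarrow> j < length ys \<Longrightarrow> j < length (filter (\<lambda>y. y \<le> k) ys) \<longleftrightarrow> ys ! j \<le> (k :: nat)"
proof (induction ys arbitrary: j)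
  case (Cons y ys)
  show ?case
  proof (cases "y \<le> k")
    case True
    then show ?thesis using Cons by (cases j) auto
  next
    case False
    then have none: "filter (\<lambda>y. y \<le> k) ys = []" using Cons.prems(1) by (auto simp: filter_empty_conv)
    have "y \<le> (y # ys) ! j" using Cons.prems by (cases j) auto
    then have "\<not> (y # ys) ! j \<le> k" using False by simp
    then show ?thesis using False none by simp
  qed
qed simp

text \<open>Both \<open>comp_C\<close> and \<open>comp_D\<close> list the class sizes of a sequence that is sorted by a class function.
  Its first \<open>k\<close> classes fill an initial segment, whose length is the sum of the first \<open>k\<close> sizes.\<close>

lemma block_no_class_sizes:
  fixes cls :: "'a \<Rightarrow> nat"
  assumes sorted: "sorted (map cls xs)" and cls: "\<And>x. x \<in> set xs \<Longrightarrow> cls x \<in> {1..N}"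
  defines "\<rho> \<equiv> map (\<lambda>a. length (filter (\<lambda>x. cls x = a) xs)) [1..<Suc N]"
  shows "sum_list \<rho> = length xs" "j < length xs \<Longrightarrow> block_no \<rho> (Suc j) = cls (xs ! j)"
proof -
  have len: "length \<rho> = N" by (simp add: \<rho>_def)
  have psum: "sum_list (take k \<rho>) = length (filter (\<lambda>y. y \<le> k) (map cls xs))" if "k \<le> N" for k
    using that
  proof (induction k)
    case 0
    have "filter (\<lambda>y. y \<le> 0) (map cls xs) = []" using cls by (fastforce simp: filter_empty_conv)
    then show ?case by simp
  next
    case (Suc k)
    have "take (Suc k) \<rho> = take k \<rho> @ [\<rho> ! k]" using Suc.prems len by (simp add: take_Suc_conv_app_nth)
    moreover have "\<rho> ! k = length (filter (\<lambda>x. cls x = Suc k) xs)"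
      using Suc.prems by (simp add: \<rho>_def del: upt_Suc)
    moreover have "length (filter (\<lambda>x. cls x \<le> Suc k) ys)
        = length (filter (\<lambda>x. cls x \<le> k) ys) + length (filter (\<lambda>x. cls x = Suc k) ys)" for ys
      by (induction ys) auto
    ultimately show ?case using Suc by (simp add: filter_map comp_def)
  qed
  have "filter (\<lambda>y. y \<le> N) (map cls xs) = map cls xs" using cls by (intro filter_True) auto
  then show "sum_list \<rho> = length xs" using psum[of N] len by simp
  assume j: "j < length xs"
  define c where "c = cls (xs ! j)"
  have c: "c \<in> {1..N}" using cls[of "xs ! j"] j by (simp add: c_def)
  have "j < sum_list (take k \<rho>) \<longleftrightarrow> c \<le> k" if "k \<le> N" for k
    using sorted_filter_prefix[OF sorted, of j k] j by (simp add: psum[OF that] c_def)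
  moreover have "c \<le> N" "c - 1 \<le> N" "\<not> c \<le> c - 1" using c by auto
  ultimately have "j < sum_list (take c \<rho>)" "\<not> j < sum_list (take (c - 1) \<rho>)" by blast+
  then have "Suc j \<in> block \<rho> c" by (simp add: block_def)
  then show "block_no \<rho> (Suc j) = cls (xs ! j)" using block_no_unique c len by (simp add: c_def)
qed

text \<open>This turns the action of a Young subgroup on subsets and set systems into permutations of \<open>{1..i}\<close>.\<close>

lemma list_position_permutation:
  assumes "distinct xs" "distinct ys" and h: "bij_betw h (set xs) (set ys)"
  obtains \<sigma> where "\<sigma> permutes {1..length xs}" "\<And>j. j \<in> {1..length xs} \<Longrightarrow> h (xs ! (j - 1)) = ys ! (\<sigma> j - 1)"
proof -
  have len: "length ys = length xs" using bij_betw_same_card[OF h] assms distinct_card by metis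
  let ?n = "length xs"
  have b: "bij_betw (\<lambda>j. zs ! (j - 1)) {1..length zs} (set zs)" if "distinct zs" for zs :: "'c list"
  proof -
    have "bij_betw (\<lambda>j. j - 1) {1..length zs} {..<length zs}"
      by (rule bij_betwI[of _ _ _ Suc]) auto
    from bij_betw_trans[OF this bij_betw_nth[OF that refl refl]] show ?thesis by (simp add: comp_def)
  qed
  define f where "f j = inv_into {1..?n} (\<lambda>j. ys ! (j - 1)) (h (xs ! (j - 1)))" for j
  have bys: "bij_betw (\<lambda>j. ys ! (j - 1)) {1..?n} (set ys)" using b[OF assms(2)] len by simp
  have bf: "bij_betw f {1..?n} {1..?n}"
    using bij_betw_trans[OF bij_betw_trans[OF b[OF assms(1)] h] bij_betw_inv_into[OF bys]]
    by (simp add: f_def[abs_def] comp_def)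
  define \<sigma> where "\<sigma> j = (if j \<in> {1..?n} then f j else j)" for j
  have "bij_betw \<sigma> {1..?n} {1..?n}"
    by (rule bij_betw_cong[THEN iffD1, OF _ bf]) (simp add: \<sigma>_def)
  then have 1: "\<sigma> permutes {1..?n}" by (rule bij_imp_permutes) (simp only: \<sigma>_def if_False)
  have 2: "h (xs ! (j - 1)) = ys ! (\<sigma> j - 1)" if j: "j \<in> {1..?n}" for j
  proof -
    have "h (xs ! (j - 1)) \<in> set ys" using h j by (auto simp: bij_betw_def)
    then have "ys ! (f j - 1) = h (xs ! (j - 1))"
      unfolding f_def using bys by (intro f_inv_into_f) (simp add: bij_betw_def)
    then show ?thesis using j by (simp add: \<sigma>_def)
  qed
  from 1 2 show thesis by (rule that)
qed

lemma concat_nth_row: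
  "a < length t \<Longrightarrow> b < length (t ! a) \<Longrightarrow> concat t ! (sum_list (take a (map length t)) + b) = t ! a ! b"
proof (induction t arbitrary: a)
  case (Cons w t)
  then show ?case by (cases a) (auto simp: nth_append add.assoc)
qed simp

lemma standard_length:
  assumes "t \<in> standard_tableaux l"
  shows "length t = length l" "length (concat t) = sum_list l" "a < length l \<Longrightarrow> length (t ! a) = l ! a"
proof -
  have m: "map length t = l" using assms by (simp add: standard_tableaux_def)
  then show "length t = length l" by auto
  show "length (concat t) = sum_list l" using m by (simp add: length_concat)
  show "a < length l \<Longrightarrow> length (t ! a) = l ! a" using m by auto
qed

lemma standard_row:
  assumes "t \<in> standard_tableaux l" "a < length l"
  shows "sorted_wrt (<) (t ! a)"
proof -
  have "t ! a \<in> set t" using assms standard_length(1)[OF assms(1)] by simp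
  then show ?thesis using assms(1) by (simp add: standard_tableaux_def)
qed

lemma d_perm_permutes:
  assumes "t \<in> standard_tableaux l"
  shows "d_perm t permutes {1..sum_list l}"
proof (rule bij_imp_permutes)
  have "distinct (concat t)" "set (concat t) = {1..sum_list l}" using assms by (auto simp: standard_tableaux_def)
  then have "bij_betw ((!) (concat t)) {..<sum_list l} {1..sum_list l}"
    using standard_length(2)[OF assms] by (intro bij_betw_nth) auto
  moreover have "bij_betw (\<lambda>j. j - 1) {1..sum_list l} {..<sum_list l}"
    by (rule bij_betwI[of _ _ _ Suc]) auto
  ultimately have "bij_betw ((!) (concat t) \<circ> (\<lambda>j. j - 1)) {1..sum_list l} {1..sum_list l}"
    by (rule bij_betw_trans[rotated])
  then show "bij_betw (d_perm t) {1..sum_list l} {1..sum_list l}"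
    by (rule bij_betw_cong[THEN iffD1, rotated]) (simp add: d_perm_def standard_length(2)[OF assms])
qed (simp only: d_perm_def standard_length(2)[OF assms] if_False)

lemma block_Suc: "block l (Suc a) = {sum_list (take a l)<..sum_list (take (Suc a) l)}"
  by (simp add: block_def)

lemma take_Suc_sum: "a < length l \<Longrightarrow> sum_list (take (Suc a) l) = sum_list (take a l) + l ! a"
  for l :: "nat list"
  by (simp add: take_Suc_conv_app_nth)

lemma card_block: "a < length l \<Longrightarrow> card (block l (Suc a)) = l ! a"
  by (simp add: block_Suc take_Suc_sum)

lemma finite_block: "finite (block l j)"
  by (simp add: block_def)

lemma d_perm_row:
  assumes t: "t \<in> standard_tableaux l" and a: "a < length l"
  shows "t ! a = map (\<lambda>b. d_perm t (Suc (sum_list (take a l) + b))) [0..<l ! a]"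
    "d_perm t ` block l (Suc a) = set (t ! a)"
proof -
  have m: "map length t = l" using t by (simp add: standard_tableaux_def)
  have e: "d_perm t (Suc (sum_list (take a l) + b)) = t ! a ! b" if "b < l ! a" for b
  proof -
    have "sum_list (take a l) + l ! a \<le> sum_list l"
      using take_Suc_sum[OF a] sum_list_take_le[of "Suc a" l] by simp
    then have "Suc (sum_list (take a l) + b) \<in> {1..sum_list l}" using that by simp
    then have "d_perm t (Suc (sum_list (take a l) + b)) = concat t ! (sum_list (take a l) + b)"
      by (simp add: d_perm_def standard_length(2)[OF t])
    also have "\<dots> = t ! a ! b"
      using concat_nth_row[of a t b] m a that standard_length[OF t] by simp
    finally show ?thesis .
  qed
  show row: "t ! a = map (\<lambda>b. d_perm t (Suc (sum_list (take a l) + b))) [0..<l ! a]"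
    using a e standard_length(3)[OF t a] by (intro nth_equalityI) auto
  have "block l (Suc a) = (\<lambda>b. Suc (sum_list (take a l) + b)) ` {..<l ! a}"
  proof (intro equalityI subsetI)
    fix x assume "x \<in> block l (Suc a)"
    then have "x = Suc (sum_list (take a l) + (x - Suc (sum_list (take a l))))"
      "x - Suc (sum_list (take a l)) < l ! a" by (auto simp: block_Suc take_Suc_sum[OF a])
    then show "x \<in> (\<lambda>b. Suc (sum_list (take a l) + b)) ` {..<l ! a}" by blast
  qed (auto simp: block_Suc take_Suc_sum[OF a])
  then show "d_perm t ` block l (Suc a) = set (t ! a)"
    by (subst row) (auto simp: image_image)
qed

text \<open>The permutations whose row contents have the types prescribed by \<open>S\<close>.  Up to the row
  stabilizer these are the row-standard tableaux of type \<open>S\<close>, and since the columns of a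
  semistandard \<open>S\<close> increase strictly, these tableaux are standard.\<close>

definition typed_perms :: "nat list \<Rightarrow> nat list \<Rightarrow> tableau \<Rightarrow> transf set" where
  "typed_perms l \<rho> S = {w. w permutes {1..sum_list l} \<and>
     (\<forall>a<length l. image_mset (\<lambda>x. block_no \<rho> (w x)) (mset_set (block l (Suc a))) = mset (S ! a))}"

lemma finite_typed_perms: "finite (typed_perms l \<rho> S)"
  by (rule finite_subset[of _ "{w. w permutes {1..sum_list l}}"]) (auto simp: typed_perms_def finite_permutations)

lemma young_block: "\<sigma> \<in> young l \<Longrightarrow> a < length l \<Longrightarrow> \<sigma> ` block l (Suc a) = block l (Suc a)"
  by (simp add: young_def)

lemma image_mset_permuted:
  assumes "\<sigma> permutes X" "\<sigma> ` B = B"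
  shows "image_mset (\<lambda>x. f (\<sigma> x)) (mset_set B) = image_mset f (mset_set B)"
proof -
  have "image_mset \<sigma> (mset_set B) = mset_set (\<sigma> ` B)"
    using permutes_inj[OF assms(1)] by (intro image_mset_mset_set) (auto intro: inj_on_subset)
  then have "image_mset f (image_mset \<sigma> (mset_set B)) = image_mset f (mset_set B)" using assms(2) by simp
  then show ?thesis by (simp add: multiset.map_comp comp_def)
qed

lemma sorted_mset_eq: "sorted xs \<Longrightarrow> sorted ys \<Longrightarrow> mset xs = mset ys \<Longrightarrow> xs = (ys :: nat list)"
  by (metis sorted_sort_id sorted_list_of_multiset_mset)

text \<open>A permutation \<open>w\<close> of this kind determines \<open>s\<close> by sorting the image of each row, and \<open>\<sigma>\<close> is the
  rearrangement inside the rows.\<close>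

lemma typed_perms_bij:
  assumes S: "S \<in> semistandard_tableaux l \<rho>" and \<rho>: "sum_list \<rho> = sum_list l"
    and l: "sorted_wrt (\<ge>) l"
  shows "bij_betw (\<lambda>(s, \<sigma>). d_perm s \<circ> \<sigma>)
    ({s \<in> standard_tableaux l. tableau_type \<rho> s = S} \<times> young l) (typed_perms l \<rho> S)"
  unfolding bij_betw_def
proof (intro conjI equalityI subsetI)
  let ?X = "{s \<in> standard_tableaux l. tableau_type \<rho> s = S}"
  show "inj_on (\<lambda>(s, \<sigma>). d_perm s \<circ> \<sigma>) (?X \<times> young l)"
  proof (rule inj_onI, clarify)
    fix s \<sigma> s' \<sigma>' assume s: "s \<in> standard_tableaux l" "s' \<in> standard_tableaux l"
      and \<sigma>: "\<sigma> \<in> young l" "\<sigma>' \<in> young l" and eq: "d_perm s \<circ> \<sigma> = d_perm s' \<circ> \<sigma>'"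
    have "s ! a = s' ! a" if a: "a < length l" for a
    proof -
      have "set (s ! a) = (d_perm s \<circ> \<sigma>) ` block l (Suc a)"
        by (simp only: image_comp[symmetric] young_block[OF \<sigma>(1) a] d_perm_row(2)[OF s(1) a])
      also have "\<dots> = set (s' ! a)"
        by (simp only: eq image_comp[symmetric] young_block[OF \<sigma>(2) a] d_perm_row(2)[OF s(2) a])
      finally have "set (s ! a) = set (s' ! a)" .
      moreover have "sorted_wrt (<) (s ! a)" "sorted_wrt (<) (s' ! a)"
        using s a by (simp_all add: standard_row)
      ultimately show ?thesis using strict_sorted_equal by blast
    qed
    then have ss: "s = s'" using standard_length(1)[OF s(1)] standard_length(1)[OF s(2)]
      by (intro nth_equalityI) auto
    moreover have "\<sigma> = \<sigma>'"
      using eq permutes_inj[OF d_perm_permutes[OF s(1)]] unfolding ss by (auto simp: fun_eq_iff inj_def)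
    ultimately show "s = s' \<and> \<sigma> = \<sigma>'" by blast
  qed
  fix w assume "w \<in> (\<lambda>(s, \<sigma>). d_perm s \<circ> \<sigma>) ` (?X \<times> young l)"
  then obtain s \<sigma> where s: "s \<in> standard_tableaux l" "tableau_type \<rho> s = S" "\<sigma> \<in> young l" "w = d_perm s \<circ> \<sigma>"
    by auto
  have "w permutes {1..sum_list l}"
    using s d_perm_permutes young_permutes permutes_compose by blast
  moreover have "image_mset (\<lambda>x. block_no \<rho> (w x)) (mset_set (block l (Suc a))) = mset (S ! a)"
    if a: "a < length l" for a
  proof -
    have "image_mset (\<lambda>x. block_no \<rho> (d_perm s (\<sigma> x))) (mset_set (block l (Suc a)))
        = image_mset (\<lambda>x. block_no \<rho> (d_perm s x)) (mset_set (block l (Suc a)))"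
      using image_mset_permuted[OF young_permutes[OF s(3)] young_block[OF s(3) a], of "\<lambda>x. block_no \<rho> (d_perm s x)"] .
    also have "\<dots> = image_mset (block_no \<rho>) (image_mset (d_perm s) (mset_set (block l (Suc a))))"
      by (simp add: multiset.map_comp comp_def)
    also have "image_mset (d_perm s) (mset_set (block l (Suc a))) = mset_set (set (s ! a))"
      using permutes_inj[OF d_perm_permutes[OF s(1)]] d_perm_row(2)[OF s(1) a]
      by (subst image_mset_mset_set) (auto intro: inj_on_subset)
    also have "mset_set (set (s ! a)) = mset (s ! a)"
    proof (rule mset_set_set)
      have "sorted_wrt (<) (s ! a)" using s(1) a by (simp add: standard_row)
      then show "distinct (s ! a)" by (simp add: strict_sorted_iff)
    qed
    also have "image_mset (block_no \<rho>) (mset (s ! a)) = mset (S ! a)"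
      using s(1,2) a standard_length(1)[OF s(1)] by (auto simp: tableau_type_def)
    finally show ?thesis by (simp add: s(4))
  qed
  ultimately show "w \<in> typed_perms l \<rho> S" by (simp add: typed_perms_def)
next
  let ?X = "{s \<in> standard_tableaux l. tableau_type \<rho> s = S}"
  fix w assume w: "w \<in> typed_perms l \<rho> S"
  then have wp: "w permutes {1..sum_list l}" by (simp add: typed_perms_def)
  let ?R = "\<lambda>a. block l (Suc a)"
  \<comment> \<open>The rows of the tableau are the sorted images of the rows of the row-reading tableau.\<close>
  define s where "s = map (\<lambda>a. sorted_list_of_set (w ` ?R a)) [0..<length l]"
  have s_nth: "s ! a = sorted_list_of_set (w ` ?R a)" "length s = length l" if "a < length l" for a
    using that by (simp_all add: s_def)
  have set_s: "set (s ! a) = w ` ?R a" if "a < length l" for a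
    using s_nth[OF that] finite_block by simp
  have sub_s: "set (s ! a) \<subseteq> {1..sum_list \<rho>}" if "a < length l" for a
  proof -
    have "set (s ! a) \<subseteq> w ` {1..sum_list l}" unfolding set_s[OF that] by (intro image_mono block_subset)
    then show ?thesis by (simp only: permutes_image[OF wp] \<rho>)
  qed
  have cardR: "card (w ` ?R a) = l ! a" if "a < length l" for a
    using card_block[OF that] permutes_inj[OF wp] by (subst card_image) (auto intro: inj_on_subset)
  have len_s: "map length s = l" using cardR by (intro nth_equalityI) (auto simp: s_def)
  have ul: "(\<Union>a<length l. ?R a) = {1..sum_list l}"
  proof (intro equalityI subsetI)
    fix x assume x: "x \<in> {1..sum_list l}"
    have "block_no l x - 1 < length l" "Suc (block_no l x - 1) = block_no l x" using block_no_mem(1)[OF x] by auto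
    then show "x \<in> (\<Union>a<length l. ?R a)" using block_no_mem(2)[OF x] by (metis UN_I lessThan_iff)
  next
    fix x assume "x \<in> (\<Union>a<length l. ?R a)"
    then show "x \<in> {1..sum_list l}" using block_subset by blast
  qed
  have set_concat: "set (concat s) = {1..sum_list l}"
  proof -
    have "set (concat s) = (\<Union>a<length l. w ` ?R a)"
      using finite_block by (auto simp: s_def)
    also have "\<dots> = w ` {1..sum_list l}" using ul by (simp only: image_UN[symmetric])
    also have "\<dots> = {1..sum_list l}" by (rule permutes_image[OF wp])
    finally show ?thesis .
  qed
  have "length (concat s) = sum_list l" using len_s by (simp add: length_concat)
  then have "distinct (concat s)" using set_concat by (intro card_distinct) simp
  have type: "map (block_no \<rho>) (s ! a) = S ! a" if a: "a < length l" for a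
  proof (rule sorted_mset_eq)
    note sub = sub_s[OF a]
    have "sorted (s ! a)" using s_nth[OF a] by simp
    then show "sorted (map (block_no \<rho>) (s ! a))"
      unfolding sorted_map by (rule sorted_wrt_mono_rel[rotated]) (use sub block_no_mono in blast)
    show "sorted (S ! a)" using S a by (auto simp: semistandard_tableaux_def)
    have "mset (s ! a) = mset_set (w ` ?R a)"
      using s_nth[OF a] set_s[OF a] mset_set_set[of "s ! a"] by simp
    also have "\<dots> = image_mset w (mset_set (?R a))"
      using permutes_inj[OF wp] by (intro image_mset_mset_set[symmetric]) (auto intro: inj_on_subset)
    finally show "mset (map (block_no \<rho>) (s ! a)) = mset (S ! a)"
      using w a by (simp add: typed_perms_def multiset.map_comp comp_def)
  qed
  have lenS: "map length S = l" "length S = length l"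
    using S by (auto simp: semistandard_tableaux_def)
  have ty: "tableau_type \<rho> s = S"
    unfolding tableau_type_def using type lenS(2) s_def by (intro nth_equalityI) auto
  \<comment> \<open>Block numbers are monotone, so types that increase down the columns force increasing entries.\<close>
  have "column_strict s"
    unfolding column_strict_def
  proof (intro allI impI)
    fix a b assume ab: "Suc a < length s \<and> b < length (s ! Suc a)"
    then have al: "a < length l" "Suc a < length l" using s_def by auto
    have lens: "length (S ! c) = length (s ! c)" if "c < length l" for c
      using type[OF that] by (metis length_map)
    have "l ! Suc a \<le> l ! a" using sorted_wrt_nth_less[OF l, of a "Suc a"] al by simp
    then have b: "b < length (s ! Suc a)" "b < length (s ! a)"
      using ab al len_s by (auto dest!: arg_cong[of _ _ "\<lambda>l. l ! a"] arg_cong[of _ _ "\<lambda>l. l ! Suc a"])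
    have "block_no \<rho> (s ! a ! b) < block_no \<rho> (s ! Suc a ! b)"
    proof -
      have "S ! a ! b < S ! Suc a ! b"
        using S al lenS(2) b(1) lens[OF al(2)] by (auto simp: semistandard_tableaux_def column_strict_def)
      then show ?thesis using type[OF al(1), symmetric] type[OF al(2), symmetric] b by simp
    qed
    moreover have "s ! c ! b \<in> {1..sum_list \<rho>}" if "c < length l" "b < length (s ! c)" for c
      using nth_mem[OF that(2)] sub_s[OF that(1)] by blast
    ultimately show "s ! a ! b < s ! Suc a ! b"
      using block_no_mono[of "s ! Suc a ! b" \<rho> "s ! a ! b"] al b by (metis not_le)
  qed
  moreover have "\<forall>v\<in>set s. sorted_wrt (<) v" by (auto simp: s_def)
  ultimately have st: "s \<in> standard_tableaux l"
    using len_s set_concat \<open>distinct (concat s)\<close> by (simp add: standard_tableaux_def)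
  define \<sigma> where "\<sigma> = pinv (d_perm s) \<circ> w"
  note dp = d_perm_permutes[OF st]
  have ws: "w = d_perm s \<circ> \<sigma>"
    using permutes_inv_o(1)[OF dp] by (simp add: \<sigma>_def o_assoc)
  have "\<sigma> \<in> young l"
    unfolding young_def
  proof (intro CollectI conjI ballI)
    show "\<sigma> permutes {1..sum_list l}" unfolding \<sigma>_def by (intro permutes_compose wp permutes_inv dp)
    fix j assume j: "j \<in> {1..length l}"
    then have a: "j - 1 < length l" "Suc (j - 1) = j" by auto
    have "\<sigma> ` block l j = pinv (d_perm s) ` (w ` block l j)" by (simp add: \<sigma>_def image_comp)
    also have "w ` block l j = d_perm s ` block l j"
      using set_s[OF a(1)] d_perm_row(2)[OF st a(1)] a(2) by simp
    also have "pinv (d_perm s) ` (d_perm s ` block l j) = block l j"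
      using image_inv_f_f[OF permutes_inj[OF dp]] .
    finally show "\<sigma> ` block l j = block l j" .
  qed
  then show "w \<in> (\<lambda>(s, \<sigma>). d_perm s \<circ> \<sigma>) ` (?X \<times> young l)"
    using ws st ty by (intro image_eqI[where x = "(s, \<sigma>)"]) auto
qed

lemma young_sum_standard:
  fixes f :: "transf \<Rightarrow> int"
  assumes S: "S \<in> semistandard_tableaux l \<rho>" and \<rho>: "sum_list \<rho> = sum_list l"
    and l: "sorted_wrt (\<ge>) l"
  shows "(\<Sum>s\<in>{s \<in> standard_tableaux l. tableau_type \<rho> s = S}. \<Sum>\<sigma>\<in>young l. f (d_perm s \<circ> \<sigma>))
    = (\<Sum>w\<in>typed_perms l \<rho> S. f w)"
  using sum.reindex_bij_betw[OF typed_perms_bij[OF assms], of f]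
  by (simp add: sum.cartesian_product case_prod_unfold)

text \<open>In the group ring: the product of the sum over \<open>typed_perms\<close> for \<open>S\<close> with the inverse sum for
  \<open>T\<close> is \<open>|\<SS>\<^sub>\<lambda>|\<close> times the Murphy element, because \<open>r\<^sub>\<lambda>\<close> is an idempotent up to this factor.\<close>

lemma murphy_type_card:
  assumes S: "S \<in> semistandard_tableaux l \<rho>" "sum_list \<rho> = sum_list l"
    and T: "T \<in> semistandard_tableaux l \<rho>'" "sum_list \<rho>' = sum_list l"
    and l: "sorted_wrt (\<ge>) l"
  shows "int (card (young l)) * murphy_type l \<rho> S \<rho>' T x
    = int (card {w \<in> typed_perms l \<rho>' T. x \<circ> w \<in> typed_perms l \<rho> S})"
proof -
  let ?X = "{s \<in> standard_tableaux l. tableau_type \<rho> s = S}"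
  let ?Y = "{t \<in> standard_tableaux l. tableau_type \<rho>' t = T}"
  let ?W = "typed_perms l \<rho> S" and ?W' = "typed_perms l \<rho>' T"
  have inner: "(\<Sum>s\<in>?X. \<Sum>\<sigma>\<in>young l. if x = d_perm s \<circ> \<sigma> \<circ> pinv (d_perm t) then 1 else 0 :: int)
      = (if x \<circ> (d_perm t \<circ> \<tau>) \<in> ?W then 1 else 0)" if t: "t \<in> standard_tableaux l" and \<tau>: "\<tau> \<in> young l" for t \<tau>
  proof -
    note dp = permutes_inv_o[OF d_perm_permutes[OF t]]
    have "(\<Sum>s\<in>?X. \<Sum>\<sigma>\<in>young l. if x = d_perm s \<circ> \<sigma> \<circ> pinv (d_perm t) then 1 else 0 :: int)
        = (\<Sum>s\<in>?X. \<Sum>\<sigma>\<in>young l. if x = d_perm s \<circ> (\<sigma> \<circ> pinv \<tau>) \<circ> pinv (d_perm t) then 1 else 0)"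
    proof (rule sum.cong[OF refl])
      fix s
      show "(\<Sum>\<sigma>\<in>young l. if x = d_perm s \<circ> \<sigma> \<circ> pinv (d_perm t) then 1 else 0 :: int)
        = (\<Sum>\<sigma>\<in>young l. if x = d_perm s \<circ> (\<sigma> \<circ> pinv \<tau>) \<circ> pinv (d_perm t) then 1 else 0)"
        by (rule sum.reindex_bij_witness[where i = "\<lambda>\<sigma>. \<sigma> \<circ> pinv \<tau>" and j = "\<lambda>\<sigma>. \<sigma> \<circ> \<tau>"])
          (use \<tau> in \<open>simp_all add: young_inv_cancel[OF \<tau>] young_comp young_inv\<close>)
    qed
    also have "\<dots> = (\<Sum>s\<in>?X. \<Sum>\<sigma>\<in>young l. if d_perm s \<circ> \<sigma> = x \<circ> (d_perm t \<circ> \<tau>) then 1 else 0)"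
    proof (intro sum.cong refl)
      fix s \<sigma>
      have "x = d_perm s \<circ> (\<sigma> \<circ> pinv \<tau>) \<circ> pinv (d_perm t) \<longleftrightarrow> d_perm s \<circ> \<sigma> = x \<circ> (d_perm t \<circ> \<tau>)"
      proof
        assume "x = d_perm s \<circ> (\<sigma> \<circ> pinv \<tau>) \<circ> pinv (d_perm t)"
        then have "x \<circ> (d_perm t \<circ> \<tau>) = d_perm s \<circ> \<sigma> \<circ> pinv \<tau> \<circ> (pinv (d_perm t) \<circ> d_perm t) \<circ> \<tau>"
          by (simp only: comp_assoc)
        also have "\<dots> = d_perm s \<circ> \<sigma>" by (simp only: dp comp_id young_inv_cancel[OF \<tau>])
        finally show "d_perm s \<circ> \<sigma> = x \<circ> (d_perm t \<circ> \<tau>)" by simp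
      next
        assume "d_perm s \<circ> \<sigma> = x \<circ> (d_perm t \<circ> \<tau>)"
        then have "d_perm s \<circ> (\<sigma> \<circ> pinv \<tau>) \<circ> pinv (d_perm t) = x \<circ> d_perm t \<circ> \<tau> \<circ> pinv \<tau> \<circ> pinv (d_perm t)"
          by (simp only: o_assoc)
        also have "\<dots> = x \<circ> (d_perm t \<circ> pinv (d_perm t))"
          by (simp only: young_inv_cancel[OF \<tau>] comp_assoc id_comp)
        also have "\<dots> = x" by (simp only: dp comp_id)
        finally show "x = d_perm s \<circ> (\<sigma> \<circ> pinv \<tau>) \<circ> pinv (d_perm t)" by simp
      qed
      then show "(if x = d_perm s \<circ> (\<sigma> \<circ> pinv \<tau>) \<circ> pinv (d_perm t) then 1 else 0 :: int)
        = (if d_perm s \<circ> \<sigma> = x \<circ> (d_perm t \<circ> \<tau>) then 1 else 0)" by simp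
    qed
    also have "\<dots> = (\<Sum>w\<in>?W. if w = x \<circ> (d_perm t \<circ> \<tau>) then 1 else 0)"
      by (rule young_sum_standard[OF S l])
    also have "\<dots> = (if x \<circ> (d_perm t \<circ> \<tau>) \<in> ?W then 1 else 0)" using finite_typed_perms by simp
    finally show ?thesis .
  qed
  have "int (card (young l)) * murphy_type l \<rho> S \<rho>' T x
      = (\<Sum>\<tau>\<in>young l. \<Sum>t\<in>?Y. \<Sum>s\<in>?X. \<Sum>\<sigma>\<in>young l. if x = d_perm s \<circ> \<sigma> \<circ> pinv (d_perm t) then 1 else 0)"
    by (simp add: murphy_type_def murphy_def sum.swap[of _ ?X])
  also have "\<dots> = (\<Sum>t\<in>?Y. \<Sum>\<tau>\<in>young l. \<Sum>s\<in>?X. \<Sum>\<sigma>\<in>young l. if x = d_perm s \<circ> \<sigma> \<circ> pinv (d_perm t) then 1 else 0)"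
    by (rule sum.swap)
  also have "\<dots> = (\<Sum>t\<in>?Y. \<Sum>\<tau>\<in>young l. if x \<circ> (d_perm t \<circ> \<tau>) \<in> ?W then 1 else 0)"
    by (intro sum.cong refl) (use inner in auto)
  also have "\<dots> = (\<Sum>w\<in>?W'. if x \<circ> w \<in> ?W then 1 else 0)" by (rule young_sum_standard[OF T l])
  also have "\<dots> = int (card {w \<in> ?W'. x \<circ> w \<in> ?W})"
    using finite_typed_perms by (simp add: sum.If_cases Int_def)
  finally show ?thesis .
qed

lemma typed_perms_left:
  assumes \<pi>: "\<pi> permutes {1..sum_list l}" "\<And>x. x \<in> {1..sum_list l} \<Longrightarrow> block_no \<rho> (\<pi> x) = block_no \<rho> x"
  shows "\<pi> \<circ> w \<in> typed_perms l \<rho> S \<longleftrightarrow> w \<in> typed_perms l \<rho> S"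
proof -
  have 1: "\<pi> \<circ> w permutes {1..sum_list l} \<longleftrightarrow> w permutes {1..sum_list l}"
  proof
    assume "\<pi> \<circ> w permutes {1..sum_list l}"
    then have "pinv \<pi> \<circ> (\<pi> \<circ> w) permutes {1..sum_list l}"
      using permutes_inv[OF \<pi>(1)] by (rule permutes_compose)
    then show "w permutes {1..sum_list l}" by (simp only: o_assoc permutes_inv_o[OF \<pi>(1)] id_comp)
  qed (use \<pi>(1) permutes_compose in blast)
  have "image_mset (\<lambda>x. block_no \<rho> ((\<pi> \<circ> w) x)) (mset_set (block l (Suc a)))
      = image_mset (\<lambda>x. block_no \<rho> (w x)) (mset_set (block l (Suc a)))" if "w permutes {1..sum_list l}" for a
  proof (rule image_mset_cong)
    fix x assume "x \<in># mset_set (block l (Suc a))"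
    then have "x \<in> {1..sum_list l}" using block_subset[of l "Suc a"] finite_block by auto
    then have "w x \<in> {1..sum_list l}" using permutes_in_image[OF that] by blast
    then show "block_no \<rho> ((\<pi> \<circ> w) x) = block_no \<rho> (w x)" using \<pi>(2) by simp
  qed
  then show ?thesis unfolding typed_perms_def using 1 by auto
qed

lemma typed_perms_right:
  assumes \<sigma>: "\<sigma> \<in> young l"
  shows "w \<circ> \<sigma> \<in> typed_perms l \<rho> S \<longleftrightarrow> w \<in> typed_perms l \<rho> S"
proof -
  have 1: "w \<circ> \<sigma> permutes {1..sum_list l} \<longleftrightarrow> w permutes {1..sum_list l}"
  proof
    assume "w \<circ> \<sigma> permutes {1..sum_list l}"
    with young_permutes[OF young_inv[OF \<sigma>]] have "(w \<circ> \<sigma>) \<circ> pinv \<sigma> permutes {1..sum_list l}"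
      by (rule permutes_compose)
    then show "w permutes {1..sum_list l}" by (simp only: young_inv_cancel[OF \<sigma>])
  qed (use young_permutes[OF \<sigma>] permutes_compose in blast)
  have "image_mset (\<lambda>x. block_no \<rho> ((w \<circ> \<sigma>) x)) (mset_set (block l (Suc a)))
      = image_mset (\<lambda>x. block_no \<rho> (w x)) (mset_set (block l (Suc a)))" if "a < length l" for a
    using image_mset_permuted[OF young_permutes[OF \<sigma>] young_block[OF \<sigma> that], of "\<lambda>x. block_no \<rho> (w x)"]
    by simp
  then show ?thesis unfolding typed_perms_def using 1 by auto
qed

lemma murphy_type_left:
  assumes S: "S \<in> semistandard_tableaux l \<rho>" "sum_list \<rho> = sum_list l"
    and T: "T \<in> semistandard_tableaux l \<rho>'" "sum_list \<rho>' = sum_list l"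
    and l: "sorted_wrt (\<ge>) l"
    and \<pi>: "\<pi> permutes {1..sum_list l}" "\<And>x. x \<in> {1..sum_list l} \<Longrightarrow> block_no \<rho> (\<pi> x) = block_no \<rho> x"
  shows "murphy_type l \<rho> S \<rho>' T (\<pi> \<circ> x) = murphy_type l \<rho> S \<rho>' T x"
proof -
  have "int (card (young l)) * murphy_type l \<rho> S \<rho>' T (\<pi> \<circ> x)
      = int (card (young l)) * murphy_type l \<rho> S \<rho>' T x"
    by (simp only: murphy_type_card[OF S T l] comp_assoc typed_perms_left[OF \<pi>])
  then show ?thesis using card_young_pos[of l] by simp
qed

lemma murphy_type_right:
  assumes S: "S \<in> semistandard_tableaux l \<rho>" "sum_list \<rho> = sum_list l"
    and T: "T \<in> semistandard_tableaux l \<rho>'" "sum_list \<rho>' = sum_list l"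
    and l: "sorted_wrt (\<ge>) l"
    and \<pi>: "\<pi> permutes {1..sum_list l}" "\<And>x. x \<in> {1..sum_list l} \<Longrightarrow> block_no \<rho>' (\<pi> x) = block_no \<rho>' x"
  shows "murphy_type l \<rho> S \<rho>' T (x \<circ> \<pi>) = murphy_type l \<rho> S \<rho>' T x"
proof -
  note c = permutes_inv_o[OF \<pi>(1)]
  have "bij_betw (\<lambda>w. \<pi> \<circ> w) {w \<in> typed_perms l \<rho>' T. (x \<circ> \<pi>) \<circ> w \<in> typed_perms l \<rho> S}
      {w \<in> typed_perms l \<rho>' T. x \<circ> w \<in> typed_perms l \<rho> S}"
  proof (rule bij_betwI[where g = "\<lambda>w. pinv \<pi> \<circ> w"])
    have cancel: "\<pi> \<circ> (pinv \<pi> \<circ> w) = w" "pinv \<pi> \<circ> (\<pi> \<circ> w) = w" for w :: transf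
      by (simp_all only: o_assoc c id_comp)
    show "(\<lambda>w. pinv \<pi> \<circ> w) \<in> {w \<in> typed_perms l \<rho>' T. x \<circ> w \<in> typed_perms l \<rho> S}
        \<rightarrow> {w \<in> typed_perms l \<rho>' T. (x \<circ> \<pi>) \<circ> w \<in> typed_perms l \<rho> S}"
    proof
      fix w assume w: "w \<in> {w \<in> typed_perms l \<rho>' T. x \<circ> w \<in> typed_perms l \<rho> S}"
      then have "pinv \<pi> \<circ> w \<in> typed_perms l \<rho>' T"
        using typed_perms_left[OF \<pi>, of "pinv \<pi> \<circ> w" T] by (simp only: cancel) simp
      then show "pinv \<pi> \<circ> w \<in> {w \<in> typed_perms l \<rho>' T. (x \<circ> \<pi>) \<circ> w \<in> typed_perms l \<rho> S}"
        using w by (simp only: comp_assoc cancel mem_Collect_eq)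
    qed
    show "(\<lambda>w. \<pi> \<circ> w) \<in> {w \<in> typed_perms l \<rho>' T. (x \<circ> \<pi>) \<circ> w \<in> typed_perms l \<rho> S}
        \<rightarrow> {w \<in> typed_perms l \<rho>' T. x \<circ> w \<in> typed_perms l \<rho> S}"
      using typed_perms_left[OF \<pi>] by (auto simp only: comp_assoc)
  qed (simp_all only: o_assoc c id_comp)
  then have "int (card (young l)) * murphy_type l \<rho> S \<rho>' T (x \<circ> \<pi>)
      = int (card (young l)) * murphy_type l \<rho> S \<rho>' T x"
    unfolding murphy_type_card[OF S T l] by (simp only: bij_betw_same_card)
  then show ?thesis using card_young_pos[of l] by simp
qed

section \<open>Young subgroups acting on subsets and on systems of subsets\<close>

lemma comp_C_invariant:
  assumes "\<rho> \<in> young \<mu>"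
  shows "comp_C \<mu> (\<rho> ` C) = comp_C \<mu> C"
proof -
  have "card (block \<mu> j \<inter> \<rho> ` C) = card (block \<mu> j \<inter> C)" if "j \<in> {1..length \<mu>}" for j
  proof -
    have inj: "inj \<rho>" using young_permutes[OF assms] by (rule permutes_inj)
    have "block \<mu> j \<inter> \<rho> ` C = \<rho> ` (block \<mu> j \<inter> C)"
      using assms that image_Int[OF inj, of "block \<mu> j" C] by (simp add: young_def)
    then show ?thesis using inj by (simp add: card_image inj_on_subset)
  qed
  then show ?thesis by (auto simp: comp_C_def)
qed

text \<open>Increasing order runs through the blocks one after the other.\<close>

lemma comp_C_block_no:
  assumes C: "C \<subseteq> {1..sum_list \<mu>}"
  shows "sum_list (comp_C \<mu> C) = card C"
    "j \<in> {1..card C} \<Longrightarrow> block_no (comp_C \<mu> C) j = block_no \<mu> (phi C j)"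
proof -
  have fC: "finite C" using C finite_subset by blast
  let ?xs = "sorted_list_of_set C"
  have xs: "set ?xs = C" "distinct ?xs" "length ?xs = card C" "sorted ?xs" using fC by auto
  have "sorted (map (block_no \<mu>) ?xs)"
    unfolding sorted_map
    by (rule sorted_wrt_mono_rel[OF _ xs(4)]) (use C xs(1) block_no_mono in blast)
  moreover have "block_no \<mu> x \<in> {1..length \<mu>}" if "x \<in> set ?xs" for x
    using that C xs(1) block_no_mem(1) by blast
  moreover have "comp_C \<mu> C = map (\<lambda>a. length (filter (\<lambda>x. block_no \<mu> x = a) ?xs)) [1..<Suc (length \<mu>)]"
    unfolding comp_C_def
  proof (rule map_cong[OF refl])
    fix a assume "a \<in> set [1..<Suc (length \<mu>)]"
    then have a: "a \<in> {1..length \<mu>}" by auto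
    have "block \<mu> a \<inter> C = set (filter (\<lambda>x. block_no \<mu> x = a) ?xs)"
      unfolding block_eq_block_no[OF a] using C xs(1) by auto
    then show "card (block \<mu> a \<inter> C) = length (filter (\<lambda>x. block_no \<mu> x = a) ?xs)"
      using distinct_card[of "filter (\<lambda>x. block_no \<mu> x = a) ?xs"] xs(2) by simp
  qed
  ultimately have *: "sum_list (comp_C \<mu> C) = length ?xs"
    "j < length ?xs \<Longrightarrow> block_no (comp_C \<mu> C) (Suc j) = block_no \<mu> (?xs ! j)" for j
    using block_no_class_sizes[of "block_no \<mu>" ?xs "length \<mu>"] by metis+
  show "sum_list (comp_C \<mu> C) = card C" using * xs(3) by simp
  assume "j \<in> {1..card C}"
  then show "block_no (comp_C \<mu> C) j = block_no \<mu> (phi C j)"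
    using *(2)[of "j - 1"] xs(3) by (auto simp: phi_def)
qed

text \<open>Since \<open>\<rho>\<close> preserves the blocks of \<open>\<mu>\<close>, it carries the increasing numbering of \<open>C\<close> to the one of its image up
  to a permutation of the positions that preserves the blocks of \<open>comp_C \<mu> C\<close>.\<close>

lemma phi_young:
  assumes \<rho>: "\<rho> \<in> young \<mu>" and C: "C \<subseteq> {1..sum_list \<mu>}"
  obtains \<sigma> where "\<sigma> permutes {1..card C}" "\<forall>j\<in>{1..card C}. \<rho> (phi C j) = phi (\<rho> ` C) (\<sigma> j)"
    "\<forall>j\<in>{1..card C}. block_no (comp_C \<mu> C) (\<sigma> j) = block_no (comp_C \<mu> C) j"
proof -
  have fC: "finite C" using C finite_subset by blast
  have inj: "inj \<rho>" using young_permutes[OF \<rho>] by (rule permutes_inj)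
  have card: "card (\<rho> ` C) = card C" using inj by (intro card_image) (auto intro: inj_on_subset)
  have sub: "\<rho> ` C \<subseteq> {1..sum_list \<mu>}" using C permutes_image[OF young_permutes[OF \<rho>]] by blast
  have "bij_betw \<rho> (set (sorted_list_of_set C)) (set (sorted_list_of_set (\<rho> ` C)))"
    using fC inj by (auto simp: bij_betw_def intro: inj_on_subset)
  then obtain \<sigma> where s: "\<sigma> permutes {1..length (sorted_list_of_set C)}"
    "\<And>j. j \<in> {1..length (sorted_list_of_set C)} \<Longrightarrow>
      \<rho> (sorted_list_of_set C ! (j - 1)) = sorted_list_of_set (\<rho> ` C) ! (\<sigma> j - 1)"
    using list_position_permutation[of "sorted_list_of_set C" "sorted_list_of_set (\<rho> ` C)" \<rho>] by auto
  have len: "length (sorted_list_of_set C) = card C" using fC by simp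
  have 1: "\<sigma> permutes {1..card C}" using s(1) len by simp
  have 2: "\<rho> (phi C j) = phi (\<rho> ` C) (\<sigma> j)" if j: "j \<in> {1..card C}" for j
    using s(2)[of j] j len permutes_in_image[OF 1, of j] card by (simp add: phi_def)
  have "block_no (comp_C \<mu> C) (\<sigma> j) = block_no (comp_C \<mu> C) j" if j: "j \<in> {1..card C}" for j
  proof -
    have sj: "\<sigma> j \<in> {1..card (\<rho> ` C)}" using permutes_in_image[OF 1, of j] j card by simp
    have pC: "phi C j \<in> {1..sum_list \<mu>}" using bij_betwE[OF phi_bij[OF fC]] j C by blast
    have "block_no (comp_C \<mu> C) (\<sigma> j) = block_no (comp_C \<mu> (\<rho> ` C)) (\<sigma> j)" by (simp add: comp_C_invariant[OF \<rho>])
    also have "\<dots> = block_no \<mu> (\<rho> (phi C j))" by (simp only: comp_C_block_no(2)[OF sub sj] 2[OF j])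
    also have "\<dots> = block_no \<mu> (phi C j)" using \<rho> pC by (simp add: young_iff)
    also have "\<dots> = block_no (comp_C \<mu> C) j" by (rule comp_C_block_no(2)[OF C j, symmetric])
    finally show ?thesis .
  qed
  with 1 2 show thesis by (intro that) auto
qed

text \<open>This makes the definite descriptions behind \<open>orbit_list\<close> and \<open>D_list\<close> meaningful.\<close>

lemma ex1_sorted_list:
  assumes "finite S" and irr: "\<And>x. x \<in> S \<Longrightarrow> \<not> R x x"
    and trans: "\<And>x y z. x \<in> S \<Longrightarrow> y \<in> S \<Longrightarrow> z \<in> S \<Longrightarrow> R x y \<Longrightarrow> R y z \<Longrightarrow> R x z"
    and total: "\<And>x y. x \<in> S \<Longrightarrow> y \<in> S \<Longrightarrow> x \<noteq> y \<Longrightarrow> R x y \<or> R y x"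
  shows "\<exists>!l. set l = S \<and> sorted_wrt R l"
proof -
  have ex: "\<exists>l. set l = F \<and> sorted_wrt R l" if "finite F" "F \<subseteq> S" for F
    using that
  proof (induction F rule: finite_induct)
    case (insert x F)
    then obtain l where l: "set l = F" "sorted_wrt R l" by auto
    let ?l = "filter (\<lambda>y. R y x) l @ [x] @ filter (\<lambda>y. \<not> R y x) l"
    have x: "x \<in> S" and F: "F \<subseteq> S" using insert by auto
    have "R x z" if "z \<in> F" "\<not> R z x" for z using total[of x z] that insert x F by auto
    then have 1: "\<forall>z\<in>set (filter (\<lambda>y. \<not> R y x) l). R x z" using l(1) by simp
    have 2: "\<forall>y\<in>set (filter (\<lambda>y. R y x) l). R y x" by simp
    have "R y z" if "y \<in> set (filter (\<lambda>y. R y x) l)" "z \<in> set (filter (\<lambda>y. \<not> R y x) l)" for y z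
    proof -
      have "y \<in> S" "z \<in> S" using that l(1) F by auto
      moreover have "R y x" "R x z" using that 1 2 by blast+
      ultimately show ?thesis using trans x by blast
    qed
    then have "\<forall>a\<in>set (filter (\<lambda>y. R y x) l). \<forall>b\<in>set ([x] @ filter (\<lambda>y. \<not> R y x) l). R a b"
      by auto
    moreover have "sorted_wrt R ([x] @ filter (\<lambda>y. \<not> R y x) l)"
      using 1 sorted_wrt_filter[OF l(2)] by simp
    ultimately have "sorted_wrt R ?l"
      unfolding sorted_wrt_append[of R "filter (\<lambda>y. R y x) l"] using sorted_wrt_filter[OF l(2)] by blast
    moreover have "set ?l = insert x F" using l(1) by auto
    ultimately show ?case by blast
  qed simp
  have uniq: "l = l'" if "set l = set l'" "set l \<subseteq> S" "sorted_wrt R l" "sorted_wrt R l'" for l l'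
    using that
  proof (induction l arbitrary: l')
    case (Cons a l)
    then obtain b k where l': "l' = b # k" by (cases l') auto
    have aS: "a \<in> S" and bS: "b \<in> S" using Cons.prems l' by auto
    have "a = b"
    proof (rule ccontr)
      assume "a \<noteq> b"
      then have "b \<in> set l" "a \<in> set k" using Cons.prems(1) l' by auto
      then have "R a b" "R b a" using Cons.prems l' by auto
      then show False using irr trans aS bS by blast
    qed
    moreover have "a \<notin> set l" "b \<notin> set k" using Cons.prems irr aS bS l' by auto
    ultimately have "set l = set k" using Cons.prems(1) l' by auto
    then show ?case using Cons l' \<open>a = b\<close> by auto
  qed simp
  obtain l where "set l = S" "sorted_wrt R l" using ex[OF assms(1)] by auto
  then show ?thesis using uniq by (intro ex1I[of _ l]) auto
qed

lemma sorted_wrt_irrefl_distinct: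
  "sorted_wrt R l \<Longrightarrow> (\<And>x. x \<in> set l \<Longrightarrow> \<not> R x x) \<Longrightarrow> distinct l"
  by (induction l) auto

lemma lex_less_trans: "(x, y) \<in> lexord less_than \<Longrightarrow> (y, z) \<in> lexord less_than \<Longrightarrow> (x, z) \<in> lexord less_than"
  using lexord_trans[of x y less_than z] by (simp add: trans_less_than)

lemma lex_less_irrefl: "(x, x) \<notin> lexord less_than"
  by (rule lexord_irreflexive) simp

lemma lex_less_total: 
  assumes "x \<noteq> y"
  shows "(x, y) \<in> lexord less_than \<or> (y, x) \<in> lexord less_than"
proof -
  have "\<forall>a b. (a, b) \<in> less_than \<or> a = b \<or> (b, a) \<in> less_than" by auto
  from lexord_linear[OF this, of x y] show ?thesis using assms by blast
qed

lemma young_vimage: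
  assumes "\<pi> \<in> young \<nu>"
  shows "\<pi> -` d = pinv \<pi> ` d" "card (\<pi> -` d) = card d" "d \<subseteq> {1..sum_list \<nu>} \<Longrightarrow> \<pi> -` d \<subseteq> {1..sum_list \<nu>}"
    "\<pi> ` (\<pi> -` d) = d"
proof -
  have p: "\<pi> permutes {1..sum_list \<nu>}" by (rule young_permutes[OF assms])
  show 1: "\<pi> -` d = pinv \<pi> ` d" using permutes_bij[OF p] by (rule bij_vimage_eq_inv_image)
  show "card (\<pi> -` d) = card d"
    unfolding 1 using permutes_inj[OF permutes_inv[OF p]] by (intro card_image) (auto intro: inj_on_subset)
  show "\<pi> ` (\<pi> -` d) = d" using permutes_surj[OF p] by (rule surj_image_vimage_eq)
  assume "d \<subseteq> {1..sum_list \<nu>}"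
  then have "pinv \<pi> ` d \<subseteq> pinv \<pi> ` {1..sum_list \<nu>}" by (rule image_mono)
  then show "\<pi> -` d \<subseteq> {1..sum_list \<nu>}" by (simp only: 1 permutes_image[OF permutes_inv[OF p]])
qed

lemma sbar_mset:
  assumes d: "d \<subseteq> {1..sum_list \<nu>}"
  shows "sorted (map (block_no \<nu>) (sorted_list_of_set d))"
    "mset (map (block_no \<nu>) (sorted_list_of_set d)) = image_mset (block_no \<nu>) (mset_set d)"
    "filter (\<lambda>x. x \<noteq> 0) (sbar \<nu> d) = map (block_no \<nu>) (sorted_list_of_set d)"
proof -
  have fd: "finite d" using d finite_subset by blast
  show "sorted (map (block_no \<nu>) (sorted_list_of_set d))"
    unfolding sorted_map
  proof (rule sorted_wrt_mono_rel[of _ "(\<le>)"])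
    fix x y assume "x \<in> set (sorted_list_of_set d)" "y \<in> set (sorted_list_of_set d)" "x \<le> y"
    moreover have "set (sorted_list_of_set d) = d" using fd by simp
    ultimately show "block_no \<nu> x \<le> block_no \<nu> y" using d block_no_mono[of x \<nu> y] by blast
  qed simp
  show "mset (map (block_no \<nu>) (sorted_list_of_set d)) = image_mset (block_no \<nu>) (mset_set d)"
    using fd mset_set_set[of "sorted_list_of_set d"] by simp
  have "block_no \<nu> x \<noteq> 0" if "x \<in> d" for x using block_no_mem(1)[of x \<nu>] that d by auto
  then show "filter (\<lambda>x. x \<noteq> 0) (sbar \<nu> d) = map (block_no \<nu>) (sorted_list_of_set d)"
    using fd by (auto simp: sbar_def filter_empty_conv intro!: filter_True)
qed

lemma sbar_invariant:
  assumes \<pi>: "\<pi> \<in> young \<nu>" and d: "d \<subseteq> {1..sum_list \<nu>}"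
  shows "sbar \<nu> (\<pi> -` d) = sbar \<nu> d"
proof -
  note v = young_vimage[OF \<pi>]
  have "image_mset (block_no \<nu>) (mset_set (\<pi> -` d)) = image_mset (block_no \<nu>) (image_mset (pinv \<pi>) (mset_set d))"
    unfolding v(1) using permutes_inj[OF young_permutes[OF young_inv[OF \<pi>]]]
    by (subst image_mset_mset_set) (auto intro: inj_on_subset)
  also have "\<dots> = image_mset (block_no \<nu>) (mset_set d)"
    unfolding multiset.map_comp
  proof (rule image_mset_cong)
    fix x assume "x \<in># mset_set d"
    then have "x \<in> {1..sum_list \<nu>}" using d finite_subset[OF d] by auto
    then show "(block_no \<nu> \<circ> pinv \<pi>) x = block_no \<nu> x" using young_inv[OF \<pi>] by (simp add: young_iff)
  qed
  finally have "map (block_no \<nu>) (sorted_list_of_set (\<pi> -` d)) = map (block_no \<nu>) (sorted_list_of_set d)"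
    using sbar_mset[OF d] sbar_mset[OF v(3)[OF d]] by (intro sorted_mset_eq) simp_all
  then show ?thesis by (simp add: sbar_def v(2))
qed

text \<open>Equal strings mean that \<open>d\<close> and \<open>d'\<close> have equally many elements in each block, hence so have their
  complements, and a permutation can be chosen block by block.\<close>

lemma sbar_eq_orbit:
  assumes d: "d \<subseteq> {1..sum_list \<nu>}" "d' \<subseteq> {1..sum_list \<nu>}" and eq: "sbar \<nu> d = sbar \<nu> d'"
  obtains \<pi> where "\<pi> \<in> young \<nu>" "\<pi> -` d = d'"
proof -
  let ?A = "{1..sum_list \<nu>}"
  have fin: "finite d" "finite d'" using d finite_subset by blast+
  have m: "image_mset (block_no \<nu>) (mset_set d) = image_mset (block_no \<nu>) (mset_set d')"
    using sbar_mset(2,3)[OF d(1)] sbar_mset(2,3)[OF d(2)] eq by metis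
  \<comment> \<open>How many points of each block lie in \<open>e\<close> determines how many lie outside.\<close>
  have part: "image_mset (\<lambda>x. (block_no \<nu> x, x \<in> e)) (mset_set ?A)
      = image_mset (\<lambda>b. (b, True)) (image_mset (block_no \<nu>) (mset_set e))
        + image_mset (\<lambda>b. (b, False)) (image_mset (block_no \<nu>) (mset_set ?A) - image_mset (block_no \<nu>) (mset_set e))"
    if e: "e \<subseteq> ?A" for e
  proof -
    have fe: "finite e" using e finite_subset by blast
    have split: "mset_set ?A = mset_set e + mset_set (?A - e)"
      using e fe mset_set_Union[of e "?A - e"] by (simp add: Un_absorb1)
    have 1: "image_mset (\<lambda>x. (block_no \<nu> x, x \<in> e)) (mset_set e) = image_mset (\<lambda>x. (block_no \<nu> x, True)) (mset_set e)"
      using fe by (intro image_mset_cong) auto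
    have 2: "image_mset (\<lambda>x. (block_no \<nu> x, x \<in> e)) (mset_set (?A - e)) = image_mset (\<lambda>x. (block_no \<nu> x, False)) (mset_set (?A - e))"
      by (intro image_mset_cong) auto
    show ?thesis unfolding split image_mset_union 1 2 by (simp add: multiset.map_comp comp_def)
  qed
  have "image_mset (\<lambda>x. (block_no \<nu> x, x \<in> d')) (mset_set ?A) = image_mset (\<lambda>x. (block_no \<nu> x, x \<in> d)) (mset_set ?A)"
    unfolding part[OF d(1)] part[OF d(2)] m ..
  then obtain p where p: "p permutes ?A" "\<forall>x\<in>?A. (block_no \<nu> x, x \<in> d') = (block_no \<nu> (p x), p x \<in> d)"
    using image_mset_eq_implies_permutes[of ?A "\<lambda>x. (block_no \<nu> x, x \<in> d')" "\<lambda>x. (block_no \<nu> x, x \<in> d)"]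
    by (metis finite_atLeastAtMost)
  have "p \<in> young \<nu>" using p by (simp add: young_iff)
  moreover have "p -` d = d'"
  proof (rule Set.set_eqI)
    fix x
    show "x \<in> p -` d \<longleftrightarrow> x \<in> d'"
    proof (cases "x \<in> ?A")
      case False
      then have "p x = x" using p(1) permutes_not_in by metis
      then show ?thesis using False d by auto
    qed (use p(2) in auto)
  qed
  ultimately show thesis by (rule that)
qed

lemma subset_orbits_mem:
  assumes "P \<in> subset_orbits \<nu>" "d \<in> P"
  shows "d \<subseteq> {1..sum_list \<nu>}" "\<pi> \<in> young \<nu> \<Longrightarrow> \<pi> -` d \<in> P"
    "d' \<in> P \<Longrightarrow> sbar \<nu> d' = sbar \<nu> d"
proof -
  from assms obtain e \<sigma> where e: "e \<subseteq> {1..sum_list \<nu>}" "P = (\<lambda>\<pi>. \<pi> -` e) ` young \<nu>" "\<sigma> \<in> young \<nu>" "d = \<sigma> -` e"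
    by (auto simp: subset_orbits_def)
  show "d \<subseteq> {1..sum_list \<nu>}" using young_vimage(3)[OF e(3,1)] e(4) by simp
  show "\<pi> -` d \<in> P" if "\<pi> \<in> young \<nu>"
  proof -
    have "\<pi> -` d = (\<sigma> \<circ> \<pi>) -` e" by (simp add: e(4) vimage_comp)
    then show ?thesis using young_comp[OF e(3) that] e(2) by blast
  qed
  show "sbar \<nu> d' = sbar \<nu> d" if "d' \<in> P"
  proof -
    from that obtain \<tau> where t: "\<tau> \<in> young \<nu>" "d' = \<tau> -` e" unfolding e(2) by blast
    show ?thesis unfolding t(2) e(4) by (simp only: sbar_invariant[OF t(1) e(1)] sbar_invariant[OF e(3,1)])
  qed
qed

abbreviation orbit_less :: "nat list \<Rightarrow> nat set set \<Rightarrow> nat set set \<Rightarrow> bool" where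
  "orbit_less \<nu> P Q \<equiv> \<forall>d\<in>P. \<forall>d'\<in>Q. (sbar \<nu> d, sbar \<nu> d') \<in> lexord less_than"

lemma orbit_list_spec:
  "set (orbit_list \<nu>) = subset_orbits \<nu> \<and> sorted_wrt (orbit_less \<nu>) (orbit_list \<nu>)"
  unfolding orbit_list_def
proof (rule theI', rule ex1_sorted_list)
  show "finite (subset_orbits \<nu>)" by (simp add: subset_orbits_def)
  have ne: "\<exists>d. d \<in> P" if "P \<in> subset_orbits \<nu>" for P
    using that young_id[of \<nu>] by (auto simp: subset_orbits_def)
  show "\<not> orbit_less \<nu> P P" if "P \<in> subset_orbits \<nu>" for P
    using ne[OF that] lex_less_irrefl by blast
  show "orbit_less \<nu> P R" if "Q \<in> subset_orbits \<nu>" "orbit_less \<nu> P Q" "orbit_less \<nu> Q R" for P Q R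
    using ne[OF that(1)] that(2,3) lex_less_trans by blast
  show "orbit_less \<nu> P Q \<or> orbit_less \<nu> Q P" if PQ: "P \<in> subset_orbits \<nu>" "Q \<in> subset_orbits \<nu>" "P \<noteq> Q" for P Q
  proof -
    obtain d d' where d: "d \<in> P" "d' \<in> Q" using ne PQ by blast
    have "sbar \<nu> d \<noteq> sbar \<nu> d'"
    proof
      assume eq: "sbar \<nu> d = sbar \<nu> d'"
      obtain e \<sigma> where e: "e \<subseteq> {1..sum_list \<nu>}" "P = (\<lambda>\<pi>. \<pi> -` e) ` young \<nu>" "\<sigma> \<in> young \<nu>" "d = \<sigma> -` e"
        using PQ(1) d(1) by (auto simp: subset_orbits_def)
      obtain e' \<sigma>' where e': "e' \<subseteq> {1..sum_list \<nu>}" "Q = (\<lambda>\<pi>. \<pi> -` e') ` young \<nu>" "\<sigma>' \<in> young \<nu>" "d' = \<sigma>' -` e'"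
        using PQ(2) d(2) by (auto simp: subset_orbits_def)
      have see: "sbar \<nu> e = sbar \<nu> e'"
        using eq unfolding e(4) e'(4) by (simp only: sbar_invariant[OF e(3,1)] sbar_invariant[OF e'(3,1)])
      obtain \<tau> where t: "\<tau> \<in> young \<nu>" "\<tau> -` e = e'" by (rule sbar_eq_orbit[OF e(1) e'(1) see])
      obtain \<tau>' where t': "\<tau>' \<in> young \<nu>" "\<tau>' -` e' = e" by (rule sbar_eq_orbit[OF e'(1) e(1) see[symmetric]])
      have "\<pi> -` e \<in> Q" if "\<pi> \<in> young \<nu>" for \<pi>
      proof -
        have "\<pi> -` e = (\<tau>' \<circ> \<pi>) -` e'" using t'(2) by (simp add: vimage_comp[symmetric])
        then show ?thesis using young_comp[OF t'(1) that] e'(2) by blast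
      qed
      moreover have "\<pi> -` e' \<in> P" if "\<pi> \<in> young \<nu>" for \<pi>
      proof -
        have "\<pi> -` e' = (\<tau> \<circ> \<pi>) -` e" using t(2) by (simp add: vimage_comp[symmetric])
        then show ?thesis using young_comp[OF t(1) that] e(2) by blast
      qed
      ultimately show False using PQ(3) e(2) e'(2) by blast
    qed
    then have "(sbar \<nu> d, sbar \<nu> d') \<in> lexord less_than \<or> (sbar \<nu> d', sbar \<nu> d) \<in> lexord less_than"
      by (rule lex_less_total)
    then show ?thesis using subset_orbits_mem(3)[OF PQ(1) d(1)] subset_orbits_mem(3)[OF PQ(2) d(2)] by metis
  qed
qed

definition orbit_no :: "nat list \<Rightarrow> nat set \<Rightarrow> nat" where
  "orbit_no \<nu> d = (THE a. a \<in> {1..length (orbit_list \<nu>)} \<and> d \<in> orbit_list \<nu> ! (a - 1))"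

lemma orbit_list_less:
  assumes "a < b" "b < length (orbit_list \<nu>)" "d \<in> orbit_list \<nu> ! a" "d' \<in> orbit_list \<nu> ! b"
  shows "(sbar \<nu> d, sbar \<nu> d') \<in> lexord less_than"
  using sorted_wrt_nth_less[OF conjunct2[OF orbit_list_spec] assms(1,2)] assms(3,4) by blast

lemma orbit_no_unique:
  assumes "a \<in> {1..length (orbit_list \<nu>)}" "d \<in> orbit_list \<nu> ! (a - 1)"
  shows "orbit_no \<nu> d = a"
  unfolding orbit_no_def
proof (rule the_equality)
  fix b assume b: "b \<in> {1..length (orbit_list \<nu>)} \<and> d \<in> orbit_list \<nu> ! (b - 1)"
  show "b = a"
  proof (rule ccontr)
    assume "b \<noteq> a"
    moreover have "1 \<le> a" "1 \<le> b" using assms(1) b by simp_all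
    ultimately consider "b - 1 < a - 1" | "a - 1 < b - 1" by linarith
    then have "(sbar \<nu> d, sbar \<nu> d) \<in> lexord less_than"
    proof cases
      case 1
      have "a - 1 < length (orbit_list \<nu>)" using assms(1) by auto
      from orbit_list_less[OF 1 this conjunct2[OF b] assms(2)] show ?thesis .
    next
      case 2
      have "b - 1 < length (orbit_list \<nu>)" using b by auto
      from orbit_list_less[OF 2 this assms(2) conjunct2[OF b]] show ?thesis .
    qed
    then show False using lex_less_irrefl by blast
  qed
qed (use assms in simp)

lemma orbit_no_mem:
  assumes "d \<subseteq> {1..sum_list \<nu>}"
  shows "orbit_no \<nu> d \<in> {1..length (orbit_list \<nu>)}" "d \<in> orbit_list \<nu> ! (orbit_no \<nu> d - 1)"
proof -
  have d: "d \<in> (\<lambda>\<pi>. \<pi> -` d) ` young \<nu>"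
    by (rule image_eqI[of _ _ id]) (simp_all add: young_id)
  have "(\<lambda>\<pi>. \<pi> -` d) ` young \<nu> \<in> set (orbit_list \<nu>)"
    using assms conjunct1[OF orbit_list_spec[of \<nu>]] by (auto simp: subset_orbits_def)
  then obtain a where a: "a < length (orbit_list \<nu>)" "orbit_list \<nu> ! a = (\<lambda>\<pi>. \<pi> -` d) ` young \<nu>"
    by (auto simp: in_set_conv_nth)
  then have 1: "Suc a \<in> {1..length (orbit_list \<nu>)}" "d \<in> orbit_list \<nu> ! (Suc a - 1)" using d by auto
  then show "orbit_no \<nu> d \<in> {1..length (orbit_list \<nu>)}" "d \<in> orbit_list \<nu> ! (orbit_no \<nu> d - 1)"
    using orbit_no_unique[OF 1] by simp_all
qed

lemma orbit_list_nth: "a \<in> {1..length (orbit_list \<nu>)} \<Longrightarrow> orbit_list \<nu> ! (a - 1) \<in> subset_orbits \<nu>"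
proof -
  assume "a \<in> {1..length (orbit_list \<nu>)}"
  then have "orbit_list \<nu> ! (a - 1) \<in> set (orbit_list \<nu>)" by (intro nth_mem) auto
  then show ?thesis using conjunct1[OF orbit_list_spec[of \<nu>]] by simp
qed

lemma orbit_no_invariant:
  assumes "\<pi> \<in> young \<nu>" "d \<subseteq> {1..sum_list \<nu>}"
  shows "orbit_no \<nu> (\<pi> -` d) = orbit_no \<nu> d"
  by (rule orbit_no_unique[OF orbit_no_mem(1)[OF assms(2)]
      subset_orbits_mem(2)[OF orbit_list_nth[OF orbit_no_mem(1)[OF assms(2)]] orbit_no_mem(2)[OF assms(2)] assms(1)]])

lemma orbit_no_eq_iff:
  assumes "d \<subseteq> {1..sum_list \<nu>}" "a \<in> {1..length (orbit_list \<nu>)}"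
  shows "d \<in> orbit_list \<nu> ! (a - 1) \<longleftrightarrow> orbit_no \<nu> d = a"
proof
  assume "d \<in> orbit_list \<nu> ! (a - 1)"
  then show "orbit_no \<nu> d = a" by (rule orbit_no_unique[OF assms(2)])
next
  assume "orbit_no \<nu> d = a"
  then show "d \<in> orbit_list \<nu> ! (a - 1)" using orbit_no_mem(2)[OF assms(1)] by simp
qed

lemma subset_less_orbit_no:
  assumes "subset_less \<nu> d d'" "d \<subseteq> {1..sum_list \<nu>}" "d' \<subseteq> {1..sum_list \<nu>}"
  shows "orbit_no \<nu> d \<le> orbit_no \<nu> d'"
  using assms(1) unfolding subset_less_def
proof (elim disjE conjE)
  assume less: "(sbar \<nu> d, sbar \<nu> d') \<in> lexord less_than"
  show ?thesis
  proof (rule ccontr)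
    assume "\<not> ?thesis"
    then have "orbit_no \<nu> d' - 1 < orbit_no \<nu> d - 1" "orbit_no \<nu> d - 1 < length (orbit_list \<nu>)"
      using orbit_no_mem(1)[OF assms(2)] orbit_no_mem(1)[OF assms(3)] by auto
    from orbit_list_less[OF this orbit_no_mem(2)[OF assms(3)] orbit_no_mem(2)[OF assms(2)]]
    show False using less lex_less_trans lex_less_irrefl by blast
  qed
next
  assume eq: "sbar \<nu> d = sbar \<nu> d'"
  obtain \<pi> where "\<pi> \<in> young \<nu>" "\<pi> -` d = d'" by (rule sbar_eq_orbit[OF assms(2,3) eq])
  then show ?thesis using orbit_no_invariant[of \<pi> \<nu> d] assms(2) by simp
qed

lemma subset_less_irrefl: "\<not> subset_less \<nu> d d"
  using lex_less_irrefl by (auto simp: subset_less_def)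

lemma D_list_ex1:
  assumes D: "D \<subseteq> Pow {1..r}"
  shows "\<exists>!l. set l = D \<and> sorted_wrt (subset_less \<nu>) l"
proof (rule ex1_sorted_list)
  have fin: "finite d" if "d \<in> D" for d using that D finite_subset[of d "{1..r}"] by auto
  show "finite D" using D finite_subset by blast
  show "subset_less \<nu> x z" if "subset_less \<nu> x y" "subset_less \<nu> y z" for x y z
    using that lex_less_trans unfolding subset_less_def by metis
  show "subset_less \<nu> x y \<or> subset_less \<nu> y x" if "x \<in> D" "y \<in> D" "x \<noteq> y" for x y
  proof -
    have "sorted_list_of_set x \<noteq> sorted_list_of_set y"
      using that fin by (metis sorted_list_of_set.set_sorted_key_list_of_set)
    then show ?thesis using lex_less_total unfolding subset_less_def by metis
  qed
qed (rule subset_less_irrefl)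

lemma D_list_eqI:
  assumes "D \<subseteq> Pow {1..r}" "set l = D" "sorted_wrt (subset_less \<nu>) l"
  shows "D_list \<nu> D = l"
  unfolding D_list_def using assms by (intro the1_equality D_list_ex1) auto

lemma D_list_spec:
  assumes D: "D \<subseteq> Pow {1..r}"
  shows "set (D_list \<nu> D) = D" "sorted_wrt (subset_less \<nu>) (D_list \<nu> D)" "distinct (D_list \<nu> D)"
    "length (D_list \<nu> D) = card D"
proof -
  have "set (D_list \<nu> D) = D \<and> sorted_wrt (subset_less \<nu>) (D_list \<nu> D)"
    unfolding D_list_def by (rule theI', rule D_list_ex1[OF D])
  then show 1: "set (D_list \<nu> D) = D" and 2: "sorted_wrt (subset_less \<nu>) (D_list \<nu> D)" by simp_all
  show 3: "distinct (D_list \<nu> D)" by (rule sorted_wrt_irrefl_distinct[OF 2 subset_less_irrefl])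
  show "length (D_list \<nu> D) = card D" using distinct_card[OF 3] 1 by simp
qed

text \<open>The order on subsets refines the order of the orbits, so \<open>D_list\<close> runs through the orbits one after
  the other.\<close>

lemma comp_D_block_no:
  assumes D: "D \<subseteq> Pow {1..sum_list \<nu>}"
  shows "sum_list (comp_D \<nu> D) = card D"
    "j \<in> {1..card D} \<Longrightarrow> block_no (comp_D \<nu> D) j = orbit_no \<nu> (D_list \<nu> D ! (j - 1))"
proof -
  let ?xs = "D_list \<nu> D" and ?N = "length (orbit_list \<nu>)"
  note xs = D_list_spec[OF D, of \<nu>]
  have "sorted (map (orbit_no \<nu>) ?xs)"
    unfolding sorted_map
    by (rule sorted_wrt_mono_rel[OF _ xs(2)]) (use D xs(1) subset_less_orbit_no in blast)
  moreover have "orbit_no \<nu> x \<in> {1..?N}" if "x \<in> set ?xs" for x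
    using that D xs(1) orbit_no_mem(1) by blast
  moreover have "comp_D \<nu> D = map (\<lambda>a. length (filter (\<lambda>x. orbit_no \<nu> x = a) ?xs)) [1..<Suc ?N]"
  proof (rule nth_equalityI)
    fix a assume "a < length (comp_D \<nu> D)"
    then have a: "a < ?N" by (simp add: comp_D_def)
    then have a': "Suc a \<in> {1..?N}" by simp
    have "D \<inter> orbit_list \<nu> ! a = set (filter (\<lambda>x. orbit_no \<nu> x = Suc a) ?xs)"
      using orbit_no_eq_iff[OF _ a'] D xs(1) by auto
    then have "card (D \<inter> orbit_list \<nu> ! a) = length (filter (\<lambda>x. orbit_no \<nu> x = Suc a) ?xs)"
      using distinct_card[of "filter (\<lambda>x. orbit_no \<nu> x = Suc a) ?xs"] xs(3) by simp
    then show "comp_D \<nu> D ! a = map (\<lambda>a. length (filter (\<lambda>x. orbit_no \<nu> x = a) ?xs)) [1..<Suc ?N] ! a"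
      using a by (simp add: comp_D_def del: upt_Suc)
  qed (simp add: comp_D_def del: upt_Suc)
  ultimately have *: "sum_list (comp_D \<nu> D) = length ?xs"
    "j < length ?xs \<Longrightarrow> block_no (comp_D \<nu> D) (Suc j) = orbit_no \<nu> (?xs ! j)" for j
    using block_no_class_sizes[of "orbit_no \<nu>" ?xs ?N] by metis+
  show "sum_list (comp_D \<nu> D) = card D" using * xs(4) by simp
  assume "j \<in> {1..card D}"
  then show "block_no (comp_D \<nu> D) j = orbit_no \<nu> (?xs ! (j - 1))"
    using *(2)[of "j - 1"] xs(4) by auto
qed

abbreviation act :: "transf \<Rightarrow> nat set set \<Rightarrow> nat set set" where
  "act \<pi> D \<equiv> (\<lambda>d. \<pi> -` d) ` D"

lemma young_vimage_inj: "\<pi> \<in> young \<nu> \<Longrightarrow> inj (\<lambda>d. \<pi> -` d)"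
  by (rule inj_on_inverseI[of _ "\<lambda>d. \<pi> ` d"]) (rule young_vimage(4))

lemma act_inverse:
  assumes "\<pi> \<in> young \<nu>"
  shows "act (pinv \<pi>) (act \<pi> D) = D" "act \<pi> (act (pinv \<pi>) D) = D"
proof -
  have "pinv \<pi> -` (\<pi> -` d) = d" "\<pi> -` (pinv \<pi> -` d) = d" for d
    by (simp_all only: vimage_comp young_inv_cancel[OF assms] vimage_id id_apply)
  then show "act (pinv \<pi>) (act \<pi> D) = D" "act \<pi> (act (pinv \<pi>) D) = D" by (simp_all only: image_image image_ident)
qed

lemma comp_D_invariant:
  assumes \<pi>: "\<pi> \<in> young \<nu>"
  shows "comp_D \<nu> (act \<pi> D) = comp_D \<nu> D"
  unfolding comp_D_def
proof (rule map_cong[OF refl])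
  fix P assume "P \<in> set (orbit_list \<nu>)"
  then have P: "P \<in> subset_orbits \<nu>" using conjunct1[OF orbit_list_spec[of \<nu>]] by simp
  have "\<pi> -` d \<in> P \<longleftrightarrow> d \<in> P" for d
  proof
    assume "\<pi> -` d \<in> P"
    from subset_orbits_mem(2)[OF P this young_inv[OF \<pi>]] show "d \<in> P"
      by (simp only: vimage_comp young_inv_cancel[OF \<pi>] vimage_id id_apply)
  qed (rule subset_orbits_mem(2)[OF P _ \<pi>])
  then have "act \<pi> D \<inter> P = (\<lambda>d. \<pi> -` d) ` (D \<inter> P)" by auto
  then show "card (act \<pi> D \<inter> P) = card (D \<inter> P)"
    using young_vimage_inj[OF \<pi>] by (simp add: card_image inj_on_subset)
qed

lemma D_sets_act:
  assumes \<pi>: "\<pi> \<in> young \<nu>" and D: "D \<in> D_sets i (sum_list \<nu>)"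
  shows "act \<pi> D \<in> D_sets i (sum_list \<nu>)"
proof -
  have ne: "\<pi> -` d \<noteq> {}" if "d \<noteq> {}" for d
    using young_vimage(4)[OF \<pi>, of d] that by (metis image_empty)
  have "act \<pi> D \<subseteq> Pow {1..sum_list \<nu>} - {{}}"
  proof
    fix e assume "e \<in> act \<pi> D"
    then obtain d where d: "d \<in> D" "e = \<pi> -` d" by blast
    then have "d \<subseteq> {1..sum_list \<nu>}" "d \<noteq> {}" using D by (auto simp: D_sets_def)
    then show "e \<in> Pow {1..sum_list \<nu>} - {{}}"
      using young_vimage(3)[OF \<pi>] ne unfolding d(2) by blast
  qed
  moreover have "disjoint (act \<pi> D)"
  proof (rule disjointI)
    fix a b assume "a \<in> act \<pi> D" "b \<in> act \<pi> D" "a \<noteq> b"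
    then obtain d d' where d: "d \<in> D" "a = \<pi> -` d" "d' \<in> D" "b = \<pi> -` d'" "d \<noteq> d'" by blast
    have "disjoint D" using D by (simp add: D_sets_def)
    then have "d \<inter> d' = {}" using d(1,3,5) by (rule disjointD)
    then show "a \<inter> b = {}" unfolding d(2,4) by blast
  qed
  moreover have "card (act \<pi> D) = card D"
    using young_vimage_inj[OF \<pi>] by (intro card_image) (auto intro: inj_on_subset)
  ultimately show ?thesis using D by (simp add: D_sets_def)
qed

lemma D_sets_facts:
  assumes D: "D \<in> D_sets i r"
  shows "D \<subseteq> Pow {1..r}" "card D = i" "d \<in> D \<Longrightarrow> d' \<in> D \<Longrightarrow> x \<in> d \<Longrightarrow> x \<in> d' \<Longrightarrow> d = d'"
    "\<Union>D \<subseteq> {1..r}" "i \<le> r"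
proof -
  show sub: "D \<subseteq> Pow {1..r}" and card: "card D = i" using D by (auto simp: D_sets_def)
  show "\<Union>D \<subseteq> {1..r}" using sub by auto
  show disj: "d \<in> D \<Longrightarrow> d' \<in> D \<Longrightarrow> x \<in> d \<Longrightarrow> x \<in> d' \<Longrightarrow> d = d'" for d d' x
    using D unfolding D_sets_def disjoint_def by blast
  have ne: "\<exists>x. x \<in> d" if "d \<in> D" for d using D that by (auto simp: D_sets_def)
  define g where "g d = (SOME x. x \<in> d)" for d :: "nat set"
  have g: "g d \<in> d" if "d \<in> D" for d unfolding g_def using ne[OF that] by (rule someI_ex)
  have "inj_on g D" using g disj by (intro inj_onI) metis
  moreover have "g ` D \<subseteq> {1..r}" using g sub by blast
  ultimately show "i \<le> r" using card_inj_on_le[of g D "{1..r}"] card by simp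
qed

lemma psi_eq:
  assumes D: "D \<in> D_sets i (sum_list \<nu>)" and j: "j \<in> {1..i}" and x: "x \<in> D_list \<nu> D ! (j - 1)"
  shows "psi \<nu> D x = j"
proof -
  note f = D_sets_facts[OF D] and L = D_list_spec[OF D_sets_facts(1)[OF D], of \<nu>]
  have mem: "D_list \<nu> D ! (k - 1) \<in> D" if "k \<in> {1..i}" for k
  proof -
    have "D_list \<nu> D ! (k - 1) \<in> set (D_list \<nu> D)" using that L(4) f(2) by (intro nth_mem) auto
    then show ?thesis using L(1) by simp
  qed
  have "(THE k. k \<in> {1..card D} \<and> x \<in> D_list \<nu> D ! (k - 1)) = j"
  proof (rule the_equality)
    fix k assume k: "k \<in> {1..card D} \<and> x \<in> D_list \<nu> D ! (k - 1)"
    then have k': "k \<in> {1..i}" using f(2) by simp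
    have "D_list \<nu> D ! (k - 1) = D_list \<nu> D ! (j - 1)" using f(3)[OF mem[OF k'] mem[OF j]] k x by blast
    then have "k - 1 = j - 1" using nth_eq_iff_index_eq[OF L(3), of "k - 1" "j - 1"] k' j L(4) f(2) by auto
    then show "k = j" using k' j by auto
  qed (use j x f(2) in simp)
  moreover have "x \<in> \<Union>D" using mem[OF j] x by blast
  ultimately show ?thesis by (simp add: psi_def)
qed

lemma psi_outside: "x \<notin> \<Union>D \<Longrightarrow> psi \<nu> D x = (if x \<in> {1..sum_list \<nu>} then 0 else x)"
  by (simp add: psi_def)

lemma psi_obtain:
  assumes D: "D \<in> D_sets i (sum_list \<nu>)" and x: "x \<in> \<Union>D"
  obtains j where "j \<in> {1..i}" "x \<in> D_list \<nu> D ! (j - 1)"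
proof -
  note f = D_sets_facts[OF D] and L = D_list_spec[OF D_sets_facts(1)[OF D], of \<nu>]
  from x obtain d where "d \<in> set (D_list \<nu> D)" "x \<in> d" using L(1) by auto
  then obtain k where "k < i" "x \<in> D_list \<nu> D ! k" using L(4) f(2) by (auto simp: in_set_conv_nth)
  then show thesis using that[of "Suc k"] by simp
qed

lemma psi_range:
  assumes D: "D \<in> D_sets i (sum_list \<nu>)"
  shows "psi \<nu> D x \<in> {1..i} \<or> psi \<nu> D x = 0 \<or> psi \<nu> D x > sum_list \<nu>"
proof (cases "x \<in> \<Union>D")
  case True
  then show ?thesis using psi_obtain[OF D True] psi_eq[OF D] by metis
next
  case False
  then show ?thesis by (auto simp: psi_outside)
qed

text \<open>The counterpart of \<open>phi_young\<close>: the action of \<open>\<pi>\<close> does not change the orbits of the members of \<open>D\<close>, so the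
  two numberings differ by a permutation that preserves the blocks of \<open>comp_D \<nu> D\<close>.\<close>

lemma psi_young:
  assumes \<pi>: "\<pi> \<in> young \<nu>" and D: "D \<in> D_sets i (sum_list \<nu>)"
  obtains \<sigma> where "\<sigma> permutes {1..i}" "psi \<nu> D \<circ> \<pi> = \<sigma> \<circ> psi \<nu> (act \<pi> D)"
    "\<forall>j\<in>{1..i}. block_no (comp_D \<nu> D) (\<sigma> j) = block_no (comp_D \<nu> D) j"
proof -
  let ?D' = "act \<pi> D"
  have D': "?D' \<in> D_sets i (sum_list \<nu>)" by (rule D_sets_act[OF \<pi> D])
  note f = D_sets_facts[OF D] and L = D_list_spec[OF D_sets_facts(1)[OF D], of \<nu>]
  note f' = D_sets_facts[OF D'] and L' = D_list_spec[OF D_sets_facts(1)[OF D'], of \<nu>]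
  have "bij_betw (\<lambda>d. \<pi> ` d) ?D' D"
    by (rule bij_betwI[where g = "\<lambda>d. \<pi> -` d"])
      (use young_vimage(4)[OF \<pi>] in \<open>auto simp: young_vimage(4)[OF \<pi>]\<close>)
  then have "bij_betw (\<lambda>d. \<pi> ` d) (set (D_list \<nu> ?D')) (set (D_list \<nu> D))" by (simp only: L(1) L'(1))
  then obtain \<sigma> where s: "\<sigma> permutes {1..length (D_list \<nu> ?D')}"
    "\<And>j. j \<in> {1..length (D_list \<nu> ?D')} \<Longrightarrow> \<pi> ` (D_list \<nu> ?D' ! (j - 1)) = D_list \<nu> D ! (\<sigma> j - 1)"
    using list_position_permutation[OF L'(3) L(3), of "\<lambda>d. \<pi> ` d"] by metis
  have len: "length (D_list \<nu> ?D') = i" using L'(4) f'(2) by simp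
  have s1: "\<sigma> permutes {1..i}" using s(1) len by simp
  have s2: "\<pi> ` (D_list \<nu> ?D' ! (j - 1)) = D_list \<nu> D ! (\<sigma> j - 1)" if "j \<in> {1..i}" for j
    using s(2) that len by simp
  have sj: "\<sigma> j \<in> {1..i}" if "j \<in> {1..i}" for j using permutes_in_image[OF s1] that by blast
  have \<pi>p: "\<pi> permutes {1..sum_list \<nu>}" by (rule young_permutes[OF \<pi>])
  have eq: "psi \<nu> D (\<pi> x) = \<sigma> (psi \<nu> ?D' x)" for x
  proof (cases "x \<in> \<Union>?D'")
    case True
    then obtain j where j: "j \<in> {1..i}" "x \<in> D_list \<nu> ?D' ! (j - 1)" by (rule psi_obtain[OF D'])
    then have "\<pi> x \<in> D_list \<nu> D ! (\<sigma> j - 1)" using s2[OF j(1)] by blast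
    then show ?thesis using psi_eq[OF D sj[OF j(1)]] psi_eq[OF D' j] by simp
  next
    case False
    then have out: "\<pi> x \<notin> \<Union>D" by auto
    show ?thesis
    proof (cases "x \<in> {1..sum_list \<nu>}")
      case True
      then have "\<pi> x \<in> {1..sum_list \<nu>}" using permutes_in_image[OF \<pi>p] by blast
      moreover have "\<sigma> 0 = 0" using permutes_not_in[OF s1, of 0] by simp
      ultimately show ?thesis by (simp only: psi_outside[OF False] psi_outside[OF out] True if_True)
    next
      case out2: False
      then have "\<pi> x = x" using permutes_not_in[OF \<pi>p] by blast
      moreover have "x \<notin> {1..i}" using out2 f(5) by auto
      then have "\<sigma> x = x" by (rule permutes_not_in[OF s1])
      ultimately show ?thesis using psi_outside[OF False] psi_outside[OF out] out2 by metis
    qed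
  qed
  have "block_no (comp_D \<nu> D) (\<sigma> j) = block_no (comp_D \<nu> D) j" if j: "j \<in> {1..i}" for j
  proof -
    let ?d = "D_list \<nu> D ! (\<sigma> j - 1)" and ?d' = "D_list \<nu> ?D' ! (j - 1)"
    have d': "?d' \<in> ?D'"
    proof -
      have "?d' \<in> set (D_list \<nu> ?D')" using j len by (intro nth_mem) auto
      then show ?thesis using L'(1) by simp
    qed
    then obtain d where d: "d \<in> D" "?d' = \<pi> -` d" by blast
    then have dd: "?d = d" using s2[OF j] young_vimage(4)[OF \<pi>] by metis
    have "block_no (comp_D \<nu> D) (\<sigma> j) = orbit_no \<nu> d"
      using comp_D_block_no(2)[OF f(1), of "\<sigma> j"] sj[OF j] f(2) dd by simp
    also have "\<dots> = orbit_no \<nu> ?d'"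
      using orbit_no_invariant[OF \<pi>, of d] d f(1) by auto
    also have "\<dots> = block_no (comp_D \<nu> ?D') j"
      using comp_D_block_no(2)[OF f'(1), of j] j f'(2) by simp
    finally show ?thesis by (simp add: comp_D_invariant[OF \<pi>])
  qed
  moreover have "psi \<nu> D \<circ> \<pi> = \<sigma> \<circ> psi \<nu> ?D'" using eq by (simp add: fun_eq_iff)
  ultimately show thesis using s1 that by blast
qed

section \<open>The cell basis elements are bi-invariant\<close>

lemma C_orbits_facts:
  assumes P: "P \<in> C_orbits \<mu> i r" and r: "sum_list \<mu> = r" and C: "C \<in> P"
  shows "C \<in> C_sets i r" "\<rho> \<in> young \<mu> \<Longrightarrow> \<rho> ` C \<in> P" "comp_C_orbit \<mu> P = comp_C \<mu> C"
proof -
  from P C obtain C0 \<tau> where C0: "C0 \<in> C_sets i r" "P = (\<lambda>\<rho>. \<rho> ` C0) ` young \<mu>" "\<tau> \<in> young \<mu>" "C = \<tau> ` C0"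
    by (auto simp: C_orbits_def)
  have tp: "\<tau> permutes {1..r}" using young_permutes[OF C0(3)] r by simp
  have "\<tau> ` C0 \<subseteq> \<tau> ` {1..r}" using C0(1) by (intro image_mono) (simp add: C_sets_def)
  moreover have "card (\<tau> ` C0) = card C0"
    using permutes_inj[OF tp] by (intro card_image) (auto intro: inj_on_subset)
  ultimately show "C \<in> C_sets i r" using C0 permutes_image[OF tp] by (simp add: C_sets_def)
  show "\<rho> ` C \<in> P" if "\<rho> \<in> young \<mu>"
  proof -
    have "\<rho> ` C = (\<rho> \<circ> \<tau>) ` C0" unfolding C0(4) by (rule image_comp)
    then show ?thesis using young_comp[OF that C0(3)] C0(2) by blast
  qed
  have "(SOME C. C \<in> P) \<in> P" using C by (rule someI[of "\<lambda>C. C \<in> P"])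
  then obtain \<tau>' where t': "\<tau>' \<in> young \<mu>" "(SOME C. C \<in> P) = \<tau>' ` C0" unfolding C0(2) by blast
  show "comp_C_orbit \<mu> P = comp_C \<mu> C"
    unfolding comp_C_orbit_def t'(2) C0(4) by (simp only: comp_C_invariant[OF t'(1)] comp_C_invariant[OF C0(3)])
qed

lemma D_orbits_facts:
  assumes Q: "Q \<in> D_orbits M \<nu> i r" and r: "sum_list \<nu> = r" and D: "D \<in> Q"
  shows "D \<in> D_sets i r" "\<pi> \<in> young \<nu> \<Longrightarrow> act \<pi> D \<in> Q" "comp_D_orbit \<nu> Q = comp_D \<nu> D"
proof -
  from Q D obtain D0 \<tau> where D0: "D0 \<in> DM_sets M \<nu> i r" "Q = (\<lambda>\<pi>. act \<pi> D0) ` young \<nu>" "\<tau> \<in> young \<nu>" "D = act \<tau> D0"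
    by (auto simp: D_orbits_def)
  have "D0 \<in> D_sets i (sum_list \<nu>)" using D0(1) r by (simp add: DM_sets_def)
  then show "D \<in> D_sets i r" using D_sets_act[OF D0(3)] D0(4) r by simp
  show "act \<pi> D \<in> Q" if "\<pi> \<in> young \<nu>"
  proof -
    have "act \<pi> D = act (\<tau> \<circ> \<pi>) D0" unfolding D0(4) by (simp only: image_image vimage_comp)
    then show ?thesis using young_comp[OF D0(3) that] D0(2) by blast
  qed
  have "(SOME D. D \<in> Q) \<in> Q" using D by (rule someI[of "\<lambda>D. D \<in> Q"])
  then obtain \<tau>' where t': "\<tau>' \<in> young \<nu>" "(SOME D. D \<in> Q) = act \<tau>' D0" unfolding D0(2) by blast
  show "comp_D_orbit \<nu> Q = comp_D \<nu> D"
    unfolding comp_D_orbit_def t'(2) D0(4) by (simp only: comp_D_invariant[OF t'(1)] comp_D_invariant[OF D0(3)])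
qed

locale cell_pair =
  fixes r n :: nat and M :: "transf set" and l :: "nat list"
    and \<mu> :: "nat list" and P :: "nat set set" and S :: tableau
    and \<nu> :: "nat list" and Q :: "nat set set set" and T :: tableau
  assumes l: "sorted_wrt (\<ge>) l" and L: "(\<mu>, P, S) \<in> L_set r n l" and R: "(\<nu>, Q, T) \<in> R_set r n M l"
begin

lemma data:
  shows "\<mu> \<in> compositions r n" "P \<in> C_orbits \<mu> (sum_list l) r" "S \<in> semistandard_tableaux l (comp_C_orbit \<mu> P)"
    "\<nu> \<in> compositions r n" "Q \<in> D_orbits M \<nu> (sum_list l) r" "T \<in> semistandard_tableaux l (comp_D_orbit \<nu> Q)"
    "sum_list \<mu> = r" "sum_list \<nu> = r"
  using L R by (auto simp: L_set_def R_set_def compositions_def)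

lemma CP:
  assumes "C \<in> P"
  shows "C \<subseteq> {1..r}" "card C = sum_list l" "\<rho> \<in> young \<mu> \<Longrightarrow> \<rho> ` C \<in> P" "comp_C_orbit \<mu> P = comp_C \<mu> C"
  using C_orbits_facts[OF data(2,7) assms] by (auto simp: C_sets_def)

lemma DQ:
  assumes "D \<in> Q"
  shows "D \<in> D_sets (sum_list l) (sum_list \<nu>)" "\<pi> \<in> young \<nu> \<Longrightarrow> act \<pi> D \<in> Q" "comp_D_orbit \<nu> Q = comp_D \<nu> D"
  using D_orbits_facts[OF data(5,8) assms] data(8) by simp_all

lemma comp_sums: "sum_list (comp_C_orbit \<mu> P) = sum_list l" "sum_list (comp_D_orbit \<nu> Q) = sum_list l"
proof -
  obtain C where C: "C \<in> P" using data(2) young_id[of \<mu>] by (auto simp: C_orbits_def)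
  show "sum_list (comp_C_orbit \<mu> P) = sum_list l"
    using comp_C_block_no(1)[of C \<mu>] CP[OF C] data(7) by simp
  obtain D where D: "D \<in> Q" using data(5) young_id[of \<nu>] by (auto simp: D_orbits_def)
  show "sum_list (comp_D_orbit \<nu> Q) = sum_list l"
    using comp_D_block_no(1)[OF D_sets_facts(1)[OF DQ(1)[OF D]]] DQ(3)[OF D] D_sets_facts(2)[OF DQ(1)[OF D]] by simp
qed

definition K :: "transf \<Rightarrow> int" where
  "K = murphy_type l (comp_C_orbit \<mu> P) S (comp_D_orbit \<nu> Q) T"

lemma cell_mring_K: "cell_mring l (\<mu>, P, S) (\<nu>, Q, T) x =
    (\<Sum>C\<in>P. \<Sum>D\<in>Q. \<Sum>\<sigma> | \<sigma> permutes {1..sum_list l}. K \<sigma> * (if x = phi C \<circ> \<sigma> \<circ> psi \<nu> D then 1 else 0))"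
  by (simp add: K_def)

text \<open>The permutation provided by \<open>phi_young\<close> is absorbed by the Murphy element, which is invariant under
  the Young subgroup of its left type.\<close>

lemma cell_mring_left:
  assumes \<rho>: "\<rho> \<in> young \<mu>"
  shows "cell_mring l (\<mu>, P, S) (\<nu>, Q, T) (\<rho> \<circ> x) = cell_mring l (\<mu>, P, S) (\<nu>, Q, T) x"
proof -
  let ?i = "sum_list l"
  let ?G = "\<lambda>C x. \<Sum>D\<in>Q. \<Sum>\<sigma> | \<sigma> permutes {1..?i}. K \<sigma> * (if x = phi C \<circ> \<sigma> \<circ> psi \<nu> D then 1 else 0)"
  have \<rho>p: "\<rho> permutes {1..r}" using young_permutes[OF \<rho>] data(7) by simp
  have G: "?G (\<rho> ` C) (\<rho> \<circ> x) = ?G C x" if C: "C \<in> P" for C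
  proof (rule sum.cong[OF refl])
    fix D assume D: "D \<in> Q"
    note DD = DQ(1)[OF D]
    have ir: "?i \<le> r" using D_sets_facts(5)[OF DD] data(8) by simp
    obtain \<sigma>0 where s0: "\<sigma>0 permutes {1..card C}" "\<forall>j\<in>{1..card C}. \<rho> (phi C j) = phi (\<rho> ` C) (\<sigma>0 j)"
      "\<forall>j\<in>{1..card C}. block_no (comp_C \<mu> C) (\<sigma>0 j) = block_no (comp_C \<mu> C) j"
      by (rule phi_young[OF \<rho> CP(1)[OF C, folded data(7)]])
    note s0 = s0[unfolded CP(2)[OF C]]
    have cardR: "card (\<rho> ` C) = ?i"
      using CP(2)[OF C] permutes_inj[OF \<rho>p] by (subst card_image) (auto intro: inj_on_subset)
    have fn: "phi (\<rho> ` C) \<circ> (\<sigma>0 \<circ> \<sigma>) \<circ> psi \<nu> D = \<rho> \<circ> (phi C \<circ> \<sigma> \<circ> psi \<nu> D)" if s: "\<sigma> permutes {1..?i}" for \<sigma>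
    proof
      fix t
      define y where "y = \<sigma> (psi \<nu> D t)"
      have "y \<in> {1..?i} \<or> y \<notin> {1..r}"
        using psi_range[OF DD, of t] permutes_in_image[OF s, of "psi \<nu> D t"] permutes_not_in[OF s, of "psi \<nu> D t"] data(8)
        unfolding y_def by fastforce
      then have "phi (\<rho> ` C) (\<sigma>0 y) = \<rho> (phi C y)"
      proof
        assume "y \<notin> {1..r}"
        then have o: "y \<notin> {1..?i}" "y \<notin> {1..card C}" "y \<notin> {1..card (\<rho> ` C)}"
          using ir CP(2)[OF C] cardR by auto
        show ?thesis
          by (simp only: permutes_not_in[OF s0(1) o(1)] phi_outside[OF o(2)] phi_outside[OF o(3)]
              permutes_not_in[OF \<rho>p \<open>y \<notin> {1..r}\<close>])
      qed (rule bspec[OF s0(2), symmetric])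
      then show "(phi (\<rho> ` C) \<circ> (\<sigma>0 \<circ> \<sigma>) \<circ> psi \<nu> D) t = (\<rho> \<circ> (phi C \<circ> \<sigma> \<circ> psi \<nu> D)) t"
        by (simp add: y_def)
    qed
    have canc: "\<rho> \<circ> x = \<rho> \<circ> y \<longleftrightarrow> x = y" for x y :: transf
      using young_inv_cancel(3)[OF \<rho>] by metis
    have KK: "K (\<sigma>0 \<circ> \<sigma>) = K \<sigma>" for \<sigma>
      unfolding K_def
      by (rule murphy_type_left[OF data(3) comp_sums(1) data(6) comp_sums(2) l s0(1)])
        (simp only: CP(4)[OF C] bspec[OF s0(3)])
    have "(\<Sum>\<sigma> | \<sigma> permutes {1..?i}. K \<sigma> * (if \<rho> \<circ> x = phi (\<rho> ` C) \<circ> \<sigma> \<circ> psi \<nu> D then 1 else 0))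
        = (\<Sum>\<sigma> | \<sigma> permutes {1..?i}. K (\<sigma>0 \<circ> \<sigma>) * (if \<rho> \<circ> x = phi (\<rho> ` C) \<circ> (\<sigma>0 \<circ> \<sigma>) \<circ> psi \<nu> D then 1 else 0))"
      by (rule sum_permutes_translate[OF s0(1), symmetric])
    also have "\<dots> = (\<Sum>\<sigma> | \<sigma> permutes {1..?i}. K \<sigma> * (if x = phi C \<circ> \<sigma> \<circ> psi \<nu> D then 1 else 0))"
      by (intro sum.cong refl) (simp only: KK fn canc mem_Collect_eq)
    finally show "(\<Sum>\<sigma> | \<sigma> permutes {1..?i}. K \<sigma> * (if \<rho> \<circ> x = phi (\<rho> ` C) \<circ> \<sigma> \<circ> psi \<nu> D then 1 else 0)) = \<dots>" .
  qed
  have "(\<Sum>C\<in>P. ?G C (\<rho> \<circ> x)) = (\<Sum>C\<in>P. ?G (\<rho> ` C) (\<rho> \<circ> x))"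
  proof (rule sum.reindex_bij_witness[where i = "\<lambda>C. \<rho> ` C" and j = "\<lambda>C. pinv \<rho> ` C"])
    fix C assume C: "C \<in> P"
    show "pinv \<rho> ` C \<in> P" "\<rho> ` C \<in> P" using CP(3)[OF C] \<rho> young_inv by blast+
    show c1: "\<rho> ` (pinv \<rho> ` C) = C" "pinv \<rho> ` (\<rho> ` C) = C"
      by (simp_all only: image_comp young_inv_cancel[OF \<rho>] image_id id_apply)
    show "?G (\<rho> ` (pinv \<rho> ` C)) (\<rho> \<circ> x) = ?G C (\<rho> \<circ> x)" by (simp only: c1)
  qed
  also have "\<dots> = (\<Sum>C\<in>P. ?G C x)" by (rule sum.cong[OF refl]) (rule G)
  finally show ?thesis unfolding cell_mring_K .
qed

text \<open>Here the permutation provided by \<open>psi_young\<close> is absorbed on the right.\<close>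

lemma cell_mring_right:
  assumes \<pi>: "\<pi> \<in> young \<nu>"
  shows "cell_mring l (\<mu>, P, S) (\<nu>, Q, T) (x \<circ> \<pi>) = cell_mring l (\<mu>, P, S) (\<nu>, Q, T) x"
proof -
  let ?i = "sum_list l"
  let ?G = "\<lambda>C D x. \<Sum>\<sigma> | \<sigma> permutes {1..?i}. K \<sigma> * (if x = phi C \<circ> \<sigma> \<circ> psi \<nu> D then 1 else 0)"
  have G: "?G C (act \<pi> D) (x \<circ> \<pi>) = ?G C D x" if D: "D \<in> Q" for C D
  proof -
    obtain \<sigma>0 where s0: "\<sigma>0 permutes {1..?i}" "psi \<nu> D \<circ> \<pi> = \<sigma>0 \<circ> psi \<nu> (act \<pi> D)"
      "\<forall>j\<in>{1..?i}. block_no (comp_D \<nu> D) (\<sigma>0 j) = block_no (comp_D \<nu> D) j"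
      by (rule psi_young[OF \<pi> DQ(1)[OF D]])
    have fn: "phi C \<circ> (\<sigma> \<circ> \<sigma>0) \<circ> psi \<nu> (act \<pi> D) = phi C \<circ> \<sigma> \<circ> psi \<nu> D \<circ> \<pi>" for \<sigma>
      by (simp only: comp_assoc s0(2))
    have canc: "x \<circ> \<pi> = y \<circ> \<pi> \<longleftrightarrow> x = y" for x y :: transf
      using young_inv_cancel(5)[OF \<pi>] by metis
    have KK: "K (\<sigma> \<circ> \<sigma>0) = K \<sigma>" for \<sigma>
      unfolding K_def
      by (rule murphy_type_right[OF data(3) comp_sums(1) data(6) comp_sums(2) l s0(1)])
        (simp only: DQ(3)[OF D] bspec[OF s0(3)])
    have "?G C (act \<pi> D) (x \<circ> \<pi>)
        = (\<Sum>\<sigma> | \<sigma> permutes {1..?i}. K (\<sigma> \<circ> \<sigma>0) * (if x \<circ> \<pi> = phi C \<circ> (\<sigma> \<circ> \<sigma>0) \<circ> psi \<nu> (act \<pi> D) then 1 else 0))"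
      by (rule sum_permutes_translate_right[OF s0(1), symmetric])
    also have "\<dots> = ?G C D x"
      by (intro sum.cong refl) (simp only: KK fn canc)
    finally show ?thesis .
  qed
  have "(\<Sum>D\<in>Q. ?G C D (x \<circ> \<pi>)) = (\<Sum>D\<in>Q. ?G C (act \<pi> D) (x \<circ> \<pi>))" for C
  proof (rule sum.reindex_bij_witness[where i = "\<lambda>D. act \<pi> D" and j = "\<lambda>D. act (pinv \<pi>) D"])
    fix D assume D: "D \<in> Q"
    show "act (pinv \<pi>) D \<in> Q" "act \<pi> D \<in> Q" using DQ(2)[OF D] \<pi> young_inv by blast+
    show c1: "act \<pi> (act (pinv \<pi>) D) = D" "act (pinv \<pi>) (act \<pi> D) = D" by (rule act_inverse[OF \<pi>])+
    show "?G C (act \<pi> (act (pinv \<pi>) D)) (x \<circ> \<pi>) = ?G C D (x \<circ> \<pi>)" by (simp only: c1)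
  qed
  also have "(\<Sum>D\<in>Q. ?G C (act \<pi> D) (x \<circ> \<pi>)) = (\<Sum>D\<in>Q. ?G C D x)" for C
    by (rule sum.cong[OF refl]) (rule G)
  finally show ?thesis unfolding cell_mring_K by simp
qed

end

section \<open>Column antisymmetrizers and dominance\<close>

lemma partitionsD:
  assumes "l \<in> partitions i"
  shows "sorted_wrt (\<ge>) l" "sum_list l = i" "0 \<notin> set l"
  using assms by (auto simp: partitions_def)

text \<open>The column of a position in the row-reading tableau, counted from 1.\<close>

definition col :: "nat list \<Rightarrow> nat \<Rightarrow> nat" where
  "col l p = p - sum_list (take (block_no l p - 1) l)"

definition col_perms :: "nat list \<Rightarrow> transf set" where
  "col_perms l = {\<tau>. \<tau> permutes {1..sum_list l} \<and> (\<forall>p\<in>{1..sum_list l}. col l (\<tau> p) = col l p)}"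

lemma finite_col_perms: "finite (col_perms l)"
  by (rule finite_subset[of _ "{w. w permutes {1..sum_list l}}"]) (auto simp: col_perms_def finite_permutations)

lemma col_row:
  assumes "p \<in> {1..sum_list l}"
  shows "p = sum_list (take (block_no l p - 1) l) + col l p" "col l p \<in> {1..l ! (block_no l p - 1)}"
proof -
  have b: "block_no l p \<in> {1..length l}" "p \<in> block l (block_no l p)" by (rule block_no_mem[OF assms])+
  then have a: "block_no l p - 1 < length l" "Suc (block_no l p - 1) = block_no l p" by auto
  have "p \<in> {sum_list (take (block_no l p - 1) l)<..sum_list (take (block_no l p - 1) l) + l ! (block_no l p - 1)}"
    using b(2) take_Suc_sum[OF a(1)] unfolding a(2) block_def by simp
  then show "p = sum_list (take (block_no l p - 1) l) + col l p" "col l p \<in> {1..l ! (block_no l p - 1)}"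
    by (auto simp: col_def)
qed

lemma position_row_col:
  assumes a: "a \<in> {1..length l}" and c: "c \<in> {1..l ! (a - 1)}"
  defines "p \<equiv> sum_list (take (a - 1) l) + c"
  shows "p \<in> {1..sum_list l}" "block_no l p = a" "col l p = c"
proof -
  have a': "a - 1 < length l" "Suc (a - 1) = a" using a by auto
  have "p \<in> block l a"
    using c take_Suc_sum[OF a'(1)] unfolding a'(2) by (auto simp: p_def block_def)
  then show "p \<in> {1..sum_list l}" and b: "block_no l p = a"
    using block_subset block_no_unique[OF a] by blast+
  show "col l p = c" by (simp add: col_def b) (simp add: p_def)
qed

text \<open>A position is determined by its row and its column.\<close>

lemma col_perms_young:
  assumes "\<tau> \<in> col_perms l" "\<tau> \<in> young l"
  shows "\<tau> = id"
proof
  fix p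
  have t: "\<tau> permutes {1..sum_list l}" using assms(1) by (simp add: col_perms_def)
  show "\<tau> p = id p"
  proof (cases "p \<in> {1..sum_list l}")
    case True
    then have tp: "\<tau> p \<in> {1..sum_list l}" using permutes_in_image[OF t] by blast
    have "block_no l (\<tau> p) = block_no l p" "col l (\<tau> p) = col l p"
      using assms True by (auto simp: young_iff col_perms_def)
    then show ?thesis using col_row(1)[OF True] col_row(1)[OF tp] by simp
  qed (use permutes_not_in[OF t] in simp)
qed

lemma block_no_le_iff:
  assumes "x \<in> {1..sum_list m}"
  shows "block_no m x \<le> j \<longleftrightarrow> x \<le> sum_list (take j m)"
proof
  note b = block_no_mem[OF assms]
  assume "block_no m x \<le> j"
  then have "sum_list (take (block_no m x) m) \<le> sum_list (take j m)" by (rule sum_list_take_mono)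
  then show "x \<le> sum_list (take j m)" using b(2) by (simp add: block_def)
next
  note b = block_no_mem[OF assms]
  assume x: "x \<le> sum_list (take j m)"
  show "block_no m x \<le> j"
  proof (rule ccontr)
    assume "\<not> ?thesis"
    then have "j \<le> block_no m x - 1" by simp
    then have "sum_list (take j m) \<le> sum_list (take (block_no m x - 1) m)" by (rule sum_list_take_mono)
    then show False using b(2) x by (simp add: block_def)
  qed
qed

text \<open>The combinatorial core of Young's rule.  The positions that \<open>d\<close> sends to the first \<open>j\<close> rows of \<open>m\<close> can be
  pushed up inside the columns of \<open>l\<close> into its first \<open>j\<close> rows, because each column has at most one of them for
  each row of \<open>m\<close>.\<close>

lemma dominates_if_columns_separated:
  assumes l: "sorted_wrt (\<ge>) l" and m: "sum_list m = sum_list l" and d: "d permutes {1..sum_list l}"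
    and sep: "\<And>p q. p \<in> {1..sum_list l} \<Longrightarrow> q \<in> {1..sum_list l} \<Longrightarrow> p \<noteq> q \<Longrightarrow> col l p = col l q \<Longrightarrow>
      block_no m (d p) \<noteq> block_no m (d q)"
  shows "dominates l m"
  unfolding dominates_def
proof
  fix j
  let ?X = "{1..sum_list l}"
  let ?A = "{p \<in> ?X. block_no m (d p) \<le> j}" and ?B = "{p \<in> ?X. block_no l p \<le> j}"
  have dX: "d p \<in> ?X" if "p \<in> ?X" for p using permutes_in_image[OF d] that by blast
  have "d ` ?A = {x \<in> ?X. block_no m x \<le> j}"
  proof (intro equalityI subsetI)
    fix x assume x: "x \<in> {x \<in> ?X. block_no m x \<le> j}"
    then obtain p where p: "p \<in> ?X" "x = d p" using permutes_image[OF d] by (metis (no_types, lifting) imageE mem_Collect_eq)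
    then show "x \<in> d ` ?A" using x by blast
  qed (use dX in blast)
  also have "\<dots> = {1..sum_list (take j m)}"
    using block_no_le_iff[of _ m j] sum_list_take_le[of j m] m by auto
  finally have "card (d ` ?A) = sum_list (take j m)" by simp
  then have cA: "card ?A = sum_list (take j m)"
    using permutes_inj[OF d] by (subst (asm) card_image) (auto intro: inj_on_subset)
  have "?B = {1..sum_list (take j l)}"
    using block_no_le_iff[of _ l j] sum_list_take_le[of j l] by auto
  then have cB: "card ?B = sum_list (take j l)" by simp
  \<comment> \<open>A column of \<open>l\<close> either ends within the first \<open>j\<close> rows or has \<open>j\<close> positions there.\<close>
  have "card {p \<in> ?A. col l p = c} \<le> card {p \<in> ?B. col l p = c}" for c
  proof (cases "\<forall>p\<in>?X. col l p = c \<longrightarrow> block_no l p \<le> j")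
    case True
    then show ?thesis by (intro card_mono) auto
  next
    case False
    then obtain p0 where p0: "p0 \<in> ?X" "col l p0 = c" "j < block_no l p0" by auto
    have "inj_on (\<lambda>p. block_no m (d p)) {p \<in> ?A. col l p = c}"
    proof (rule inj_onI, rule ccontr)
      fix p q assume p: "p \<in> {p \<in> ?A. col l p = c}" and q: "q \<in> {p \<in> ?A. col l p = c}"
        and "block_no m (d p) = block_no m (d q)" "p \<noteq> q"
      moreover have "p \<in> ?X" "q \<in> ?X" "col l p = col l q" using p q by simp_all
      ultimately show False using sep by blast
    qed
    moreover have "(\<lambda>p. block_no m (d p)) ` {p \<in> ?A. col l p = c} \<subseteq> {1..j}"
    proof
      fix b assume "b \<in> (\<lambda>p. block_no m (d p)) ` {p \<in> ?A. col l p = c}"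
      then obtain p where p: "p \<in> ?X" "block_no m (d p) \<le> j" "b = block_no m (d p)" by auto
      have "d p \<in> {1..sum_list m}" using dX[OF p(1)] m by simp
      then have "block_no m (d p) \<in> {1..length m}" by (rule block_no_mem(1))
      then show "b \<in> {1..j}" using p by simp
    qed
    ultimately have "card {p \<in> ?A. col l p = c} \<le> card {1..j}" by (intro card_inj_on_le) auto
    also have "\<dots> \<le> card {p \<in> ?B. col l p = c}"
    proof -
      define f where "f a = sum_list (take (a - 1) l) + c" for a
      have f: "f a \<in> {1..sum_list l}" "block_no l (f a) = a" "col l (f a) = c" if a: "a \<in> {1..j}" for a
      proof -
        have b0: "block_no l p0 \<in> {1..length l}" by (rule block_no_mem(1)[OF p0(1)])
        then have al: "a \<in> {1..length l}" using a p0(3) by auto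
        have "l ! (block_no l p0 - 1) \<le> l ! (a - 1)"
          using sorted_wrt_nth_less[OF l, of "a - 1" "block_no l p0 - 1"] a p0(3) b0 by auto
        then have "c \<in> {1..l ! (a - 1)}" using col_row(2)[OF p0(1)] p0(2) by auto
        from position_row_col[OF al this]
        show "f a \<in> {1..sum_list l}" "block_no l (f a) = a" "col l (f a) = c" by (simp_all add: f_def)
      qed
      have "inj_on f {1..j}" using f(2) by (metis inj_on_inverseI)
      moreover have "f ` {1..j} \<subseteq> {p \<in> ?B. col l p = c}" using f by auto
      ultimately show ?thesis by (intro card_inj_on_le) auto
    qed
    finally show ?thesis .
  qed
  then have "(\<Sum>c\<in>col l ` ?X. card {p \<in> ?A. col l p = c}) \<le> (\<Sum>c\<in>col l ` ?X. card {p \<in> ?B. col l p = c})"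
    by (rule sum_mono)
  moreover have "card ?A = (\<Sum>c\<in>col l ` ?X. card {p \<in> ?A. col l p = c})" by (rule card_sum_fibres) auto
  moreover have "card ?B = (\<Sum>c\<in>col l ` ?X. card {p \<in> ?B. col l p = c})" by (rule card_sum_fibres) auto
  ultimately show "sum_list (take j m) \<le> sum_list (take j l)" using cA cB by simp
qed

lemma dominates_antisym:
  assumes l: "l \<in> partitions i" and m: "m \<in> partitions i" and "dominates l m" "dominates m l"
  shows "l = m"
proof -
  have eq: "sum_list (take j l) = sum_list (take j m)" for j
    using assms(3,4) by (simp add: dominates_def le_antisym)
  have le: "length b \<le> length a" if "a \<in> partitions i" "b \<in> partitions i"
    "\<And>j. sum_list (take j a) = sum_list (take j b)" for a b
  proof (rule ccontr)
    assume "\<not> ?thesis"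
    then have lt: "length a < length b" by simp
    have "b ! length a \<noteq> 0" using partitionsD(3)[OF that(2)] nth_mem[OF lt] by metis
    moreover have "sum_list (take (Suc (length a)) b) = sum_list (take (length a) b) + b ! length a"
      by (rule take_Suc_sum[OF lt])
    moreover have "sum_list (take (length a) b) = i" "sum_list (take (Suc (length a)) b) = i"
      using that(3)[of "length a"] that(3)[of "Suc (length a)"] that(1) by (auto simp: partitions_def)
    ultimately show False by simp
  qed
  have len: "length l = length m" using le[OF l m eq] le[OF m l eq[symmetric]] by simp
  show ?thesis
  proof (rule nth_equalityI[OF len])
    fix j assume j: "j < length l"
    then show "l ! j = m ! j"
      using take_Suc_sum[of j l] take_Suc_sum[of j m] eq[of j] eq[of "Suc j"] len by simp
  qed
qed

text \<open>The sum is the coefficient of the identity in the product of the column antisymmetrizer of \<open>l\<close> with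
  \<open>d r\<^sub>m d'\<^sup>-\<^sup>1\<close>.  As \<open>l\<close> does not dominate \<open>m\<close>, some column of \<open>l\<close> has two positions that \<open>d'\<^sup>-\<^sup>1\<close> sends to the same
  row of \<open>m\<close>.  Their transposition is absorbed by \<open>r\<^sub>m\<close> and changes the sign of the antisymmetrizer.\<close>

lemma col_alternating_zero:
  assumes l: "l \<in> partitions i" and m: "m \<in> partitions i" "dominates m l" "m \<noteq> l"
    and d': "d' permutes {1..i}"
  shows "(\<Sum>\<tau>\<in>col_perms l. sign \<tau> * (\<Sum>\<sigma>\<in>young m. if pinv \<tau> = d \<circ> \<sigma> \<circ> pinv d' then 1 else (0::int))) = 0"
proof -
  note lp = partitionsD[OF l] and mp = partitionsD[OF m(1)]
  let ?X = "{1..i}"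
  have d'i: "pinv d' permutes {1..sum_list l}" using permutes_inv[OF d'] lp(2) by simp
  have "\<not> dominates l m" using dominates_antisym[OF l m(1) _ m(2)] m(3) by blast
  then obtain p q where pq: "p \<in> ?X" "q \<in> ?X" "p \<noteq> q" "col l p = col l q"
    "block_no m (pinv d' p) = block_no m (pinv d' q)"
    using dominates_if_columns_separated[OF lp(1) _ d'i, of m] lp(2) mp(2) by metis
  define \<theta> where "\<theta> = Transposition.transpose p q"
  have \<theta>X: "\<theta> permutes ?X" unfolding \<theta>_def using pq by (intro permutes_swap_id) auto
  have \<theta>\<theta>: "\<theta> \<circ> \<theta> = id" by (simp add: \<theta>_def)
  have inv\<theta>: "pinv \<theta> = \<theta>" using \<theta>\<theta> by (rule inv_unique_comp[OF _ \<theta>\<theta>])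
  have col\<theta>: "col l (\<theta> x) = col l x" for x using pq(4) by (simp add: \<theta>_def transpose_def)
  have \<theta>_col: "\<theta> \<circ> \<tau> \<in> col_perms l" if "\<tau> \<in> col_perms l" for \<tau>
    using that \<theta>X lp(2) by (auto simp: col_perms_def col\<theta> intro: permutes_compose)
  have "(pinv d' \<circ> \<theta> \<circ> d') \<in> young m"
    unfolding young_iff
  proof (intro conjI ballI)
    have "\<theta> \<circ> d' permutes ?X" by (rule permutes_compose[OF d' \<theta>X])
    then have "pinv d' \<circ> (\<theta> \<circ> d') permutes ?X" by (rule permutes_compose) (rule permutes_inv[OF d'])
    then show "pinv d' \<circ> \<theta> \<circ> d' permutes {1..sum_list m}" by (simp add: comp_assoc mp(2))
    fix x
    have dx: "pinv d' (d' x) = x" using permutes_inverses(2)[OF d'] .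
    have "block_no m (pinv d' (\<theta> y)) = block_no m (pinv d' y)" for y
      using pq(5) by (simp add: \<theta>_def transpose_def)
    from this[of "d' x"] show "block_no m ((pinv d' \<circ> \<theta> \<circ> d') x) = block_no m x" by (simp add: dx)
  qed
  then obtain \<eta> where \<eta>: "\<eta> \<in> young m" "\<eta> = pinv d' \<circ> \<theta> \<circ> d'" by simp
  have d'\<eta>: "\<eta> \<circ> pinv d' = pinv d' \<circ> \<theta>"
    by (simp only: \<eta>(2) comp_assoc permutes_inv_o(1)[OF d'] comp_id)
  define f where "f \<tau> = (\<Sum>\<sigma>\<in>young m. if pinv \<tau> = d \<circ> \<sigma> \<circ> pinv d' then 1 else (0::int))" for \<tau>
  have f\<theta>: "f (\<theta> \<circ> \<tau>) = f \<tau>" if t: "\<tau> \<in> col_perms l" for \<tau>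
  proof -
    have tp: "\<tau> permutes ?X" using t lp(2) by (simp add: col_perms_def)
    have inv: "pinv (\<theta> \<circ> \<tau>) = pinv \<tau> \<circ> \<theta>"
      using o_inv_distrib[OF permutes_bij[OF \<theta>X] permutes_bij[OF tp]] inv\<theta> by simp
    have "f (\<theta> \<circ> \<tau>) = (\<Sum>\<sigma>\<in>young m. if pinv \<tau> \<circ> \<theta> = d \<circ> (\<sigma> \<circ> \<eta>) \<circ> pinv d' then 1 else 0)"
      unfolding f_def inv
      by (rule sum.reindex_bij_witness[where i = "\<lambda>\<sigma>. \<sigma> \<circ> \<eta>" and j = "\<lambda>\<sigma>. \<sigma> \<circ> pinv \<eta>"])
        (use \<eta>(1) in \<open>simp_all add: young_inv_cancel[OF \<eta>(1)] young_comp young_inv\<close>)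
    also have "\<dots> = f \<tau>"
      unfolding f_def
    proof (rule sum.cong[OF refl])
      fix \<sigma>
      have "d \<circ> (\<sigma> \<circ> \<eta>) \<circ> pinv d' = d \<circ> \<sigma> \<circ> pinv d' \<circ> \<theta>" by (simp only: comp_assoc d'\<eta>)
      moreover have "x \<circ> \<theta> = y \<circ> \<theta> \<longleftrightarrow> x = y" for x y :: transf using \<theta>\<theta> by (metis comp_assoc comp_id)
      ultimately show "(if pinv \<tau> \<circ> \<theta> = d \<circ> (\<sigma> \<circ> \<eta>) \<circ> pinv d' then 1 else 0 :: int)
          = (if pinv \<tau> = d \<circ> \<sigma> \<circ> pinv d' then 1 else 0)" by (simp only:)
    qed
    finally show ?thesis .
  qed
  have sgn: "sign (\<theta> \<circ> \<tau>) = - sign \<tau>" if t: "\<tau> \<in> col_perms l" for \<tau>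
  proof -
    have "permutation \<theta>" using \<theta>X permutation_permutes by blast
    moreover have "permutation \<tau>" using t permutation_permutes by (auto simp: col_perms_def)
    ultimately show ?thesis using pq(3) by (simp add: sign_compose \<theta>_def sign_swap_id)
  qed
  have "(\<Sum>\<tau>\<in>col_perms l. sign \<tau> * f \<tau>) = (\<Sum>\<tau>\<in>col_perms l. sign (\<theta> \<circ> \<tau>) * f (\<theta> \<circ> \<tau>))"
    by (rule sum.reindex_bij_witness[where i = "\<lambda>\<tau>. \<theta> \<circ> \<tau>" and j = "\<lambda>\<tau>. \<theta> \<circ> \<tau>"])
      (use \<theta>_col \<theta>\<theta> in \<open>simp_all add: o_assoc\<close>)
  also have "\<dots> = - (\<Sum>\<tau>\<in>col_perms l. sign \<tau> * f \<tau>)"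
    by (simp add: f\<theta> sgn sum_negf cong: sum.cong)
  finally show ?thesis by (simp add: f_def)
qed

section \<open>Murphy elements whose type separates the points\<close>

definition row_reading :: "nat list \<Rightarrow> tableau" where
  "row_reading l = map (\<lambda>a. [Suc (sum_list (take a l))..<Suc (sum_list (take (Suc a) l))]) [0..<length l]"

lemma concat_row_reading: "concat (row_reading l) = [1..<Suc (sum_list l)]"
proof -
  have "concat (map (\<lambda>a. [Suc (sum_list (take a l))..<Suc (sum_list (take (Suc a) l))]) [0..<k])
      = [1..<Suc (sum_list (take k l))]" for k
  proof (induction k)
    case (Suc k)
    have "sum_list (take (Suc k) l) = sum_list (take k l) + (sum_list (take (Suc k) l) - sum_list (take k l))"
      using sum_list_take_mono[of k "Suc k" l] by simp
    then have "[1..<Suc (sum_list (take (Suc k) l))]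
        = [1..<Suc (sum_list (take k l))] @ [Suc (sum_list (take k l))..<Suc (sum_list (take (Suc k) l))]"
      using upt_add_eq_append[of 1 "Suc (sum_list (take k l))" "sum_list (take (Suc k) l) - sum_list (take k l)"]
      by (simp del: upt_Suc)
    then show ?case using Suc by (simp add: upt_Suc_append[of 0 k] del: upt_Suc)
  qed simp
  from this[of "length l"] show ?thesis by (simp add: row_reading_def del: upt_Suc)
qed

lemma row_reading_nth:
  assumes "a < length l"
  shows "row_reading l ! a = [Suc (sum_list (take a l))..<Suc (sum_list (take (Suc a) l))]"
    "set (row_reading l ! a) = block l (Suc a)" "length (row_reading l ! a) = l ! a"
    "b < l ! a \<Longrightarrow> row_reading l ! a ! b = Suc (sum_list (take a l) + b)"
proof -
  show 1: "row_reading l ! a = [Suc (sum_list (take a l))..<Suc (sum_list (take (Suc a) l))]"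
    using assms by (simp add: row_reading_def del: upt_Suc)
  show "set (row_reading l ! a) = block l (Suc a)" unfolding 1 block_Suc by auto
  show "length (row_reading l ! a) = l ! a" unfolding 1 take_Suc_sum[OF assms] by simp
  show "b < l ! a \<Longrightarrow> row_reading l ! a ! b = Suc (sum_list (take a l) + b)"
    unfolding 1 take_Suc_sum[OF assms] by (subst nth_upt) auto
qed

lemma length_filter_upt: "length (filter P [1..<Suc i]) = card {x \<in> {1..i}. P x}"
proof -
  have "set (filter P [1..<Suc i]) = {x \<in> {1..i}. P x}" by auto
  then show ?thesis using distinct_card[of "filter P [1..<Suc i]"] by (simp del: upt_Suc)
qed

lemma count_list_map: "count_list (map f xs) j = length (filter (\<lambda>x. f x = j) xs)"
  by (induction xs) auto

lemma row_reading_semistandard: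
  assumes l: "sorted_wrt (\<ge>) l" and \<rho>: "sum_list \<rho> = sum_list l" and inj: "inj_on (block_no \<rho>) {1..sum_list l}"
  shows "tableau_type \<rho> (row_reading l) \<in> semistandard_tableaux l \<rho>"
proof -
  let ?t = "tableau_type \<rho> (row_reading l)"
  have len: "length ?t = length l" by (simp add: tableau_type_def row_reading_def)
  have nth: "?t ! a = map (block_no \<rho>) (row_reading l ! a)" if "a < length l" for a
    using that by (simp add: tableau_type_def row_reading_def)
  have 1: "map length ?t = l" by (rule nth_equalityI) (simp_all add: len nth row_reading_nth(3))
  have cc: "concat ?t = map (block_no \<rho>) [1..<Suc (sum_list l)]"
    unfolding tableau_type_def map_concat[symmetric] concat_row_reading ..
  have "block_no \<rho> x \<in> {1..length \<rho>}" if "x \<in> set [1..<Suc (sum_list l)]" for x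
    using that \<rho> by (intro block_no_mem(1)) auto
  then have 2: "set (concat ?t) \<subseteq> {1..length \<rho>}" unfolding cc by (auto simp del: upt_Suc)
  have 3: "count_list (concat ?t) j = \<rho> ! (j - 1)" if j: "j \<in> {1..length \<rho>}" for j
  proof -
    have "count_list (concat ?t) j = card {x \<in> {1..sum_list l}. block_no \<rho> x = j}"
      unfolding cc count_list_map length_filter_upt ..
    also have "{x \<in> {1..sum_list l}. block_no \<rho> x = j} = block \<rho> j" using block_eq_block_no[OF j] \<rho> by simp
    also have "card (block \<rho> j) = \<rho> ! (j - 1)" using card_block[of "j - 1" \<rho>] j by auto
    finally show ?thesis .
  qed
  have sub: "block l (Suc a) \<subseteq> {1..sum_list \<rho>}" for a using block_subset[of l "Suc a"] \<rho> by simp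
  have 4: "sorted w" if "w \<in> set ?t" for w
  proof -
    from that len obtain a where a: "a < length l" "w = ?t ! a" by (auto simp: in_set_conv_nth)
    show ?thesis
      unfolding a(2) nth[OF a(1)] sorted_map
    proof (rule sorted_wrt_mono_rel[of _ "(\<le>)"])
      fix x y assume "x \<in> set (row_reading l ! a)" "y \<in> set (row_reading l ! a)" "x \<le> y"
      then show "block_no \<rho> x \<le> block_no \<rho> y"
        using sub[of a] unfolding row_reading_nth(2)[OF a(1)] by (intro block_no_mono) auto
    qed (simp add: row_reading_nth(1)[OF a(1)] del: upt_Suc)
  qed
  have 5: "column_strict ?t"
    unfolding column_strict_def
  proof (intro allI impI)
    fix a b assume ab: "Suc a < length ?t \<and> b < length (?t ! Suc a)"
    then have al: "Suc a < length l" "a < length l" using len by auto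
    have b: "b < l ! Suc a" using ab by (simp add: nth[OF al(1)] row_reading_nth(3)[OF al(1)])
    have b': "b < l ! a" using b sorted_wrt_nth_less[OF l, of a "Suc a"] al by simp
    let ?x = "row_reading l ! a ! b" and ?y = "row_reading l ! Suc a ! b"
    have "?x \<in> block l (Suc a)"
      using nth_mem[of b "row_reading l ! a"] b' row_reading_nth(2,3)[OF al(2)] by simp
    then have x: "?x \<in> {1..sum_list l}" using block_subset by blast
    have "?y \<in> block l (Suc (Suc a))"
      using nth_mem[of b "row_reading l ! Suc a"] b row_reading_nth(2,3)[OF al(1)] by simp
    then have y: "?y \<in> {1..sum_list l}" using block_subset by blast
    have lt: "?x < ?y"
      using b b' row_reading_nth(4)[OF al(1) b] row_reading_nth(4)[OF al(2) b'] take_Suc_sum[OF al(2)] by simp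
    then have "block_no \<rho> ?x \<le> block_no \<rho> ?y" using x y \<rho> by (intro block_no_mono) auto
    moreover have "block_no \<rho> ?x \<noteq> block_no \<rho> ?y" using inj_onD[OF inj _ x y] lt by auto
    ultimately show "?t ! a ! b < ?t ! Suc a ! b"
      using b b' by (simp add: nth al row_reading_nth(3))
  qed
  show ?thesis unfolding semistandard_tableaux_def using 1 2 3 4 5 by blast
qed

text \<open>If the blocks separate the points, prescribing types amounts to prescribing entries, and the rows have
  to be mapped to themselves.\<close>

lemma typed_perms_row_reading:
  assumes \<rho>: "sum_list \<rho> = sum_list l" and inj: "inj_on (block_no \<rho>) {1..sum_list l}"
  shows "typed_perms l \<rho> (tableau_type \<rho> (row_reading l)) = young l"
proof -
  have row: "mset (tableau_type \<rho> (row_reading l) ! a) = image_mset (block_no \<rho>) (mset_set (block l (Suc a)))"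
    if a: "a < length l" for a
  proof -
    have "tableau_type \<rho> (row_reading l) ! a = map (block_no \<rho>) (row_reading l ! a)"
      using a by (simp add: tableau_type_def row_reading_def)
    moreover have "mset (row_reading l ! a) = mset_set (set (row_reading l ! a))"
      by (rule mset_set_set[symmetric]) (simp add: row_reading_nth(1)[OF a] del: upt_Suc)
    ultimately show ?thesis by (simp add: row_reading_nth(2)[OF a])
  qed
  show ?thesis
  proof (intro equalityI subsetI)
    fix \<sigma> assume s: "\<sigma> \<in> young l"
    show "\<sigma> \<in> typed_perms l \<rho> (tableau_type \<rho> (row_reading l))"
      unfolding typed_perms_def using young_permutes[OF s] row
        image_mset_permuted[OF young_permutes[OF s] young_block[OF s], of _ "block_no \<rho>"] by simp
  next
    fix w assume w: "w \<in> typed_perms l \<rho> (tableau_type \<rho> (row_reading l))"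
    then have wp: "w permutes {1..sum_list l}" by (simp add: typed_perms_def)
    have "w ` block l j = block l j" if j: "j \<in> {1..length l}" for j
    proof -
      from j have a: "j - 1 < length l" "Suc (j - 1) = j" by auto
      have "image_mset (\<lambda>x. block_no \<rho> (w x)) (mset_set (block l j)) = image_mset (block_no \<rho>) (mset_set (block l j))"
      proof -
        have "image_mset (\<lambda>x. block_no \<rho> (w x)) (mset_set (block l (Suc (j - 1)))) = mset (tableau_type \<rho> (row_reading l) ! (j - 1))"
          using w a(1) unfolding typed_perms_def by blast
        then show ?thesis unfolding row[OF a(1)] unfolding a(2) .
      qed
      then have "set_mset (image_mset (\<lambda>x. block_no \<rho> (w x)) (mset_set (block l j)))
          = set_mset (image_mset (block_no \<rho>) (mset_set (block l j)))" by (rule arg_cong)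
      then have "block_no \<rho> ` (w ` block l j) = block_no \<rho> ` block l j"
        using finite_block by (simp add: image_image)
      moreover have "w ` block l j \<subseteq> {1..sum_list l}"
        using image_mono[OF block_subset[of l j], of w] unfolding permutes_image[OF wp] .
      ultimately show ?thesis using inj_on_image_eq_iff[OF inj _ block_subset] by blast
    qed
    then show "w \<in> young l" using wp by (simp add: young_def)
  qed
qed

text \<open>In \<open>murphy_type_card\<close> the permutations on the right now form the row stabilizer, under which
  \<open>typed_perms\<close> is invariant, so either all of them count or none.\<close>

lemma murphy_row_left:
  assumes S: "S \<in> semistandard_tableaux l \<rho>" "sum_list \<rho> = sum_list l" and l: "sorted_wrt (\<ge>) l"
    and \<rho>0: "sum_list \<rho>0 = sum_list l" and inj: "inj_on (block_no \<rho>0) {1..sum_list l}"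
  shows "murphy_type l \<rho> S \<rho>0 (tableau_type \<rho>0 (row_reading l)) \<sigma> = (if \<sigma> \<in> typed_perms l \<rho> S then 1 else 0)"
proof -
  have "int (card (young l)) * murphy_type l \<rho> S \<rho>0 (tableau_type \<rho>0 (row_reading l)) \<sigma>
      = int (card {w \<in> young l. \<sigma> \<circ> w \<in> typed_perms l \<rho> S})"
    unfolding murphy_type_card[OF S row_reading_semistandard[OF l \<rho>0 inj] \<rho>0 l] typed_perms_row_reading[OF \<rho>0 inj] ..
  also have "{w \<in> young l. \<sigma> \<circ> w \<in> typed_perms l \<rho> S} = (if \<sigma> \<in> typed_perms l \<rho> S then young l else {})"
    using typed_perms_right by auto
  finally have "int (card (young l)) * murphy_type l \<rho> S \<rho>0 (tableau_type \<rho>0 (row_reading l)) \<sigma>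
      = int (card (young l)) * (if \<sigma> \<in> typed_perms l \<rho> S then 1 else 0)" by simp
  then show ?thesis using card_young_pos[of l] by simp
qed

lemma murphy_row_right:
  assumes T: "T \<in> semistandard_tableaux l \<rho>" "sum_list \<rho> = sum_list l" and l: "sorted_wrt (\<ge>) l"
    and \<rho>0: "sum_list \<rho>0 = sum_list l" and inj: "inj_on (block_no \<rho>0) {1..sum_list l}"
    and \<sigma>: "\<sigma> permutes {1..sum_list l}"
  shows "murphy_type l \<rho>0 (tableau_type \<rho>0 (row_reading l)) \<rho> T \<sigma> = (if pinv \<sigma> \<in> typed_perms l \<rho> T then 1 else 0)"
proof -
  note c = permutes_inv_o[OF \<sigma>]
  have cancel: "\<sigma> \<circ> (pinv \<sigma> \<circ> y) = y" "pinv \<sigma> \<circ> (\<sigma> \<circ> y) = y" for y :: transf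
    by (simp_all only: o_assoc c id_comp)
  have "int (card (young l)) * murphy_type l \<rho>0 (tableau_type \<rho>0 (row_reading l)) \<rho> T \<sigma>
      = int (card {w \<in> typed_perms l \<rho> T. \<sigma> \<circ> w \<in> young l})"
    unfolding murphy_type_card[OF row_reading_semistandard[OF l \<rho>0 inj] \<rho>0 T l] typed_perms_row_reading[OF \<rho>0 inj] ..
  also have "{w \<in> typed_perms l \<rho> T. \<sigma> \<circ> w \<in> young l}
      = (if pinv \<sigma> \<in> typed_perms l \<rho> T then (\<lambda>y. pinv \<sigma> \<circ> y) ` young l else {})"
  proof -
    have "w \<in> typed_perms l \<rho> T \<longleftrightarrow> pinv \<sigma> \<in> typed_perms l \<rho> T" if "\<sigma> \<circ> w \<in> young l" for w
      using typed_perms_right[OF that, of "pinv \<sigma>" \<rho> T] by (simp only: cancel)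
    moreover have "w \<in> (\<lambda>y. pinv \<sigma> \<circ> y) ` young l" if "\<sigma> \<circ> w \<in> young l" for w
      using that cancel(2)[of w] by (metis image_eqI)
    moreover have "\<sigma> \<circ> w \<in> young l" if "w \<in> (\<lambda>y. pinv \<sigma> \<circ> y) ` young l" for w
      using that cancel(1) by auto
    ultimately show ?thesis by auto
  qed
  also have "card (if pinv \<sigma> \<in> typed_perms l \<rho> T then (\<lambda>y. pinv \<sigma> \<circ> y) ` young l else {})
      = card (young l) * (if pinv \<sigma> \<in> typed_perms l \<rho> T then 1 else 0)"
  proof -
    have "inj_on (\<lambda>y. pinv \<sigma> \<circ> y) (young l)" using cancel(1) by (intro inj_on_inverseI[of _ "\<lambda>y. \<sigma> \<circ> y"]) auto
    then show ?thesis by (simp add: card_image)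
  qed
  finally have "int (card (young l)) * murphy_type l \<rho>0 (tableau_type \<rho>0 (row_reading l)) \<rho> T \<sigma>
      = int (card (young l)) * (if pinv \<sigma> \<in> typed_perms l \<rho> T then 1 else 0)" by (simp split: if_splits)
  then show ?thesis using card_young_pos[of l] by simp
qed

text \<open>This is \<open>d(s) r\<^sub>\<lambda> \<cdot> r\<^sub>\<lambda> d(t)\<^sup>-\<^sup>1 = |\<SS>\<^sub>\<lambda>| d(s) r\<^sub>\<lambda> d(t)\<^sup>-\<^sup>1\<close>, summed over the tableaux of the given types.\<close>

lemma murphy_convolution:
  assumes S: "S \<in> semistandard_tableaux l \<rho>" "sum_list \<rho> = sum_list l"
    and T: "T \<in> semistandard_tableaux l \<rho>'" "sum_list \<rho>' = sum_list l" and l: "sorted_wrt (\<ge>) l"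
    and r1: "sum_list \<rho>1 = sum_list l" "inj_on (block_no \<rho>1) {1..sum_list l}"
    and r2: "sum_list \<rho>2 = sum_list l" "inj_on (block_no \<rho>2) {1..sum_list l}"
    and \<tau>: "\<tau> permutes {1..sum_list l}"
  shows "(\<Sum>\<sigma> | \<sigma> permutes {1..sum_list l}.
      murphy_type l \<rho> S \<rho>1 (tableau_type \<rho>1 (row_reading l)) \<sigma> *
      murphy_type l \<rho>2 (tableau_type \<rho>2 (row_reading l)) \<rho>' T (pinv \<sigma> \<circ> \<tau>))
    = int (card (young l)) * murphy_type l \<rho> S \<rho>' T \<tau>"
proof -
  let ?G = "{\<sigma>. \<sigma> permutes {1..sum_list l}}"
  let ?W = "typed_perms l \<rho> S" and ?W' = "typed_perms l \<rho>' T"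
  note c = permutes_inv_o[OF \<tau>]
  have "(\<Sum>\<sigma>\<in>?G. murphy_type l \<rho> S \<rho>1 (tableau_type \<rho>1 (row_reading l)) \<sigma> *
      murphy_type l \<rho>2 (tableau_type \<rho>2 (row_reading l)) \<rho>' T (pinv \<sigma> \<circ> \<tau>))
    = (\<Sum>\<sigma>\<in>?G. if \<sigma> \<in> ?W \<and> pinv \<tau> \<circ> \<sigma> \<in> ?W' then 1 else 0)"
  proof (rule sum.cong[OF refl])
    fix \<sigma> assume "\<sigma> \<in> ?G"
    then have s: "\<sigma> permutes {1..sum_list l}" by simp
    have st: "pinv \<sigma> \<circ> \<tau> permutes {1..sum_list l}" using \<tau> permutes_inv[OF s] by (rule permutes_compose)
    have "pinv (pinv \<sigma> \<circ> \<tau>) = pinv \<tau> \<circ> \<sigma>"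
      using o_inv_distrib[OF permutes_bij[OF permutes_inv[OF s]] permutes_bij[OF \<tau>]] permutes_inv_inv[OF s] by simp
    then show "murphy_type l \<rho> S \<rho>1 (tableau_type \<rho>1 (row_reading l)) \<sigma> *
        murphy_type l \<rho>2 (tableau_type \<rho>2 (row_reading l)) \<rho>' T (pinv \<sigma> \<circ> \<tau>)
        = (if \<sigma> \<in> ?W \<and> pinv \<tau> \<circ> \<sigma> \<in> ?W' then 1 else 0)"
      by (simp only: murphy_row_left[OF S l r1] murphy_row_right[OF T l r2 st]) simp
  qed
  also have "\<dots> = int (card {\<sigma> \<in> ?G. \<sigma> \<in> ?W \<and> pinv \<tau> \<circ> \<sigma> \<in> ?W'})"
    by (simp add: sum.If_cases finite_permutations Int_def)
  also have "card {\<sigma> \<in> ?G. \<sigma> \<in> ?W \<and> pinv \<tau> \<circ> \<sigma> \<in> ?W'} = card {w \<in> ?W'. \<tau> \<circ> w \<in> ?W}"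
  proof (rule bij_betw_same_card[of "\<lambda>\<sigma>. pinv \<tau> \<circ> \<sigma>"], rule bij_betwI[where g = "\<lambda>w. \<tau> \<circ> w"])
    have cancel: "\<tau> \<circ> (pinv \<tau> \<circ> y) = y" "pinv \<tau> \<circ> (\<tau> \<circ> y) = y" for y :: transf
      by (simp_all only: o_assoc c id_comp)
    show "(\<lambda>\<sigma>. pinv \<tau> \<circ> \<sigma>) \<in> {\<sigma> \<in> ?G. \<sigma> \<in> ?W \<and> pinv \<tau> \<circ> \<sigma> \<in> ?W'} \<rightarrow> {w \<in> ?W'. \<tau> \<circ> w \<in> ?W}"
      by (auto simp only: cancel)
    show "(\<lambda>w. \<tau> \<circ> w) \<in> {w \<in> ?W'. \<tau> \<circ> w \<in> ?W} \<rightarrow> {\<sigma> \<in> ?G. \<sigma> \<in> ?W \<and> pinv \<tau> \<circ> \<sigma> \<in> ?W'}"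
    proof
      fix w assume w: "w \<in> {w \<in> ?W'. \<tau> \<circ> w \<in> ?W}"
      then have "\<tau> \<circ> w \<in> ?G" by (simp add: typed_perms_def)
      then show "\<tau> \<circ> w \<in> {\<sigma> \<in> ?G. \<sigma> \<in> ?W \<and> pinv \<tau> \<circ> \<sigma> \<in> ?W'}"
        using w by (simp only: mem_Collect_eq cancel)
    qed
  qed (simp_all only: o_assoc c id_comp)
  also have "int (card {w \<in> ?W'. \<tau> \<circ> w \<in> ?W}) = int (card (young l)) * murphy_type l \<rho> S \<rho>' T \<tau>"
    by (rule murphy_type_card[OF S T l, symmetric])
  finally show ?thesis .
qed

section \<open>Cell basis elements over the full transformation monoid\<close>

lemma psi_full:
  assumes D: "D \<in> D_sets i r" and cover: "\<Union>D = {1..r}" and \<nu>: "sum_list \<nu> = r"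
  shows "psi \<nu> D \<in> full_transf r" "psi \<nu> D ` {1..r} = {1..i}"
proof -
  have D': "D \<in> D_sets i (sum_list \<nu>)" using D \<nu> by simp
  have ir: "i \<le> r" by (rule D_sets_facts(5)[OF D])
  have in1: "psi \<nu> D x \<in> {1..i}" if "x \<in> {1..r}" for x
  proof -
    from that cover have "x \<in> \<Union>D" by simp
    then obtain j where "j \<in> {1..i}" "x \<in> D_list \<nu> D ! (j - 1)" by (rule psi_obtain[OF D'])
    then show ?thesis using psi_eq[OF D'] by simp
  qed
  have out: "psi \<nu> D x = x" if "x \<notin> {1..r}" for x
  proof -
    have "x \<notin> \<Union>D" using that cover by simp
    then have "psi \<nu> D x = (if x \<in> {1..r} then 0 else x)" using \<nu> by (simp only: psi_outside not_False_eq_True)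
    then show ?thesis using that by (simp only: if_False)
  qed
  show "psi \<nu> D \<in> full_transf r"
    unfolding full_transf_iff
  proof (intro conjI ballI allI impI)
    show "psi \<nu> D x \<in> {1..r}" if "x \<in> {1..r}" for x using in1[OF that] ir by auto
  qed (use out in auto)
  have "j \<in> psi \<nu> D ` {1..r}" if j: "j \<in> {1..i}" for j
  proof -
    note L = D_list_spec[OF D_sets_facts(1)[OF D], of \<nu>]
    have "D_list \<nu> D ! (j - 1) \<in> set (D_list \<nu> D)"
      using j L(4) D_sets_facts(2)[OF D] by (intro nth_mem) auto
    then have d: "D_list \<nu> D ! (j - 1) \<in> D" using L(1) by simp
    then have "D_list \<nu> D ! (j - 1) \<noteq> {}" using D by (auto simp: D_sets_def)
    then obtain x where x: "x \<in> D_list \<nu> D ! (j - 1)" by blast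
    then have "x \<in> {1..r}" using d cover by blast
    moreover have "psi \<nu> D x = j" by (rule psi_eq[OF D' j x])
    ultimately show ?thesis by blast
  qed
  then show "psi \<nu> D ` {1..r} = {1..i}" using in1 by blast
qed

lemma factorization_full:
  assumes C: "C \<in> C_sets i r" and \<sigma>: "\<sigma> permutes {1..i}" and b: "b \<in> full_transf r" "b ` {1..r} = {1..i}" and ir: "i \<le> r"
  shows "phi C \<circ> \<sigma> \<circ> b \<in> full_transf r" "(phi C \<circ> \<sigma> \<circ> b) ` {1..r} = C"
    "\<sigma> \<circ> b \<in> full_transf r" "(\<sigma> \<circ> b) ` {1..r} = {1..i}"
proof -
  show 1: "\<sigma> \<circ> b \<in> full_transf r" using permutes_full_transf[OF \<sigma> ir] b(1) by (rule full_transf_comp)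
  show 2: "(\<sigma> \<circ> b) ` {1..r} = {1..i}" by (simp only: image_comp[symmetric] b(2) permutes_image[OF \<sigma>])
  have "phi C \<circ> (\<sigma> \<circ> b) \<in> {m \<in> full_transf r. m ` {1..r} = C}"
    using bij_betwE[OF phi_comp_bij[OF C]] 1 2 by blast
  then show "phi C \<circ> \<sigma> \<circ> b \<in> full_transf r" "(phi C \<circ> \<sigma> \<circ> b) ` {1..r} = C" by (simp_all add: comp_assoc)
qed

text \<open>Points of \<open>{1..r}\<close> outside the union are sent to 0 by \<open>psi\<close> and hence by \<open>\<alpha>\<close>, but a full transformation sends no
  point of \<open>{1..r}\<close> to 0.\<close>

lemma DM_sets_cover:
  assumes D: "D \<in> DM_sets (full_transf r) \<nu> i r" and \<nu>: "sum_list \<nu> = r"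
  shows "\<Union>D = {1..r}"
proof -
  from D obtain \<alpha> C \<sigma> where a: "D \<in> D_sets i r" "\<alpha> \<in> full_transf r" "C \<in> C_sets i r" "\<sigma> permutes {1..i}"
    "\<alpha> = phi C \<circ> \<sigma> \<circ> psi \<nu> D" unfolding DM_sets_def by blast
  have "x \<in> \<Union>D" if x: "x \<in> {1..r}" for x
  proof (rule ccontr)
    assume "x \<notin> \<Union>D"
    then have "psi \<nu> D x = 0" using psi_outside[of x D \<nu>] x \<nu> by simp
    moreover have "\<sigma> 0 = 0" using permutes_not_in[OF a(4), of 0] by simp
    moreover have "phi C 0 = 0" by (simp add: phi_def)
    ultimately have "\<alpha> x = 0" unfolding a(5) by simp
    moreover have "\<alpha> x \<in> {1..r}" using a(2) x unfolding full_transf_iff by blast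
    ultimately show False by simp
  qed
  then show ?thesis using D_sets_facts(4)[OF a(1)] by blast
qed

context cell_pair
begin

lemma DQ_cover:
  assumes M: "M = full_transf r" and D: "D \<in> Q"
  shows "\<Union>D = {1..r}"
proof -
  from data(5) D obtain D0 \<pi> where d: "D0 \<in> DM_sets M \<nu> (sum_list l) r" "\<pi> \<in> young \<nu>" "D = act \<pi> D0"
    by (auto simp: D_orbits_def)
  have "\<Union>D = \<pi> -` \<Union>D0" unfolding d(3) by blast
  also have "\<dots> = \<pi> -` {1..r}" using DM_sets_cover[of D0 r \<nu>] d(1) M data(8) by simp
  also have "\<dots> = {1..r}" using permutes_vimage[OF young_permutes[OF d(2)]] data(8) by simp
  finally show ?thesis .
qed

lemma cell_factor:
  assumes M: "M = full_transf r" and C: "C \<in> P" and D: "D \<in> Q" and \<sigma>: "\<sigma> permutes {1..sum_list l}"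
  shows "phi C \<circ> \<sigma> \<circ> psi \<nu> D \<in> full_transf r" "(phi C \<circ> \<sigma> \<circ> psi \<nu> D) ` {1..r} = C"
    "rank r (phi C \<circ> \<sigma> \<circ> psi \<nu> D) = sum_list l"
    "\<sigma> \<circ> psi \<nu> D \<in> full_transf r" "(\<sigma> \<circ> psi \<nu> D) ` {1..r} = {1..sum_list l}"
    "C \<in> C_sets (sum_list l) r" "D \<in> D_sets (sum_list l) r"
proof -
  show DD: "D \<in> D_sets (sum_list l) r" using DQ(1)[OF D] data(8) by simp
  note psi = psi_full[OF DD DQ_cover[OF M D] data(8)]
  show CC: "C \<in> C_sets (sum_list l) r" using CP(1,2)[OF C] by (simp add: C_sets_def)
  note f = factorization_full[OF CC \<sigma> psi D_sets_facts(5)[OF DD]]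
  show "phi C \<circ> \<sigma> \<circ> psi \<nu> D \<in> full_transf r" "(phi C \<circ> \<sigma> \<circ> psi \<nu> D) ` {1..r} = C"
    "\<sigma> \<circ> psi \<nu> D \<in> full_transf r" "(\<sigma> \<circ> psi \<nu> D) ` {1..r} = {1..sum_list l}" by (rule f)+
  then show "rank r (phi C \<circ> \<sigma> \<circ> psi \<nu> D) = sum_list l" using CP(2)[OF C] by (simp only: rank_def)
qed

lemma cell_mring_factor:
  assumes "cell_mring l (\<mu>, P, S) (\<nu>, Q, T) x \<noteq> 0"
  shows "\<exists>C\<in>P. \<exists>D\<in>Q. \<exists>\<sigma>. \<sigma> permutes {1..sum_list l} \<and> x = phi C \<circ> \<sigma> \<circ> psi \<nu> D"
proof (rule ccontr)
  assume "\<not> ?thesis"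
  then have "K \<sigma> * (if x = phi C \<circ> \<sigma> \<circ> psi \<nu> D then 1 else 0) = 0"
    if "C \<in> P" "D \<in> Q" "\<sigma> permutes {1..sum_list l}" for C D \<sigma> using that by auto
  then have "cell_mring l (\<mu>, P, S) (\<nu>, Q, T) x = 0"
    unfolding cell_mring_K by (intro sum.neutral ballI) auto
  then show False using assms by simp
qed

lemma cell_mring_support:
  assumes M: "M = full_transf r" and x: "cell_mring l (\<mu>, P, S) (\<nu>, Q, T) x \<noteq> 0"
  shows "x \<in> full_transf r" "rank r x = sum_list l"
proof -
  from cell_mring_factor[OF x] obtain C D \<sigma>
    where *: "C \<in> P" "D \<in> Q" "\<sigma> permutes {1..sum_list l}" "x = phi C \<circ> \<sigma> \<circ> psi \<nu> D" by blast
  show "x \<in> full_transf r" "rank r x = sum_list l"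
    unfolding *(4) by (rule cell_factor[OF M *(1,2,3)])+
qed

end

text \<open>The distinguished set system consists of the fibres \<open>{1}, \<dots>, {i - 1}, {i..r}\<close> of \<open>x \<mapsto> min x i\<close>.  Its map
  \<open>psi\<close> is the identity on \<open>{1..i}\<close>, so it cancels against \<open>phi {1..i}\<close>.\<close>

definition std_part :: "nat \<Rightarrow> nat \<Rightarrow> nat \<Rightarrow> nat set" where
  "std_part r i j = (if j < i then {j} else {i..r})"

definition std_D :: "nat \<Rightarrow> nat \<Rightarrow> nat set set" where
  "std_D r i = std_part r i ` {1..i}"

lemma regular_comp_facts:
  assumes "r \<le> n"
  shows "length (regular_comp r n) = n" "sum_list (regular_comp r n) = r"
    "x \<in> {1..r} \<Longrightarrow> block_no (regular_comp r n) x = x"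
proof -
  show len: "length (regular_comp r n) = n" using assms by (simp add: regular_comp_def)
  show "sum_list (regular_comp r n) = r" by (simp add: regular_comp_def sum_list_replicate)
  assume x: "x \<in> {1..r}"
  show "block_no (regular_comp r n) x = x"
    by (rule block_no_unique) (use x len assms regular_comp_block[OF x] in auto)
qed

lemma phi_initial: "phi {1..i} = id"
proof
  fix j
  have "sorted_list_of_set {1..i} = [1..<Suc i]" by (metis atLeastLessThanSuc_atLeastAtMost sorted_list_of_set_range)
  then show "phi {1..i} j = id j" by (auto simp: phi_def simp del: upt_Suc)
qed

context
  fixes r n i :: nat
  assumes rn: "r \<le> n" and i: "1 \<le> i" "i \<le> r"
begin

lemma std_part_facts:
  assumes "j \<in> {1..i}"
  shows "std_part r i j \<subseteq> {1..r}" "j \<in> std_part r i j"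
    "\<exists>w. sorted_list_of_set (std_part r i j) = j # w"
    "x \<in> {1..r} \<Longrightarrow> x \<in> std_part r i j \<longleftrightarrow> min x i = j"
proof -
  show "std_part r i j \<subseteq> {1..r}" "j \<in> std_part r i j" "x \<in> {1..r} \<Longrightarrow> x \<in> std_part r i j \<longleftrightarrow> min x i = j"
    using assms i by (auto simp: std_part_def)
  show "\<exists>w. sorted_list_of_set (std_part r i j) = j # w"
  proof (cases "j < i")
    case True
    then show ?thesis by (simp add: std_part_def)
  next
    case False
    then have "j = i" using assms by simp
    moreover have "sorted_list_of_set {i..r} = [i..<Suc r]"
      by (metis atLeastLessThanSuc_atLeastAtMost sorted_list_of_set_range)
    moreover have "[i..<Suc r] = i # [Suc i..<Suc r]" using i by (simp add: upt_conv_Cons del: upt_Suc)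
    ultimately show ?thesis by (simp add: std_part_def del: upt_Suc)
  qed
qed

lemma std_D_list: "D_list (regular_comp r n) (std_D r i) = map (std_part r i) [1..<Suc i]"
proof (rule D_list_eqI)
  show "std_D r i \<subseteq> Pow {1..r}" using std_part_facts(1) unfolding std_D_def by blast
  show "set (map (std_part r i) [1..<Suc i]) = std_D r i" by (auto simp: std_D_def)
  have "subset_less (regular_comp r n) (std_part r i j) (std_part r i k)" if "j \<in> {1..i}" "k \<in> {1..i}" "j < k" for j k
  proof -
    from std_part_facts(3)[OF that(1)] obtain w where w: "sorted_list_of_set (std_part r i j) = j # w" by blast
    from std_part_facts(3)[OF that(2)] obtain w' where w': "sorted_list_of_set (std_part r i k) = k # w'" by blast
    have "block_no (regular_comp r n) j = j" "block_no (regular_comp r n) k = k"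
      using that i by (auto intro!: regular_comp_facts(3)[OF rn])
    then show ?thesis using that(3) by (simp add: subset_less_def sbar_def w w')
  qed
  note less = this
  show "sorted_wrt (subset_less (regular_comp r n)) (map (std_part r i) [1..<Suc i])"
    unfolding sorted_wrt_map
  proof (rule sorted_wrt_mono_rel[of _ "(<)"])
    fix j k assume "j \<in> set [1..<Suc i]" "k \<in> set [1..<Suc i]" "j < k"
    then show "subset_less (regular_comp r n) (std_part r i j) (std_part r i k)"
      by (intro less) (auto simp del: upt_Suc)
  qed (rule sorted_wrt_upt)
qed

lemma std_D_list_nth: "j \<in> {1..i} \<Longrightarrow> D_list (regular_comp r n) (std_D r i) ! (j - 1) = std_part r i j"
  unfolding std_D_list by (auto simp del: upt_Suc)

lemma std_D_sets: "std_D r i \<in> D_sets i r"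
proof -
  have inj: "inj_on (std_part r i) {1..i}"
  proof (rule inj_onI)
    fix j k assume j: "j \<in> {1..i}" and k: "k \<in> {1..i}" and eq: "std_part r i j = std_part r i k"
    have "j \<in> {1..r}" using j i by auto
    then show "j = k" using std_part_facts(2)[OF j] std_part_facts(4)[OF k, of j] eq j by auto
  qed
  have "disjoint (std_D r i)"
  proof (rule disjointI)
    fix a b assume "a \<in> std_D r i" "b \<in> std_D r i" "a \<noteq> b"
    then obtain j k where jk: "j \<in> {1..i}" "k \<in> {1..i}" "a = std_part r i j" "b = std_part r i k" "j \<noteq> k"
      unfolding std_D_def by blast
    show "a \<inter> b = {}"
    proof (rule ccontr)
      assume "a \<inter> b \<noteq> {}"
      then obtain x where x: "x \<in> std_part r i j" "x \<in> std_part r i k" using jk by blast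
      then have "x \<in> {1..r}" using std_part_facts(1)[OF jk(1)] by blast
      then show False using std_part_facts(4)[OF jk(1)] std_part_facts(4)[OF jk(2)] x jk(5) by metis
    qed
  qed
  moreover have "std_D r i \<subseteq> Pow {1..r} - {{}}"
    using std_part_facts(1,2) unfolding std_D_def by blast
  moreover have "card (std_D r i) = i" using card_image[OF inj] by (simp add: std_D_def)
  ultimately show ?thesis by (simp add: D_sets_def)
qed

lemma std_D_cover: "\<Union>(std_D r i) = {1..r}"
proof (intro equalityI subsetI)
  fix x assume x: "x \<in> {1..r}"
  then have "min x i \<in> {1..i}" using i by auto
  then show "x \<in> \<Union>(std_D r i)" using std_part_facts(4)[OF _ x] unfolding std_D_def by blast
qed (use D_sets_facts(4)[OF std_D_sets] in blast)

lemma psi_std_D: "psi (regular_comp r n) (std_D r i) = collapse r i"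
proof
  fix x
  have D: "std_D r i \<in> D_sets i (sum_list (regular_comp r n))" using std_D_sets regular_comp_facts(2)[OF rn] by simp
  show "psi (regular_comp r n) (std_D r i) x = collapse r i x"
  proof (cases "x \<in> {1..r}")
    case True
    then have j: "min x i \<in> {1..i}" using i by auto
    have "D_list (regular_comp r n) (std_D r i) ! (min x i - 1) = std_part r i (min x i)"
      by (rule std_D_list_nth[OF j])
    then have "psi (regular_comp r n) (std_D r i) x = min x i"
      using std_part_facts(4)[OF j True] by (intro psi_eq[OF D j]) simp
    then show ?thesis using True by (simp add: collapse_def)
  next
    case False
    then have "x \<notin> \<Union>(std_D r i)" by (simp only: std_D_cover not_False_eq_True)
    from psi_outside[OF this, of "regular_comp r n"]
    have "psi (regular_comp r n) (std_D r i) x = (if x \<in> {1..r} then 0 else x)"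
      by (simp only: regular_comp_facts(2)[OF rn])
    then show ?thesis using False by (simp only: collapse_def if_False)
  qed
qed

lemma std_DM: "std_D r i \<in> DM_sets (full_transf r) (regular_comp r n) i r"
proof -
  have "transf_index r (collapse r i) = i"
    using rank_index[OF collapse_full[OF i]] collapse_image[OF i] by (simp add: rank_def)
  moreover have "collapse r i = phi {1..i} \<circ> id \<circ> psi (regular_comp r n) (std_D r i)"
    by (simp only: phi_initial psi_std_D id_comp)
  moreover have "{1..i} \<in> C_sets i r" using i by (auto simp: C_sets_def)
  ultimately show ?thesis
    using std_D_sets collapse_full[OF i] permutes_id[of "{1..i}"] unfolding DM_sets_def by blast
qed

lemma std_orbits:
  "{{1..i}} \<in> C_orbits (regular_comp r n) i r"
  "{std_D r i} \<in> D_orbits (full_transf r) (regular_comp r n) i r"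
proof -
  have "{1..i} \<in> C_sets i r" using i by (auto simp: C_sets_def)
  then show "{{1..i}} \<in> C_orbits (regular_comp r n) i r"
    unfolding C_orbits_def young_regular_comp[OF rn] by force
  have "{std_D r i} = (\<lambda>\<pi>. (\<lambda>d. \<pi> -` d) ` std_D r i) ` {id}" by simp
  then show "{std_D r i} \<in> D_orbits (full_transf r) (regular_comp r n) i r"
    unfolding D_orbits_def young_regular_comp[OF rn] using std_DM by (rule image_eqI)
qed

lemma std_types:
  "sum_list (comp_C_orbit (regular_comp r n) {{1..i}}) = i"
  "inj_on (block_no (comp_C_orbit (regular_comp r n) {{1..i}})) {1..i}"
  "sum_list (comp_D_orbit (regular_comp r n) {std_D r i}) = i"
  "inj_on (block_no (comp_D_orbit (regular_comp r n) {std_D r i})) {1..i}"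
proof -
  let ?o = "regular_comp r n"
  note o = regular_comp_facts[OF rn]
  have sub: "{1..i} \<subseteq> {1..sum_list ?o}" using i o(2) by auto
  have C: "comp_C_orbit ?o {{1..i}} = comp_C ?o {1..i}" by (simp add: comp_C_orbit_def)
  show "sum_list (comp_C_orbit ?o {{1..i}}) = i"
    unfolding C using comp_C_block_no(1)[OF sub] by simp
  have "block_no (comp_C ?o {1..i}) j = j" if "j \<in> {1..i}" for j
  proof -
    have "j \<in> {1..card {1..i}}" "j \<in> {1..r}" using that i by auto
    then show ?thesis by (simp only: comp_C_block_no(2)[OF sub] phi_initial id_apply o(3))
  qed
  then show "inj_on (block_no (comp_C_orbit ?o {{1..i}})) {1..i}" unfolding C by (intro inj_onI) metis
  have D: "comp_D_orbit ?o {std_D r i} = comp_D ?o (std_D r i)" by (simp add: comp_D_orbit_def)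
  have Dsub: "std_D r i \<subseteq> Pow {1..sum_list ?o}" using D_sets_facts(1)[OF std_D_sets] o(2) by simp
  have card: "card (std_D r i) = i" by (rule D_sets_facts(2)[OF std_D_sets])
  show "sum_list (comp_D_orbit ?o {std_D r i}) = i"
    unfolding D using comp_D_block_no(1)[OF Dsub] card by simp
  have bn: "block_no (comp_D ?o (std_D r i)) j = orbit_no ?o (std_part r i j)" if "j \<in> {1..i}" for j
  proof -
    have "D_list ?o (std_D r i) ! (j - 1) = std_part r i j" by (rule std_D_list_nth[OF that])
    then show ?thesis using comp_D_block_no(2)[OF Dsub, of j] that card by simp
  qed
  have orb: "d = d'" if "d \<subseteq> {1..r}" "d' \<subseteq> {1..r}" "orbit_no ?o d = orbit_no ?o d'" for d d'
  proof -
    have dr: "d \<subseteq> {1..sum_list ?o}" "d' \<subseteq> {1..sum_list ?o}" using that o(2) by simp_all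
    let ?P = "orbit_list ?o ! (orbit_no ?o d - 1)"
    have "?P \<in> subset_orbits ?o" by (rule orbit_list_nth[OF orbit_no_mem(1)[OF dr(1)]])
    then obtain e where "?P = {e}" unfolding subset_orbits_def young_regular_comp[OF rn] by auto
    then show ?thesis using orbit_no_mem(2)[OF dr(1)] orbit_no_mem(2)[OF dr(2)] that(3) by simp
  qed
  show "inj_on (block_no (comp_D_orbit ?o {std_D r i})) {1..i}"
    unfolding D
  proof (rule inj_onI)
    fix j k assume j: "j \<in> {1..i}" and k: "k \<in> {1..i}"
      and "block_no (comp_D ?o (std_D r i)) j = block_no (comp_D ?o (std_D r i)) k"
    then have "std_part r i j = std_part r i k"
      using bn[OF j] bn[OF k] orb[OF std_part_facts(1)[OF j] std_part_facts(1)[OF k]] by simp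
    moreover have "j \<in> {1..r}" using j i by auto
    ultimately show "j = k" using std_part_facts(2)[OF j] std_part_facts(4)[OF k, of j] j by auto
  qed
qed

end

section \<open>Products of cell basis elements\<close>

text \<open>Multiplicativity of \<open>nf\<close> along compositions that preserve both ranks transfers products computed in
  the monoid algebra to the elements of the cell basis, whose coefficients refer to the \<open>b\<^sub>D\<close> and not to the
  \<open>X(D) / n(D)\<close>.\<close>

locale cell_twisted = full_twisted r n nf k_type
  for r n nf and k_type :: "'k::field_char_0 itself" +
  assumes nf_mult: "\<lbrakk>\<mu> \<in> compositions r n; \<nu> \<in> compositions r n; a \<in> full_transf r; b \<in> full_transf r;
      rank r (a \<circ> b) = rank r a; rank r (a \<circ> b) = rank r b\<rbrakk>
    \<Longrightarrow> nf (\<mu>, regular_comp r n, double_coset \<mu> a (regular_comp r n)) *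
        nf (regular_comp r n, \<nu>, double_coset (regular_comp r n) b \<nu>)
      = nf (\<mu>, \<nu>, double_coset \<mu> (a \<circ> b) \<nu>)"
begin

abbreviation cell :: "nat list \<Rightarrow> lidx \<Rightarrow> ridx \<Rightarrow> bidx \<Rightarrow> 'k" where
  "cell l u v \<equiv> cell_elem r n T l u v"

abbreviation Lset :: "nat list \<Rightarrow> lidx set" where "Lset \<equiv> L_set r n"

abbreviation Rset :: "nat list \<Rightarrow> ridx set" where "Rset \<equiv> R_set r n T"

lemma cell_carrier: "cell l u v \<in> carrier A"
  by (auto simp: twisted_algebra_def cell_elem_def)

lemma cell_value:
  assumes l: "sorted_wrt (\<ge>) l" and u: "u \<in> Lset l" and v: "v \<in> Rset l" and m: "m \<in> T"
  shows "cell l u v (fst u, fst v, double_coset (fst u) m (fst v)) = of_int (cell_mring l u v m)"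
proof -
  obtain \<mu> P S \<nu> Q S' where uv: "u = (\<mu>, P, S)" "v = (\<nu>, Q, S')" using prod_cases3 by metis
  interpret cell_pair r n T l \<mu> P S \<nu> Q S' by unfold_locales (use l u v uv in auto)
  obtain \<sigma> \<pi> where s: "\<sigma> \<in> young \<mu>" "\<pi> \<in> young \<nu>" "(SOME x. x \<in> double_coset \<mu> m \<nu>) = \<sigma> \<circ> m \<circ> \<pi>"
    by (rule some_double_coset)
  have "(\<mu>, \<nu>, double_coset \<mu> m \<nu>) \<in> basis_set r n T"
    using data(1,4) m by (auto simp: basis_set_def double_cosets_def)
  moreover have "coset_coeff (cell_mring l u v) (double_coset \<mu> m \<nu>) = cell_mring l u v m"
    unfolding coset_coeff_def s(3) uv by (simp only: cell_mring_right[OF s(2)] cell_mring_left[OF s(1)])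
  ultimately show ?thesis by (simp add: cell_elem_def uv)
qed

lemma mfun_cell:
  assumes l: "sorted_wrt (\<ge>) l" and u: "u \<in> Lset l" and v: "v \<in> Rset l"
  shows "mfun (cell l u v) \<alpha> \<beta> m = (if \<alpha> = fst u \<and> \<beta> = fst v \<and> m \<in> T
    then of_int (cell_mring l u v m) / of_nat (nf (\<alpha>, \<beta>, double_coset \<alpha> m \<beta>)) else 0)"
proof -
  have "fst u \<in> \<Lambda>" "fst v \<in> \<Lambda>" using u v by (auto simp: L_set_def R_set_def)
  moreover have "cell l u v (\<alpha>, \<beta>, D) = 0" if "\<not> (\<alpha> = fst u \<and> \<beta> = fst v)" for D
    using that by (auto simp: cell_elem_def)
  ultimately show ?thesis using cell_value[OF l u v, of m] by (auto simp: mfun_def)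
qed

text \<open>The row-reading tableau is semistandard here, because the regular composition separates the points.\<close>

definition std_u :: "nat list \<Rightarrow> lidx" where
  "std_u l = (reg, {{1..sum_list l}}, tableau_type (comp_C_orbit reg {{1..sum_list l}}) (row_reading l))"

definition std_v :: "nat list \<Rightarrow> ridx" where
  "std_v l = (reg, {std_D r (sum_list l)}, tableau_type (comp_D_orbit reg {std_D r (sum_list l)}) (row_reading l))"

lemma std_uv:
  assumes l: "l \<in> partitions i" and i: "1 \<le> i" "i \<le> r"
  shows "std_u l \<in> Lset l" "std_v l \<in> Rset l"
proof -
  note lp = partitionsD[OF l]
  note o = std_orbits[OF r_le_n i] and t = std_types[OF r_le_n i]
  show "std_u l \<in> Lset l" using o(1) reg_mem row_reading_semistandard[OF lp(1)] t(1,2) lp(2)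
    by (simp add: std_u_def L_set_def)
  show "std_v l \<in> Rset l" using o(2) reg_mem row_reading_semistandard[OF lp(1)] t(3,4) lp(2)
    by (simp add: std_v_def R_set_def)
qed

lemma cell_as_delta_sum:
  assumes "cell_pair r n T l \<mu> P S \<nu> Q S'"
  shows "(\<lambda>x. of_int (cell_mring l (\<mu>, P, S) (\<nu>, Q, S') x) :: 'k)
    = (\<lambda>x. \<Sum>(C, D, \<sigma>)\<in>P \<times> Q \<times> {\<sigma>. \<sigma> permutes {1..sum_list l}}.
        if x = phi C \<circ> \<sigma> \<circ> psi \<nu> D
        then of_int (murphy_type l (comp_C_orbit \<mu> P) S (comp_D_orbit \<nu> Q) S' \<sigma>) else 0)"
proof
  fix x
  interpret cell_pair r n T l \<mu> P S \<nu> Q S' by fact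
  show "of_int (cell_mring l (\<mu>, P, S) (\<nu>, Q, S') x)
    = (\<Sum>(C, D, \<sigma>)\<in>P \<times> Q \<times> {\<sigma>. \<sigma> permutes {1..sum_list l}}.
        if x = phi C \<circ> \<sigma> \<circ> psi \<nu> D
        then of_int (murphy_type l (comp_C_orbit \<mu> P) S (comp_D_orbit \<nu> Q) S' \<sigma>) else (0::'k))"
    unfolding cell_mring_K K_def sum.cartesian_product[symmetric] of_int_sum
    by (intro sum.cong refl) auto
qed

text \<open>The maps in the middle cancel, so the product is computed in the group ring, where \<open>murphy_convolution\<close>
  applies; no terms of lower order arise.\<close>

lemma cell_mult:
  assumes l: "l \<in> partitions i" and i: "1 \<le> i" "i \<le> r" and u: "u \<in> Lset l" and v: "v \<in> Rset l"
  shows "cell l u (std_v l) \<otimes>\<^bsub>A\<^esub> cell l (std_u l) v = of_nat (card (young l)) \<odot>\<^bsub>A\<^esub> cell l u v"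
proof -
  note lp = partitionsD[OF l]
  note t = std_types[OF r_le_n i]
  note su = std_uv(1)[OF l i] and sv = std_uv(2)[OF l i]
  obtain \<mu> P S \<nu> Q S' where uv: "u = (\<mu>, P, S)" "v = (\<nu>, Q, S')" using prod_cases3 by metis
  let ?G = "{\<sigma>. \<sigma> permutes {1..i}}"
  let ?\<rho>1 = "comp_C_orbit reg {{1..i}}" and ?\<rho>2 = "comp_D_orbit reg {std_D r i}"
  let ?S0 = "tableau_type ?\<rho>1 (row_reading l)" and ?T0 = "tableau_type ?\<rho>2 (row_reading l)"
  have suv: "std_u l = (reg, {{1..i}}, ?S0)" "std_v l = (reg, {std_D r i}, ?T0)"
    by (simp_all add: std_u_def std_v_def lp(2))
  interpret c0: cell_pair r n T l \<mu> P S \<nu> Q S' by unfold_locales (use lp(1) u v uv in auto)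
  interpret c1: cell_pair r n T l \<mu> P S reg "{std_D r i}" ?T0 by unfold_locales (use lp(1) u sv uv suv in auto)
  interpret c2: cell_pair r n T l reg "{{1..i}}" ?S0 \<nu> Q S' by unfold_locales (use lp(1) su v uv suv in auto)
  have \<mu>\<nu>: "\<mu> \<in> \<Lambda>" "\<nu> \<in> \<Lambda>" by (rule c0.data)+
  let ?K1 = "murphy_type l (comp_C_orbit \<mu> P) S ?\<rho>2 ?T0"
  let ?K2 = "murphy_type l ?\<rho>1 ?S0 (comp_D_orbit \<nu> Q) S'"
  let ?K = "murphy_type l (comp_C_orbit \<mu> P) S (comp_D_orbit \<nu> Q) S'"
  let ?c1 = "\<lambda>x. of_int (cell_mring l u (std_v l) x) :: 'k"
  let ?c2 = "\<lambda>x. of_int (cell_mring l (std_u l) v x) :: 'k"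
  let ?c = "\<lambda>x. of_int (cell_mring l u v x) :: 'k"
  have finG: "finite ?G" by (simp add: finite_permutations)
  have A1: "phi C \<circ> \<sigma> \<circ> collapse r i \<in> T" if "C \<in> P" "\<sigma> \<in> ?G" for C \<sigma>
    using c1.cell_factor(1)[OF refl that(1), of "std_D r i" \<sigma>] that(2) lp(2) psi_std_D[OF r_le_n i] by simp
  have A2: "\<sigma> \<circ> psi \<nu> D \<in> T" "(\<sigma> \<circ> psi \<nu> D) ` {1..r} = {1..i}" if "D \<in> Q" "\<sigma> \<in> ?G" for D \<sigma>
    using c2.cell_factor(4,5)[OF refl _ that(1), of "{1..i}" \<sigma>] that(2) lp(2) by simp_all
  \<comment> \<open>The idempotent in the middle acts trivially on maps with image \<open>{1..i}\<close>.\<close>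
  have A12: "phi C \<circ> \<sigma> \<circ> collapse r i \<circ> (\<tau> \<circ> psi \<nu> D) = phi C \<circ> (\<sigma> \<circ> \<tau>) \<circ> psi \<nu> D"
    if "D \<in> Q" "\<tau> \<in> ?G" for C \<sigma> \<tau> D
  proof -
    have "collapse r i \<circ> (\<tau> \<circ> psi \<nu> D) = \<tau> \<circ> psi \<nu> D"
      by (rule collapse_comp[OF A2(1)[OF that]]) (simp only: A2(2)[OF that] order_refl)
    then show ?thesis by (metis comp_assoc)
  qed
  have delta: "mconv (\<lambda>x. if x = phi C \<circ> \<sigma> \<circ> collapse r i then of_int (?K1 \<sigma>) else 0)
      (\<lambda>x. if x = \<tau> \<circ> psi \<nu> D then of_int (?K2 \<tau>) else 0) m
    = (if phi C \<circ> (\<sigma> \<circ> \<tau>) \<circ> psi \<nu> D = m then of_int (?K1 \<sigma>) * of_int (?K2 \<tau>) else 0)"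
    if "C \<in> P" "\<sigma> \<in> ?G" "D \<in> Q" "\<tau> \<in> ?G" for C \<sigma> D \<tau> m
    unfolding mconv_delta_delta[OF A1[OF that(1,2)] A2(1)[OF that(3,4)]] A12[OF that(3,4)] ..
  have prod: "mconv ?c1 ?c2 m = of_nat (card (young l)) * ?c m" for m
  proof -
    have e1: "?c1 = (\<lambda>x. \<Sum>(C, \<sigma>)\<in>P \<times> ?G. if x = phi C \<circ> \<sigma> \<circ> collapse r i then of_int (?K1 \<sigma>) else 0)"
    proof
      fix x
      have "?c1 x = (\<Sum>C\<in>P. \<Sum>D\<in>{std_D r i}. \<Sum>\<sigma>\<in>?G. if x = phi C \<circ> \<sigma> \<circ> psi reg D then of_int (?K1 \<sigma>) else 0)"
        unfolding uv suv fun_cong[OF cell_as_delta_sum[OF c1.cell_pair_axioms], of x] lp(2)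
        by (simp only: sum.cartesian_product)
      then show "?c1 x = (\<Sum>(C, \<sigma>)\<in>P \<times> ?G. if x = phi C \<circ> \<sigma> \<circ> collapse r i then of_int (?K1 \<sigma>) else 0)"
        unfolding sum.cartesian_product[symmetric] by (simp add: psi_std_D[OF r_le_n i])
    qed
    have e2: "?c2 = (\<lambda>x. \<Sum>(D, \<sigma>)\<in>Q \<times> ?G. if x = \<sigma> \<circ> psi \<nu> D then of_int (?K2 \<sigma>) else 0)"
    proof
      fix x
      have "?c2 x = (\<Sum>C\<in>{{1..i}}. \<Sum>D\<in>Q. \<Sum>\<sigma>\<in>?G. if x = phi C \<circ> \<sigma> \<circ> psi \<nu> D then of_int (?K2 \<sigma>) else 0)"
        unfolding uv suv fun_cong[OF cell_as_delta_sum[OF c2.cell_pair_axioms], of x] lp(2)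
        by (simp only: sum.cartesian_product)
      then show "?c2 x = (\<Sum>(D, \<sigma>)\<in>Q \<times> ?G. if x = \<sigma> \<circ> psi \<nu> D then of_int (?K2 \<sigma>) else 0)"
        unfolding sum.cartesian_product[symmetric] by (simp add: phi_initial[simplified])
    qed
    have "mconv ?c1 ?c2 m = (\<Sum>(C, \<sigma>)\<in>P \<times> ?G. \<Sum>(D, \<tau>)\<in>Q \<times> ?G.
        mconv (\<lambda>x. if x = phi C \<circ> \<sigma> \<circ> collapse r i then of_int (?K1 \<sigma>) else 0)
          (\<lambda>x. if x = \<tau> \<circ> psi \<nu> D then of_int (?K2 \<tau>) else 0) m)"
      unfolding e1 e2 by (simp only: case_prod_unfold mconv_sum_left mconv_sum_right)
    also have "\<dots> = (\<Sum>(C, \<sigma>)\<in>P \<times> ?G. \<Sum>(D, \<tau>)\<in>Q \<times> ?G.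
        if phi C \<circ> (\<sigma> \<circ> \<tau>) \<circ> psi \<nu> D = m then of_int (?K1 \<sigma>) * of_int (?K2 \<tau>) else 0)"
      unfolding case_prod_unfold by (intro sum.cong refl delta) auto
    also have "\<dots> = (\<Sum>C\<in>P. \<Sum>\<sigma>\<in>?G. \<Sum>D\<in>Q. \<Sum>\<tau>\<in>?G.
        if phi C \<circ> (\<sigma> \<circ> \<tau>) \<circ> psi \<nu> D = m then of_int (?K1 \<sigma>) * of_int (?K2 \<tau>) else 0)"
      by (simp only: sum.cartesian_product[symmetric])
    also have "\<dots> = (\<Sum>C\<in>P. \<Sum>D\<in>Q. \<Sum>\<tau>\<in>?G. if m = phi C \<circ> \<tau> \<circ> psi \<nu> D then of_nat (card (young l)) * of_int (?K \<tau>) else 0)"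
    proof (rule sum.cong[OF refl])
      fix C
      have "(\<Sum>\<sigma>\<in>?G. \<Sum>D\<in>Q. \<Sum>\<tau>\<in>?G. if phi C \<circ> (\<sigma> \<circ> \<tau>) \<circ> psi \<nu> D = m then of_int (?K1 \<sigma>) * of_int (?K2 \<tau>) else 0)
          = (\<Sum>D\<in>Q. \<Sum>\<sigma>\<in>?G. \<Sum>\<tau>\<in>?G. if phi C \<circ> (\<sigma> \<circ> \<tau>) \<circ> psi \<nu> D = m then of_int (?K1 \<sigma>) * of_int (?K2 \<tau>) else (0::'k))"
        by (rule sum.swap)
      also have "\<dots> = (\<Sum>D\<in>Q. \<Sum>\<tau>\<in>?G. if m = phi C \<circ> \<tau> \<circ> psi \<nu> D then of_nat (card (young l)) * of_int (?K \<tau>) else 0)"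
      proof (rule sum.cong[OF refl])
        fix D
        have "(\<Sum>\<sigma>\<in>?G. \<Sum>\<tau>\<in>?G. if phi C \<circ> (\<sigma> \<circ> \<tau>) \<circ> psi \<nu> D = m then of_int (?K1 \<sigma>) * of_int (?K2 \<tau>) else (0::'k))
            = (\<Sum>\<sigma>\<in>?G. \<Sum>\<tau>\<in>?G. if phi C \<circ> \<tau> \<circ> psi \<nu> D = m then of_int (?K1 \<sigma>) * of_int (?K2 (pinv \<sigma> \<circ> \<tau>)) else 0)"
        proof (rule sum.cong[OF refl])
          fix \<sigma> assume "\<sigma> \<in> ?G"
          then have s: "\<sigma> permutes {1..i}" by simp
          have canc: "pinv \<sigma> \<circ> (\<sigma> \<circ> \<tau>) = \<tau>" for \<tau> :: transf
            by (simp only: o_assoc permutes_inv_o[OF s] id_comp)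
          show "(\<Sum>\<tau>\<in>?G. if phi C \<circ> (\<sigma> \<circ> \<tau>) \<circ> psi \<nu> D = m then of_int (?K1 \<sigma>) * of_int (?K2 \<tau>) else (0::'k))
            = (\<Sum>\<tau>\<in>?G. if phi C \<circ> \<tau> \<circ> psi \<nu> D = m then of_int (?K1 \<sigma>) * of_int (?K2 (pinv \<sigma> \<circ> \<tau>)) else 0)"
            using sum_permutes_translate[OF s, of "\<lambda>\<tau>. if phi C \<circ> \<tau> \<circ> psi \<nu> D = m then of_int (?K1 \<sigma>) * of_int (?K2 (pinv \<sigma> \<circ> \<tau>)) else (0::'k)"]
            by (simp only: canc)
        qed
        also have "\<dots> = (\<Sum>\<tau>\<in>?G. \<Sum>\<sigma>\<in>?G. if phi C \<circ> \<tau> \<circ> psi \<nu> D = m then of_int (?K1 \<sigma>) * of_int (?K2 (pinv \<sigma> \<circ> \<tau>)) else 0)"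
          by (rule sum.swap)
        also have "\<dots> = (\<Sum>\<tau>\<in>?G. if m = phi C \<circ> \<tau> \<circ> psi \<nu> D then of_nat (card (young l)) * of_int (?K \<tau>) else 0)"
        proof (rule sum.cong[OF refl])
          fix \<tau> assume "\<tau> \<in> ?G"
          then have "(\<Sum>\<sigma>\<in>?G. ?K1 \<sigma> * ?K2 (pinv \<sigma> \<circ> \<tau>)) = int (card (young l)) * ?K \<tau>"
            using murphy_convolution[OF c0.data(3) c0.comp_sums(1) c0.data(6) c0.comp_sums(2) lp(1),
                of ?\<rho>2 ?\<rho>1 \<tau>] t lp(2) by simp
          then have *: "(\<Sum>\<sigma>\<in>?G. of_int (?K1 \<sigma>) * of_int (?K2 (pinv \<sigma> \<circ> \<tau>))) = (of_nat (card (young l)) * of_int (?K \<tau>) :: 'k)"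
            by (metis (no_types, lifting) of_int_mult of_int_of_nat_eq of_int_sum sum.cong)
          show "(\<Sum>\<sigma>\<in>?G. if phi C \<circ> \<tau> \<circ> psi \<nu> D = m then of_int (?K1 \<sigma>) * of_int (?K2 (pinv \<sigma> \<circ> \<tau>)) else (0::'k))
            = (if m = phi C \<circ> \<tau> \<circ> psi \<nu> D then of_nat (card (young l)) * of_int (?K \<tau>) else 0)" 
          proof (cases "m = phi C \<circ> \<tau> \<circ> psi \<nu> D")
            case True
            then show ?thesis using * by (simp only: True[symmetric] if_True)
          qed auto
        qed
        finally show "(\<Sum>\<sigma>\<in>?G. \<Sum>\<tau>\<in>?G. if phi C \<circ> (\<sigma> \<circ> \<tau>) \<circ> psi \<nu> D = m then of_int (?K1 \<sigma>) * of_int (?K2 \<tau>) else 0) = \<dots>" .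
      qed
      finally show "(\<Sum>\<sigma>\<in>?G. \<Sum>D\<in>Q. \<Sum>\<tau>\<in>?G. if phi C \<circ> (\<sigma> \<circ> \<tau>) \<circ> psi \<nu> D = m then of_int (?K1 \<sigma>) * of_int (?K2 \<tau>) else 0) = \<dots>" .
    qed
    also have "\<dots> = of_nat (card (young l)) * ?c m"
    proof -
      have "?c m = (\<Sum>C\<in>P. \<Sum>D\<in>Q. \<Sum>\<tau>\<in>?G. if m = phi C \<circ> \<tau> \<circ> psi \<nu> D then of_int (?K \<tau>) else 0)"
        unfolding uv fun_cong[OF cell_as_delta_sum[OF c0.cell_pair_axioms], of m] lp(2)
        by (simp only: sum.cartesian_product)
      then show ?thesis by (simp add: sum_distrib_left if_distrib[of "\<lambda>x. of_nat (card (young l)) * x"] cong: if_cong)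
    qed
    finally show ?thesis .
  qed
  have sf: "fst u = \<mu>" "fst v = \<nu>" "fst (std_u l) = reg" "fst (std_v l) = reg" by (simp_all add: uv suv)
  note cells = mfun_cell[OF lp(1) u sv] mfun_cell[OF lp(1) su v] mfun_cell[OF lp(1) u v]
  show ?thesis
  proof (rule mfun_inject[OF mult_carrier smult_carrier[OF cell_carrier]], intro ext)
    fix \<alpha> \<beta> m
    show "mfun (cell l u (std_v l) \<otimes>\<^bsub>A\<^esub> cell l (std_u l) v) \<alpha> \<beta> m = mfun (of_nat (card (young l)) \<odot>\<^bsub>A\<^esub> cell l u v) \<alpha> \<beta> m"
    proof (cases "\<alpha> = \<mu> \<and> \<beta> = \<nu> \<and> m \<in> T")
      case True
      let ?N = "of_nat (nf (\<mu>, \<nu>, double_coset \<mu> m \<nu>)) :: 'k"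
      have "mfun (cell l u (std_v l) \<otimes>\<^bsub>A\<^esub> cell l (std_u l) v) \<mu> \<nu> m
          = mconv (mfun (cell l u (std_v l)) \<mu> reg) (mfun (cell l (std_u l) v) reg \<nu>) m"
        unfolding mfun_mult by (rule conv_reg_left) (simp add: cells sf)
      also have "\<dots> = (\<Sum>a\<in>T. \<Sum>b\<in>T. (if a \<circ> b = m then ?c1 a * ?c2 b else 0) / ?N)"
        unfolding mconv_def
      proof (intro sum.cong refl)
        fix a b assume ab: "a \<in> T" "b \<in> T"
        show "(if a \<circ> b = m then mfun (cell l u (std_v l)) \<mu> reg a * mfun (cell l (std_u l) v) reg \<nu> b else 0)
          = (if a \<circ> b = m then ?c1 a * ?c2 b else 0) / ?N"
        proof (cases "a \<circ> b = m \<and> ?c1 a \<noteq> 0 \<and> ?c2 b \<noteq> 0")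
          case True
          then have nz: "cell_mring l (\<mu>, P, S) (reg, {std_D r i}, ?T0) a \<noteq> 0"
            "cell_mring l (reg, {{1..i}}, ?S0) (\<nu>, Q, S') b \<noteq> 0" by (simp_all add: uv suv del: cell_mring.simps)
          have rk: "rank r a = i" "rank r b = i"
            using c1.cell_mring_support(2)[OF refl nz(1)] c2.cell_mring_support(2)[OF refl nz(2)] lp(2) by simp_all
          \<comment> \<open>Composition preserves the ranks on the supports, so the normalizations multiply.\<close>
          obtain C D1 \<sigma> where a: "C \<in> P" "D1 \<in> {std_D r i}" "\<sigma> \<in> ?G" "a = phi C \<circ> \<sigma> \<circ> psi reg D1"
            using c1.cell_mring_factor[OF nz(1)] unfolding lp(2) by blast
          obtain C2 D \<tau> where b: "C2 \<in> {{1..i}}" "D \<in> Q" "\<tau> \<in> ?G" "b = phi C2 \<circ> \<tau> \<circ> psi \<nu> D"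
            using c2.cell_mring_factor[OF nz(2)] unfolding lp(2) by blast
          have ab': "a = phi C \<circ> \<sigma> \<circ> collapse r i" "b = \<tau> \<circ> psi \<nu> D"
            using a(2) b(1) by (simp_all only: a(4) b(4) singleton_iff psi_std_D[OF r_le_n i] phi_initial id_comp)
          have "\<sigma> \<circ> \<tau> permutes {1..sum_list l}" using a(3) b(3) lp(2) by (simp add: permutes_compose)
          from c0.cell_factor(3)[OF refl a(1) b(2) this]
          have "rank r (a \<circ> b) = i" unfolding ab' A12[OF b(2,3)] lp(2) .
          then have "nf (\<mu>, reg, double_coset \<mu> a reg) * nf (reg, \<nu>, double_coset reg b \<nu>) = nf (\<mu>, \<nu>, double_coset \<mu> m \<nu>)"
            using nf_mult[OF \<mu>\<nu> ab] rk True by simp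
          then have "of_nat (nf (\<mu>, reg, double_coset \<mu> a reg)) * of_nat (nf (reg, \<nu>, double_coset reg b \<nu>)) = ?N"
            by (metis of_nat_mult)
          then show ?thesis using True ab by (simp add: cells sf)
        next
          case False
          then show ?thesis using ab by (auto simp: cells sf)
        qed
      qed
      also have "\<dots> = mconv ?c1 ?c2 m / ?N" by (simp add: mconv_def sum_divide_distrib)
      also have "\<dots> = of_nat (card (young l)) * ?c m / ?N" by (simp only: prod)
      finally show ?thesis using True by (simp add: mfun_smult cells sf)
    next
      case False
      have "conv (mfun (cell l u (std_v l))) (mfun (cell l (std_u l) v)) \<alpha> \<beta> m = 0" if "m \<in> T"
        using False that by (auto simp: conv_def mconv_def cells sf intro!: sum.neutral)
      moreover have "conv (mfun (cell l u (std_v l))) (mfun (cell l (std_u l) v)) \<alpha> \<beta> m = 0" if "m \<notin> T"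
        using bi_invariantD(3)[OF conv_bi_invariant[OF mfun_bi_invariant mfun_bi_invariant] that] .
      ultimately show ?thesis using False by (auto simp: mfun_mult mfun_smult cells sf)
    qed
  qed
qed

end

section \<open>A functional that vanishes on the larger cells\<close>

lemma perm_comp_collapse_eq:
  assumes "\<sigma> permutes {1..i}" "\<tau> permutes {1..i}" and i: "1 \<le> i" "i \<le> r"
  shows "\<sigma> \<circ> collapse r i = \<tau> \<circ> collapse r i \<longleftrightarrow> \<sigma> = \<tau>"
proof
  assume eq: "\<sigma> \<circ> collapse r i = \<tau> \<circ> collapse r i"
  show "\<sigma> = \<tau>"
  proof
    fix x
    show "\<sigma> x = \<tau> x"
    proof (cases "x \<in> {1..i}")
      case True
      then have "collapse r i x = x" using i by (auto simp: collapse_def)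
      then show ?thesis using fun_cong[OF eq, of x] by (simp only: o_apply)
    next
      case False
      then show ?thesis using permutes_not_in[OF assms(1)] permutes_not_in[OF assms(2)] by metis
    qed
  qed
qed simp

lemma comp_inv_eq_iff:
  assumes "\<pi> permutes X"
  shows "a \<circ> pinv \<pi> = b \<longleftrightarrow> a = b \<circ> \<pi>"
proof
  assume b: "a \<circ> pinv \<pi> = b"
  have "b \<circ> \<pi> = a \<circ> (pinv \<pi> \<circ> \<pi>)" by (simp only: b[symmetric] comp_assoc)
  then show "a = b \<circ> \<pi>" by (simp only: permutes_inv_o[OF assms] comp_id)
next
  assume a: "a = b \<circ> \<pi>"
  have "a \<circ> pinv \<pi> = b \<circ> (\<pi> \<circ> pinv \<pi>)" by (simp only: a comp_assoc)
  then show "a \<circ> pinv \<pi> = b" by (simp only: permutes_inv_o[OF assms] comp_id)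
qed

context cell_twisted
begin

text \<open>The pairing of the regular block of \<open>f\<close> with the column antisymmetrizer of \<open>l\<close>, which \<open>collapse\<close>
  places among the maps of rank \<open>sum_list l\<close>.\<close>

definition col_sum :: "nat list \<Rightarrow> (bidx \<Rightarrow> 'k) \<Rightarrow> 'k" where
  "col_sum l f = (\<Sum>\<tau>\<in>col_perms l.
    of_int (sign \<tau>) * f (reg, reg, double_coset reg (pinv \<tau> \<circ> collapse r (sum_list l)) reg))"

lemma diff_apply:
  assumes "f \<in> carrier A" "g \<in> carrier A"
  shows "(f \<ominus>\<^bsub>A\<^esub> g) b = f b - g b"
proof -
  have "(g \<oplus>\<^bsub>A\<^esub> (\<ominus>\<^bsub>A\<^esub> g)) b = \<zero>\<^bsub>A\<^esub> b" using alg.r_neg[OF assms(2)] by simp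
  then have "(\<ominus>\<^bsub>A\<^esub> g) b = - g b" by (simp add: twisted_algebra_def eq_neg_iff_add_eq_0 add.commute)
  moreover have "(f \<ominus>\<^bsub>A\<^esub> g) b = f b + (\<ominus>\<^bsub>A\<^esub> g) b" unfolding a_minus_def by (simp add: twisted_algebra_def)
  ultimately show ?thesis by simp
qed

lemma col_sum_diff: "f \<in> carrier A \<Longrightarrow> g \<in> carrier A \<Longrightarrow> col_sum l (f \<ominus>\<^bsub>A\<^esub> g) = col_sum l f - col_sum l g"
  by (simp add: col_sum_def diff_apply right_diff_distrib sum_subtractf)

lemma col_sum_smult: "col_sum l (c \<odot>\<^bsub>A\<^esub> f) = c * col_sum l f"
  by (simp add: col_sum_def twisted_algebra_def sum_distrib_left mult_ac)

lemma col_sum_finsum: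
  assumes "\<And>i. i \<in> I \<Longrightarrow> g i \<in> carrier A"
  shows "col_sum l (\<Oplus>\<^bsub>A\<^esub>i\<in>I. g i) = (\<Sum>i\<in>I. col_sum l (g i))"
proof -
  have "(\<Oplus>\<^bsub>A\<^esub>i\<in>I. g i) b = (\<Sum>i\<in>I. g i b)" for b using assms by (rule finsum_apply)
  then show ?thesis unfolding col_sum_def sum_distrib_left by (simp only: sum_distrib_left) (rule sum.swap)
qed

lemma cell_mring_collapse:
  assumes i: "1 \<le> i" "i \<le> r" and cp: "cell_pair r n T m reg P S reg Q S'" and m: "sum_list m = i"
    and \<theta>: "\<theta> permutes {1..i}"
  shows "cell_mring m (reg, P, S) (reg, Q, S') (\<theta> \<circ> collapse r i) = (\<Sum>C\<in>P. \<Sum>D\<in>Q.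
    \<Sum>\<sigma> | \<sigma> permutes {1..i}. if \<theta> \<circ> collapse r i = phi C \<circ> \<sigma> \<circ> psi reg D
      then murphy_type m (comp_C_orbit reg P) S (comp_D_orbit reg Q) S' \<sigma> else 0)"
proof -
  interpret cell_pair r n T m reg P S reg Q S' by fact
  show ?thesis unfolding cell_mring_K K_def m by (intro sum.cong refl) auto
qed

text \<open>For the distinguished indices both types separate the points, so the Murphy element is \<open>r\<^sub>\<lambda>\<close>.\<close>

lemma std_cell_mring:
  assumes l: "l \<in> partitions i" and i: "1 \<le> i" "i \<le> r" and \<theta>: "\<theta> permutes {1..i}"
  shows "cell_mring l (std_u l) (std_v l) (\<theta> \<circ> collapse r i) = (if \<theta> \<in> young l then 1 else 0)"
proof -
  note lp = partitionsD[OF l] and t = std_types[OF r_le_n i]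
  let ?\<rho>1 = "comp_C_orbit reg {{1..i}}" and ?\<rho>2 = "comp_D_orbit reg {std_D r i}"
  let ?S0 = "tableau_type ?\<rho>1 (row_reading l)" and ?T0 = "tableau_type ?\<rho>2 (row_reading l)"
  have suv: "std_u l = (reg, {{1..i}}, ?S0)" "std_v l = (reg, {std_D r i}, ?T0)"
    by (simp_all add: std_u_def std_v_def lp(2))
  have cp: "cell_pair r n T l reg {{1..i}} ?S0 reg {std_D r i} ?T0"
    using std_uv[OF l i] lp(1) unfolding suv by unfold_locales
  have t': "sum_list ?\<rho>1 = sum_list l" "inj_on (block_no ?\<rho>1) {1..sum_list l}"
    "sum_list ?\<rho>2 = sum_list l" "inj_on (block_no ?\<rho>2) {1..sum_list l}" unfolding lp(2) by (rule t)+
  let ?K = "murphy_type l ?\<rho>1 ?S0 ?\<rho>2 ?T0"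
  have "cell_mring l (std_u l) (std_v l) (\<theta> \<circ> collapse r i)
      = (\<Sum>\<sigma> | \<sigma> permutes {1..i}. if \<theta> \<circ> collapse r i = phi {1..i} \<circ> \<sigma> \<circ> psi reg (std_D r i) then ?K \<sigma> else 0)"
    unfolding suv cell_mring_collapse[OF i cp lp(2) \<theta>] by simp
  also have "\<dots> = (\<Sum>\<sigma> | \<sigma> permutes {1..i}. if \<sigma> = \<theta> then ?K \<sigma> else 0)"
  proof (rule sum.cong[OF refl])
    fix \<sigma> assume "\<sigma> \<in> {\<sigma>. \<sigma> permutes {1..i}}"
    then have "\<sigma> permutes {1..i}" by simp
    then have "\<theta> \<circ> collapse r i = phi {1..i} \<circ> \<sigma> \<circ> psi reg (std_D r i) \<longleftrightarrow> \<sigma> = \<theta>"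
      unfolding phi_initial id_comp psi_std_D[OF r_le_n i] using perm_comp_collapse_eq[OF \<theta> _ i] by metis
    then show "(if \<theta> \<circ> collapse r i = phi {1..i} \<circ> \<sigma> \<circ> psi reg (std_D r i) then ?K \<sigma> else 0) = (if \<sigma> = \<theta> then ?K \<sigma> else 0)"
      by (simp only:)
  qed
  also have "\<dots> = ?K \<theta>" using \<theta> by (simp add: finite_permutations)
  also have "\<dots> = (if \<theta> \<in> young l then 1 else 0)"
    unfolding murphy_row_left[OF row_reading_semistandard[OF lp(1) t'(1,2)] t'(1) lp(1) t'(3,4)]
      typed_perms_row_reading[OF t'(1,2)] ..
  finally show ?thesis .
qed

lemma col_permsD: "\<tau> \<in> col_perms l \<Longrightarrow> \<tau> permutes {1..sum_list l}"
  by (simp add: col_perms_def)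

text \<open>Only the identity preserves both rows and columns.\<close>

lemma col_sum_std:
  assumes l: "l \<in> partitions i" and i: "1 \<le> i" "i \<le> r"
  shows "col_sum l (cell l (std_u l) (std_v l)) = 1"
proof -
  note lp = partitionsD[OF l]
  have val: "cell l (std_u l) (std_v l) (reg, reg, double_coset reg (pinv \<tau> \<circ> collapse r i) reg) = (if \<tau> = id then 1 else 0)"
    if \<tau>: "\<tau> \<in> col_perms l" for \<tau>
  proof -
    have p: "\<tau> permutes {1..i}" using col_permsD[OF \<tau>] lp(2) by simp
    note q = permutes_inv[OF p]
    have "pinv \<tau> \<circ> collapse r i \<in> T"
      using permutes_full_transf[OF q i(2)] collapse_full[OF i] by (rule full_transf_comp)
    moreover have "fst (std_u l) = reg" "fst (std_v l) = reg" by (simp_all add: std_u_def std_v_def)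
    ultimately have "cell l (std_u l) (std_v l) (reg, reg, double_coset reg (pinv \<tau> \<circ> collapse r i) reg)
        = of_int (cell_mring l (std_u l) (std_v l) (pinv \<tau> \<circ> collapse r i))"
      using cell_value[OF lp(1) std_uv[OF l i], of "pinv \<tau> \<circ> collapse r i"] by simp
    moreover have "pinv \<tau> \<in> young l \<longleftrightarrow> \<tau> = id"
    proof
      assume "pinv \<tau> \<in> young l"
      then have "pinv (pinv \<tau>) \<in> young l" by (rule young_inv)
      then show "\<tau> = id" using col_perms_young[OF \<tau>] permutes_inv_inv[OF p] by simp
    qed (use young_id in simp)
    ultimately show ?thesis by (simp add: std_cell_mring[OF l i q])
  qed
  have "id \<in> col_perms l" by (simp add: col_perms_def)
  moreover have "col_sum l (cell l (std_u l) (std_v l)) = (\<Sum>\<tau>\<in>col_perms l. if \<tau> = id then 1 else 0)"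
    unfolding col_sum_def lp(2) by (rule sum.cong[OF refl]) (auto simp: val)
  ultimately show ?thesis by (simp add: finite_col_perms)
qed

text \<open>A pair \<open>(C, D)\<close> contributes only if \<open>C = {1..i}\<close> and \<open>psi reg D = \<pi> \<circ> collapse r i\<close> for a permutation \<open>\<pi>\<close>.
  Its contribution is then a sum of terms as in \<open>col_alternating_zero\<close>, with \<open>d(t)\<close> shifted by \<open>\<pi>\<close>.\<close>

lemma col_sum_cell_mring:
  assumes pl: "l \<in> partitions i" and i: "1 \<le> i" "i \<le> r"
    and m: "m \<in> partitions i" "dominates m l" "m \<noteq> l"
    and cp: "cell_pair r n T m reg P S reg Q S'"
  shows "(\<Sum>\<tau>\<in>col_perms l. sign \<tau> * cell_mring m (reg, P, S) (reg, Q, S') (pinv \<tau> \<circ> collapse r i)) = 0"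
proof -
  note lp = partitionsD[OF pl] and mp = partitionsD[OF m(1)]
  interpret cell_pair r n T m reg P S reg Q S' by fact
  let ?G = "{\<sigma>. \<sigma> permutes {1..i}}"
  let ?\<rho> = "comp_C_orbit reg P" and ?\<rho>' = "comp_D_orbit reg Q"
  let ?K = "murphy_type m ?\<rho> S ?\<rho>' S'"
  let ?Z = "\<lambda>\<tau> C D. \<Sum>\<sigma>\<in>?G. if pinv \<tau> \<circ> collapse r i = phi C \<circ> \<sigma> \<circ> psi reg D then ?K \<sigma> else 0"
  have perm: "pinv \<tau> permutes {1..i}" if "\<tau> \<in> col_perms l" for \<tau>
    using permutes_inv[OF col_permsD[OF that]] lp(2) by simp
  have zero: "(\<Sum>\<tau>\<in>col_perms l. sign \<tau> * ?Z \<tau> C D) = 0" if C: "C \<in> P" and D: "D \<in> Q" for C D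
  proof (cases "\<exists>\<tau>\<in>col_perms l. \<exists>\<sigma>\<in>?G. pinv \<tau> \<circ> collapse r i = phi C \<circ> \<sigma> \<circ> psi reg D")
    case False
    then have "?Z \<tau> C D = 0" if "\<tau> \<in> col_perms l" for \<tau> using that by (intro sum.neutral) auto
    then show ?thesis by (intro sum.neutral) simp
  next
    case True
    then obtain \<tau>0 \<sigma>0 where 0: "\<tau>0 \<in> col_perms l" "\<sigma>0 permutes {1..i}"
      "pinv \<tau>0 \<circ> collapse r i = phi C \<circ> \<sigma>0 \<circ> psi reg D" by blast
    have "C = (pinv \<tau>0 \<circ> collapse r i) ` {1..r}"
      unfolding 0(3) by (rule cell_factor(2)[OF refl C D, symmetric]) (use 0(2) mp(2) in simp)
    also have "\<dots> = {1..i}"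
      by (simp only: image_comp[symmetric] collapse_image[OF i] permutes_image[OF perm[OF 0(1)]])
    finally have "phi C = id" using phi_initial by simp
    then have phi: "phi C \<circ> \<sigma> = \<sigma>" for \<sigma> :: transf by simp
    define \<pi> where "\<pi> = pinv \<sigma>0 \<circ> pinv \<tau>0"
    have \<pi>: "\<pi> permutes {1..i}" unfolding \<pi>_def using perm[OF 0(1)] permutes_inv[OF 0(2)] by (rule permutes_compose)
    have "psi reg D = pinv \<sigma>0 \<circ> (\<sigma>0 \<circ> psi reg D)" by (simp only: o_assoc permutes_inv_o[OF 0(2)] id_comp)
    then have psi: "psi reg D = \<pi> \<circ> collapse r i" using 0(3) unfolding phi \<pi>_def by (metis comp_assoc)
    have Z: "?Z \<tau> C D = (\<Sum>s | s \<in> standard_tableaux m \<and> tableau_type ?\<rho> s = S.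
        \<Sum>t | t \<in> standard_tableaux m \<and> tableau_type ?\<rho>' t = S'.
        \<Sum>w\<in>young m. if pinv \<tau> = d_perm s \<circ> w \<circ> pinv (pinv \<pi> \<circ> d_perm t) then 1 else 0)"
      if \<tau>: "\<tau> \<in> col_perms l" for \<tau>
    proof -
      have *: "pinv \<tau> \<circ> collapse r i = phi C \<circ> \<sigma> \<circ> psi reg D \<longleftrightarrow> \<sigma> = pinv \<tau> \<circ> pinv \<pi>" if "\<sigma> \<in> ?G" for \<sigma>
      proof -
        have "\<sigma> \<circ> \<pi> permutes {1..i}" using that \<pi> permutes_compose by blast
        then have "pinv \<tau> \<circ> collapse r i = \<sigma> \<circ> \<pi> \<circ> collapse r i \<longleftrightarrow> pinv \<tau> = \<sigma> \<circ> \<pi>"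
          by (rule perm_comp_collapse_eq[OF perm[OF \<tau>] _ i])
        moreover have "pinv \<tau> = \<sigma> \<circ> \<pi> \<longleftrightarrow> \<sigma> = pinv \<tau> \<circ> pinv \<pi>"
          using comp_inv_eq_iff[OF \<pi>, of "pinv \<tau>" \<sigma>] by blast
        ultimately show ?thesis unfolding phi psi o_assoc by blast
      qed
      have "pinv \<tau> \<circ> pinv \<pi> \<in> ?G" using permutes_compose[OF permutes_inv[OF \<pi>] perm[OF \<tau>]] by simp
      moreover have "?Z \<tau> C D = (\<Sum>\<sigma>\<in>?G. if \<sigma> = pinv \<tau> \<circ> pinv \<pi> then ?K \<sigma> else 0)"
        by (rule sum.cong[OF refl]) (simp only: *)
      ultimately have "?Z \<tau> C D = ?K (pinv \<tau> \<circ> pinv \<pi>)" by (simp add: finite_permutations)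
      also have "\<dots> = (\<Sum>s | s \<in> standard_tableaux m \<and> tableau_type ?\<rho> s = S.
        \<Sum>t | t \<in> standard_tableaux m \<and> tableau_type ?\<rho>' t = S'.
        \<Sum>w\<in>young m. if pinv \<tau> = d_perm s \<circ> w \<circ> pinv (pinv \<pi> \<circ> d_perm t) then 1 else 0)"
        unfolding murphy_type_def murphy_def
      proof (rule sum.cong[OF refl], rule sum.cong[OF refl], rule sum.cong[OF refl])
        fix s t w assume "t \<in> {t \<in> standard_tableaux m. tableau_type ?\<rho>' t = S'}"
        then have dt: "d_perm t permutes {1..i}" using d_perm_permutes[of t m] mp(2) by simp
        have inv: "pinv (pinv \<pi> \<circ> d_perm t) = pinv (d_perm t) \<circ> \<pi>"
          using o_inv_distrib[OF permutes_bij[OF permutes_inv[OF \<pi>]] permutes_bij[OF dt]] permutes_inv_inv[OF \<pi>] by simp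
        have "pinv \<tau> \<circ> pinv \<pi> = d_perm s \<circ> w \<circ> pinv (d_perm t) \<longleftrightarrow> pinv \<tau> = d_perm s \<circ> w \<circ> pinv (pinv \<pi> \<circ> d_perm t)"
          unfolding inv comp_inv_eq_iff[OF \<pi>] by (simp only: comp_assoc)
        then show "(if pinv \<tau> \<circ> pinv \<pi> = d_perm s \<circ> w \<circ> pinv (d_perm t) then 1 else 0)
          = (if pinv \<tau> = d_perm s \<circ> w \<circ> pinv (pinv \<pi> \<circ> d_perm t) then 1 else (0::int))" by (simp only:)
      qed
      finally show ?thesis .
    qed
    have "(\<Sum>\<tau>\<in>col_perms l. sign \<tau> * ?Z \<tau> C D) = (\<Sum>\<tau>\<in>col_perms l.
        \<Sum>s | s \<in> standard_tableaux m \<and> tableau_type ?\<rho> s = S. \<Sum>t | t \<in> standard_tableaux m \<and> tableau_type ?\<rho>' t = S'.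
        sign \<tau> * (\<Sum>w\<in>young m. if pinv \<tau> = d_perm s \<circ> w \<circ> pinv (pinv \<pi> \<circ> d_perm t) then 1 else 0))"
      by (rule sum.cong[OF refl]) (simp only: Z sum_distrib_left)
    also have "\<dots> = (\<Sum>s | s \<in> standard_tableaux m \<and> tableau_type ?\<rho> s = S. \<Sum>t | t \<in> standard_tableaux m \<and> tableau_type ?\<rho>' t = S'.
        \<Sum>\<tau>\<in>col_perms l. sign \<tau> * (\<Sum>w\<in>young m. if pinv \<tau> = d_perm s \<circ> w \<circ> pinv (pinv \<pi> \<circ> d_perm t) then 1 else 0))"
      by (rule trans[OF sum.swap], rule sum.cong[OF refl], rule sum.swap)
    also have "\<dots> = 0"
    proof (rule sum.neutral, rule ballI, rule sum.neutral, rule ballI, rule col_alternating_zero[OF pl m])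
      fix t assume "t \<in> {t \<in> standard_tableaux m. tableau_type ?\<rho>' t = S'}"
      then have "d_perm t permutes {1..i}" using d_perm_permutes[of t m] mp(2) by simp
      then show "pinv \<pi> \<circ> d_perm t permutes {1..i}" using permutes_inv[OF \<pi>] by (rule permutes_compose)
    qed
    finally show ?thesis .
  qed
  have "(\<Sum>\<tau>\<in>col_perms l. sign \<tau> * cell_mring m (reg, P, S) (reg, Q, S') (pinv \<tau> \<circ> collapse r i))
      = (\<Sum>\<tau>\<in>col_perms l. \<Sum>C\<in>P. \<Sum>D\<in>Q. sign \<tau> * ?Z \<tau> C D)"
    by (rule sum.cong[OF refl]) (simp only: cell_mring_collapse[OF i cp mp(2) perm] sum_distrib_left)
  also have "\<dots> = (\<Sum>C\<in>P. \<Sum>D\<in>Q. \<Sum>\<tau>\<in>col_perms l. sign \<tau> * ?Z \<tau> C D)"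
    by (rule trans[OF sum.swap], rule sum.cong[OF refl], rule sum.swap)
  also have "\<dots> = 0" by (intro sum.neutral ballI zero)
  finally show ?thesis .
qed

text \<open>Cells of other compositions have no component in the regular block, and cells of partitions of another
  number are supported on maps of another rank.\<close>

lemma col_sum_cell:
  assumes pl: "l \<in> partitions i" and i: "1 \<le> i" "i \<le> r"
    and m: "m \<in> partitions j" "part_ge m l" "m \<noteq> l" and u: "u \<in> Lset m" and v: "v \<in> Rset m"
  shows "col_sum l (cell m u v) = 0"
proof (cases "fst u = reg \<and> fst v = reg")
  case False
  then have "cell m u v (reg, reg, D) = 0" for D by (auto simp: cell_elem_def)
  then show ?thesis by (simp add: col_sum_def)
next
  case True
  note lp = partitionsD[OF pl] and mp = partitionsD[OF m(1)]
  obtain P S Q S' where uv: "u = (reg, P, S)" "v = (reg, Q, S')" using True by (metis prod.collapse)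
  interpret cell_pair r n T m reg P S reg Q S' by unfold_locales (use mp(1) u v uv in auto)
  have xT: "pinv \<tau> \<circ> collapse r i \<in> T" "rank r (pinv \<tau> \<circ> collapse r i) = i" if "\<tau> \<in> col_perms l" for \<tau>
  proof -
    have q: "pinv \<tau> permutes {1..i}" using permutes_inv[OF col_permsD[OF that]] lp(2) by simp
    show "pinv \<tau> \<circ> collapse r i \<in> T"
      using permutes_full_transf[OF q i(2)] collapse_full[OF i] by (rule full_transf_comp)
    have "(pinv \<tau> \<circ> collapse r i) ` {1..r} = {1..i}"
      by (simp only: image_comp[symmetric] collapse_image[OF i] permutes_image[OF q])
    then show "rank r (pinv \<tau> \<circ> collapse r i) = i" by (simp only: rank_def) simp
  qed
  have "col_sum l (cell m u v) = of_int (\<Sum>\<tau>\<in>col_perms l. sign \<tau> * cell_mring m u v (pinv \<tau> \<circ> collapse r i))"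
    unfolding col_sum_def of_int_sum of_int_mult lp(2)
    by (rule sum.cong[OF refl]) (use cell_value[OF mp(1) u v xT(1)] True in simp)
  also have "(\<Sum>\<tau>\<in>col_perms l. sign \<tau> * cell_mring m u v (pinv \<tau> \<circ> collapse r i)) = 0"
  proof (cases "j = i")
    case True
    have "dominates m l" using m(2) mp(2) lp(2) True by (simp add: part_ge_def)
    then show ?thesis
      unfolding uv using m(1,3) True by (intro col_sum_cell_mring[OF pl i] cell_pair_axioms) simp_all
  next
    case False
    have "cell_mring m u v (pinv \<tau> \<circ> collapse r i) = 0" if "\<tau> \<in> col_perms l" for \<tau>
      using cell_mring_support(2)[OF refl, of "pinv \<tau> \<circ> collapse r i"] xT(2)[OF that] False mp(2) unfolding uv by metis
    then show ?thesis by (intro sum.neutral ballI) simp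
  qed
  finally show ?thesis by simp
qed

abbreviation "hat l \<equiv> cell_hat A (Lam r T) part_ge Lset Rset cell l"

lemma col_sum_hat:
  assumes l: "l \<in> partitions i" and i: "1 \<le> i" "i \<le> r" and f: "f \<in> hat l"
  shows "col_sum l f = 0"
proof -
  from f obtain F c where F: "f = (\<Oplus>\<^bsub>A\<^esub>b\<in>F. c b \<odot>\<^bsub>A\<^esub> b)"
    "F \<subseteq> {cell m s t |m s t. m \<in> Lam r T \<and> part_ge m l \<and> m \<noteq> l \<and> s \<in> Lset m \<and> t \<in> Rset m}"
    unfolding cell_hat_def k_span_def by blast
  have b: "b \<in> carrier A" "col_sum l b = 0" if "b \<in> F" for b
  proof -
    from that F(2) obtain m s t where *: "b = cell m s t" "m \<in> Lam r T" "part_ge m l" "m \<noteq> l" "s \<in> Lset m" "t \<in> Rset m"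
      by blast
    show "b \<in> carrier A" unfolding *(1) by (rule cell_carrier)
    from *(2) obtain j where "m \<in> partitions j" by (auto simp: Lam_def)
    then show "col_sum l b = 0" unfolding *(1) using *(3-6) by (intro col_sum_cell[OF l i])
  qed
  have "col_sum l f = (\<Sum>b\<in>F. col_sum l (c b \<odot>\<^bsub>A\<^esub> b))"
    unfolding F(1) by (rule col_sum_finsum) (rule smult_carrier[OF b(1)])
  also have "\<dots> = 0" by (intro sum.neutral ballI) (simp add: col_sum_smult b(2))
  finally show ?thesis .
qed

text \<open>By \<open>cell_mult\<close> this scalar has the defining property of the bracket.  It is the only one, since \<open>col_sum\<close>
  vanishes on \<open>hat l\<close> but not on the cell basis element of the distinguished indices.\<close>

lemma bracket_std:
  assumes l: "l \<in> partitions i" and i: "1 \<le> i" "i \<le> r"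
  shows "cell_bracket A (Lam r T) part_ge Lset Rset cell l (std_u l) (std_v l) = of_nat (card (young l))"
  unfolding cell_bracket_def
proof (rule the_equality)
  have "\<zero>\<^bsub>A\<^esub> = (\<Oplus>\<^bsub>A\<^esub>b\<in>{}. undefined b \<odot>\<^bsub>A\<^esub> b)" by simp
  then have zero: "\<zero>\<^bsub>A\<^esub> \<in> hat l" unfolding cell_hat_def k_span_def by blast
  show "\<forall>s'\<in>Lset l. \<forall>t'\<in>Rset l. cell l s' (std_v l) \<otimes>\<^bsub>A\<^esub> cell l (std_u l) t'
      \<ominus>\<^bsub>A\<^esub> of_nat (card (young l)) \<odot>\<^bsub>A\<^esub> cell l s' t' \<in> hat l"
  proof (intro ballI)
    fix s' t' assume "s' \<in> Lset l" "t' \<in> Rset l"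
    note eq = cell_mult[OF l i this]
    have "of_nat (card (young l)) \<odot>\<^bsub>A\<^esub> cell l s' t' \<in> carrier A" by (rule smult_carrier[OF cell_carrier])
    note neg = alg.r_neg[OF this]
    show "cell l s' (std_v l) \<otimes>\<^bsub>A\<^esub> cell l (std_u l) t' \<ominus>\<^bsub>A\<^esub> of_nat (card (young l)) \<odot>\<^bsub>A\<^esub> cell l s' t' \<in> hat l"
      unfolding eq a_minus_def neg by (rule zero)
  qed
next
  fix c assume "\<forall>s'\<in>Lset l. \<forall>t'\<in>Rset l. cell l s' (std_v l) \<otimes>\<^bsub>A\<^esub> cell l (std_u l) t' \<ominus>\<^bsub>A\<^esub> c \<odot>\<^bsub>A\<^esub> cell l s' t' \<in> hat l"
  then have "cell l (std_u l) (std_v l) \<otimes>\<^bsub>A\<^esub> cell l (std_u l) (std_v l) \<ominus>\<^bsub>A\<^esub> c \<odot>\<^bsub>A\<^esub> cell l (std_u l) (std_v l) \<in> hat l"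
    using std_uv[OF l i] by blast
  then have "col_sum l (of_nat (card (young l)) \<odot>\<^bsub>A\<^esub> cell l (std_u l) (std_v l) \<ominus>\<^bsub>A\<^esub> c \<odot>\<^bsub>A\<^esub> cell l (std_u l) (std_v l)) = 0"
    unfolding cell_mult[OF l i std_uv[OF l i]] by (rule col_sum_hat[OF l i])
  then show "c = of_nat (card (young l))"
    by (simp add: col_sum_diff smult_carrier cell_carrier col_sum_smult col_sum_std[OF l i])
qed

lemma Lam0_eq_Lam: "Lam0 r n T A = Lam r T"
proof -
  have "\<exists>s\<in>Lset l. \<exists>t\<in>Rset l. cell_bracket A (Lam r T) part_ge Lset Rset cell l s t \<noteq> 0" if "l \<in> Lam r T" for l
  proof -
    from that obtain m where m: "m \<in> T" "l \<in> partitions (transf_index r m)" by (auto simp: Lam_def index_set_def)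
    then have l: "l \<in> partitions (rank r m)" by (simp add: rank_index)
    have i: "1 \<le> rank r m" "rank r m \<le> r" using rank_pos[OF r_pos, of m] rank_le[of r m] by simp_all
    have "(of_nat (card (young l)) :: 'k) \<noteq> 0" using card_young_pos[of l] by simp
    then show ?thesis using std_uv[OF l i] bracket_std[OF l i] by metis
  qed
  then show ?thesis unfolding Lam0_def cell_Lam0_def by blast
qed

end

section \<open>The two normalizations\<close>

lemma double_cosets_subset:
  "D \<in> double_cosets (full_transf r) \<mu> \<nu> \<Longrightarrow> \<mu> \<in> compositions r n \<Longrightarrow> \<nu> \<in> compositions r n \<Longrightarrow> D \<subseteq> full_transf r"
  using young_full_transf[of \<mu> r n] young_full_transf[of \<nu> r n]
  by (auto simp: double_cosets_def double_coset_def intro!: full_transf_comp)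

lemma double_coset_in: "m \<in> M \<Longrightarrow> double_coset \<mu> m \<nu> \<in> double_cosets M \<mu> \<nu>"
  by (auto simp: double_cosets_def)

lemma n_L_coset: "m \<in> M \<Longrightarrow> n_L (\<mu>, \<nu>, double_coset \<mu> m \<nu>) = card ((\<lambda>\<sigma>. \<sigma> \<circ> m) ` young \<mu>)"
  by (rule n_L_eq[OF double_coset_in double_coset_self])

lemma n_R_coset: "m \<in> M \<Longrightarrow> n_R (\<mu>, \<nu>, double_coset \<mu> m \<nu>) = card ((\<lambda>\<pi>. m \<circ> \<pi>) ` young \<nu>)"
  by (rule n_R_eq[OF double_coset_in double_coset_self])

lemma card_image_young_pos: "0 < card (f ` young \<mu>)"
  using young_id[of \<mu>] finite_young[of \<mu>] by (auto simp: card_gt_0_iff)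

lemma full_transf_outside: "m \<in> full_transf r \<Longrightarrow> x \<notin> {1..r} \<Longrightarrow> m x = x"
  unfolding full_transf_iff by (cases "x = 0") auto

lemma id_full_transf: "id \<in> full_transf r"
  by (simp add: full_transf_iff)

text \<open>If \<open>b\<close> does not lower the rank of \<open>a\<close>, then \<open>a\<close> and \<open>a \<circ> b\<close> have the same image, so two elements of the
  Young subgroup agree after one of them if and only if they agree after the other.  The second factor is 1.\<close>

lemma n_L_mult:
  assumes T: "a \<in> full_transf r" "b \<in> full_transf r" and rk: "rank r (a \<circ> b) = rank r a" and rn: "r \<le> n"
  shows "n_L (\<mu>, regular_comp r n, double_coset \<mu> a (regular_comp r n)) *
      n_L (regular_comp r n, \<nu>, double_coset (regular_comp r n) b \<nu>)
    = n_L (\<mu>, \<nu>, double_coset \<mu> (a \<circ> b) \<nu>)"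
proof -
  have "(a \<circ> b) ` {1..r} \<subseteq> a ` {1..r}" using full_transf_image[OF T(2)] by (auto simp: image_subset_iff)
  then have im: "(a \<circ> b) ` {1..r} = a ` {1..r}"
    by (rule card_subset_eq[rotated]) (use rk in \<open>simp_all add: rank_def\<close>)
  have key: "\<sigma> \<circ> a = \<sigma>' \<circ> a \<longleftrightarrow> \<sigma> \<circ> (a \<circ> b) = \<sigma>' \<circ> (a \<circ> b)" for \<sigma> \<sigma>' :: transf
  proof
    assume eq: "\<sigma> \<circ> (a \<circ> b) = \<sigma>' \<circ> (a \<circ> b)"
    show "\<sigma> \<circ> a = \<sigma>' \<circ> a"
    proof
      fix x
      have "\<exists>y. a x = (a \<circ> b) y"
      proof (cases "x \<in> {1..r}")
        case True
        then have "a x \<in> (a \<circ> b) ` {1..r}" unfolding im by (rule imageI)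
        then show ?thesis by blast
      next
        case False
        then have "b x = x" by (rule full_transf_outside[OF T(2)])
        then show ?thesis by (intro exI[of _ x]) simp
      qed
      then show "(\<sigma> \<circ> a) x = (\<sigma>' \<circ> a) x" using fun_cong[OF eq] by auto
    qed
  qed (simp only: o_assoc)
  have "bij_betw (\<lambda>m. m \<circ> b) ((\<lambda>\<sigma>. \<sigma> \<circ> a) ` young \<mu>) ((\<lambda>\<sigma>. \<sigma> \<circ> (a \<circ> b)) ` young \<mu>)"
    unfolding bij_betw_def inj_on_def image_image ball_simps o_assoc[symmetric] by (simp add: key)
  then have "card ((\<lambda>\<sigma>. \<sigma> \<circ> a) ` young \<mu>) = card ((\<lambda>\<sigma>. \<sigma> \<circ> (a \<circ> b)) ` young \<mu>)" by (rule bij_betw_same_card)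
  then show ?thesis
    using n_L_coset[OF T(1)] n_L_coset[OF T(2)] n_L_coset[OF full_transf_comp[OF T]] young_regular_comp[OF rn] by simp
qed

text \<open>If \<open>a\<close> does not lower the rank of \<open>b\<close>, it is injective on the image of \<open>b\<close> and can be cancelled.  The
  first factor is 1.\<close>

lemma n_R_mult:
  assumes T: "a \<in> full_transf r" "b \<in> full_transf r" and rk: "rank r (a \<circ> b) = rank r b" and rn: "r \<le> n"
    and \<nu>: "\<nu> \<in> compositions r n"
  shows "n_R (\<mu>, regular_comp r n, double_coset \<mu> a (regular_comp r n)) *
      n_R (regular_comp r n, \<nu>, double_coset (regular_comp r n) b \<nu>)
    = n_R (\<mu>, \<nu>, double_coset \<mu> (a \<circ> b) \<nu>)"
proof -
  have "card (a ` (b ` {1..r})) = card (b ` {1..r})" using rk unfolding rank_def image_comp .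
  then have inj: "inj_on a (b ` {1..r})" by (rule eq_card_imp_inj_on[rotated]) simp
  have key: "b \<circ> \<pi> = b \<circ> \<pi>' \<longleftrightarrow> a \<circ> b \<circ> \<pi> = a \<circ> b \<circ> \<pi>'" if p: "\<pi> \<in> young \<nu>" "\<pi>' \<in> young \<nu>" for \<pi> \<pi>'
  proof
    assume eq: "a \<circ> b \<circ> \<pi> = a \<circ> b \<circ> \<pi>'"
    have pT: "\<pi> \<in> full_transf r" "\<pi>' \<in> full_transf r" using p young_full_transf[OF \<nu>] by auto
    show "b \<circ> \<pi> = b \<circ> \<pi>'"
    proof
      fix x
      show "(b \<circ> \<pi>) x = (b \<circ> \<pi>') x"
      proof (cases "x \<in> {1..r}")
        case True
        then have "b (\<pi> x) \<in> b ` {1..r}" "b (\<pi>' x) \<in> b ` {1..r}" using pT unfolding full_transf_iff by blast+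
        moreover have "a (b (\<pi> x)) = a (b (\<pi>' x))" using fun_cong[OF eq, of x] by simp
        ultimately show ?thesis using inj_onD[OF inj] by (simp only: o_apply)
      next
        case False
        then have "\<pi> x = x" "\<pi>' x = x" by (rule full_transf_outside[OF pT(1)], rule full_transf_outside[OF pT(2)])
        then show ?thesis by simp
      qed
    qed
  qed (simp only: comp_assoc)
  have "bij_betw (\<lambda>m. a \<circ> m) ((\<lambda>\<pi>. b \<circ> \<pi>) ` young \<nu>) ((\<lambda>\<pi>. a \<circ> b \<circ> \<pi>) ` young \<nu>)"
    unfolding bij_betw_def inj_on_def image_image ball_simps o_assoc by (simp add: key)
  then have "card ((\<lambda>\<pi>. b \<circ> \<pi>) ` young \<nu>) = card ((\<lambda>\<pi>. a \<circ> b \<circ> \<pi>) ` young \<nu>)" by (rule bij_betw_same_card)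
  then show ?thesis
    using n_R_coset[OF T(1)] n_R_coset[OF T(2)] n_R_coset[OF full_transf_comp[OF T]] young_regular_comp[OF rn] by simp
qed

lemma cell_twisted_L:
  assumes "1 \<le> r" "r \<le> n"
  shows "cell_twisted r n n_L"
proof unfold_locales
  fix \<mu> D assume "\<mu> \<in> compositions r n"
  show "n_L (\<mu>, \<mu>, young \<mu>) = card (young \<mu>)"
    using n_L_coset[OF id_full_transf, of \<mu> \<mu>] unfolding double_coset_unit by simp
next
  fix \<mu> \<nu> D assume "D \<in> double_cosets (full_transf r) \<mu> \<nu>"
  then show "0 < n_L (\<mu>, \<nu>, D)" using n_L_eq double_cosets_some(1) card_image_young_pos by metis
next
  fix \<mu> \<pi> \<nu> D1 D2 D
  assume "\<mu> \<in> compositions r n" "\<pi> \<in> compositions r n" "\<nu> \<in> compositions r n"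
    "D1 \<in> double_cosets (full_transf r) \<mu> \<pi>" "D2 \<in> double_cosets (full_transf r) \<pi> \<nu>"
    "D \<in> double_cosets (full_transf r) \<mu> \<nu>"
  then show "int (n_L (\<mu>, \<pi>, D1)) * int (n_L (\<pi>, \<nu>, D2)) dvd int (n_L (\<mu>, \<nu>, D)) * a_coeff (full_transf r) D1 D2 D"
    by (intro n_L_dvd finite_full_transf double_cosets_subset)
qed (use assms full_transf_comp finite_full_transf young_full_transf n_L_mult in blast)+

lemma cell_twisted_R:
  assumes "1 \<le> r" "r \<le> n"
  shows "cell_twisted r n n_R"
proof unfold_locales
  fix \<mu> D assume "\<mu> \<in> compositions r n"
  show "n_R (\<mu>, \<mu>, young \<mu>) = card (young \<mu>)"
    using n_R_coset[OF id_full_transf, of \<mu> \<mu>] unfolding double_coset_unit by simp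
next
  fix \<mu> \<nu> D assume "D \<in> double_cosets (full_transf r) \<mu> \<nu>"
  then show "0 < n_R (\<mu>, \<nu>, D)" using n_R_eq double_cosets_some(1) card_image_young_pos by metis
next
  fix \<mu> \<pi> \<nu> D1 D2 D
  assume "\<mu> \<in> compositions r n" "\<pi> \<in> compositions r n" "\<nu> \<in> compositions r n"
    "D1 \<in> double_cosets (full_transf r) \<mu> \<pi>" "D2 \<in> double_cosets (full_transf r) \<pi> \<nu>"
    "D \<in> double_cosets (full_transf r) \<mu> \<nu>"
  then show "int (n_R (\<mu>, \<pi>, D1)) * int (n_R (\<pi>, \<nu>, D2)) dvd int (n_R (\<mu>, \<nu>, D)) * a_coeff (full_transf r) D1 D2 D"
    by (intro n_R_dvd finite_full_transf double_cosets_subset)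
qed (use assms full_transf_comp finite_full_transf young_full_transf n_R_mult in blast)+

theorem theorem5p1:
  fixes r n :: nat
  assumes "1 \<le> r" and "r \<le> n"
  shows "Lam0 r n (full_transf r) (S_L r n (full_transf r) :: ('k::field_char_0, bidx \<Rightarrow> 'k) module)
           = Lam r (full_transf r)
       \<and> Lam0 r n (full_transf r) (S_R r n (full_transf r) :: ('k, bidx \<Rightarrow> 'k) module)
           = Lam r (full_transf r)
       \<and> quasi_hereditary (S_L r n (full_transf r) :: ('k, bidx \<Rightarrow> 'k) module)
       \<and> quasi_hereditary (S_R r n (full_transf r) :: ('k, bidx \<Rightarrow> 'k) module)"
proof -
  interpret left: cell_twisted r n n_L "TYPE('k)" using assms by (rule cell_twisted_L)
  interpret right: cell_twisted r n n_R "TYPE('k)" using assms by (rule cell_twisted_R)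
  show ?thesis
    unfolding S_L_def S_R_def
    by (intro conjI left.Lam0_eq_Lam right.Lam0_eq_Lam left.quasi_hereditary_A right.quasi_hereditary_A)
qed

end
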